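(* Let $k\ge4$ be an even integer. All the zeros of ${\rm E}_k'$ in the upper half-plane $\mathfrak{H}$ are simple.
   Context: For even $k\ge4$, ${\rm E}_k(z)=1-\frac{2k}{{\rm B}_k}\sum_{n\ge1}\sigma_{k-1}(n)q^n$, $q=e^{2\pi i z}$, $z\in\mathfrak{H}$, is the normalized Eisenstein series of weight $k$ for ${\bf SL}_2({\bf Z})$ (${\rm B}_k$ Bernoulli number, $\sigma_{k-1}(n)=\sum_{d\mid n}d^{k-1}$), and ${\rm E}_k'$ is its derivative in $z$. *)

theory Defs
  imports "HOL-Complex_Analysis.Complex_Analysis"
    "HOL-Computational_Algebra.Formal_Power_Series"
begin

(* Exponential generating function X / (exp X - 1) = (\<Sum>n. B_n X^n / n!). *)
definition bernoulli :: "nat \<Rightarrow> real" where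
  "bernoulli n = fact n * fps_nth (fps_X / (fps_exp 1 - 1)) n"

definition divisor_power_sum :: "nat \<Rightarrow> nat \<Rightarrow> nat" where
  "divisor_power_sum m n = (\<Sum>d | d dvd n. d ^ m)"

(* Only meaningful for Im z > 0, where the q-series converges; outside the upper
   half-plane the value is unspecified and irrelevant.  The series starts at n = 1,
   hence the shift by Suc. *)
definition Eisenstein_E :: "nat \<Rightarrow> complex \<Rightarrow> complex" where
  "Eisenstein_E k z =
     1 - 2 * of_nat k / of_real (bernoulli k) *
       (\<Sum>n. of_nat (divisor_power_sum (k - 1) (Suc n)) * exp (2 * of_real pi * \<i> * z) ^ Suc n)"

end

theory Submission
  imports Defs "HOL-Complex_Analysis.Complex_Analysis"
begin

text \<open>
  Write \<open>q = exp (2 \<pi> \<i> z)\<close>, \<open>D = q d/dq\<close> and \<open>e = B\<^sub>k/k! E\<^sub>k\<close>.  A multiple zero of \<open>E\<^sub>k'\<close> is a point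
  with \<open>D e = D\<^sup>2 e = 0\<close>, and there are two cases.

  If \<open>e = 0\<close> as well, the lattice sums of \<open>Q(c, d) (c z + d)\<^bsup>-k-2\<^esup>\<close> vanish for all quadratic forms \<open>Q\<close>.
  For a reduced basis of the lattice and \<open>Q = d (c + d)\<close> the terms with \<open>c = 0\<close> contribute at least 2 to the
  normalised sum and all the others less than 2, a contradiction.

  If \<open>e \<noteq> 0\<close>, Ramanujan's equations turn \<open>D e = D\<^sup>2 e = 0\<close> into a non-trivial algebraic relation with rational
  coefficients between \<open>E\<^sub>4(q)\<close> and \<open>E\<^sub>6(q)\<close>, and express \<open>E\<^sub>2(q)\<close> through them.  After rescaling the lattice, the
  invariants of \<open>\<wp>\<close> and the period quotient \<open>E\<^sub>2\<close> are algebraic numbers.  This is impossible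
  by Schneider's method.  The functions \<open>\<wp>\<close> and \<open>Z\<close>, Weierstrass' zeta function plus the multiple of \<open>v\<close> that makes it
  \<open>2 \<pi> \<i>\<close>-periodic, satisfy algebraic differential equations over a number field, with algebraic initial values at a
  half period.  By Siegel's lemma a non-zero integer polynomial in them vanishes there to high order \<open>n\<close>, hence, by
  periodicity, at all zeros of \<open>exp v + 1\<close>.  The maximum principle on a strip of half-width \<open>n\<^bsup>1/4\<^esup>\<close> then makes
  the first non-zero Taylor coefficient smaller than Liouville's inequality allows.
\<close>


text \<open>The split on e is forced: D e = 0 reads k (E_2 / 12) e = - h with a modular form h,
  which determines E_2 only after division by e. Where e = 0 the quantity E_2 is free, transcendence
  has nothing to contradict, and sizes of lattice sums must decide. The form Q vanishes on the short
  vectors tau and tau - 1 of a reduced basis, the ones that compete with 1. Otherwise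
  \<open>Z\<close> has the period 2 pi i exactly, so its Taylor expansions at the points pi i + 2 pi
  i m coincide: one set of linear equations imposes zeros at infinitely many points, and the single
  factor (1 + exp v)^n records them all. With O(sqrt n) powers of each function, clearing the poles
  costs exp (C sqrt n r^2) on the lines Re v = r and Re v = - r, while the zeros gain about exp (- n
  r / 2). For r = n^(1/4) this is exp (O(n)) against exp (- n^(5/4) / 2), which also beats the
  arithmetic loss exp (K n ln n). No zero estimate enters, since n is the exact order of vanishing
  and only a lower bound for n is required.\<close>

subsection \<open>Siegel's lemma and Liouville's inequality\<close>

text \<open>Vectors with entries in [0, H] have images in a box with
  \<open>card U * B * H + 1\<close> points per coordinate. By \<open>large\<close> there are more
  vectors than images, and the difference of two vectors with the same image solves the
  system.\<close>

lemma siegel_pigeonhole: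
  fixes a :: "'e \<Rightarrow> 'u \<Rightarrow> int" and B H :: nat
  assumes fin: "finite E" "finite U"
    and bnd: "\<And>e u. e \<in> E \<Longrightarrow> u \<in> U \<Longrightarrow> \<bar>a e u\<bar> \<le> int B"
    and large: "(card U * B * H + 1) ^ card E < (H + 1) ^ card U"
  shows "\<exists>x. (\<exists>u\<in>U. x u \<noteq> 0) \<and> (\<forall>u\<in>U. \<bar>x u\<bar> \<le> int H) \<and>
    (\<forall>e\<in>E. (\<Sum>u\<in>U. a e u * x u) = 0)"
proof -
  \<comment> \<open>The smallest value of form \<open>e\<close> on the cube: only negative
    coefficients pull it down. Starting the interval there keeps its length at \<open>wid\<close>
    instead of twice that.\<close>
  define lo where "lo e = (\<Sum>u\<in>U. min 0 (a e u) * int H)" for e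
  define wid where "wid = int (card U * B * H)"
  define D where "D = PiE U (\<lambda>_. {0..int H})"
  define V where "V = PiE E (\<lambda>e. {lo e..lo e + wid})"
  define f where "f x = restrict (\<lambda>e. \<Sum>u\<in>U. a e u * x u) E" for x :: "'u \<Rightarrow> int"
  have cD: "card D = (H + 1) ^ card U"
    unfolding D_def using fin by (simp add: card_PiE nat_add_distrib)
  have cV: "card V = (card U * B * H + 1) ^ card E"
    unfolding V_def wid_def using fin by (simp add: card_PiE nat_add_distrib algebra_simps nat_mult_distrib)
  have finV: "finite V" unfolding V_def using fin by (simp add: finite_PiE)
  have fV: "f ` D \<subseteq> V"
  proof
    fix y assume "y \<in> f ` D"
    then obtain x where x: "x \<in> D" "y = f x" by blast
    have "(\<Sum>u\<in>U. a e u * x u) \<in> {lo e..lo e + wid}" if e: "e \<in> E" for e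
    proof -
      have 1: "min 0 (a e u) * int H \<le> a e u * x u \<and> a e u * x u \<le> min 0 (a e u) * int H + int B * int H"
        if u: "u \<in> U" for u
      proof -
        have xu: "0 \<le> x u" "x u \<le> int H" using x u by (auto simp: D_def PiE_iff)
        have ab: "\<bar>a e u\<bar> \<le> int B" using bnd e u by auto
        show ?thesis
        proof (cases "a e u \<ge> 0")
          case True
          then show ?thesis using xu ab by (auto intro!: mult_mono)
        next
          case False
          have "a e u * int H \<le> a e u * x u"
            using False xu by (intro mult_left_mono_neg) auto
          moreover have "a e u * x u \<le> 0" using False xu by (simp add: mult_nonpos_nonneg)
          moreover have "- a e u * int H \<le> int B * int H" using ab False by (intro mult_right_mono) auto
          ultimately show ?thesis using False by auto
        qed
      qed
      have "lo e \<le> (\<Sum>u\<in>U. a e u * x u)" unfolding lo_def using 1 by (intro sum_mono) auto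
      moreover have "(\<Sum>u\<in>U. a e u * x u) \<le> (\<Sum>u\<in>U. min 0 (a e u) * int H + int B * int H)"
        using 1 by (intro sum_mono) auto
      moreover have "\<dots> = lo e + wid" by (simp add: lo_def wid_def sum.distrib)
      ultimately show ?thesis by auto
    qed
    then show "y \<in> V" using x by (auto simp: V_def f_def)
  qed
  have "\<not> inj_on f D"
  proof
    assume "inj_on f D"
    then have "card D \<le> card V" using card_inj_on_le fV finV by blast
    then show False using large cD cV by simp
  qed
  then obtain x y where xy: "x \<in> D" "y \<in> D" "f x = f y" "x \<noteq> y" by (auto simp: inj_on_def)
  have "\<exists>u\<in>U. x u \<noteq> y u" using xy unfolding D_def by (meson PiE_ext)
  moreover have "\<bar>x u - y u\<bar> \<le> int H" if "u \<in> U" for u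
  proof -
    have "x u \<in> {0..int H}" "y u \<in> {0..int H}" using xy that unfolding D_def by (auto simp: PiE_iff)
    then show ?thesis by auto
  qed
  moreover have "(\<Sum>u\<in>U. a e u * (x u - y u)) = 0" if "e \<in> E" for e
  proof -
    have "f x e = f y e" using xy by simp
    then show ?thesis using that by (simp add: f_def right_diff_distrib sum_subtractf)
  qed
  ultimately show ?thesis by (intro exI[of _ "\<lambda>u. x u - y u"]) auto
qed

text \<open>An order in a number field is given by an integral basis \<open>\<omega>\<close> that is closed under multiplication up to integer
  coefficients; it need not contain 1, but contains the positive integer \<open>M\<close>.\<close>

locale number_order =
  fixes d :: nat and \<omega> :: "nat \<Rightarrow> complex" and M :: nat
  assumes indep: "\<And>c :: nat \<Rightarrow> int. (\<Sum>i<d. of_int (c i) * \<omega> i) = 0 \<Longrightarrow> (\<forall>i<d. c i = 0)"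
    and mult_closed: "\<And>i j. i < d \<Longrightarrow> j < d \<Longrightarrow> \<exists>c :: nat \<Rightarrow> int. \<omega> i * \<omega> j = (\<Sum>k<d. of_int (c k) * \<omega> k)"
    and M_pos: "M > 0"
    and M_mem: "\<exists>c :: nat \<Rightarrow> int. of_nat M = (\<Sum>k<d. of_int (c k) * \<omega> k)"
begin

definition str :: "nat \<Rightarrow> nat \<Rightarrow> nat \<Rightarrow> int" where
  "str i j = (SOME c. \<omega> i * \<omega> j = (\<Sum>k<d. of_int (c k) * \<omega> k))"

lemma str: "i < d \<Longrightarrow> j < d \<Longrightarrow> \<omega> i * \<omega> j = (\<Sum>k<d. of_int (str i j k) * \<omega> k)"
  unfolding str_def using someI_ex[OF mult_closed] by blast

definition \<kappa> :: real where
  "\<kappa> = 1 + (\<Sum>i<d. \<Sum>j<d. \<Sum>k<d. \<bar>of_int (str i j k)\<bar>)"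

lemma \<kappa>_ge1: "\<kappa> \<ge> 1" unfolding \<kappa>_def by (simp add: sum_nonneg)

text \<open>The normalisation by \<open>\<kappa>\<close> makes the size submultiplicative.\<close>

definition bdd :: "complex \<Rightarrow> real \<Rightarrow> bool" where
  "bdd x B \<longleftrightarrow> (\<exists>c :: nat \<Rightarrow> int. x = (\<Sum>i<d. of_int (c i) * \<omega> i) \<and> (\<forall>i<d. \<kappa> * \<bar>of_int (c i)\<bar> \<le> B))"

lemma bdd_mono: "bdd x B \<Longrightarrow> B \<le> B' \<Longrightarrow> bdd x B'"
  unfolding bdd_def by fastforce

lemma d_pos: "d > 0"
proof (rule ccontr)
  assume "\<not> d > 0" then show False using M_mem M_pos by auto
qed

lemma bdd_nonneg: "bdd x B \<Longrightarrow> B \<ge> 0"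
  unfolding bdd_def using d_pos \<kappa>_ge1
  by (metis abs_ge_zero mult_nonneg_nonneg order_trans zero_le_one)

lemma bdd_0: "B \<ge> 0 \<Longrightarrow> bdd 0 B"
  unfolding bdd_def by (rule exI[of _ "\<lambda>_. 0"]) auto

lemma bdd_add:
  assumes "bdd x B" "bdd y B'" shows "bdd (x + y) (B + B')"
proof -
  obtain c c' :: "nat \<Rightarrow> int" where c: "x = (\<Sum>i<d. of_int (c i) * \<omega> i)" "\<And>i. i<d \<Longrightarrow> \<kappa> * \<bar>of_int (c i)\<bar> \<le> B"
    "y = (\<Sum>i<d. of_int (c' i) * \<omega> i)" "\<And>i. i<d \<Longrightarrow> \<kappa> * \<bar>of_int (c' i)\<bar> \<le> B'"
    using assms unfolding bdd_def by blast
  have "\<kappa> * \<bar>of_int (c i + c' i)\<bar> \<le> B + B'" if "i < d" for i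
  proof -
    have "\<kappa> * \<bar>of_int (c i + c' i)\<bar> \<le> \<kappa> * (\<bar>of_int (c i)\<bar> + \<bar>of_int (c' i)\<bar>)"
      using \<kappa>_ge1 by (intro mult_left_mono) auto
    then show ?thesis using c(2)[OF that] c(4)[OF that] by (simp add: distrib_left)
  qed
  then show ?thesis unfolding bdd_def
    by (intro exI[of _ "\<lambda>i. c i + c' i"]) (auto simp: c sum.distrib algebra_simps)
qed

lemma bdd_sum: "finite A \<Longrightarrow> (\<And>a. a \<in> A \<Longrightarrow> bdd (f a) (g a)) \<Longrightarrow> bdd (\<Sum>a\<in>A. f a) (\<Sum>a\<in>A. g a)"
  by (induction A rule: finite_induct) (auto simp: bdd_0 bdd_add)

lemma bdd_int:
  assumes "bdd x B" shows "bdd (of_int n * x) (\<bar>of_int n\<bar> * B)"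
proof -
  obtain c :: "nat \<Rightarrow> int" where c: "x = (\<Sum>i<d. of_int (c i) * \<omega> i)" "\<And>i. i<d \<Longrightarrow> \<kappa> * \<bar>of_int (c i)\<bar> \<le> B"
    using assms unfolding bdd_def by blast
  have "\<kappa> * \<bar>of_int (n * c i)\<bar> \<le> \<bar>of_int n\<bar> * B" if "i < d" for i
  proof -
    have "\<kappa> * \<bar>of_int (n * c i)\<bar> = \<bar>of_int n\<bar> * (\<kappa> * \<bar>of_int (c i)\<bar>)"
      by (simp only: of_int_mult abs_mult mult_ac)
    then show ?thesis using mult_left_mono[OF c(2)[OF that], of "\<bar>of_int n\<bar>"] by (simp only: abs_ge_zero)
  qed
  then show ?thesis unfolding bdd_def
    by (intro exI[of _ "\<lambda>i. n * c i"]) (auto simp: c sum_distrib_left algebra_simps)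
qed

lemma bdd_nat: "bdd x B \<Longrightarrow> bdd (of_nat n * x) (of_nat n * B)"
  using bdd_int[of x B "int n"] by simp

text \<open>The coefficients of the factors are at most B / \<kappa> and B' / \<kappa>. One of the
  two factors 1 / \<kappa> pays for the structure constants, the other remains as the normalisation
  of the product.\<close>

lemma bdd_mult:
  assumes "bdd x B" "bdd y B'" shows "bdd (x * y) (B * B')"
proof -
  obtain c c' :: "nat \<Rightarrow> int" where c: "x = (\<Sum>i<d. of_int (c i) * \<omega> i)" "\<And>i. i<d \<Longrightarrow> \<kappa> * \<bar>of_int (c i)\<bar> \<le> B"
    "y = (\<Sum>i<d. of_int (c' i) * \<omega> i)" "\<And>i. i<d \<Longrightarrow> \<kappa> * \<bar>of_int (c' i)\<bar> \<le> B'"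
    using assms unfolding bdd_def by blast
  define e where "e k = (\<Sum>i<d. \<Sum>j<d. c i * c' j * str i j k)" for k
  have "x * y = (\<Sum>i<d. \<Sum>j<d. of_int (c i) * of_int (c' j) * (\<omega> i * \<omega> j))"
    unfolding c sum_product by (intro sum.cong refl) (simp only: mult_ac)
  also have "\<dots> = (\<Sum>i<d. \<Sum>j<d. \<Sum>k<d. of_int (c i * c' j * str i j k) * \<omega> k)"
    by (intro sum.cong refl) (simp add: str sum_distrib_left algebra_simps)
  also have "\<dots> = (\<Sum>i<d. \<Sum>k<d. \<Sum>j<d. of_int (c i * c' j * str i j k) * \<omega> k)"
    by (intro sum.cong refl sum.swap)
  also have "\<dots> = (\<Sum>k<d. \<Sum>i<d. \<Sum>j<d. of_int (c i * c' j * str i j k) * \<omega> k)"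
    by (rule sum.swap)
  also have "\<dots> = (\<Sum>k<d. of_int (e k) * \<omega> k)"
    by (simp add: e_def sum_distrib_right)
  finally have xy: "x * y = (\<Sum>k<d. of_int (e k) * \<omega> k)" .
  have B0: "0 \<le> B" "0 \<le> B'" using assms bdd_nonneg by auto
  have "\<kappa> * \<bar>of_int (e k)\<bar> \<le> B * B'" if k: "k < d" for k
  proof -
    have "\<bar>real_of_int (e k)\<bar> \<le> (\<Sum>i<d. \<Sum>j<d. \<bar>of_int (c i * c' j * str i j k)\<bar>)"
      unfolding e_def of_int_sum
      by (rule order_trans[OF sum_abs]) (intro sum_mono sum_abs)
    also have "\<dots> \<le> (\<Sum>i<d. \<Sum>j<d. (B/\<kappa>) * (B'/\<kappa>) * \<bar>of_int (str i j k)\<bar>)"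
    proof (intro sum_mono)
      fix i j assume ij: "i \<in> {..<d}" "j \<in> {..<d}"
      have "\<bar>real_of_int (c i)\<bar> \<le> B/\<kappa>" "\<bar>real_of_int (c' j)\<bar> \<le> B'/\<kappa>"
        using c(2)[of i] c(4)[of j] ij \<kappa>_ge1 by (auto simp: field_simps)
      then show "\<bar>real_of_int (c i * c' j * str i j k)\<bar> \<le> (B/\<kappa>) * (B'/\<kappa>) * \<bar>of_int (str i j k)\<bar>"
        using B0 \<kappa>_ge1 by (simp add: abs_mult mult_mono mult_right_mono del: times_divide_eq_left times_divide_eq_right)
    qed
    also have "\<dots> = (B/\<kappa>) * (B'/\<kappa>) * (\<Sum>i<d. \<Sum>j<d. \<bar>of_int (str i j k)\<bar>)"
      by (simp add: sum_distrib_left)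
    also have "\<dots> \<le> (B/\<kappa>) * (B'/\<kappa>) * \<kappa>"
    proof (intro mult_left_mono)
      have "(\<Sum>i<d. \<Sum>j<d. \<bar>of_int (str i j k)\<bar>) \<le> (\<Sum>i<d. \<Sum>j<d. \<Sum>k<d. \<bar>real_of_int (str i j k)\<bar>)"
        using k by (intro sum_mono member_le_sum) auto
      then show "(\<Sum>i<d. \<Sum>j<d. \<bar>of_int (str i j k)\<bar>) \<le> \<kappa>" unfolding \<kappa>_def by simp
    qed (use B0 \<kappa>_ge1 in auto)
    finally show ?thesis using \<kappa>_ge1 by (simp add: field_simps)
  qed
  then show ?thesis unfolding bdd_def using xy by blast
qed

definition wmax :: real where "wmax = 1 + (\<Sum>i<d. norm (\<omega> i))"

lemma wmax_pos: "wmax > 0" unfolding wmax_def by (simp add: add_pos_nonneg sum_nonneg)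

text \<open>Takes the place of the norm of a number field, without conjugates. The equation \<alpha>
  \<beta> + x_d M = 0 amounts to d linear conditions on d + 1 integers, namely the coordinates of
  \<beta> and x_d, and Siegel's lemma bounds a solution. If x_d were 0, then \<beta> = 0 and by
  independence all unknowns would vanish.\<close>

lemma exists_multiple_int:
  assumes al: "bdd \<alpha> B" "\<alpha> \<noteq> 0" and MB: "bdd (of_nat M) B" and Bi: "B = of_nat b"
    and B0: "\<forall>i<d. bdd (\<omega> i) (of_nat B0)" "B0 \<ge> 1"
  shows "\<exists>\<beta> (m::int). m \<noteq> 0 \<and> \<alpha> * \<beta> = of_int m \<and> norm \<beta> \<le> of_nat ((d+1) * (B0 * b)) ^ d * wmax
     \<and> (\<exists>c :: nat \<Rightarrow> int. \<beta> = (\<Sum>i<d. of_int (c i) * \<omega> i))"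
proof -
  have "\<forall>j<d. \<exists>c :: nat \<Rightarrow> int. \<alpha> * \<omega> j = (\<Sum>i<d. of_int (c i) * \<omega> i) \<and> (\<forall>i<d. \<bar>real_of_int (c i)\<bar> \<le> B * B0)"
  proof (intro allI impI)
    fix j assume "j < d"
    then have "bdd (\<alpha> * \<omega> j) (B * B0)" using bdd_mult al B0 by blast
    then obtain c :: "nat \<Rightarrow> int" where c: "\<alpha> * \<omega> j = (\<Sum>i<d. of_int (c i) * \<omega> i)" "\<forall>i<d. \<kappa> * \<bar>real_of_int (c i)\<bar> \<le> B * B0"
      unfolding bdd_def by blast
    have "\<bar>real_of_int (c i)\<bar> \<le> B * B0" if "i < d" for i
    proof -
      have "1 * \<bar>real_of_int (c i)\<bar> \<le> \<kappa> * \<bar>real_of_int (c i)\<bar>" using \<kappa>_ge1 by (intro mult_right_mono) auto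
      then show ?thesis using c(2) that by force
    qed
    then show "\<exists>c :: nat \<Rightarrow> int. \<alpha> * \<omega> j = (\<Sum>i<d. of_int (c i) * \<omega> i) \<and> (\<forall>i<d. \<bar>real_of_int (c i)\<bar> \<le> B * B0)"
      using c by blast
  qed
  then obtain N :: "nat \<Rightarrow> nat \<Rightarrow> int" where N: "\<And>j. j<d \<Longrightarrow> \<alpha> * \<omega> j = (\<Sum>i<d. of_int (N j i) * \<omega> i)"
      "\<And>j i. j<d \<Longrightarrow> i<d \<Longrightarrow> \<bar>real_of_int (N j i)\<bar> \<le> B * B0" by metis
  obtain mc :: "nat \<Rightarrow> int" where mc: "of_nat M = (\<Sum>i<d. of_int (mc i) * \<omega> i)" "\<forall>i<d. \<kappa> * \<bar>real_of_int (mc i)\<bar> \<le> B"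
    using MB unfolding bdd_def by blast
  have B00: "B \<ge> 0" using Bi by simp
  have mcb: "\<bar>real_of_int (mc i)\<bar> \<le> B * B0" if "i < d" for i
  proof -
    have "1 * \<bar>real_of_int (mc i)\<bar> \<le> \<kappa> * \<bar>real_of_int (mc i)\<bar>" using \<kappa>_ge1 by (intro mult_right_mono) auto
    moreover have "B * 1 \<le> B * B0" using B0(2) B00 by (intro mult_left_mono) auto
    ultimately show ?thesis using mc(2) that by force
  qed
  \<comment> \<open>Column j < d holds the coordinates of \<alpha> times the j-th basis element, the
    last column those of M.\<close>
  define a where "a i j = (if j < d then N j i else mc i)" for i j
  \<comment> \<open>The Siegel exponent is d / ((d + 1) - d) = d.\<close>
  define H where "H = ((d+1) * (B0 * b)) ^ d"
  have bnd: "\<bar>a i j\<bar> \<le> int (B0 * b)" if "i \<in> {..<d}" "j \<in> {..d}" for i j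
  proof -
    have "\<bar>real_of_int (a i j)\<bar> \<le> B * B0" using N(2) mcb that unfolding a_def by auto
    then have "real_of_int \<bar>a i j\<bar> \<le> real_of_int (int (B0 * b))" unfolding Bi by (simp add: mult.commute)
    then show ?thesis by linarith
  qed
  have b1: "b \<ge> 1"
  proof (rule ccontr)
    assume "\<not> b \<ge> 1"
    then have "b = 0" by simp
    then have "mc i = 0" if "i<d" for i using mcb[OF that] Bi by simp
    then show False using mc(1) M_pos by simp
  qed
  have big: "(card {..d} * (B0 * b) * H + 1) ^ card {..<d} < (H + 1) ^ card {..d}"
  proof -
    have "(card {..d} * (B0 * b) * H + 1) ^ card {..<d} \<le> (((d+1) * (B0*b)) * (H + 1)) ^ d"
      using b1 B0(2) by (simp add: Suc_le_eq power_mono algebra_simps)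
    also have "\<dots> = H * (H+1) ^ d" by (simp only: power_mult_distrib H_def)
    also have "\<dots> < (H+1) ^ Suc d" by simp
    finally show ?thesis by simp
  qed
  have "\<exists>x. (\<exists>u\<in>{..d}. x u \<noteq> 0) \<and> (\<forall>u\<in>{..d}. \<bar>x u\<bar> \<le> int H) \<and>
    (\<forall>e\<in>{..<d}. (\<Sum>u\<in>{..d}. a e u * x u) = 0)"
    by (rule siegel_pigeonhole[OF finite_lessThan finite_atMost bnd big])
  then obtain x where x: "\<exists>u\<in>{..d}. x u \<noteq> 0" "\<forall>u\<in>{..d}. \<bar>x u\<bar> \<le> int H" 
     "\<forall>e\<in>{..<d}. (\<Sum>u\<in>{..d}. a e u * x u) = 0"
    by blast
  define \<beta> where "\<beta> = (\<Sum>j<d. of_int (x j) * \<omega> j)"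
  have "\<alpha> * \<beta> = (\<Sum>j<d. of_int (x j) * (\<alpha> * \<omega> j))" by (simp add: \<beta>_def sum_distrib_left algebra_simps)
  also have "\<dots> = (\<Sum>j<d. \<Sum>i<d. of_int (a i j * x j) * \<omega> i)"
    by (intro sum.cong refl) (simp add: N a_def sum_distrib_left algebra_simps)
  also have "\<dots> = (\<Sum>i<d. of_int (\<Sum>j<d. a i j * x j) * \<omega> i)"
    by (subst sum.swap) (simp add: sum_distrib_right)
  also have "\<dots> = (\<Sum>i<d. of_int (- mc i * x d) * \<omega> i)"
  proof (intro sum.cong refl)
    fix i assume i: "i \<in> {..<d}"
    have "(\<Sum>u\<in>{..d}. a i u * x u) = (\<Sum>j<d. a i j * x j) + mc i * x d"
      by (simp add: a_def flip: lessThan_Suc_atMost)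
    then have "(\<Sum>j<d. a i j * x j) = - mc i * x d" using x(3) i by force
    then show "of_int (\<Sum>j<d. a i j * x j) * \<omega> i = of_int (- mc i * x d) * \<omega> i" by simp
  qed
  also have "\<dots> = - of_int (x d) * of_nat M" by (simp add: mc(1) sum_distrib_left algebra_simps sum_negf)
  finally have eq: "\<alpha> * \<beta> = of_int (- x d * int M)" by simp
  have "x d \<noteq> 0"
  proof
    assume xd: "x d = 0"
    then have "\<beta> = 0" using eq al by simp
    then have "\<forall>i<d. x i = 0" using indep[of x] by (simp add: \<beta>_def)
    then show False using x(1) xd by (metis atMost_iff le_neq_implies_less)
  qed
  moreover have "norm \<beta> \<le> of_nat H * wmax"
  proof -
    have "norm \<beta> \<le> (\<Sum>j<d. norm (of_int (x j) * \<omega> j))" unfolding \<beta>_def by (rule norm_sum)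
    also have "\<dots> \<le> (\<Sum>j<d. of_nat H * norm (\<omega> j))"
    proof (intro sum_mono)
      fix j assume "j \<in> {..<d}"
      then have "\<bar>x j\<bar> \<le> int H" using x(2) by auto
      then have "\<bar>real_of_int (x j)\<bar> \<le> of_nat H" by linarith
      then show "norm (of_int (x j) * \<omega> j) \<le> of_nat H * norm (\<omega> j)"
        by (simp add: norm_mult mult_right_mono)
    qed
    also have "\<dots> \<le> of_nat H * wmax" unfolding wmax_def
      by (subst sum_distrib_left[symmetric], intro mult_left_mono) auto
    finally show ?thesis .
  qed
  ultimately show ?thesis unfolding H_def using eq M_pos \<beta>_def
    by (intro exI[of _ \<beta>] exI[of _ "- x d * int M"]) auto
qed

text \<open>A non-zero \<alpha> has a multiple \<alpha> \<beta> that is a non-zero integer, with a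
  cofactor of norm at most C (B + 1)^d. Since 1 is a lower bound for the product, \<alpha> cannot be
  smaller than the reciprocal.\<close>

lemma liouville_bound:
  "\<exists>C::real. C \<ge> 1 \<and> (\<forall>\<alpha> B. bdd \<alpha> B \<longrightarrow> \<alpha> \<noteq> 0 \<longrightarrow> norm \<alpha> \<ge> 1 / (C * (B + 1) ^ d))"
proof -
  have mem: "\<exists>B. bdd x (of_nat B)" if ex: "\<exists>c :: nat \<Rightarrow> int. x = (\<Sum>k<d. of_int (c k) * \<omega> k)" for x
  proof -
    obtain c :: "nat \<Rightarrow> int" where c: "x = (\<Sum>k<d. of_int (c k) * \<omega> k)" using ex by blast
    define B where "B = (\<Sum>k<d. \<kappa> * \<bar>of_int (c k)\<bar>)"
    have "\<kappa> * \<bar>of_int (c i)\<bar> \<le> B" if "i<d" for i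
      unfolding B_def using that \<kappa>_ge1 by (intro member_le_sum[of i "{..<d}" "\<lambda>i. \<kappa> * \<bar>of_int (c i)\<bar>"]) auto
    then have "bdd x B" unfolding bdd_def using c by blast
    then show ?thesis using bdd_mono real_nat_ceiling_ge by blast
  qed
  have "\<forall>i<d. \<exists>B. bdd (\<omega> i) (of_nat B)"
  proof (intro allI impI mem)
    fix i assume "i < d"
    then show "\<exists>c :: nat \<Rightarrow> int. \<omega> i = (\<Sum>k<d. of_int (c k) * \<omega> k)"
      by (intro exI[of _ "\<lambda>k. if k = i then 1 else 0"]) (simp add: if_distrib if_distribR cong: if_cong)
  qed
  then obtain Bf where Bf: "\<forall>i<d. bdd (\<omega> i) (of_nat (Bf i))" by metis
  define B0 where "B0 = 1 + (\<Sum>i<d. Bf i)"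
  have B0: "\<forall>i<d. bdd (\<omega> i) (of_nat B0)"
  proof (intro allI impI)
    fix i assume "i < d"
    then have "Bf i \<le> B0" unfolding B0_def by (intro trans_le_add2 member_le_sum) auto
    then show "bdd (\<omega> i) (of_nat B0)" using Bf \<open>i < d\<close> bdd_mono by fastforce
  qed
  obtain BM where BM: "bdd (of_nat M) (of_nat BM)" using mem M_mem by blast
  define C where "C = 1 + of_nat (((d+1) * B0 * (BM + 2)) ^ d) * wmax"
  have C1: "C \<ge> 1" unfolding C_def using wmax_pos by simp
  moreover have "norm \<alpha> \<ge> 1 / (C * (B + 1) ^ d)" if a: "bdd \<alpha> B" "\<alpha> \<noteq> 0" for \<alpha> B
  proof -
    have Bp: "B \<ge> 0" using a bdd_nonneg by blast
    define b where "b = BM + nat \<lceil>B\<rceil>"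
    have b1: "bdd \<alpha> (of_nat b)" using a(1) by (rule bdd_mono) (unfold b_def, linarith)
    have b2: "bdd (of_nat M) (of_nat b)" using BM by (rule bdd_mono) (unfold b_def, linarith)
    obtain \<beta> m where bm: "m \<noteq> 0" "\<alpha> * \<beta> = of_int m" "norm \<beta> \<le> of_nat ((d+1) * (B0 * b)) ^ d * wmax"
      using exists_multiple_int[OF b1 a(2) b2 refl, of B0] B0 unfolding B0_def by auto
    have "real b \<le> (BM + 2) * (B + 1)"
    proof -
      have "real b \<le> BM + B + 1" unfolding b_def using Bp by linarith
      also have "\<dots> \<le> (BM + 2) * (B + 1)" using Bp by (simp add: algebra_simps)
      finally show ?thesis .
    qed
    then have "real ((d+1) * (B0 * b)) \<le> real ((d+1) * B0) * ((BM + 2) * (B + 1))"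
      by (simp only: of_nat_mult mult.assoc[symmetric] mult_left_mono of_nat_0_le_iff) (metis mult_left_mono of_nat_0_le_iff mult.assoc of_nat_mult)
    then have "real ((d+1) * (B0 * b)) ^ d \<le> (real ((d+1) * B0) * ((BM + 2) * (B + 1))) ^ d"
      by (intro power_mono) auto
    also have "\<dots> = of_nat (((d+1) * B0 * (BM + 2)) ^ d) * (B+1) ^ d"
      by (simp only: of_nat_power of_nat_mult of_nat_add of_nat_numeral power_mult_distrib mult_ac)
    finally have le: "real ((d+1) * (B0 * b)) ^ d \<le> of_nat (((d+1) * B0 * (BM + 2)) ^ d) * (B+1) ^ d" .
    have "norm \<beta> \<le> of_nat (((d+1) * B0 * (BM + 2)) ^ d) * (B+1) ^ d * wmax"
      by (rule order_trans[OF bm(3) mult_right_mono[OF le less_imp_le[OF wmax_pos]]])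
    also have "\<dots> = (of_nat (((d+1) * B0 * (BM + 2)) ^ d) * wmax) * (B+1) ^ d" by (simp only: mult_ac)
    also have "\<dots> \<le> C * (B+1)^d" unfolding C_def using Bp by (intro mult_right_mono) auto
    finally have nb: "norm \<beta> \<le> C * (B+1)^d" .
    have "1 \<le> \<bar>real_of_int m\<bar>" using bm(1) by linarith
    also have "\<dots> = norm \<alpha> * norm \<beta>" using bm(2) by (metis norm_mult norm_of_int)
    also have "\<dots> \<le> norm \<alpha> * (C * (B+1)^d)" using nb by (intro mult_left_mono) auto
    finally have "1 \<le> norm \<alpha> * (C * (B+1)^d)" .
    moreover have "C * (B+1)^d > 0" using C1 Bp by simp
    ultimately show ?thesis by (simp add: field_simps)
  qed
  ultimately show ?thesis by blast
qed

end


lemma summable_power_geometric: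
  fixes x :: real assumes "\<bar>x\<bar> < 1"
  shows "summable (\<lambda>m. of_nat m ^ p * x ^ m)"
  using assms
proof (induction p arbitrary: x)
  case (Suc p)
  have "summable (\<lambda>n. diffs (\<lambda>m. of_nat m ^ p) n * x ^ n)"
    by (rule termdiff_converges[of x 1]) (use Suc in \<open>auto simp: dist_norm\<close>)
  then have "summable (\<lambda>n. x * (diffs (\<lambda>m. of_nat m ^ p) n * x ^ n))" by (rule summable_mult)
  then have "summable (\<lambda>n. of_nat (Suc n) ^ Suc p * x ^ Suc n)"
    by (simp add: diffs_def algebra_simps)
  then show ?case by (subst summable_Suc_iff[symmetric])
qed (auto simp: summable_geometric)

subsection \<open>Weierstrass functions as Lambert series\<close>

text \<open>One family covers the series for \<open>Z\<close>, its derivatives in v and its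
  derivative in q: \<open>c\<close> and \<open>s\<close> select exp v or exp (- v), with or without
  an extra factor q, and q d/dq brings down the factor m, which raises \<open>p\<close>.\<close>

definition Lser :: "complex \<Rightarrow> nat \<Rightarrow> (complex \<Rightarrow> complex) \<Rightarrow> complex \<Rightarrow> complex \<Rightarrow> complex \<Rightarrow> complex" where
  "Lser q p \<phi> c s v = (\<Sum>m. of_nat m ^ p * \<phi> (q ^ m * c * exp (s * v)))"

text \<open>Locally uniform convergence: on a unit ball the arguments drop below 1/2 in norm from
  some m on, and then the bound on \<open>\<phi>\<close> gives the majorant m^p |q|^m up to a
  constant. The earlier terms are differentiable because \<open>S\<close> avoids the pole at
  1.\<close>

lemma Lser_deriv:
  fixes \<phi> \<phi>' :: "complex \<Rightarrow> complex"
  assumes q: "norm q < 1"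
    and d: "\<And>x. x \<noteq> 1 \<Longrightarrow> (\<phi> has_field_derivative \<phi>' x) (at x)"
    and b: "\<And>x. norm x \<le> 1/2 \<Longrightarrow> norm (\<phi> x) \<le> C * norm x"
    and S: "open S" "\<And>v m. v \<in> S \<Longrightarrow> q ^ m * c * exp (s * v) \<noteq> 1"
    and v: "v \<in> S"
  shows "summable (\<lambda>m. of_nat m ^ p * \<phi> (q ^ m * c * exp (s * v)))" (is ?A)
    and "(Lser q p \<phi> c s has_field_derivative s * Lser q p (\<lambda>x. x * \<phi>' x) c s v) (at v)" (is ?B)
proof -
  define f where "f m v = of_nat m ^ p * \<phi> (q ^ m * c * exp (s * v))" for m v
  define f' where "f' m v = s * (of_nat m ^ p * ((q ^ m * c * exp (s * v)) * \<phi>' (q ^ m * c * exp (s * v))))" for m v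
  have der: "(f n has_field_derivative f' n x) (at x)" if "x \<in> S" for n x
    unfolding f_def f'_def
    by (rule derivative_eq_intros DERIV_chain'[where f="\<lambda>v. q ^ n * c * exp (s * v)" and g=\<phi>, OF _ d] refl S(2)[OF that] | simp)+
  have C0: "C \<ge> 0" using order_trans[OF norm_ge_zero b[of "1/2"]] by simp
  have bound: "\<exists>d h. 0 < d \<and> summable h \<and> (\<forall>\<^sub>F n in sequentially. \<forall>y\<in>ball x d \<inter> S. norm (f n y) \<le> h n)" for x
  proof -
    define K where "K = norm c * exp (norm s * (norm x + 1))"
    define h where "h m = C * K * (of_nat m ^ p * norm q ^ m)" for m
    have "summable h" unfolding h_def by (intro summable_mult summable_power_geometric) (use q in auto)
    moreover have "\<forall>\<^sub>F n in sequentially. \<forall>y\<in>ball x 1 \<inter> S. norm (f n y) \<le> h n"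
    proof -
      have "(\<lambda>n. norm q ^ n * K) \<longlonglongrightarrow> 0 * K" by (intro tendsto_intros LIMSEQ_power_zero) (use q in auto)
      then have "\<forall>\<^sub>F n in sequentially. norm q ^ n * K < 1/2" by (rule order_tendstoD) auto
      then show ?thesis
      proof eventually_elim
        case (elim n)
        show ?case
        proof
          fix y assume y: "y \<in> ball x 1 \<inter> S"
          have ny: "norm y \<le> norm x + 1" using y norm_triangle_ineq2[of y x] by (auto simp: dist_norm norm_minus_commute)
          have "norm (exp (s * y)) \<le> exp (norm s * norm y)" by (metis norm_exp norm_mult)
          also have "\<dots> \<le> exp (norm s * (norm x + 1))" using ny by (simp add: mult_left_mono)
          finally have "norm (q ^ n * c * exp (s * y)) \<le> norm q ^ n * K"
            unfolding K_def norm_mult norm_power by (simp add: mult_left_mono mult.assoc)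
          then have le: "norm (q ^ n * c * exp (s * y)) \<le> norm q ^ n * K" .
          have "norm (f n y) = of_nat n ^ p * norm (\<phi> (q ^ n * c * exp (s * y)))" by (simp add: f_def norm_mult norm_power)
          also have "\<dots> \<le> of_nat n ^ p * (C * norm (q ^ n * c * exp (s * y)))"
            using le elim by (intro mult_left_mono b) auto
          also have "\<dots> \<le> of_nat n ^ p * (C * (norm q ^ n * K))" using le C0 by (intro mult_left_mono) auto
          finally show "norm (f n y) \<le> h n" unfolding h_def by (simp add: algebra_simps)
        qed
      qed
    qed
    ultimately show ?thesis by (intro exI[of _ "1::real"] exI[of _ h]) auto
  qed
  obtain g g' where g: "\<And>x. x \<in> S \<Longrightarrow> (\<lambda>n. f n x) sums g x" "\<And>x. x \<in> S \<Longrightarrow> (\<lambda>n. f' n x) sums g' x"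
     "\<And>x. x \<in> S \<Longrightarrow> (g has_field_derivative g' x) (at x)"
    using series_and_derivative_comparison_local[OF S(1) der bound] by blast
  show ?A using g(1)[OF v] by (simp add: f_def sums_iff)
  have eq: "g x = Lser q p \<phi> c s x" if "x \<in> S" for x
    using g(1)[OF that] by (simp add: f_def sums_iff Lser_def)
  show ?B
  \<comment> \<open>The comparison theorem yields summability of the differentiated terms including
    the factor \<open>s\<close>; for s = 0 this cannot be divided out, but then the function is
    constant.\<close>
  proof (cases "s = 0")
    case True
    have "Lser q p \<phi> c s = (\<lambda>_. Lser q p \<phi> c s v)" unfolding Lser_def True by simp
    then have "(Lser q p \<phi> c s has_field_derivative 0) (at v)" by (metis DERIV_const)
    then show ?thesis using True by simp
  next
    case False
    have "summable (\<lambda>m. of_nat m ^ p * ((q ^ m * c * exp (s * v)) * \<phi>' (q ^ m * c * exp (s * v))))"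
      using g(2)[OF v] False by (auto simp: f'_def sums_iff summable_cmult_iff)
    then have "g' v = s * Lser q p (\<lambda>x. x * \<phi>' x) c s v"
      using g(2)[OF v] unfolding f'_def Lser_def by (simp add: sums_iff suminf_mult)
    moreover have "(Lser q p \<phi> c s has_field_derivative g' v) (at v)"
      by (rule has_field_derivative_transform_within_open[OF g(3)[OF v] S(1) v]) (rule eq)
    ultimately show ?thesis by simp
  qed
qed

text \<open>\<open>fa\<close> and \<open>fb\<close> generate x^n and n x^n over n >= 1, and
  \<open>fb\<close> is x times the derivative of \<open>fa\<close>. So differentiation in v and in q
  both lead from the first to the second.\<close>

definition fa :: "complex \<Rightarrow> complex" where "fa x = x / (1 - x)"
definition fb :: "complex \<Rightarrow> complex" where "fb x = x / (1 - x) ^ 2"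

lemma fa_deriv: "x \<noteq> 1 \<Longrightarrow> (fa has_field_derivative 1 / (1 - x)^2) (at x)"
  unfolding fa_def by (auto intro!: derivative_eq_intros simp: field_simps power2_eq_square)

lemma fb_deriv: "x \<noteq> 1 \<Longrightarrow> (fb has_field_derivative (1 + x) / (1 - x)^3) (at x)"
proof -
  assume x: "x \<noteq> 1"
  define y where "y = 1 - x"
  have y: "y \<noteq> 0" "x = 1 - y" using x by (auto simp: y_def)
  have "(fb has_field_derivative (1 * (1 - x)^2 - x * (2 * (1 - x) * (-1))) / ((1 - x)^2 * (1 - x)^2)) (at x)"
    unfolding fb_def using x by (auto intro!: derivative_eq_intros)
  also have "(1 * (1 - x)^2 - x * (2 * (1 - x) * (-1))) / ((1 - x)^2 * (1 - x)^2) = (1 + x) / (1 - x)^3"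
    unfolding y(2) using y(1) by (simp add: field_simps power2_eq_square power3_eq_cube)
  finally show ?thesis .
qed

lemma half_bound: "norm (x::complex) \<le> 1/2 \<Longrightarrow> norm (1 - x) \<ge> 1/2"
  using norm_triangle_ineq2[of 1 x] by simp

lemma fa_bound: "norm x \<le> 1/2 \<Longrightarrow> norm (fa x) \<le> 2 * norm x"
proof -
  assume "norm x \<le> 1/2"
  then have h: "norm (1 - x) \<ge> 1/2" by (rule half_bound)
  have "norm (fa x) = norm x / norm (1 - x)" by (simp add: fa_def norm_divide)
  also have "\<dots> \<le> norm x / (1/2)" using h by (intro divide_left_mono mult_pos_pos) auto
  finally show ?thesis by simp
qed

lemma fb_bound: "norm x \<le> 1/2 \<Longrightarrow> norm (fb x) \<le> 4 * norm x"
proof -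
  assume "norm x \<le> 1/2"
  then have h: "norm (1 - x) \<ge> 1/2" by (rule half_bound)
  then have h2: "norm (1 - x) ^ 2 \<ge> (1/2)^2" by (intro power_mono) auto
  have "norm (fb x) = norm x / norm (1 - x) ^ 2" by (simp add: fb_def norm_divide norm_power)
  also have "\<dots> \<le> norm x / ((1/2)^2)" using h h2 by (intro divide_left_mono mult_pos_pos) (auto intro: zero_less_power)
  finally show ?thesis by (simp add: power2_eq_square)
qed

text \<open>The curve \<open>\<complex> / (2 \<pi> \<i> \<int> + t \<int>)\<close>, in multiplicative form; only the nome \<open>q = exp t\<close> matters.\<close>

locale nome =
  fixes q t :: complex
  assumes q0: "q \<noteq> 0" and q1: "norm q < 1" and expt: "exp t = q"
begin

text \<open>Written so that the complement is visibly the set where no term of the series for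
  \<open>Z\<close> and \<open>T\<close> meets its pole; \<open>\<Lambda>_iff\<close> recovers the
  additive description.\<close>

definition \<Lambda> :: "complex set" where
  "\<Lambda> = {v. \<exists>m::nat. q ^ m = exp v \<or> q ^ m * exp v = 1}"

lemma Ret: "Re t < 0"
proof -
  have "norm q = exp (Re t)" using expt norm_exp_eq_Re by metis
  then show ?thesis using q1 by simp
qed

lemma \<Lambda>_iff: "v \<in> \<Lambda> \<longleftrightarrow> (\<exists>a b::int. v = of_int a * t + 2 * of_int b * pi * \<i>)"
proof
  assume "v \<in> \<Lambda>"
  then obtain m :: nat where "q ^ m = exp v \<or> q ^ m * exp v = 1" unfolding \<Lambda>_def by blast
  then have "exp v = exp (of_nat m * t) \<or> exp v = exp (- of_nat m * t)"
    using q0 by (auto simp: expt[symmetric] exp_of_nat_mult[symmetric] exp_minus field_simps)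
  then show "\<exists>a b::int. v = of_int a * t + 2 * of_int b * pi * \<i>"
    unfolding exp_eq by (metis mult.commute mult.left_commute of_int_minus of_int_of_nat_eq of_int_mult of_int_numeral of_real_mult of_real_of_int_eq)
next
  assume "\<exists>a b::int. v = of_int a * t + 2 * of_int b * pi * \<i>"
  then obtain a b :: int where ab: "v = of_int a * t + 2 * of_int b * pi * \<i>" by blast
  have e: "exp v = exp (of_int a * t)" unfolding ab exp_eq by auto
  show "v \<in> \<Lambda>"
  proof (cases "a \<ge> 0")
    case True
    then obtain n where "a = int n" using nonneg_int_cases by blast
    then show ?thesis using e unfolding \<Lambda>_def by (auto simp: exp_of_nat_mult expt)
  next
    case False
    then obtain n where n: "a = - int n" by (metis int_cases2 nle_le of_nat_0_le_iff)
    have "q ^ n * exp v = 1" unfolding e n by (simp add: exp_of_nat_mult expt exp_minus q0)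
    then show ?thesis unfolding \<Lambda>_def by blast
  qed
qed

lemma \<Lambda>_add: "v \<in> \<Lambda> \<Longrightarrow> w \<in> \<Lambda> \<Longrightarrow> v + w \<in> \<Lambda>"
  unfolding \<Lambda>_iff
proof (elim exE)
  fix a b a' b' :: int
  assume "v = of_int a * t + 2 * of_int b * pi * \<i>" "w = of_int a' * t + 2 * of_int b' * pi * \<i>"
  then show "\<exists>a b::int. v + w = of_int a * t + 2 * of_int b * pi * \<i>"
    by (intro exI[of _ "a + a'"] exI[of _ "b + b'"]) (simp add: algebra_simps)
qed

lemma \<Lambda>_uminus: "v \<in> \<Lambda> \<Longrightarrow> - v \<in> \<Lambda>"
  unfolding \<Lambda>_iff
proof (elim exE)
  fix a b :: int
  assume "v = of_int a * t + 2 * of_int b * pi * \<i>"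
  then show "\<exists>a b::int. - v = of_int a * t + 2 * of_int b * pi * \<i>"
    by (intro exI[of _ "- a"] exI[of _ "- b"]) (simp add: algebra_simps)
qed

lemma t_in_\<Lambda>: "t \<in> \<Lambda>" unfolding \<Lambda>_iff by (intro exI[of _ 1] exI[of _ 0]) auto
lemma pi_in_\<Lambda>: "2 * pi * \<i> \<in> \<Lambda>" unfolding \<Lambda>_iff by (intro exI[of _ 0] exI[of _ 1]) auto
lemma zero_in_\<Lambda>: "0 \<in> \<Lambda>" unfolding \<Lambda>_iff by (intro exI[of _ 0]) auto

lemma \<Lambda>_add_iff: "w \<in> \<Lambda> \<Longrightarrow> v + w \<in> \<Lambda> \<longleftrightarrow> v \<in> \<Lambda>"
  using \<Lambda>_add[of v w] \<Lambda>_add[of "v + w" "- w"] \<Lambda>_uminus[of w] by auto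

lemma \<Lambda>_uminus_iff: "- v \<in> \<Lambda> \<longleftrightarrow> v \<in> \<Lambda>"
  using \<Lambda>_uminus[of v] \<Lambda>_uminus[of "-v"] by auto

text \<open>A lower bound for the norm of non-zero lattice points: a nonzero multiple of t shows in
  the real part, and multiples of 2 pi i alone have norm at least 2 pi.\<close>

definition \<rho> :: real where "\<rho> = min (- Re t) (2 * pi)"

lemma \<rho>_pos: "\<rho> > 0" unfolding \<rho>_def using Ret by simp

lemma \<Lambda>_small: "v \<in> \<Lambda> \<Longrightarrow> norm v < \<rho> \<Longrightarrow> v = 0"
proof -
  assume v: "v \<in> \<Lambda>" "norm v < \<rho>"
  then obtain a b :: int where ab: "v = of_int a * t + 2 * of_int b * pi * \<i>" unfolding \<Lambda>_iff by blast
  have "\<bar>Re v\<bar> < - Re t" using v abs_Re_le_cmod[of v] unfolding \<rho>_def by linarith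
  then have "\<bar>of_int a\<bar> * - Re t < 1 * - Re t" using Ret by (simp add: ab abs_mult)
  then have "\<bar>real_of_int a\<bar> < 1" using Ret by (simp only: mult_less_cancel_right)
  then have a: "a = 0" by linarith
  have "\<bar>Im v\<bar> < 2 * pi" using v abs_Im_le_cmod[of v] unfolding \<rho>_def by linarith
  then have "\<bar>of_int b\<bar> * (2 * pi) < 1 * (2 * pi)" by (simp add: ab a abs_mult)
  then have "\<bar>real_of_int b\<bar> < 1" by simp
  then have "b = 0" by linarith
  with a ab show "v = 0" by simp
qed

lemma \<Lambda>_isolated: "v \<in> \<Lambda> \<Longrightarrow> w \<in> \<Lambda> \<Longrightarrow> dist v w < \<rho> \<Longrightarrow> v = w"
  using \<Lambda>_small[of "v - w"] \<Lambda>_add[of v "-w"] \<Lambda>_uminus[of w] by (auto simp: dist_norm)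

lemma closed_\<Lambda>: "closed \<Lambda>"
  by (rule discrete_imp_closed[OF \<rho>_pos]) (metis \<Lambda>_isolated dist_commute)

lemma open_compl_\<Lambda>: "open (- \<Lambda>)" using closed_\<Lambda> by blast

lemma nl1: "v \<in> - \<Lambda> \<Longrightarrow> q ^ m * 1 * exp (-1 * v) \<noteq> 1"
proof -
  assume "v \<in> - \<Lambda>"
  then have "q ^ m \<noteq> exp v" by (auto simp: \<Lambda>_def)
  then show ?thesis by (simp add: exp_minus divide_inverse[symmetric])
qed
lemma nl2: "v \<in> - \<Lambda> \<Longrightarrow> q ^ m * q * exp (1 * v) \<noteq> 1"
proof -
  assume "v \<in> - \<Lambda>"
  then have "q ^ Suc m * exp v \<noteq> 1" unfolding \<Lambda>_def by blast
  then show ?thesis by (simp add: mult_ac)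
qed
lemma nl3: "v \<in> - \<Lambda> \<Longrightarrow> q ^ m * 1 * exp (1 * v) \<noteq> 1"
  unfolding \<Lambda>_def by auto

text \<open>\<open>Z v\<close> is \<open>1/2 + \<Sum>\<^sub>m u\<^sup>-\<^sup>1 q\<^sup>m / (1 - u\<^sup>-\<^sup>1 q\<^sup>m) - \<Sum>\<^sub>m u q\<^bsup>m+1\<^esup> / (1 - u q\<^bsup>m+1\<^esup>)\<close> with \<open>u = exp v\<close>:
  it has simple poles of residue 1 on the lattice and \<open>Z (v + t) = Z v - 1\<close>.  \<open>T\<close> is its derivative \<open>q d/dq\<close>.\<close>

definition Z :: "complex \<Rightarrow> complex" where
  "Z v = 1/2 + Lser q 0 fa 1 (-1) v - Lser q 0 fa q 1 v"
definition Z1 :: "complex \<Rightarrow> complex" where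
  "Z1 v = - Lser q 0 fb 1 (-1) v - Lser q 0 fb q 1 v"
definition T :: "complex \<Rightarrow> complex" where
  "T v = Lser q 1 fb 1 (-1) v - Lser q 1 fb 1 1 v"

lemma Z_deriv: assumes "v \<notin> \<Lambda>" shows "(Z has_field_derivative Z1 v) (at v)"
proof -
  have v: "v \<in> - \<Lambda>" using assms by simp
  show ?thesis unfolding Z_def[abs_def]
    by (rule derivative_eq_intros Lser_deriv(2)[OF q1 fa_deriv fa_bound open_compl_\<Lambda> nl1 v]
       Lser_deriv(2)[OF q1 fa_deriv fa_bound open_compl_\<Lambda> nl2 v] refl | assumption)+
      (simp add: Z1_def fb_def[abs_def])
qed

lemma Z_holo: "Z holomorphic_on - \<Lambda>"
  using Z_deriv open_compl_\<Lambda> by (auto simp: holomorphic_on_open)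

lemma deriv_Z: "v \<notin> \<Lambda> \<Longrightarrow> deriv Z v = Z1 v" using Z_deriv DERIV_imp_deriv by blast

lemma T_holo: "T holomorphic_on - \<Lambda>"
  unfolding holomorphic_on_open[OF open_compl_\<Lambda>] T_def[abs_def]
proof
  fix v assume v: "v \<in> - \<Lambda>"
  show "\<exists>f'. ((\<lambda>v. Lser q 1 fb 1 (- 1) v - Lser q 1 fb 1 1 v) has_field_derivative f') (at v)"
    using Lser_deriv(2)[OF q1 fb_deriv fb_bound open_compl_\<Lambda> nl1 v, of 1]
      Lser_deriv(2)[OF q1 fb_deriv fb_bound open_compl_\<Lambda> nl3 v, of 1] DERIV_diff by blast
qed

text \<open>Adding t to v multiplies exp v by q, so the index m shifts by one and a single term
  drops out or enters. With the weight m, the shift m + 1 = m + 1 * 1 splits off the corresponding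
  series with p = 0.\<close>

lemma Lser_shift_minus:
  "v \<notin> \<Lambda> \<Longrightarrow> (\<And>x. x \<noteq> 1 \<Longrightarrow> (\<phi> has_field_derivative \<phi>' x) (at x)) \<Longrightarrow>
    (\<And>x. norm x \<le> 1/2 \<Longrightarrow> norm (\<phi> x) \<le> C * norm x) \<Longrightarrow>
   Lser q 0 \<phi> 1 (-1) (v + t) = \<phi> (inverse (q * exp v)) + Lser q 0 \<phi> 1 (-1) v \<and>
   Lser q 0 \<phi> q 1 v = \<phi> (q * exp v) + Lser q 0 \<phi> q 1 (v + t) \<and>
   Lser q 1 \<phi> 1 (-1) (v + t) = Lser q 0 \<phi> 1 (-1) v + Lser q 1 \<phi> 1 (-1) v \<and>
   Lser q 1 \<phi> 1 1 v = Lser q 0 \<phi> q 1 v + Lser q 1 \<phi> 1 1 (v + t)"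
proof -
  assume v: "v \<notin> \<Lambda>" and d: "\<And>x. x \<noteq> 1 \<Longrightarrow> (\<phi> has_field_derivative \<phi>' x) (at x)"
    and b: "\<And>x. norm x \<le> 1/2 \<Longrightarrow> norm (\<phi> x) \<le> C * norm x"
  have v': "v \<in> - \<Lambda>" and vt: "v + t \<in> - \<Lambda>" using v \<Lambda>_add_iff[OF t_in_\<Lambda>, of v] by auto
  have e: "exp (v + t) = q * exp v" "exp (-1 * (v + t)) = inverse (q * exp v)" "exp (-1 * v) = inverse (exp v)"
    by (auto simp: exp_add expt exp_minus exp_diff field_simps)
  have s1: "summable (\<lambda>m. of_nat m ^ p * \<phi> (q ^ m * 1 * exp (-1 * v)))" if "v \<in> - \<Lambda>" for p v
    by (rule Lser_deriv(1)[OF q1 d b open_compl_\<Lambda> nl1 that])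
  have s2: "summable (\<lambda>m. of_nat m ^ p * \<phi> (q ^ m * q * exp (1 * v)))" if "v \<in> - \<Lambda>" for p v
    by (rule Lser_deriv(1)[OF q1 d b open_compl_\<Lambda> nl2 that])
  have s3: "summable (\<lambda>m. of_nat m ^ p * \<phi> (q ^ m * 1 * exp (1 * v)))" if "v \<in> - \<Lambda>" for p v
    by (rule Lser_deriv(1)[OF q1 d b open_compl_\<Lambda> nl3 that])
  have c: "q ^ Suc m * 1 * inverse (q * exp v) = q ^ m * 1 * inverse (exp v)" for m using q0 by simp
  have 1: "Lser q 0 \<phi> 1 (-1) (v + t) = \<phi> (inverse (q * exp v)) + Lser q 0 \<phi> 1 (-1) v"
    using suminf_split_head[OF s1[OF vt, of 0], unfolded e c] unfolding Lser_def e by simp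
  have 2: "Lser q 0 \<phi> q 1 v = \<phi> (q * exp v) + Lser q 0 \<phi> q 1 (v + t)"
    using suminf_split_head[OF s2[OF v', of 0]] unfolding Lser_def by (simp add: exp_add expt mult_ac)
  have 3: "Lser q 1 \<phi> 1 (-1) (v + t) = Lser q 0 \<phi> 1 (-1) v + Lser q 1 \<phi> 1 (-1) v"
  proof -
    have "Lser q 1 \<phi> 1 (-1) (v + t) = (\<Sum>m. of_nat (Suc m) * \<phi> (q ^ m * inverse (exp v)))"
      using suminf_split_head[OF s1[OF vt, of 1], unfolded e c] unfolding Lser_def e
      by (simp only: power_one_right mult_1_right of_nat_0 mult_zero_left diff_zero)
    also have "\<dots> = (\<Sum>m. \<phi> (q ^ m * inverse (exp v)) + of_nat m * \<phi> (q ^ m * inverse (exp v)))"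
      by (simp add: algebra_simps)
    also have "\<dots> = Lser q 0 \<phi> 1 (-1) v + Lser q 1 \<phi> 1 (-1) v"
      using suminf_add[OF s1[OF v', of 0] s1[OF v', of 1]] unfolding Lser_def e by simp
    finally show ?thesis .
  qed
  have 4: "Lser q 1 \<phi> 1 1 v = Lser q 0 \<phi> q 1 v + Lser q 1 \<phi> 1 1 (v + t)"
  proof -
    have "Lser q 1 \<phi> 1 1 v = (\<Sum>m. of_nat (Suc m) * \<phi> (q ^ m * q * exp v))"
      using suminf_split_head[OF s3[OF v', of 1]] unfolding Lser_def by (simp add: algebra_simps)
    also have "\<dots> = (\<Sum>m. \<phi> (q ^ m * q * exp v) + of_nat m * \<phi> (q ^ m * 1 * exp (1 * (v + t))))"
      by (simp add: exp_add expt algebra_simps)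
    also have "\<dots> = Lser q 0 \<phi> q 1 v + Lser q 1 \<phi> 1 1 (v + t)"
      using suminf_add[OF s2[OF v', of 0] s3[OF vt, of 1]] unfolding Lser_def by simp
    finally show ?thesis .
  qed
  from 1 2 3 4 show ?thesis by blast
qed

text \<open>This -1 is the jump of \<open>Z\<close> under v + t; the summand 1/2 in \<open>Z\<close>
  is half of it and makes \<open>Z\<close> odd.\<close>

lemma fa_inverse: "x \<noteq> 0 \<Longrightarrow> x \<noteq> 1 \<Longrightarrow> fa (inverse x) + fa x = - 1"
  unfolding fa_def by (simp add: divide_simps) (simp add: algebra_simps)
lemma fb_inverse:
  assumes "x \<noteq> 0" "x \<noteq> 1" shows "fb (inverse x) = fb x"
proof -
  have "1 - inverse x = - (1 - x) / x" using assms by (simp add: field_simps)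
  then have "fb (inverse x) = inverse x / ((1 - x)^2 / x^2)"
    unfolding fb_def by (simp add: power_divide power2_eq_square) (simp add: algebra_simps)
  then show ?thesis using assms by (simp add: fb_def power2_eq_square)
qed

lemma Z_period_t: assumes "v \<notin> \<Lambda>" shows "Z (v + t) = Z v - 1"
proof -
  have "q * exp v \<noteq> 1" using nl2[of v 0] assms by simp
  then show ?thesis using Lser_shift_minus[OF assms fa_deriv fa_bound] fa_inverse[of "q * exp v"] q0
    unfolding Z_def by (simp add: algebra_simps) 
qed

lemma Z1_period_t: assumes "v \<notin> \<Lambda>" shows "Z1 (v + t) = Z1 v"
proof -
  have "q * exp v \<noteq> 1" using nl2[of v 0] assms by simp
  then show ?thesis using Lser_shift_minus[OF assms fb_deriv fb_bound] fb_inverse[of "q * exp v"] q0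
    unfolding Z1_def by (simp add: algebra_simps) 
qed

text \<open>This is q d/dq applied to Z (v + t) = Z v - 1: as t is a logarithm of q, the chain rule
  contributes the extra term \<open>Z1\<close>.\<close>

lemma T_period_t: assumes "v \<notin> \<Lambda>" shows "T (v + t) = T v - Z1 v"
  using Lser_shift_minus[OF assms fb_deriv fb_bound] unfolding T_def Z1_def by (simp add: algebra_simps) 

lemma exp_2pi: "exp (s * (v + 2 * pi * \<i>)) = exp (s * v)" if "s = 1 \<or> s = -1" for s v :: complex
  using that by (auto simp: exp_add exp_minus distrib_left)

lemma Z_period_pi: "Z (v + 2 * pi * \<i>) = Z v" unfolding Z_def Lser_def by (simp only: exp_2pi simp_thms)
lemma T_period_pi: "T (v + 2 * pi * \<i>) = T v" unfolding T_def Lser_def by (simp only: exp_2pi simp_thms)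

lemma Z_odd: assumes "v \<notin> \<Lambda>" shows "Z (- v) = - Z v"
proof -
  have v': "v \<in> - \<Lambda>" and mv: "- v \<in> - \<Lambda>" using assms \<Lambda>_uminus_iff by auto
  have s1: "summable (\<lambda>m. of_nat m ^ p * fa (q ^ m * 1 * exp (-1 * v)))" if "v \<in> - \<Lambda>" for p v
    by (rule Lser_deriv(1)[OF q1 fa_deriv fa_bound open_compl_\<Lambda> nl1 that])
  have n1: "exp v \<noteq> 1" using nl3[of v 0] assms by simp
  have a: "Lser q 0 fa 1 (-1) v = fa (inverse (exp v)) + Lser q 0 fa q 1 (- v)"
    using suminf_split_head[OF s1[OF v', of 0]] unfolding Lser_def by (simp add: exp_minus algebra_simps)
  have b: "Lser q 0 fa 1 (-1) (- v) = fa (exp v) + Lser q 0 fa q 1 v"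
    using suminf_split_head[OF s1[OF mv, of 0]] unfolding Lser_def by (simp add: algebra_simps)
  show ?thesis using a b fa_inverse[of "exp v"] n1 unfolding Z_def by (simp add: algebra_simps)
qed

end


section \<open>Lambert series as absolutely convergent double sums\<close>

definition lam :: "nat \<Rightarrow> nat \<Rightarrow> complex \<Rightarrow> complex" where
  "lam p j x = (\<Sum>n. of_nat (Suc n) ^ p * of_nat (divisor_power_sum j (Suc n)) * x ^ Suc n)"

lemma has_sum_atLeast1: "(f has_sum S) {1::nat..} \<longleftrightarrow> ((\<lambda>n. f (Suc n)) has_sum S) UNIV"
  by (rule has_sum_reindex_bij_witness[of _ Suc "\<lambda>n. n - 1"]) auto

lemma has_sum_diff:
  fixes f g :: "'a \<Rightarrow> complex"
  assumes "(f has_sum a) A" "(g has_sum b) A"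
  shows "((\<lambda>x. f x - g x) has_sum (a - b)) A"
proof -
  have "((\<lambda>x. f x + (-1) * g x) has_sum (a + (-1) * b)) A"
    by (intro has_sum_add has_sum_cmult_right assms)
  then show ?thesis by simp
qed

lemma summable_on_times_nonneg:
  fixes f :: "'a \<Rightarrow> real" and g :: "'b \<Rightarrow> real"
  assumes "f summable_on A" "g summable_on B" "\<And>x. x \<in> A \<Longrightarrow> f x \<ge> 0" "\<And>x. x \<in> B \<Longrightarrow> g x \<ge> 0"
  shows "(\<lambda>(x, y). f x * g y) summable_on A \<times> B"
proof (rule summable_on_SigmaI)
  show "((\<lambda>y. case (x, y) of (x, y) \<Rightarrow> f x * g y) has_sum f x * infsum g B) B" if "x \<in> A" for x
    using assms(2) by (auto intro!: has_sum_cmult_right)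
  show "(\<lambda>x. f x * infsum g B) summable_on A" using assms(1) by (rule summable_on_cmult_left)
qed (use assms in auto)

lemma summable_on_power_geometric:
  fixes y :: real assumes "0 \<le> y" "y < 1"
  shows "(\<lambda>m. of_nat m ^ p * y ^ m) summable_on A"
proof -
  have "(\<lambda>m. of_nat m ^ p * y ^ m) summable_on UNIV"
    by (subst summable_on_UNIV_nonneg_real_iff) (use assms in \<open>auto intro!: summable_power_geometric\<close>)
  then show ?thesis by (rule summable_on_subset) simp
qed

text \<open>The exponent m n couples the indices. Since m + n <= 2 m n, the square root y of |x|
  satisfies |x|^(m n) <= y^m y^n, and the majorant is a product of two single series.\<close>

lemma lambert_abs_summable:
  fixes x :: complex
  assumes "norm x < 1"
  shows "(\<lambda>z. norm (case z of (m, n) \<Rightarrow> of_nat (m * n) ^ p * of_nat n ^ j * x ^ (m * n))) summable_on {1..} \<times> {1..}"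
proof -
  define y where "y = sqrt (norm x)"
  have y: "0 \<le> y" "y < 1" "y ^ 2 = norm x" using assms by (auto simp: y_def)
  have s: "(\<lambda>(m, n). (of_nat m ^ p * y ^ m) * (of_nat n ^ (p + j) * y ^ n)) summable_on {1..} \<times> {1..}"
    by (rule summable_on_times_nonneg) (use y in \<open>auto intro!: summable_on_power_geometric\<close>)
  show ?thesis
  proof (rule summable_on_comparison_test[OF s])
    fix z :: "nat \<times> nat" assume "z \<in> {1..} \<times> {1..}"
    then obtain m n where z: "z = (m, n)" "m \<ge> 1" "n \<ge> 1" by auto
    have "m + n \<le> 2 * (m * n)"
      using z(2,3) by (cases m; cases n) auto
    then have "y ^ (2 * (m * n)) \<le> y ^ (m + n)" using y by (intro power_decreasing) auto
    then have "norm x ^ (m * n) \<le> y ^ m * y ^ n" using y(3) by (simp add: power_mult power_add)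
    then have "real (m * n) ^ p * real n ^ j * norm x ^ (m * n) \<le> real (m * n) ^ p * real n ^ j * (y ^ m * y ^ n)"
      by (intro mult_left_mono) auto
    then show "norm (case z of (m, n) \<Rightarrow> of_nat (m * n) ^ p * of_nat n ^ j * x ^ (m * n))
       \<le> (case z of (m, n) \<Rightarrow> real m ^ p * y ^ m * (real n ^ (p + j) * y ^ n))"
      by (simp add: z norm_mult norm_power power_mult_distrib power_add mult_ac)
  qed auto
qed

text \<open>Group the pairs (m, n) by their product N; the second entry runs through the divisors of
  N.\<close>

lemma lambert_has_sum:
  fixes x :: complex
  assumes "norm x < 1"
  shows "((\<lambda>(m, n). of_nat (m * n) ^ p * of_nat n ^ j * x ^ (m * n)) has_sum lam p j x) ({1..} \<times> {1..})"
    and "summable (\<lambda>n. norm (of_nat (Suc n) ^ p * of_nat (divisor_power_sum j (Suc n)) * x ^ Suc n))"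
proof -
  let ?f = "\<lambda>(m, n). of_nat (m * n) ^ p * of_nat n ^ j * x ^ (m * n)"
  obtain S where S: "(?f has_sum S) ({1..} \<times> {1..})"
    using abs_summable_summable[OF lambert_abs_summable[OF assms, of p j]] summable_on_def by blast
  let ?B = "\<lambda>N::nat. {d. d dvd N}"
  have bij: "((\<lambda>(N, d). of_nat N ^ p * of_nat d ^ j * x ^ N) has_sum S) (Sigma {1..} ?B)"
    by (rule iffD1[OF has_sum_reindex_bij_witness[of _ "\<lambda>(N, d). (N div d, d)" "\<lambda>(m, n). (m * n, n)"] S])
       (auto simp: Suc_le_eq dvd_div_eq_0_iff dest: dvd_pos_nat)
  have "((\<lambda>N. of_nat N ^ p * of_nat (divisor_power_sum j N) * x ^ N) has_sum S) {1..}"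
  proof (rule has_sum_SigmaD[OF bij])
    fix N :: nat assume N: "N \<in> {1..}"
    then have "finite (?B N)" by (simp add: finite_divisors_nat)
    then show "((\<lambda>d. case (N, d) of (N, d) \<Rightarrow> of_nat N ^ p * of_nat d ^ j * x ^ N) has_sum
        of_nat N ^ p * of_nat (divisor_power_sum j N) * x ^ N) (?B N)"
      by (intro has_sum_finiteI) (auto simp: divisor_power_sum_def sum_distrib_left sum_distrib_right)
  qed
  then have hs: "((\<lambda>n. of_nat (Suc n) ^ p * of_nat (divisor_power_sum j (Suc n)) * x ^ Suc n) has_sum S) UNIV"
    by (simp only: has_sum_atLeast1)
  then have "S = lam p j x" unfolding lam_def by (rule sums_unique[OF has_sum_imp_sums])
  then show "(?f has_sum lam p j x) ({1..} \<times> {1..})" using S by simp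
  show "summable (\<lambda>n. norm (of_nat (Suc n) ^ p * of_nat (divisor_power_sum j (Suc n)) * x ^ Suc n))"
    by (rule summable_on_imp_summable, rule iffD1[OF summable_on_iff_abs_summable_on_complex])
       (use hs in \<open>auto simp only: summable_on_def\<close>)
qed

lemma fa_has_sum: "norm x < 1 \<Longrightarrow> ((\<lambda>n. x ^ n) has_sum fa x) {1..}"
proof -
  assume x: "norm x < 1"
  have "(\<lambda>n. x * x ^ n) sums (x * (1 / (1 - x)))" by (intro sums_mult geometric_sums x)
  moreover have "summable (\<lambda>n. norm (x * x ^ n))"
    using x by (simp add: norm_mult norm_power summable_mult summable_geometric)
  ultimately show ?thesis unfolding has_sum_atLeast1 fa_def by (simp add: norm_summable_imp_has_sum)
qed

lemma fb_has_sum: "norm x < 1 \<Longrightarrow> ((\<lambda>n. of_nat n * x ^ n) has_sum fb x) {1..}"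
proof -
  assume x: "norm x < 1"
  have "(\<lambda>n. x * (of_nat (Suc n) * x ^ n)) sums (x * (1 / (1 - x)^2))" by (intro sums_mult geometric_deriv_sums x)
  moreover have "summable (\<lambda>n. norm (x * (of_nat (Suc n) * x ^ n)))"
  proof -
    have "summable (\<lambda>m. of_nat (Suc m) ^ 1 * norm x ^ Suc m)"
      using summable_power_geometric[of "norm x" 1] x by (subst summable_Suc_iff) auto
    then show ?thesis by (simp add: norm_mult norm_power mult_ac del: of_nat_Suc)
  qed
  ultimately have "((\<lambda>n. x * (of_nat (Suc n) * x ^ n)) has_sum (x * (1 / (1 - x)^2))) UNIV"
    by (rule norm_summable_imp_has_sum[rotated])
  then show ?thesis unfolding has_sum_atLeast1 fb_def by (simp add: mult_ac)
qed

text \<open>Indexed by \<open>p\<close> so that the expansions of \<open>Z\<close> (p = 0) and of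
  \<open>T\<close> (p = 1) come from the same argument.\<close>

definition fab :: "nat \<Rightarrow> complex \<Rightarrow> complex" where "fab p = (if p = 0 then fa else fb)"

lemma fab_has_sum: "norm x < 1 \<Longrightarrow> p \<le> 1 \<Longrightarrow> ((\<lambda>n. of_nat n ^ p * x ^ n) has_sum fab p x) {1..}"
  using fa_has_sum[of x] fb_has_sum[of x] by (cases p) (auto simp: fab_def)

text \<open>A triple sum over m, n and the exponent j of exp (- n v) - exp (n v), read in two
  orders: j and then n first gives \<open>fab\<close>, while (m, n) first gives the Taylor
  coefficient \<open>lam\<close>. The smallness of v is what makes the triple sum absolutely
  convergent.\<close>

lemma exp_lambert_sums:
  fixes q v :: complex
  assumes q: "norm q * exp (norm v) < 1" and p: "p \<le> 1"
  shows "(\<lambda>j. ((-1) ^ j - 1) / fact j * lam p j q * v ^ j) sums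
    (\<Sum>m. of_nat (Suc m) ^ p * (fab p (q ^ Suc m * exp (- v)) - fab p (q ^ Suc m * exp v)))"
    (is ?A)
  and "summable (\<lambda>m. of_nat (Suc m) ^ p * (fab p (q ^ Suc m * exp (- v)) - fab p (q ^ Suc m * exp v)))" (is ?B)
proof -
  define f where "f = (\<lambda>((m::nat, n::nat), j::nat). of_nat (m * n) ^ p * q ^ (m * n) * (((-1) ^ j - 1) * (of_nat n * v) ^ j / fact j))"
  define g where "g = (\<lambda>((m::nat, n::nat), j::nat). of_nat (m * n) ^ p * norm q ^ (m * n) * (2 * ((of_nat n * norm v) ^ j / fact j)))"
  define I where "I = {1::nat..} \<times> {1::nat..}"
  define \<rho> where "\<rho> = norm q * exp (norm v)"
  have exps: "((\<lambda>j. x ^ j / fact j) has_sum exp x) UNIV" for x :: complex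
  proof (rule norm_summable_imp_has_sum)
    show "(\<lambda>j. x ^ j / fact j) sums exp x" using exp_converges[of x] by (simp add: scaleR_conv_of_real field_simps)
    show "summable (\<lambda>j. norm (x ^ j / fact j))" using summable_norm_exp[of x] by (simp add: norm_divide norm_power field_simps)
  qed
  have expr: "((\<lambda>j. x ^ j / fact j) has_sum exp x) UNIV" if "x \<ge> 0" for x :: real
  proof (rule sums_nonneg_imp_has_sum)
    show "(\<lambda>j. x ^ j / fact j) sums exp x" using exp_converges[of x] by (simp add: field_simps)
  qed (use that in auto)
  have q1: "norm q < 1"
  proof -
    have "norm q * 1 \<le> norm q * exp (norm v)" by (intro mult_left_mono) auto
    then show ?thesis using q by linarith
  qed
  have "g summable_on (I \<times> UNIV)"
  proof (rule summable_on_SigmaI)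
    fix z assume "z \<in> I"
    then obtain m n where z: "z = (m, n)" by (cases z)
    show "((\<lambda>j. g (z, j)) has_sum (case z of (m, n) \<Rightarrow> of_nat (m * n) ^ p * norm q ^ (m * n) * (2 * exp (of_nat n * norm v)))) UNIV"
      unfolding z g_def prod.case by (intro has_sum_cmult_right expr) auto
  next
    have s: "(\<lambda>(m, n). 2 * (of_nat (m * n) ^ p * \<rho> ^ (m * n))) summable_on I"
      using summable_on_cmult_right[OF lambert_abs_summable[of "of_real \<rho>" p 0], of 2] q
      by (simp add: I_def \<rho>_def case_prod_unfold norm_mult norm_power)
    show "(\<lambda>z. case z of (m, n) \<Rightarrow> of_nat (m * n) ^ p * norm q ^ (m * n) * (2 * exp (of_nat n * norm v))) summable_on I"
    proof (rule summable_on_comparison_test[OF s])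
      fix z assume "z \<in> I"
      then obtain m n where z: "z = (m, n)" "m \<ge> 1" "n \<ge> 1" by (auto simp: I_def)
      \<comment> \<open>Since m >= 1, exp (n |v|) is at most exp (m n |v|), which merges with |q|^(m
        n) into a power of \<open>\<rho>\<close>.\<close>
      have "of_nat n * norm v \<le> of_nat (m * n) * norm v"
        using z by (intro mult_right_mono) auto
      then have "exp (of_nat n * norm v) \<le> exp (norm v) ^ (m * n)"
        by (simp add: exp_of_nat_mult[symmetric] mult.commute)
      then have "norm q ^ (m * n) * exp (of_nat n * norm v) \<le> \<rho> ^ (m * n)"
        unfolding \<rho>_def power_mult_distrib by (intro mult_left_mono) auto
      then have "of_nat (m * n) ^ p * (norm q ^ (m * n) * exp (of_nat n * norm v)) \<le> of_nat (m * n) ^ p * \<rho> ^ (m * n)"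
        by (intro mult_left_mono) auto
      then show "(case z of (m, n) \<Rightarrow> of_nat (m * n) ^ p * norm q ^ (m * n) * (2 * exp (of_nat n * norm v)))
          \<le> (case z of (m, n) \<Rightarrow> 2 * (of_nat (m * n) ^ p * \<rho> ^ (m * n)))" by (simp add: z mult_ac)
    qed (auto simp: case_prod_unfold)
  qed (auto simp: g_def case_prod_unfold)
  then have "(\<lambda>z. norm (f z)) summable_on (I \<times> UNIV)"
  proof (rule summable_on_comparison_test)
    fix z assume "z \<in> I \<times> (UNIV :: nat set)"
    then obtain m n j where z: "z = ((m, n), j)" by (metis prod.exhaust)
    have "norm ((-1) ^ j - 1 :: complex) \<le> 2" by (cases "even j") auto
    then have "norm ((-1) ^ j - 1 :: complex) * (norm (of_nat n * v) ^ j / fact j) \<le> 2 * (norm (of_nat n * v) ^ j / fact j)"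
      by (intro mult_right_mono) auto
    then have "of_nat (m * n) ^ p * norm q ^ (m * n) * (norm ((-1) ^ j - 1 :: complex) * (norm (of_nat n * v) ^ j / fact j))
       \<le> of_nat (m * n) ^ p * norm q ^ (m * n) * (2 * (norm (of_nat n * v) ^ j / fact j))"
      by (intro mult_left_mono) auto
    then show "norm (f z) \<le> g z"
      by (simp add: z f_def g_def norm_mult norm_power norm_divide)
  qed auto
  then have "f summable_on (I \<times> UNIV)" by (rule abs_summable_summable)
  then obtain S where S: "(f has_sum S) (I \<times> UNIV)" by (auto simp: summable_on_def)
  have 1: "((\<lambda>(m, n). of_nat (m * n) ^ p * q ^ (m * n) * (exp (- (of_nat n * v)) - exp (of_nat n * v))) has_sum S) I"
  proof (rule has_sum_SigmaD[OF S])
    fix z assume "z \<in> I"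
    then obtain m n where z: "z = (m, n)" by (cases z)
    have "((\<lambda>j. (- (of_nat n * v)) ^ j / fact j - (of_nat n * v) ^ j / fact j) has_sum exp (- (of_nat n * v)) - exp (of_nat n * v)) UNIV"
      by (intro has_sum_diff exps)
    moreover have "(- x) ^ j / fact j - x ^ j / fact j = ((-1) ^ j - 1) * x ^ j / fact j" for x :: complex and j
      by (simp add: power_minus[of x] diff_divide_distrib left_diff_distrib)
    ultimately have "((\<lambda>j. ((-1) ^ j - 1) * (of_nat n * v) ^ j / fact j) has_sum exp (- (of_nat n * v)) - exp (of_nat n * v)) UNIV"
      by (simp only:)
    then show "((\<lambda>y. f (z, y)) has_sum (case z of (m, n) \<Rightarrow> of_nat (m * n) ^ p * q ^ (m * n) * (exp (- (of_nat n * v)) - exp (of_nat n * v)))) UNIV"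
      unfolding z f_def prod.case by (intro has_sum_cmult_right)
  qed
  have 2: "((\<lambda>m. of_nat m ^ p * (fab p (q ^ m * exp (- v)) - fab p (q ^ m * exp v))) has_sum S) {1..}"
  proof (rule has_sum_SigmaD[OF 1[unfolded I_def]])
    fix m :: nat assume m: "m \<in> {1..}"
    have le: "norm (q ^ m * exp w) < 1" if "norm w = norm v" for w
    proof -
      have "norm (q ^ m * exp w) \<le> norm q ^ m * exp (norm v)"
        using norm_exp[of w] that by (simp add: norm_mult norm_power mult_left_mono)
      also have "\<dots> \<le> norm q ^ 1 * exp (norm v)" using m q1 by (intro mult_right_mono power_decreasing) auto
      finally show ?thesis using q by simp
    qed
    have "((\<lambda>n. of_nat n ^ p * (q ^ m * exp (- v)) ^ n - of_nat n ^ p * (q ^ m * exp v) ^ n) has_sum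
        (fab p (q ^ m * exp (- v)) - fab p (q ^ m * exp v))) {1..}"
      by (intro has_sum_diff fab_has_sum le p) auto
    then have "((\<lambda>n. of_nat m ^ p * (of_nat n ^ p * (q ^ m * exp (- v)) ^ n - of_nat n ^ p * (q ^ m * exp v) ^ n)) has_sum
       of_nat m ^ p * (fab p (q ^ m * exp (- v)) - fab p (q ^ m * exp v))) {1..}"
      by (rule has_sum_cmult_right)
    moreover have "of_nat m ^ p * (of_nat n ^ p * (q ^ m * exp (- v)) ^ n - of_nat n ^ p * (q ^ m * exp v) ^ n) =
        of_nat (m * n) ^ p * q ^ (m * n) * (exp (- (of_nat n * v)) - exp (of_nat n * v))" for n
    proof -
      have "exp (- (of_nat n * v)) = exp (- v) ^ n" by (metis exp_of_nat_mult mult_minus_right)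
      moreover have "exp (of_nat n * v) = exp v ^ n" by (rule exp_of_nat_mult)
      ultimately show ?thesis by (simp add: power_mult_distrib power_mult algebra_simps)
    qed
    ultimately show "((\<lambda>n. case (m, n) of (m, n) \<Rightarrow> of_nat (m * n) ^ p * q ^ (m * n) * (exp (- (of_nat n * v)) - exp (of_nat n * v))) has_sum
        of_nat m ^ p * (fab p (q ^ m * exp (- v)) - fab p (q ^ m * exp v))) {1..}"
      by (simp only: prod.case)
  qed
  then have sm: "(\<lambda>m. of_nat (Suc m) ^ p * (fab p (q ^ Suc m * exp (- v)) - fab p (q ^ Suc m * exp v))) sums S"
    unfolding has_sum_atLeast1 by (rule has_sum_imp_sums)
  then show ?B by (rule sums_summable)
  have S': "((\<lambda>(j, z). f (z, j)) has_sum S) (UNIV \<times> I)"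
    using S by (simp add: has_sum_swap[of _ _ I] case_prod_unfold)
  have "((\<lambda>j. ((-1) ^ j - 1) / fact j * lam p j q * v ^ j) has_sum S) UNIV"
  proof (rule has_sum_SigmaD[OF S'])
    fix j :: nat
    have "((\<lambda>z. ((-1) ^ j - 1) / fact j * v ^ j * (case z of (m, n) \<Rightarrow> of_nat (m * n) ^ p * of_nat n ^ j * q ^ (m * n))) has_sum
       ((-1) ^ j - 1) / fact j * v ^ j * lam p j q) I"
      unfolding I_def by (rule has_sum_cmult_right[OF lambert_has_sum(1)[OF q1]])
    then show "((\<lambda>z. case (j, z) of (j, z) \<Rightarrow> f (z, j)) has_sum ((-1) ^ j - 1) / fact j * lam p j q * v ^ j) I"
      by (simp add: f_def case_prod_unfold power_mult_distrib mult_ac)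
  qed
  then show ?A using sm by (simp add: has_sum_imp_sums sums_unique[symmetric])
qed

section \<open>The Bernoulli generating function and Taylor expansions at the origin\<close>

definition Bf :: "complex fps" where "Bf = fps_X / (fps_exp 1 - 1)"

lemma exp_minus_1_dvd_X: "(fps_exp 1 - 1 :: 'a :: field_char_0 fps) dvd fps_X"
proof -
  have "subdegree (fps_exp 1 - 1 :: 'a fps) = 1" by (rule subdegreeI) auto
  moreover have "(fps_exp 1 - 1 :: 'a fps) \<noteq> 0" using calculation by auto
  ultimately show ?thesis by (subst fps_dvd_iff) auto
qed

lemma Bf_mult: "Bf * (fps_exp 1 - 1) = fps_X"
  unfolding Bf_def by (rule dvd_div_mult_self[OF exp_minus_1_dvd_X])

text \<open>\<open>bernoulli\<close> is defined by a real quotient. Its coefficientwise complex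
  image solves the equation that determines \<open>Bf\<close>, and power series have no zero
  divisors.\<close>

lemma Bf_nth: "fps_nth Bf n = of_real (bernoulli n) / fact n"
proof -
  define F where "F = (fps_X / (fps_exp 1 - 1) :: real fps)"
  have F: "F * (fps_exp 1 - 1) = fps_X" unfolding F_def by (rule dvd_div_mult_self[OF exp_minus_1_dvd_X])
  define G where "G = Abs_fps (\<lambda>n. of_real (fps_nth F n) :: complex)"
  have "G * (fps_exp 1 - 1) = fps_X"
  proof (rule fps_ext)
    fix n
    have "fps_nth (G * (fps_exp 1 - 1)) n = of_real (fps_nth (F * (fps_exp 1 - 1)) n)"
      unfolding fps_mult_nth by (auto simp: G_def intro!: sum.cong)
    then show "fps_nth (G * (fps_exp 1 - 1)) n = fps_nth fps_X n" by (simp add: F)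
  qed
  then have "G * (fps_exp 1 - 1) = Bf * (fps_exp 1 - 1)" using Bf_mult by simp
  moreover have "(fps_exp 1 - 1 :: complex fps) \<noteq> 0"
  proof
    assume "(fps_exp 1 - 1 :: complex fps) = 0"
    then have "fps_nth (fps_exp 1 - 1 :: complex fps) 1 = 0" by simp
    then show False by simp
  qed
  ultimately have "G = Bf" by simp
  then have "fps_nth Bf n = fps_nth G n" by simp
  then have "fps_nth Bf n = of_real (fps_nth F n)" unfolding G_def by simp
  then show ?thesis by (simp add: bernoulli_def F_def)
qed


lemma has_fps_expansion_imp_eventually_sums:
  fixes f :: "complex \<Rightarrow> complex"
  assumes "f has_fps_expansion F"
  shows "\<forall>\<^sub>F v in nhds 0. (\<lambda>n. fps_nth F n * v ^ n) sums f v"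
proof -
  have "\<forall>\<^sub>F v in nhds 0. v \<in> eball 0 (fps_conv_radius F)"
    using assms by (intro eventually_nhds_in_open) (auto simp: has_fps_expansion_def zero_ereal_def)
  moreover have "\<forall>\<^sub>F v in nhds 0. eval_fps F v = f v" using assms by (simp add: has_fps_expansion_def)
  ultimately show ?thesis
  proof eventually_elim
    case (elim v)
    then have "(\<lambda>n. fps_nth F n * v ^ n) sums eval_fps F v" by (intro sums_eval_fps) (auto simp: in_eball_iff dist_norm)
    then show ?case using elim by simp
  qed
qed

lemma eventually_nhds_0_uminus:
  fixes P :: "complex \<Rightarrow> bool"
  assumes "\<forall>\<^sub>F v in nhds 0. P v" shows "\<forall>\<^sub>F v in nhds 0. P (- v)"
proof -
  have "((\<lambda>v. - v) \<longlongrightarrow> - 0) (nhds (0::complex))" by (intro tendsto_minus filterlim_ident)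
  then have "filterlim (\<lambda>v. - v) (nhds (0::complex)) (nhds 0)" by simp
  then show ?thesis using assms by (simp add: filterlim_iff)
qed

lemma odd_imp_fps_even_0:
  fixes f :: "complex \<Rightarrow> complex"
  assumes F: "f has_fps_expansion F" and odd: "\<forall>\<^sub>F v in nhds 0. f (- v) = - f v" and n: "even n"
  shows "fps_nth F n = 0"
proof -
  have "(\<lambda>v. - f v) has_fps_expansion Abs_fps (\<lambda>n. (-1) ^ n * fps_nth F n)"
  proof (rule has_fps_expansionI)
    show "\<forall>\<^sub>F v in nhds 0. (\<lambda>n. fps_nth (Abs_fps (\<lambda>n. (-1) ^ n * fps_nth F n)) n * v ^ n) sums - f v"
      using eventually_nhds_0_uminus[OF has_fps_expansion_imp_eventually_sums[OF F]] odd
    proof eventually_elim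
      case (elim v)
      have "fps_nth (Abs_fps (\<lambda>n. (-1) ^ n * fps_nth F n)) n * v ^ n = fps_nth F n * (- v) ^ n" for n
        by (subst power_minus) simp
      then show ?case using elim by (simp only:)
    qed
  qed
  moreover have "(\<lambda>v. - f v) has_fps_expansion - F" using F by (rule has_fps_expansion_minus)
  ultimately have "Abs_fps (\<lambda>n. (-1) ^ n * fps_nth F n) = - F" by (rule fps_expansion_unique_complex)
  then have "fps_nth (Abs_fps (\<lambda>n. (-1) ^ n * fps_nth F n)) n = fps_nth (- F) n" by simp
  then have "fps_nth F n = - fps_nth F n" using n by simp
  then show ?thesis by simp
qed

lemma has_fps_expansion_div_power_tendsto_0:
  fixes h :: "complex \<Rightarrow> complex"
  assumes H: "h has_fps_expansion H" and z: "\<And>i. i \<le> n \<Longrightarrow> fps_nth H i = 0"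
  shows "((\<lambda>v. h v / v ^ n) \<longlongrightarrow> 0) (at 0)"
proof -
  have "(\<lambda>x. if x = 0 then fps_nth H n else h x / x ^ n) has_fps_expansion fps_shift n H" if "H \<noteq> 0"
    using that z by (intro has_fps_expansion_shift H refl) (meson le_cases nth_subdegree_nonzero)
  moreover have "(\<lambda>x. if x = 0 then fps_nth H n else h x / x ^ n) has_fps_expansion fps_shift n H" if "H = 0"
  proof -
    have "\<forall>\<^sub>F x in nhds 0. h x = 0" using H that by (auto simp: has_fps_expansion_def elim: eventually_mono)
    then have "\<forall>\<^sub>F x in nhds 0. (if x = 0 then fps_nth H n else h x / x ^ n) = 0"
      by eventually_elim (auto simp: that)
    then have "(\<lambda>x. if x = 0 then fps_nth H n else h x / x ^ n) has_fps_expansion 0"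
      by (auto simp: has_fps_expansion_def elim: eventually_mono)
    then show ?thesis using that by simp
  qed
  ultimately have "(\<lambda>x. if x = 0 then fps_nth H n else h x / x ^ n) has_fps_expansion fps_shift n H" by blast
  then have "isCont (\<lambda>x. if x = 0 then fps_nth H n else h x / x ^ n) 0"
    by (rule has_fps_expansion_imp_continuous)
  then have "((\<lambda>x. if x = 0 then fps_nth H n else h x / x ^ n) \<longlongrightarrow> fps_nth H n) (at 0)"
    by (simp add: isCont_def)
  then have "((\<lambda>v. h v / v ^ n) \<longlongrightarrow> fps_nth H n) (at 0)"
    by (rule Lim_transform_eventually) (auto simp: eventually_at_filter)
  then show ?thesis using z by simp
qed

lemma Bf_0: "fps_nth Bf 0 = 1" and Bf_1: "fps_nth Bf 1 = - 1/2"
proof -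
  have "fps_nth (Bf * (fps_exp 1 - 1)) 1 = 1" by (simp add: Bf_mult)
  then show 0: "fps_nth Bf 0 = 1" by (simp add: fps_mult_nth atLeast0_atMost_Suc)
  have "fps_nth (Bf * (fps_exp 1 - 1)) 2 = 0" by (simp add: Bf_mult)
  then have "fps_nth Bf 1 + 1/2 = 0" using 0
    by (simp add: fps_mult_nth atLeast0_atMost_Suc numeral_2_eq_2 add.commute)
  then show "fps_nth Bf 1 = - 1/2" by (simp add: eq_neg_iff_add_eq_0)
qed

lemma Bf_expansion: "(\<lambda>v. if v = 0 then 1 else v / (exp v - 1)) has_fps_expansion Bf"
proof -
  have sd: "subdegree (fps_exp 1 - 1 :: complex fps) = 1" by (rule subdegreeI) auto
  show ?thesis unfolding Bf_def
    by (intro has_fps_expansion_divide fps_expansion_intros) (use sd in \<open>auto simp: sd\<close>)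
qed

text \<open>\<open>eis k\<close> is \<open>B\<^sub>k / k!\<close> times \<open>E\<^sub>k\<close>, and \<open>eisD p k\<close> is its \<open>p\<close>-th derivative with respect to \<open>q d/dq\<close> (for \<open>p > 0\<close>).
  In this normalisation they are Taylor coefficients of \<open>Z v - 1/v\<close> and of \<open>T\<close> at 0.\<close>

definition eis :: "nat \<Rightarrow> complex \<Rightarrow> complex" where
  "eis k q = of_real (bernoulli k) / fact k - 2 / fact (k - 1) * lam 0 (k - 1) q"

definition eisD :: "nat \<Rightarrow> nat \<Rightarrow> complex \<Rightarrow> complex" where
  "eisD p k q = - 2 / fact (k - 1) * lam p (k - 1) q"

context nome
begin

text \<open>\<open>A0\<close> is the regular part of \<open>Z\<close>. Both functions get the value
  0 at the origin, as oddness forces; \<open>T\<close> has no pole there because its term m = 0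
  carries the factor m.\<close>

definition A0 :: "complex \<Rightarrow> complex" where "A0 v = (if v = 0 then 0 else Z v - 1 / v)"
definition T0 :: "complex \<Rightarrow> complex" where "T0 v = (if v = 0 then 0 else T v)"
definition AF :: "complex fps" where "AF = Abs_fps (\<lambda>n. if odd n then eis (n + 1) q else 0)"
definition TF :: "complex fps" where "TF = Abs_fps (\<lambda>n. if odd n then eisD 1 (n + 1) q else 0)"

lemma eventually_small: "\<forall>\<^sub>F v::complex in nhds 0. norm q * exp (norm v) < 1"
proof -
  have "((\<lambda>v::complex. norm q * exp (norm v)) \<longlongrightarrow> norm q * exp (norm (0::complex))) (at 0)"
    by (intro tendsto_intros)
  then have "\<forall>\<^sub>F v::complex in at 0. norm q * exp (norm v) < 1" by (rule order_tendstoD) (use q1 in simp)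
  then show ?thesis by (simp add: eventually_nhds_conv_at q1)
qed

lemma eventually_off_\<Lambda>: "\<forall>\<^sub>F v in nhds 0. v \<noteq> 0 \<longrightarrow> v \<notin> \<Lambda>"
proof -
  have "\<forall>\<^sub>F v in nhds 0. v \<in> ball 0 \<rho>" by (intro eventually_nhds_in_open) (auto simp: \<rho>_pos)
  then show ?thesis by eventually_elim (use \<Lambda>_small in auto)
qed

lemma Z_expand: assumes "v \<notin> \<Lambda>" "norm q * exp (norm v) < 1"
  shows "Z v = 1/2 + 1 / (exp v - 1) + (\<Sum>m. of_nat (Suc m) ^ 0 * (fab 0 (q ^ Suc m * exp (- v)) - fab 0 (q ^ Suc m * exp v)))"
proof -
  have v: "v \<in> - \<Lambda>" using assms by simp
  have s1: "summable (\<lambda>m. of_nat m ^ 0 * fa (q ^ m * 1 * exp (-1 * v)))"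
    by (rule Lser_deriv(1)[OF q1 fa_deriv fa_bound open_compl_\<Lambda> nl1 v])
  have s2: "summable (\<lambda>m. of_nat m ^ 0 * fa (q ^ m * q * exp (1 * v)))"
    by (rule Lser_deriv(1)[OF q1 fa_deriv fa_bound open_compl_\<Lambda> nl2 v])
  have s1': "summable (\<lambda>m. fa (q ^ Suc m * exp (- v)))" using s1 by (subst summable_Suc_iff) simp
  have s2': "summable (\<lambda>m. fa (q ^ Suc m * exp v))" using s2 by (simp add: mult_ac)
  have "Lser q 0 fa 1 (-1) v = fa (exp (- v)) + (\<Sum>m. fa (q ^ Suc m * exp (- v)))"
    using suminf_split_head[OF s1] unfolding Lser_def by simp
  moreover have "Lser q 0 fa q 1 v = (\<Sum>m. fa (q ^ Suc m * exp v))" unfolding Lser_def by (simp add: mult_ac)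
  moreover have "exp v \<noteq> 1" using nl3[OF v, of 0] by simp
  then have "fa (exp (- v)) = 1 / (exp v - 1)" unfolding fa_def by (simp add: exp_minus field_simps)
  ultimately show ?thesis unfolding Z_def fab_def using suminf_diff[OF s1' s2'] by simp
qed

lemma T_expand: assumes "v \<notin> \<Lambda>"
  shows "T v = (\<Sum>m. of_nat (Suc m) ^ 1 * (fab 1 (q ^ Suc m * exp (- v)) - fab 1 (q ^ Suc m * exp v)))"
proof -
  have v: "v \<in> - \<Lambda>" using assms by simp
  have s1: "summable (\<lambda>m. of_nat m ^ 1 * fb (q ^ m * 1 * exp (-1 * v)))"
    by (rule Lser_deriv(1)[OF q1 fb_deriv fb_bound open_compl_\<Lambda> nl1 v])
  have s2: "summable (\<lambda>m. of_nat m ^ 1 * fb (q ^ m * 1 * exp (1 * v)))"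
    by (rule Lser_deriv(1)[OF q1 fb_deriv fb_bound open_compl_\<Lambda> nl3 v])
  have d: "T v = (\<Sum>m. of_nat m ^ 1 * fb (q ^ m * 1 * exp (-1 * v)) - of_nat m ^ 1 * fb (q ^ m * 1 * exp (1 * v)))"
    unfolding T_def Lser_def by (rule suminf_diff[OF s1 s2])
  show ?thesis unfolding d fab_def using suminf_split_head[OF summable_diff[OF s1 s2]]
    by (simp add: right_diff_distrib del: power_Suc)
qed

lemma A0_expansion: "A0 has_fps_expansion AF"
proof -
  define F where "F = Abs_fps (\<lambda>n. fps_nth Bf (Suc n) + (if n = 0 then 1/2 else 0) + ((-1) ^ n - 1) / fact n * lam 0 n q)"
  have F: "A0 has_fps_expansion F"
  proof (rule has_fps_expansionI)
    show "\<forall>\<^sub>F v in nhds 0. (\<lambda>n. fps_nth F n * v ^ n) sums A0 v"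
      using has_fps_expansion_imp_eventually_sums[OF Bf_expansion] eventually_small eventually_off_\<Lambda>
    proof eventually_elim
      case (elim v)
      show ?case
      proof (cases "v = 0")
        case True
        have "(\<lambda>n. fps_nth F n * 0 ^ n) sums fps_nth F 0" by (rule powser_sums_zero)
        then show ?thesis using True Bf_1 by (simp add: A0_def F_def)
      next
        case False
        then have v: "v \<notin> \<Lambda>" using elim by simp
        have "exp v \<noteq> 1" using nl3[of v 0] v by simp
        have "(\<lambda>n. fps_nth Bf (Suc n) * v ^ Suc n) sums (v / (exp v - 1) - fps_nth Bf 0 * v ^ 0)"
          using elim(1) False by (subst sums_Suc_iff) auto
        then have "(\<lambda>n. fps_nth Bf (Suc n) * v ^ Suc n / v) sums ((v / (exp v - 1) - 1) / v)"
          by (intro sums_divide) (simp add: Bf_0)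
        then have 1: "(\<lambda>n. fps_nth Bf (Suc n) * v ^ n) sums (1 / (exp v - 1) - 1 / v)"
          using False by (simp add: diff_divide_distrib)
        have 2: "(\<lambda>n. (if n = 0 then 1/2 else 0) * v ^ n) sums (1/2)"
          using sums_single[of 0 "\<lambda>n. 1/2 * v ^ n"] by (simp add: if_distrib[of "\<lambda>x. x * _"] cong: if_cong)
        have 3: "(\<lambda>n. ((-1) ^ n - 1) / fact n * lam 0 n q * v ^ n) sums
           (\<Sum>m. of_nat (Suc m) ^ 0 * (fab 0 (q ^ Suc m * exp (- v)) - fab 0 (q ^ Suc m * exp v)))"
          by (rule exp_lambert_sums(1)) (use elim in auto)
        have "(\<lambda>n. fps_nth F n * v ^ n) sums (Z v - 1 / v)"
          using sums_add[OF sums_add[OF 1 2] 3] unfolding Z_expand[OF v elim(2)] F_def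
          by (simp add: algebra_simps)
        then show ?thesis using False by (simp add: A0_def)
      qed
    qed
  qed
  have "\<forall>\<^sub>F v in nhds 0. A0 (- v) = - A0 v"
    using eventually_off_\<Lambda> by eventually_elim (auto simp: A0_def Z_odd)
  \<comment> \<open>The even coefficients of \<open>F\<close> contain Bernoulli numbers of odd index
    and the compensating 1/2. That they vanish is read off from the oddness of
    \<open>Z\<close>.\<close>
  then have ev: "even n \<Longrightarrow> fps_nth F n = 0" for n using odd_imp_fps_even_0[OF F] by blast
  have "F = AF"
  proof (rule fps_ext)
    fix n
    show "fps_nth F n = fps_nth AF n"
    proof (cases "even n")
      case True
      then show ?thesis using ev by (simp add: AF_def)
    next
      case False
      then have "n \<noteq> 0" by (metis even_zero)
      then show ?thesis using False unfolding AF_def F_def eis_def fps_nth_Abs_fps Bf_nth by simp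
    qed
  qed
  then show ?thesis using F by simp
qed

lemma T0_expansion: "T0 has_fps_expansion TF"
proof (rule has_fps_expansionI)
  show "\<forall>\<^sub>F v in nhds 0. (\<lambda>n. fps_nth TF n * v ^ n) sums T0 v"
    using eventually_small eventually_off_\<Lambda>
  proof eventually_elim
    case (elim v)
    show ?case
    proof (cases "v = 0")
      case True
      have "(\<lambda>n. fps_nth TF n * 0 ^ n) sums fps_nth TF 0" by (rule powser_sums_zero)
      then show ?thesis using True by (simp add: T0_def TF_def)
    next
      case False
      then have v: "v \<notin> \<Lambda>" using elim by simp
      have "(\<lambda>n. ((-1) ^ n - 1) / fact n * lam 1 n q * v ^ n) sums T v"
        unfolding T_expand[OF v] by (rule exp_lambert_sums(1)) (use elim in auto)
      moreover have "((-1) ^ n - 1) / fact n * lam 1 n q = fps_nth TF n" for n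
        by (simp add: TF_def eisD_def)
      ultimately have "(\<lambda>n. fps_nth TF n * v ^ n) sums T v" by (simp only:)
      then show ?thesis using False by (simp add: T0_def)
    qed
  qed
qed

lemma periodic_int:
  fixes g :: "complex \<Rightarrow> 'a" assumes "\<And>v. g (v + w) = g v"
  shows "g (v + of_int a * w) = g v"
proof (induction a rule: int_induct[where k = 0])
  case (step1 i)
  then show ?case using assms[of "v + of_int i * w"] by (simp add: algebra_simps)
next
  case (step2 i)
  then show ?case using assms[of "v + of_int (i - 1) * w"] by (simp add: algebra_simps)
qed simp

text \<open>Liouville: periodicity carries the removable singularity at 0 to every lattice point,
  the extended function is entire and bounded, and its constant value is the limit 0.\<close>

lemma elliptic_eq_0:
  assumes hol: "g holomorphic_on - \<Lambda>" and p1: "\<And>v. v \<notin> \<Lambda> \<Longrightarrow> g (v + 2 * pi * \<i>) = g v"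
    and p2: "\<And>v. v \<notin> \<Lambda> \<Longrightarrow> g (v + t) = g v" and lim: "(g \<longlongrightarrow> 0) (at 0)" and v: "v \<notin> \<Lambda>"
  shows "g v = 0"
proof -
  \<comment> \<open>At lattice points \<open>g\<close> is arbitrary. Resetting it to 0 there makes
    the periodicity unconditional and agrees with the limit.\<close>
  define G where "G v = (if v \<in> \<Lambda> then 0 else g v)" for v
  have G1: "G (v + 2 * pi * \<i>) = G v" for v unfolding G_def using p1 \<Lambda>_add_iff[OF pi_in_\<Lambda>] by auto
  have G2: "G (v + t) = G v" for v unfolding G_def using p2 \<Lambda>_add_iff[OF t_in_\<Lambda>] by auto
  have GL: "G (v + of_int a * t + of_int b * (2 * pi * \<i>)) = G v" for v a b
    using periodic_int[of G, OF G1] periodic_int[of G, OF G2] by metis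
  have "isCont G 0"
  proof -
    have "\<forall>\<^sub>F v in at 0. g v = G v"
      using eventually_off_\<Lambda> unfolding eventually_at_filter by eventually_elim (simp add: G_def)
    then have "(G \<longlongrightarrow> 0) (at 0)" using lim by (rule Lim_transform_eventually[rotated])
    then show ?thesis by (simp add: isCont_def G_def zero_in_\<Lambda>)
  qed
  have hol1: "G holomorphic_on - \<Lambda>" using hol by (rule holomorphic_transform) (simp add: G_def)
  have hol0: "G holomorphic_on ball 0 \<rho>"
  proof (rule no_isolated_singularity[where K = "{0}"])
    show h: "G holomorphic_on ball 0 \<rho> - {0}"
      using hol1 by (rule holomorphic_on_subset) (use \<Lambda>_small in auto)
    have "isCont G v" if "v \<in> ball 0 \<rho>" for v
    proof (cases "v = 0")
      case True
      then show ?thesis using \<open>isCont G 0\<close> by simp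
    next
      case False
      then show ?thesis using h that by (meson Diff_iff continuous_on_interior holomorphic_on_imp_continuous_on
         interior_open open_Diff open_ball closed_singleton singletonD continuous_on_eq_continuous_at)
    qed
    then show "continuous_on (ball 0 \<rho>) G" by (simp add: continuous_at_imp_continuous_on)
  qed auto
  have "G holomorphic_on UNIV"
  proof (subst holomorphic_on_open)
    show "\<forall>v\<in>UNIV. \<exists>f'. (G has_field_derivative f') (at v)"
    proof
      fix v
      show "\<exists>f'. (G has_field_derivative f') (at v)"
      proof (cases "v \<in> \<Lambda>")
        case False
        then show ?thesis using hol1 open_compl_\<Lambda> by (auto simp: holomorphic_on_open)
      next
        case True
        then obtain a b :: int where ab: "v = of_int a * t + 2 * of_int b * pi * \<i>" unfolding \<Lambda>_iff by blast
        obtain f' where f': "(G has_field_derivative f') (at 0)"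
          using hol0 \<rho>_pos unfolding holomorphic_on_open[OF open_ball] by (metis centre_in_ball)
        have "((\<lambda>x. G (x + - v)) has_field_derivative f') (at v)"
          by (rule iffD1[OF DERIV_shift]) (use f' in simp)
        moreover have "G (x + - v) = G x" for x
          using GL[of "x + - v" a b] by (simp add: ab algebra_simps)
        ultimately show ?thesis by auto
      qed
    qed
  qed auto
  moreover have "bounded (range G)"
  proof -
    \<comment> \<open>A compact box containing a representative of every point: first a multiple of
      t adjusts the real part, then a multiple of 2 pi i the imaginary part.\<close>
    define K where "K = cbox (Complex (Re t) 0) (Complex 0 (2 * pi))"
    have "compact (G ` K)" using \<open>G holomorphic_on UNIV\<close> unfolding K_def
      by (intro compact_continuous_image compact_cbox holomorphic_on_imp_continuous_on)
         (rule holomorphic_on_subset, auto)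
    moreover have "range G \<subseteq> G ` K"
    proof clarify
      fix v
      define a where "a = \<lfloor>Re v / Re t\<rfloor>"
      define b where "b = \<lfloor>(Im v - of_int a * Im t) / (2 * pi)\<rfloor>"
      define w where "w = v - of_int a * t - of_int b * (2 * pi * \<i>)"
      have "of_int a \<le> Re v / Re t" "Re v / Re t < of_int a + 1" unfolding a_def by linarith+
      then have 1: "Re w \<le> 0" "Re w \<ge> Re t" using Ret by (auto simp: w_def field_simps)
      have "of_int b \<le> (Im v - of_int a * Im t) / (2 * pi)" "(Im v - of_int a * Im t) / (2 * pi) < of_int b + 1"
        unfolding b_def by linarith+
      then have 2: "Im w \<ge> 0" "Im w \<le> 2 * pi" by (auto simp: w_def field_simps)
      have "w \<in> K" using 1 2 unfolding K_def by (simp add: in_cbox_complex_iff)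
      moreover have "G v = G w" using GL[of w a b] by (simp add: w_def)
      ultimately show "G v \<in> G ` K" by blast
    qed
    ultimately show ?thesis using bounded_subset compact_imp_bounded by blast
  qed
  ultimately have "G constant_on UNIV" by (rule Liouville_theorem)
  then have "G v = G 0" unfolding constant_on_def by auto
  then show ?thesis using v by (simp add: G_def zero_in_\<Lambda>)
qed

end


section \<open>Heat equation and differential equations of the Weierstrass function\<close>

lemma fps_split_5:
  fixes F :: "complex fps"
  assumes "fps_nth F 0 = 0" "fps_nth F 1 = 0" "fps_nth F 3 = 0"
  shows "F = fps_X ^ 2 * (fps_const (fps_nth F 2) + fps_const (fps_nth F 4) * fps_X ^ 2 + fps_X ^ 3 * fps_shift 5 F)"
proof (rule fps_ext)
  fix n :: nat
  consider "n = 0" | "n = 1" | "n = 2" | "n = 3" | "n = 4" | "n \<ge> 5" by linarith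
  then show "fps_nth F n = fps_nth (fps_X ^ 2 * (fps_const (fps_nth F 2) + fps_const (fps_nth F 4) * fps_X ^ 2 + fps_X ^ 3 * fps_shift 5 F)) n"
    by cases (use assms in \<open>auto simp: fps_X_power_mult_nth fps_X_power_nth fps_mult_left_const_nth\<close>)
qed

lemma fps_split_4:
  fixes F :: "complex fps"
  assumes "fps_nth F 0 = 0" "fps_nth F 2 = 0"
  shows "F = fps_X * (fps_const (fps_nth F 1) + fps_const (fps_nth F 3) * fps_X ^ 2 + fps_X ^ 3 * fps_shift 4 F)"
proof (rule fps_ext)
  fix n :: nat
  consider "n = 0" | "n = 1" | "n = 2" | "n = 3" | "n \<ge> 4" by linarith
  then show "fps_nth F n = fps_nth (fps_X * (fps_const (fps_nth F 1) + fps_const (fps_nth F 3) * fps_X ^ 2 + fps_X ^ 3 * fps_shift 4 F)) n"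
    by cases (use assms in \<open>auto simp: fps_X_power_mult_nth fps_X_power_nth fps_mult_left_const_nth\<close>)
qed

context nome
begin

definition Z2 where "Z2 = deriv Z1"
definition Z3 where "Z3 = deriv Z2"
text \<open>The constant \<open>eis 2 q\<close> is the linear coefficient of
  \<open>Z v - 1 / v\<close>; adding it removes the constant term, so this is the Weierstrass
  function of the lattice. It ties the quasi-period to E_2.\<close>

definition wp where "wp v = eis 2 q - Z1 v"
definition A1 where "A1 = deriv A0"
definition A2 where "A2 = deriv A1"
definition A3 where "A3 = deriv A2"
definition AF1 where "AF1 = fps_deriv AF"
definition AF2 where "AF2 = fps_deriv AF1"
definition AF3 where "AF3 = fps_deriv AF2"

lemma expansions: "A1 has_fps_expansion AF1" "A2 has_fps_expansion AF2" "A3 has_fps_expansion AF3"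
  unfolding A1_def A2_def A3_def AF1_def AF2_def AF3_def
  by (intro has_fps_expansion_deriv A0_expansion)+

lemma Z1_holo: "Z1 holomorphic_on - \<Lambda>"
  by (rule holomorphic_transform[OF holomorphic_deriv[OF Z_holo open_compl_\<Lambda>]]) (simp add: deriv_Z)
lemma Z2_holo: "Z2 holomorphic_on - \<Lambda>" unfolding Z2_def by (intro holomorphic_deriv Z1_holo open_compl_\<Lambda>)
lemma Z3_holo: "Z3 holomorphic_on - \<Lambda>" unfolding Z3_def by (intro holomorphic_deriv Z2_holo open_compl_\<Lambda>)

lemma Z1_deriv: "v \<notin> \<Lambda> \<Longrightarrow> (Z1 has_field_derivative Z2 v) (at v)"
  unfolding Z2_def by (rule holomorphic_derivI[OF Z1_holo open_compl_\<Lambda>]) simp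
lemma Z2_deriv: "v \<notin> \<Lambda> \<Longrightarrow> (Z2 has_field_derivative Z3 v) (at v)"
  unfolding Z3_def by (rule holomorphic_derivI[OF Z2_holo open_compl_\<Lambda>]) simp

lemma laurent:
  "\<forall>\<^sub>F v in at 0. v \<notin> \<Lambda> \<and> Z v = 1 / v + A0 v \<and> Z1 v = - 1 / v^2 + A1 v \<and> Z2 v = 2 / v^3 + A2 v \<and>
     Z3 v = - 6 / v^4 + A3 v \<and> T v = T0 v"
proof -
  obtain s where s: "open s" "0 \<in> s" "A0 holomorphic_on s"
    using has_fps_expansion_imp_holomorphic[OF A0_expansion] by metis
  define U where "U = s \<inter> ball 0 \<rho> - {0}"
  have U: "open U" unfolding U_def using s by auto
  have UL: "v \<notin> \<Lambda>" if "v \<in> U" for v using that \<Lambda>_small unfolding U_def by auto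
  have dA0: "(A0 has_field_derivative A1 v) (at v)" if "v \<in> U" for v
    unfolding A1_def using that by (intro holomorphic_derivI[OF s(3,1)]) (auto simp: U_def)
  have dA1: "(A1 has_field_derivative A2 v) (at v)" if "v \<in> U" for v
    unfolding A2_def using that
    by (intro holomorphic_derivI[of _ s]) (auto simp: U_def A1_def s intro!: holomorphic_deriv)
  have dA2: "(A2 has_field_derivative A3 v) (at v)" if "v \<in> U" for v
    unfolding A3_def using that
    by (intro holomorphic_derivI[of _ s]) (auto simp: U_def A1_def A2_def s intro!: holomorphic_deriv)
  have nz: "v \<noteq> 0" if "v \<in> U" for v using that by (auto simp: U_def)
  have 0: "Z v = 1 / v + A0 v" if "v \<in> U" for v using nz[OF that] by (simp add: A0_def)
  have 1: "Z1 v = - 1 / v^2 + A1 v" if "v \<in> U" for v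
  proof -
    have "((\<lambda>v. 1 / v + A0 v) has_field_derivative (- 1 / v^2 + A1 v)) (at v)"
      by (rule derivative_eq_intros dA0 refl that nz | simp add: power2_eq_square)+
    then have "(Z has_field_derivative (- 1 / v^2 + A1 v)) (at v)"
      by (rule has_field_derivative_transform_within_open[OF _ U that]) (simp add: 0)
    then show ?thesis using Z_deriv[OF UL[OF that]] DERIV_unique by blast
  qed
  have 2: "Z2 v = 2 / v^3 + A2 v" if "v \<in> U" for v
  proof -
    have "((\<lambda>v. - 1 / v^2 + A1 v) has_field_derivative (2 / v^3 + A2 v)) (at v)"
      using nz[OF that]
      by (auto intro!: derivative_eq_intros dA1 that simp: field_simps eval_nat_numeral)
    then have "(Z1 has_field_derivative (2 / v^3 + A2 v)) (at v)"
      by (rule has_field_derivative_transform_within_open[OF _ U that]) (simp add: 1)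
    then show ?thesis using Z1_deriv[OF UL[OF that]] DERIV_unique by blast
  qed
  have 3: "Z3 v = - 6 / v^4 + A3 v" if "v \<in> U" for v
  proof -
    have "((\<lambda>v. 2 / v^3 + A2 v) has_field_derivative (- 6 / v^4 + A3 v)) (at v)"
      using nz[OF that]
      by (auto intro!: derivative_eq_intros dA2 that simp: field_simps eval_nat_numeral)
    then have "(Z2 has_field_derivative (- 6 / v^4 + A3 v)) (at v)"
      by (rule has_field_derivative_transform_within_open[OF _ U that]) (simp add: 2)
    then show ?thesis using Z2_deriv[OF UL[OF that]] DERIV_unique by blast
  qed
  have "\<forall>\<^sub>F v in at 0. v \<in> s \<inter> ball 0 \<rho>"
    using s \<rho>_pos by (intro eventually_at_in_open') auto
  moreover have "\<forall>\<^sub>F v in at 0. v \<noteq> (0::complex)" by (simp add: eventually_at_filter)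
  ultimately show ?thesis
  proof eventually_elim
    case (elim v)
    then have "v \<in> U" by (simp add: U_def)
    then show ?case using 0 1 2 3 UL elim by (simp add: T0_def)
  qed
qed

lemma deriv_period:
  assumes g: "g holomorphic_on - \<Lambda>" and p: "\<And>v. v \<notin> \<Lambda> \<Longrightarrow> g (v + w) = g v" and w: "w \<in> \<Lambda>" and v: "v \<notin> \<Lambda>"
  shows "deriv g (v + w) = deriv g v"
proof -
  have vw: "v + w \<notin> \<Lambda>" using v w \<Lambda>_add_iff by blast
  have "(g has_field_derivative deriv g (v + w)) (at (v + w))"
    using holomorphic_derivI[OF g open_compl_\<Lambda>] vw by auto
  then have "((\<lambda>v. g (v + w)) has_field_derivative deriv g (v + w)) (at v)" by (simp add: DERIV_shift)
  then have "(g has_field_derivative deriv g (v + w)) (at v)"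
    by (rule has_field_derivative_transform_within_open[OF _ open_compl_\<Lambda>]) (use v p in auto)
  then show ?thesis by (simp add: DERIV_imp_deriv)
qed

lemma deriv_uminus:
  assumes g: "g holomorphic_on - \<Lambda>" and p: "\<And>v. v \<notin> \<Lambda> \<Longrightarrow> g (- v) = c * g v" and v: "v \<notin> \<Lambda>"
  shows "deriv g (- v) = - c * deriv g v"
proof -
  have mv: "- v \<notin> \<Lambda>" using v \<Lambda>_uminus_iff by blast
  have "(g has_field_derivative deriv g (- v)) (at (- v))"
    using holomorphic_derivI[OF g open_compl_\<Lambda>] mv by auto
  then have "((\<lambda>v. g (- v)) has_field_derivative deriv g (- v) * (-1)) (at v)"
    by (rule DERIV_chain2[where g = "\<lambda>v. - v"]) (auto intro!: derivative_eq_intros)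
  then have "((\<lambda>v. c * g v) has_field_derivative deriv g (- v) * (-1)) (at v)"
    by (rule has_field_derivative_transform_within_open[OF _ open_compl_\<Lambda>]) (use v p in auto)
  moreover have "((\<lambda>v. c * g v) has_field_derivative c * deriv g v) (at v)"
    using holomorphic_derivI[OF g open_compl_\<Lambda>] v by (intro DERIV_cmult) auto
  ultimately have "deriv g (- v) * (-1) = c * deriv g v" by (rule DERIV_unique)
  then have "- (- deriv g (- v)) = - (c * deriv g v)" by simp
  then show ?thesis by simp
qed

lemma Z1_period_pi: "v \<notin> \<Lambda> \<Longrightarrow> Z1 (v + 2 * pi * \<i>) = Z1 v"
  using deriv_period[OF Z_holo Z_period_pi pi_in_\<Lambda>] deriv_Z \<Lambda>_add_iff[OF pi_in_\<Lambda>] by metis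
lemma Z2_period_pi: "v \<notin> \<Lambda> \<Longrightarrow> Z2 (v + 2 * pi * \<i>) = Z2 v"
  unfolding Z2_def by (rule deriv_period[OF Z1_holo Z1_period_pi pi_in_\<Lambda>])
lemma Z3_period_pi: "v \<notin> \<Lambda> \<Longrightarrow> Z3 (v + 2 * pi * \<i>) = Z3 v"
  unfolding Z3_def by (rule deriv_period[OF Z2_holo Z2_period_pi pi_in_\<Lambda>])
lemma Z2_period_t: "v \<notin> \<Lambda> \<Longrightarrow> Z2 (v + t) = Z2 v"
  unfolding Z2_def by (rule deriv_period[OF Z1_holo Z1_period_t t_in_\<Lambda>])
lemma Z3_period_t: "v \<notin> \<Lambda> \<Longrightarrow> Z3 (v + t) = Z3 v"
  unfolding Z3_def by (rule deriv_period[OF Z2_holo Z2_period_t t_in_\<Lambda>])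

lemma Z1_even: "v \<notin> \<Lambda> \<Longrightarrow> Z1 (- v) = Z1 v"
  using deriv_uminus[OF Z_holo, of "-1" v] deriv_Z[of v] deriv_Z[of "-v"] Z_odd \<Lambda>_uminus_iff[of v] by auto
lemma Z2_odd: "v \<notin> \<Lambda> \<Longrightarrow> Z2 (- v) = - Z2 v"
  unfolding Z2_def using deriv_uminus[OF Z1_holo, of 1 v] Z1_even by auto

text \<open>A finite check of the coefficients up to the pole order yields two things: the identity
  of functions, and the vanishing of the whole series \<open>H\<close>, which is an infinite family
  of relations between Eisenstein series.\<close>

lemma elliptic_eq_0_fps:
  assumes hol: "g holomorphic_on - \<Lambda>" and p1: "\<And>v. v \<notin> \<Lambda> \<Longrightarrow> g (v + 2 * pi * \<i>) = g v"
    and p2: "\<And>v. v \<notin> \<Lambda> \<Longrightarrow> g (v + t) = g v"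
    and h: "h has_fps_expansion H" "\<forall>\<^sub>F v in at 0. g v = h v / v ^ n" "\<And>i. i \<le> n \<Longrightarrow> fps_nth H i = 0"
  shows "v \<notin> \<Lambda> \<Longrightarrow> g v = 0" and "H = 0"
proof -
  have "((\<lambda>v. h v / v ^ n) \<longlongrightarrow> 0) (at 0)" by (rule has_fps_expansion_div_power_tendsto_0[OF h(1,3)])
  moreover have "\<forall>\<^sub>F v in at 0. h v / v ^ n = g v" using h(2) by eventually_elim simp
  ultimately have "(g \<longlongrightarrow> 0) (at 0)" by (rule Lim_transform_eventually)
  then show 0: "g v = 0" if "v \<notin> \<Lambda>" for v using elliptic_eq_0[OF hol p1 p2] that by blast
  have "\<forall>\<^sub>F v in nhds 0. v \<noteq> 0 \<longrightarrow> h v = 0"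
    using h(2) laurent unfolding eventually_at_filter by eventually_elim (use 0 in auto)
  moreover have "h 0 = 0"
  proof -
    have "fps_nth H 0 = h 0" using h(1) by (simp add: fps_nth_fps_expansion)
    then show ?thesis using h(3)[of 0] by simp
  qed
  ultimately have "\<forall>\<^sub>F v in nhds 0. h v = 0" by (auto elim: eventually_mono)
  then have "h has_fps_expansion 0" by (auto simp: has_fps_expansion_def elim: eventually_mono)
  then show "H = 0" using h(1) fps_expansion_unique_complex by blast
qed

text \<open>The expansion of \<open>wp v - 1 / v^2\<close>.\<close>

definition CF :: "complex fps" where "CF = fps_const (eis 2 q) - AF1"

lemma AF_coeffs: "fps_nth AF 0 = 0" "fps_nth AF (Suc 0) = eis 2 q" "fps_nth AF 2 = 0" "fps_nth AF 3 = eis 4 q"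
    "fps_nth AF 4 = 0" "fps_nth AF 5 = eis 6 q"
  by (simp_all add: AF_def numeral_2_eq_2[symmetric])
lemma AF1_coeffs: "fps_nth AF1 0 = eis 2 q" "fps_nth AF1 (Suc 0) = 0" "fps_nth AF1 2 = 3 * eis 4 q" "fps_nth AF1 3 = 0"
    "fps_nth AF1 4 = 5 * eis 6 q"
  by (simp_all add: AF1_def AF_coeffs numeral_2_eq_2[symmetric])
lemma AF2_coeffs: "fps_nth AF2 0 = 0" "fps_nth AF2 (Suc 0) = 6 * eis 4 q" "fps_nth AF2 2 = 0" "fps_nth AF2 3 = 20 * eis 6 q"
  by (simp_all add: AF2_def AF1_coeffs numeral_2_eq_2[symmetric])
lemma AF3_coeffs: "fps_nth AF3 0 = 6 * eis 4 q"
  by (simp add: AF3_def AF2_coeffs)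
lemma CF_coeffs: "fps_nth CF 0 = 0" "fps_nth CF (Suc 0) = 0" "fps_nth CF 2 = - 3 * eis 4 q" "fps_nth CF 3 = 0"
    "fps_nth CF 4 = - 5 * eis 6 q"
  by (simp_all add: CF_def AF1_coeffs)

text \<open>If \<open>Z\<close> is a logarithmic derivative of theta, the heat equation for theta
  becomes \<open>T = Z2 / 2 + Z * Z1\<close>. Under v + t both \<open>T\<close> and
  \<open>Z * Z1\<close> change by \<open>- Z1\<close>, so the difference is elliptic and only its
  expansion at 0 has to be checked. Its coefficients give Ramanujan's equations.\<close>

lemma heat_fps:
  "fps_X ^ 2 * TF - fps_const (1/2) * fps_X ^ 2 * AF2 - fps_X * AF1 + AF - fps_X ^ 2 * AF * AF1 = 0" (is "?H = 0")
proof (rule elliptic_eq_0_fps(2)[where g = "\<lambda>v. T v - 1/2 * Z2 v - Z v * Z1 v"])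
  show "(\<lambda>v. T v - 1/2 * Z2 v - Z v * Z1 v) holomorphic_on - \<Lambda>"
    by (intro holomorphic_intros T_holo Z2_holo Z_holo Z1_holo)
  show "(\<lambda>v. v ^ 2 * T0 v - 1/2 * v ^ 2 * A2 v - v * A1 v + A0 v - v ^ 2 * A0 v * A1 v) has_fps_expansion ?H"
    by (intro fps_expansion_intros T0_expansion A0_expansion expansions)
  show "\<forall>\<^sub>F v in at 0. T v - 1/2 * Z2 v - Z v * Z1 v =
     (v ^ 2 * T0 v - 1/2 * v ^ 2 * A2 v - v * A1 v + A0 v - v ^ 2 * A0 v * A1 v) / v ^ 2"
    using laurent unfolding eventually_at_filter
  proof eventually_elim
    case (elim v)
    show ?case
    proof (intro impI)
      assume v: "v \<noteq> 0"
      have e: "Z v = 1 / v + A0 v" "Z1 v = - 1 / v^2 + A1 v" "Z2 v = 2 / v^3 + A2 v" "T v = T0 v"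
        using elim v by auto
      show "T v - 1/2 * Z2 v - Z v * Z1 v =
         (v ^ 2 * T0 v - 1/2 * v ^ 2 * A2 v - v * A1 v + A0 v - v ^ 2 * A0 v * A1 v) / v ^ 2"
        unfolding e using v by (simp add: field_simps eval_nat_numeral)
    qed
  qed
  show "fps_nth ?H i = 0" if "i \<le> 2" for i
  proof -
    consider "i = 0" | "i = 1" | "i = 2" using \<open>i \<le> 2\<close> by linarith
    then show ?thesis
      by cases (simp_all add: fps_X_power_mult_nth mult.assoc AF_coeffs AF1_coeffs AF2_coeffs TF_def)
  qed
  fix v assume v: "v \<notin> \<Lambda>"
  show "T (v + 2 * pi * \<i>) - 1/2 * Z2 (v + 2 * pi * \<i>) - Z (v + 2 * pi * \<i>) * Z1 (v + 2 * pi * \<i>) = T v - 1/2 * Z2 v - Z v * Z1 v"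
    by (simp only: T_period_pi Z2_period_pi[OF v] Z_period_pi Z1_period_pi[OF v])
  show "T (v + t) - 1/2 * Z2 (v + t) - Z (v + t) * Z1 (v + t) = T v - 1/2 * Z2 v - Z v * Z1 v"
    by (simp only: T_period_t[OF v] Z2_period_t[OF v] Z_period_t[OF v] Z1_period_t[OF v]) (simp add: algebra_simps)
qed

text \<open>\<open>- Z3\<close> is the second derivative of \<open>wp\<close>, so this is the
  classical equation with g_2 = - 60 \<open>eis 4 q\<close>. The function form feeds Schneider's
  method, the series form the recursion for Eisenstein series.\<close>

lemma wp_ode: 
  shows "v \<notin> \<Lambda> \<Longrightarrow> - Z3 v = 6 * wp v ^ 2 + 30 * eis 4 q"
  and wp_fps: "fps_X ^ 2 * AF3 + 12 * CF + 6 * fps_X ^ 2 * CF ^ 2 + fps_const (30 * eis 4 q) * fps_X ^ 2 = 0" (is "?H = 0")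
proof -
  let ?g = "\<lambda>v. Z3 v + 6 * wp v ^ 2 + 30 * eis 4 q"
  let ?h = "\<lambda>v. v ^ 2 * A3 v + 12 * (eis 2 q - A1 v) + 6 * v ^ 2 * (eis 2 q - A1 v) ^ 2 + 30 * eis 4 q * v ^ 2"
  have a: "?g holomorphic_on - \<Lambda>" unfolding wp_def by (intro holomorphic_intros Z3_holo Z1_holo)
  have b: "?h has_fps_expansion ?H"
    unfolding CF_def power2_eq_square by (intro fps_expansion_intros expansions)
  have c: "\<forall>\<^sub>F v in at 0. ?g v = ?h v / v ^ 2"
    using laurent unfolding eventually_at_filter
  proof eventually_elim
    case (elim v)
    show ?case
    proof (intro impI)
      assume v: "v \<noteq> 0"
      have e: "wp v = 1 / v ^ 2 + (eis 2 q - A1 v)" "Z3 v = - 6 / v ^ 4 + A3 v"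
        using elim v by (auto simp: wp_def)
      define c where "c = eis 2 q - A1 v"
      show "?g v = ?h v / v ^ 2"
        unfolding e c_def[symmetric] using v by (simp add: field_simps eval_nat_numeral)
    qed
  qed
  have d: "fps_nth ?H i = 0" if "i \<le> 2" for i
  proof -
    consider "i = 0" | "i = 1" | "i = 2" using \<open>i \<le> 2\<close> by linarith
    then show ?thesis
      by cases (simp_all add: fps_X_power_mult_nth fps_X_power_nth mult.assoc AF3_coeffs CF_coeffs power2_eq_square)
  qed
  have e: "?g (v + 2 * pi * \<i>) = ?g v" if v: "v \<notin> \<Lambda>" for v
    by (simp only: wp_def Z1_period_pi[OF v] Z3_period_pi[OF v])
  have f: "?g (v + t) = ?g v" if v: "v \<notin> \<Lambda>" for v
    by (simp only: wp_def Z1_period_t[OF v] Z3_period_t[OF v])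
  show "?H = 0" by (rule elliptic_eq_0_fps(2)[OF a e f b c d])
  show "- Z3 v = 6 * wp v ^ 2 + 30 * eis 4 q" if "v \<notin> \<Lambda>"
    using elliptic_eq_0_fps(1)[OF a e f b c d that] by (simp add: add_eq_0_iff algebra_simps)
qed

text \<open>The Weierstrass cubic with g_3 = - 140 \<open>eis 6 q\<close>. At the half period, where
  \<open>Z2\<close> vanishes, it makes the value of \<open>wp\<close> algebraic over the
  invariants.\<close>

lemma wp_cubic:
  assumes "v \<notin> \<Lambda>"
  shows "Z2 v ^ 2 = 4 * wp v ^ 3 + 60 * eis 4 q * wp v + 140 * eis 6 q"
proof -
  let ?g = "\<lambda>v. Z2 v ^ 2 - 4 * wp v ^ 3 - 60 * eis 4 q * wp v - 140 * eis 6 q"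
  let ?c = "\<lambda>v. eis 2 q - A1 v"
  let ?h = "\<lambda>v. (2 + v ^ 3 * A2 v) * (2 + v ^ 3 * A2 v) - 4 * ((1 + v ^ 2 * ?c v) * (1 + v ^ 2 * ?c v) * (1 + v ^ 2 * ?c v))
     - 60 * eis 4 q * v ^ 4 * (1 + v ^ 2 * ?c v) - 140 * eis 6 q * v ^ 6"
  let ?H = "(2 + fps_X ^ 3 * AF2) * (2 + fps_X ^ 3 * AF2) - 4 * ((1 + fps_X ^ 2 * CF) * (1 + fps_X ^ 2 * CF) * (1 + fps_X ^ 2 * CF))
     - 60 * fps_const (eis 4 q) * fps_X ^ 4 * (1 + fps_X ^ 2 * CF) - 140 * fps_const (eis 6 q) * fps_X ^ 6"
  have a: "?g holomorphic_on - \<Lambda>" unfolding wp_def by (intro holomorphic_intros Z2_holo Z1_holo)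
  have b: "?h has_fps_expansion ?H"
    unfolding CF_def by (intro fps_expansion_intros expansions)
  have c: "\<forall>\<^sub>F v in at 0. ?g v = ?h v / v ^ 6"
    using laurent unfolding eventually_at_filter
  proof eventually_elim
    case (elim v)
    show ?case
    proof (intro impI)
      assume v: "v \<noteq> 0"
      have z: "Z2 v = (2 + v ^ 3 * A2 v) / v ^ 3" "wp v = (1 + v ^ 2 * ?c v) / v ^ 2"
        using elim v by (auto simp: wp_def field_simps eval_nat_numeral)
      have y: "v ^ 6 = (v ^ 3) ^ 2" "v ^ 6 = (v ^ 2) ^ 3" by (simp_all add: power_mult[symmetric])
      have gen: "a = A / k \<Longrightarrow> p = B / k \<Longrightarrow> w = C / k \<Longrightarrow> d = D / k \<Longrightarrow>
         a - 4 * p - 60 * e * w - d = (A - 4 * B - 60 * e * C - D) / k" for a A p B w C d e k D :: complex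
        by (simp add: diff_divide_distrib)
      have 1: "Z2 v ^ 2 = (2 + v ^ 3 * A2 v) * (2 + v ^ 3 * A2 v) / v ^ 6"
        unfolding z y(1) power_divide by (simp add: power2_eq_square)
      have 2: "wp v ^ 3 = (1 + v ^ 2 * ?c v) * (1 + v ^ 2 * ?c v) * (1 + v ^ 2 * ?c v) / v ^ 6"
        unfolding z y(2) power_divide by (simp add: power3_eq_cube)
      have 3: "wp v = v ^ 4 * (1 + v ^ 2 * ?c v) / v ^ 6"
        unfolding z using v by (simp add: field_simps eval_nat_numeral)
      have 4: "140 * eis 6 q = 140 * eis 6 q * v ^ 6 / v ^ 6" using v by simp
      have "?g v = ((2 + v ^ 3 * A2 v) * (2 + v ^ 3 * A2 v) - 4 * ((1 + v ^ 2 * ?c v) * (1 + v ^ 2 * ?c v) * (1 + v ^ 2 * ?c v))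
          - 60 * eis 4 q * (v ^ 4 * (1 + v ^ 2 * ?c v)) - 140 * eis 6 q * v ^ 6) / v ^ 6"
        by (rule gen[OF 1 2 3 4])
      then show "?g v = ?h v / v ^ 6" by (simp only: mult.assoc)
    qed
  qed
  \<comment> \<open>Below order 7 only two coefficients each of \<open>CF\<close> and
    \<open>AF2\<close> matter. With the tails named \<open>D\<close> and \<open>E\<close>, the
    cancellation is a polynomial identity that exhibits the factor x^7.\<close>
  have c: "CF = fps_X ^ 2 * (fps_const (- 3 * eis 4 q) + fps_const (- 5 * eis 6 q) * fps_X ^ 2 + fps_X ^ 3 * fps_shift 5 CF)"
  proof -
    have "fps_nth CF 0 = 0" "fps_nth CF 1 = 0" "fps_nth CF 3 = 0" "fps_nth CF 2 = - 3 * eis 4 q" "fps_nth CF 4 = - 5 * eis 6 q"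
      by (simp_all add: CF_coeffs)
    then show ?thesis using fps_split_5[of CF] by metis
  qed
  have a2: "AF2 = fps_X * (fps_const (6 * eis 4 q) + fps_const (20 * eis 6 q) * fps_X ^ 2 + fps_X ^ 3 * fps_shift 4 AF2)"
  proof -
    have "fps_nth AF2 0 = 0" "fps_nth AF2 2 = 0" "fps_nth AF2 1 = 6 * eis 4 q" "fps_nth AF2 3 = 20 * eis 6 q"
      by (simp_all add: AF2_coeffs)
    then show ?thesis using fps_split_4[of AF2] by metis
  qed
  define x e4 e6 D E where "x = (fps_X :: complex fps)" "e4 = fps_const (eis 4 q)" "e6 = fps_const (eis 6 q)"
    "D = fps_shift 5 CF" "E = fps_shift 4 AF2"
  define cc aa where "cc = - 3 * e4 - 5 * e6 * x ^ 2 + x ^ 3 * D" "aa = 6 * e4 + 20 * e6 * x ^ 2 + x ^ 3 * E"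
  have k: "fps_const (- 3 * eis 4 q) = - 3 * e4" "fps_const (- 5 * eis 6 q) = - 5 * e6"
      "fps_const (6 * eis 4 q) = 6 * e4" "fps_const (20 * eis 6 q) = 20 * e6"
    unfolding x_e4_e6_D_E_def by (simp_all add: numeral_fps_const)
  have "CF = x ^ 2 * (- 3 * e4 + - 5 * e6 * x ^ 2 + x ^ 3 * D)"
    using c unfolding k x_e4_e6_D_E_def(1,4)[symmetric] .
  then have c': "CF = x ^ 2 * cc" unfolding cc_aa_def by simp
  have a2': "AF2 = x * aa" using a2 unfolding k x_e4_e6_D_E_def(1,5)[symmetric] cc_aa_def .
  have HH: "?H = x ^ 7 * ((4 * E - 12 * D) + x * (aa ^ 2 - 12 * cc ^ 2 - 60 * e4 * cc) - 4 * x ^ 5 * cc ^ 3)"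
  proof -
    have "?H = x ^ 4 * (4 * aa - 12 * cc - 60 * e4 - 140 * e6 * x ^ 2) + x ^ 8 * (aa ^ 2 - 12 * cc ^ 2 - 60 * e4 * cc) - 4 * x ^ 12 * cc ^ 3"
      unfolding c' a2' x_e4_e6_D_E_def(1-3)[symmetric] by algebra
    also have "4 * aa - 12 * cc - 60 * e4 - 140 * e6 * x ^ 2 = x ^ 3 * (4 * E - 12 * D)"
      unfolding cc_aa_def by algebra
    finally show ?thesis by algebra
  qed
  have d: "fps_nth ?H i = 0" if "i \<le> 6" for i
    unfolding HH x_e4_e6_D_E_def(1) fps_X_power_mult_nth using that by simp
  have e: "?g (v + 2 * pi * \<i>) = ?g v" if v: "v \<notin> \<Lambda>" for v
    by (simp only: wp_def Z1_period_pi[OF v] Z2_period_pi[OF v])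
  have f: "?g (v + t) = ?g v" if v: "v \<notin> \<Lambda>" for v
    by (simp only: wp_def Z1_period_t[OF v] Z2_period_t[OF v])
  have "?g v = 0" by (rule elliptic_eq_0_fps(1)[OF a e f b \<open>\<forall>\<^sub>F v in at 0. ?g v = ?h v / v ^ 6\<close> d assms])
  then show ?thesis by (simp add: algebra_simps)
qed

lemma pi_i_notin_\<Lambda>: "of_real pi * \<i> \<notin> \<Lambda>"
proof
  assume "of_real pi * \<i> \<in> \<Lambda>"
  then obtain m :: nat where "q ^ m = -1 \<or> q ^ m * (-1) = 1" unfolding \<Lambda>_def by auto
  then have m: "q ^ m = - 1" by (auto simp: minus_equation_iff)
  then have "norm q ^ m = 1" by (metis norm_minus_cancel norm_one norm_power)
  then have "m = 0" using q1 q0 by (metis less_irrefl norm_ge_zero power_less_one_iff bot_nat_0.not_eq_extremum power_strict_decreasing power_0 zero_less_norm_iff)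
  then show False using m by simp
qed

text \<open>An odd function with period 2 pi i vanishes at pi i. Hence the initial data at this
  point reduce to the single value of \<open>wp\<close>.\<close>

lemma half_period: "Z (of_real pi * \<i>) = 0" "Z2 (of_real pi * \<i>) = 0"
proof -
  let ?w = "of_real pi * \<i>"
  have n: "- ?w \<notin> \<Lambda>" using pi_i_notin_\<Lambda> \<Lambda>_uminus_iff by blast
  have e: "- ?w + 2 * pi * \<i> = ?w" by simp
  have "Z ?w = Z (- ?w)" using Z_period_pi[of "- ?w"] unfolding e .
  then have "Z ?w = - Z ?w" using Z_odd[OF pi_i_notin_\<Lambda>] by (metis mult_minus_left)
  then show "Z ?w = 0" by simp
  have "Z2 ?w = Z2 (- ?w)" using Z2_period_pi[OF n] unfolding e .
  then have "Z2 ?w = - Z2 ?w" using Z2_odd[OF pi_i_notin_\<Lambda>] by (metis mult_minus_left)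
  then show "Z2 ?w = 0" by simp
qed

end


subsection \<open>Quasimodular forms\<close>

definition pdisc :: "complex set" where "pdisc = {q. q \<noteq> 0 \<and> norm q < 1}"

lemma open_pdisc: "open pdisc"
proof -
  have "pdisc = ball 0 1 - {0}" by (auto simp: pdisc_def)
  then show ?thesis by (metis open_Diff open_ball closed_singleton)
qed

lemma nome_Ln: "q \<in> pdisc \<Longrightarrow> nome q (Ln q)"
  by unfold_locales (auto simp: pdisc_def)

text \<open>Every number divides 0, and the sum over this infinite set has the default value 0; so
  the series may be started at n = 0.\<close>

lemma divisor_power_sum_0 [simp]: "divisor_power_sum j 0 = 0"
  by (simp add: divisor_power_sum_def)

lemma lam_powser: 
  assumes "norm x < 1"
  shows "summable (\<lambda>n. (of_nat n ^ p * of_nat (divisor_power_sum j n)) * x ^ n)"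
    and "lam p j x = (\<Sum>n. (of_nat n ^ p * of_nat (divisor_power_sum j n)) * x ^ n)"
proof -
  have s: "summable (\<lambda>n. (of_nat (Suc n) ^ p * of_nat (divisor_power_sum j (Suc n))) * x ^ Suc n)"
    using summable_norm_cancel[OF lambert_has_sum(2)[OF assms]] .
  then show 1: "summable (\<lambda>n. (of_nat n ^ p * of_nat (divisor_power_sum j n)) * x ^ n)"
    by (subst (asm) summable_Suc_iff)
  show "lam p j x = (\<Sum>n. (of_nat n ^ p * of_nat (divisor_power_sum j n)) * x ^ n)"
    using suminf_split_head[OF 1] unfolding lam_def by simp
qed

lemma lam_deriv_raw:
  assumes "norm x < 1"
  shows "(lam p j has_field_derivative (\<Sum>n. diffs (\<lambda>n. of_nat n ^ p * of_nat (divisor_power_sum j n)) n * x ^ n)) (at x)"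
proof -
  obtain K where K: "norm x < K" "K < 1" using assms dense by blast
  then have "K > 0" using norm_ge_zero[of x] by linarith
  then have nK: "norm x < norm (of_real K :: complex)" "norm (of_real K :: complex) < 1" using K by auto
  have "((\<lambda>x. \<Sum>n. (of_nat n ^ p * of_nat (divisor_power_sum j n)) * x ^ n) has_field_derivative
     (\<Sum>n. diffs (\<lambda>n. of_nat n ^ p * of_nat (divisor_power_sum j n)) n * x ^ n)) (at x)"
    by (rule termdiffs_strong[OF lam_powser(1)[OF nK(2)] nK(1)])
  then show ?thesis
    by (rule has_field_derivative_transform_within_open[of _ _ _ "ball 0 1"]) (use assms in \<open>auto simp: lam_powser(2)\<close>)
qed

lemma lam_deriv:
  assumes "x \<in> pdisc"
  shows "(lam p j has_field_derivative (lam (Suc p) j x / x)) (at x)"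
proof -
  have x: "x \<noteq> 0" "norm x < 1" using assms by (auto simp: pdisc_def)
  have "(\<Sum>n. diffs (\<lambda>n. of_nat n ^ p * of_nat (divisor_power_sum j n)) n * x ^ n) =
     (\<Sum>n. of_nat (Suc n) ^ Suc p * of_nat (divisor_power_sum j (Suc n)) * x ^ Suc n / x)"
    using x by (intro suminf_cong) (simp add: diffs_def field_simps)
  also have "\<dots> = lam (Suc p) j x / x"
    unfolding lam_def by (rule suminf_divide) (use summable_norm_cancel[OF lambert_has_sum(2)[OF x(2), of "Suc p" j]] in simp)
  finally show ?thesis using lam_deriv_raw[OF x(2), of p j] by simp
qed

lemma eis_deriv:
  assumes "x \<in> pdisc" shows "(eis k has_field_derivative eisD 1 k x / x) (at x)"
  unfolding eis_def[abs_def] eisD_def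
  by (rule derivative_eq_intros lam_deriv[OF assms] refl)+ (simp add: mult_ac)

lemma eisD_deriv:
  assumes "x \<in> pdisc" shows "(eisD p k has_field_derivative eisD (Suc p) k x / x) (at x)"
  unfolding eisD_def[abs_def]
  by (rule derivative_eq_intros lam_deriv[OF assms] refl)+ (simp add: mult_ac)

lemma lam_at_0: "((\<lambda>q. lam p j q / q) \<longlongrightarrow> 1) (at 0)" "((\<lambda>q. lam p j q) \<longlongrightarrow> 0) (at 0)"
proof -
  have 0: "lam p j 0 = 0" unfolding lam_def by simp
  have 1: "diffs (\<lambda>n. of_nat n ^ p * of_nat (divisor_power_sum j n)) 0 = (1::complex)"
    by (simp add: diffs_def divisor_power_sum_def)
  have d: "(lam p j has_field_derivative 1) (at 0)"
    using lam_deriv_raw[of 0 p j] by (simp add: 1)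
  then show "((\<lambda>q. lam p j q / q) \<longlongrightarrow> 1) (at 0)" by (simp add: has_field_derivative_iff 0)
  show "((\<lambda>q. lam p j q) \<longlongrightarrow> 0) (at 0)" using DERIV_isCont[OF d] by (simp add: isCont_def 0)
qed

text \<open>The polynomials in \<open>E\<^sub>4\<close> and \<open>E\<^sub>6\<close> with rational coefficients, graded by weight.\<close>

inductive MF :: "nat \<Rightarrow> (complex \<Rightarrow> complex) \<Rightarrow> bool" where
  zero: "even w \<Longrightarrow> MF w (\<lambda>_. 0)"
| const: "MF 0 (\<lambda>_. of_rat r)"
| e4: "MF 4 (eis 4)"
| e6: "MF 6 (eis 6)"
| add: "MF w f \<Longrightarrow> MF w g \<Longrightarrow> MF w (\<lambda>q. f q + g q)"
| mult: "MF w f \<Longrightarrow> MF w' g \<Longrightarrow> MF (w + w') (\<lambda>q. f q * g q)"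
| cong: "MF w f \<Longrightarrow> (\<And>q. q \<in> pdisc \<Longrightarrow> f q = g q) \<Longrightarrow> MF w g"

lemma MF_even: "MF w f \<Longrightarrow> even w" by (induction rule: MF.induct) auto

lemma MF_cmult: "MF w f \<Longrightarrow> MF w (\<lambda>q. of_rat r * f q)"
  using MF.mult[OF MF.const] by fastforce

lemma MF_numeral: "MF w f \<Longrightarrow> MF w (\<lambda>q. numeral n * f q)"
  using MF_cmult[of w f "numeral n"] by simp

lemma MF_nat: "MF w f \<Longrightarrow> MF w (\<lambda>q. of_nat n * f q)"
  using MF_cmult[of w f "of_nat n"] by simp

lemma MF_neg_nat: "MF w f \<Longrightarrow> MF w (\<lambda>q. - of_nat n * f q)"
  using MF_cmult[of w f "- of_nat n"] by (simp only: of_rat_minus of_rat_of_nat_eq)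

lemma MF_sum: "finite A \<Longrightarrow> even w \<Longrightarrow> (\<And>a. a \<in> A \<Longrightarrow> MF w (f a)) \<Longrightarrow> MF w (\<lambda>q. \<Sum>a\<in>A. f a q)"
  by (induction A rule: finite_induct) (auto intro: MF.intros)

text \<open>The coefficient of v^(k-2) in \<open>wp_fps\<close>, where \<open>c i\<close> is the
  i-th coefficient of \<open>CF\<close>. The linear terms combine to (k - 1) (k + 1) (k - 6) times
  \<open>eis k q\<close>, and the last factor is why k = 6 stays a generator.\<close>

lemma eis_recurrence:
  assumes q: "q \<in> pdisc" and k: "even k" "k \<ge> 8"
  defines "c \<equiv> \<lambda>i. if even i \<and> i \<ge> 2 then - of_nat (i + 1) * eis (i + 2) q else 0"
  shows "of_nat (k - 1) * of_nat (k + 1) * of_nat (k - 6) * eis k q = - 6 * (\<Sum>i=0..k-4. c i * c (k - 4 - i))"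
proof -
  interpret nome q "Ln q" using nome_Ln q .
  obtain m where m: "k = m + 8" using k(2) by (metis le_add_diff_inverse2)
  have em: "even m" using k m by simp
  have CF: "fps_nth CF i = c i" for i
  proof (cases "i = 0")
    case False
    then show ?thesis by (auto simp: CF_def AF1_def AF_def c_def algebra_simps)
  qed (simp add: CF_def AF1_def AF_def c_def numeral_2_eq_2[symmetric])
  have e1: "fps_nth AF3 (m + 4) = of_nat (m + 5) * of_nat (m + 6) * of_nat (m + 7) * eis k q"
  proof -
    have i: "m + 4 + 1 = m + 5" "m + 5 + 1 = m + 6" "m + 6 + 1 = m + 7" by simp_all
    have "fps_nth AF (m + 7) = eis k q" using em m by (simp add: AF_def add_ac)
    then show ?thesis unfolding AF3_def AF2_def AF1_def fps_deriv_nth i by simp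
  qed
  have e2: "fps_nth CF (m + 6) = - of_nat (m + 7) * eis k q"
  proof -
    have i: "m + 6 + 2 = k" "m + 6 + 1 = m + 7" using m by simp_all
    show ?thesis unfolding CF c_def i using em by simp
  qed
  define S where "S = (\<Sum>i=0..k-4. c i * c (k - 4 - i))"
  have e3: "fps_nth (CF ^ 2) (m + 4) = S"
  proof -
    have i: "m + 4 = k - 4" using m by simp
    show ?thesis unfolding power2_eq_square fps_mult_nth CF i S_def ..
  qed
  have "fps_nth (fps_X ^ 2 * AF3 + 12 * CF + 6 * fps_X ^ 2 * CF ^ 2 + fps_const (30 * eis 4 q) * fps_X ^ 2) (m + 6) = 0"
    unfolding wp_fps by simp
  moreover have "fps_nth (6 * fps_X ^ 2 * CF ^ 2) (m + 6) = 6 * fps_nth (CF ^ 2) (m + 4)"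
    by (simp add: mult.assoc fps_X_power_mult_nth add.commute[of 4 m])
  ultimately have "of_nat (m + 5) * of_nat (m + 6) * of_nat (m + 7) * eis k q - 12 * of_nat (m + 7) * eis k q
       + 6 * S = 0"
    by (simp add: fps_X_power_mult_nth fps_X_power_nth e1 e2 e3 add.commute[of 4 m]) (simp add: algebra_simps)
  moreover have "of_nat (m + 5) * of_nat (m + 6) * of_nat (m + 7) - 12 * of_nat (m + 7) =
      (of_nat (m + 7) * of_nat (m + 9) * of_nat (m + 2) :: complex)"
    by (simp add: algebra_simps)
  moreover have "k - 1 = m + 7" "k + 1 = m + 9" "k - 6 = m + 2" using m by auto
  moreover have "a * e - c * e + s = 0 \<Longrightarrow> a - c = d \<Longrightarrow> d * e = - s" for a c d e s :: complex
    by (auto simp: left_diff_distrib eq_neg_iff_add_eq_0)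
  ultimately have "of_nat (m + 7) * of_nat (m + 9) * of_nat (m + 2) * eis k q = - (6 * S)"
    by blast
  then show ?thesis unfolding S_def[symmetric] using \<open>k - 1 = m + 7\<close> \<open>k + 1 = m + 9\<close> \<open>k - 6 = m + 2\<close> by (simp only: mult_minus_left)
qed

text \<open>For k >= 8 the products on the right of the recurrence only involve smaller even indices
  that are at least 4, and the weights add up to k.\<close>

lemma MF_eis: "even k \<Longrightarrow> k \<ge> 4 \<Longrightarrow> MF k (eis k)"
proof (induction k rule: less_induct)
  case (less k)
  consider "k = 4" | "k = 6" | "k \<ge> 8"
    using less.prems by (cases "k = 5"; cases "k = 7") force+
  then show ?case
  proof cases
    case 3
    define c where "c i q = (if even i \<and> i \<ge> 2 then - of_nat (i + 1) * eis (i + 2) q else 0)" for i q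
    have "MF k (\<lambda>q. \<Sum>i=0..k-4. c i q * c (k - 4 - i) q)"
    proof (rule MF_sum)
      fix i assume i: "i \<in> {0..k-4}"
      show "MF k (\<lambda>q. c i q * c (k - 4 - i) q)"
      proof (cases "even i \<and> i \<ge> 2 \<and> k - 4 - i \<ge> 2")
        case True
        have 1: "MF (i + 2) (\<lambda>q. - of_nat (i + 1) * eis (i + 2) q)" if "even i" "i \<ge> 2" "i + 2 < k" for i
          by (rule MF_neg_nat, rule less.IH) (use that in auto)
        have 2: "c i = (\<lambda>q. - of_nat (i + 1) * eis (i + 2) q)" if "even i" "i \<ge> 2" for i
          using that by (auto simp: c_def fun_eq_iff)
        have "even (k - 4 - i)" using True less.prems i by simp
        then have 3: "MF (i + 2) (c i)" "MF (k - 4 - i + 2) (c (k - 4 - i))"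
          using 1[of i] 2[of i] 1[of "k - 4 - i"] 2[of "k - 4 - i"] True i 3 by auto
        have w: "i + 2 + (k - 4 - i + 2) = k" using i True \<open>k \<ge> 8\<close> by simp
        show ?thesis using MF.mult[OF 3] unfolding w .
      next
        case False
        then have "(\<lambda>q. c i q * c (k - 4 - i) q) = (\<lambda>_. 0)" by (auto simp: c_def)
        then show ?thesis using MF.zero[of k] less.prems by (simp only:)
      qed
    qed (use less.prems in auto)
    then have "MF k (\<lambda>q. of_rat (- 6 / (of_nat (k - 1) * of_nat (k + 1) * of_nat (k - 6))) * (\<Sum>i=0..k-4. c i q * c (k - 4 - i) q))"
      by (rule MF_cmult)
    then show ?thesis
    proof (rule MF.cong)
      fix q assume "q \<in> pdisc"
      from eis_recurrence[OF this less.prems(1) 3]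
      have *: "of_nat (k - 1) * of_nat (k + 1) * of_nat (k - 6) * eis k q = - 6 * (\<Sum>i=0..k-4. c i q * c (k - 4 - i) q)"
        unfolding c_def .
      have nz: "(of_nat (k - 1) * of_nat (k + 1) * of_nat (k - 6) :: complex) \<noteq> 0"
      proof -
        have "k - 1 \<noteq> 0" "k + 1 \<noteq> 0" "k - 6 \<noteq> 0" using 3 by auto
        then show ?thesis by (simp only: mult_eq_0_iff of_nat_eq_0_iff) simp
      qed 
      have r: "of_rat (- 6 / (of_nat (k - 1) * of_nat (k + 1) * of_nat (k - 6))) = (- 6 / (of_nat (k - 1) * of_nat (k + 1) * of_nat (k - 6)) :: complex)"
        unfolding of_rat_divide of_rat_mult of_rat_of_nat_eq of_rat_neg_numeral_eq ..
      then show "of_rat (- 6 / (of_nat (k - 1) * of_nat (k + 1) * of_nat (k - 6))) * (\<Sum>i=0..k-4. c i q * c (k - 4 - i) q) = eis k q"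
      proof -
        have "N \<noteq> 0 \<Longrightarrow> N * e = - 6 * S \<Longrightarrow> (- 6 / N) * S = e" for N e S :: complex by (simp add: field_simps)
        from this[OF nz *] show ?thesis by (simp only: r)
      qed
    qed
  qed (auto intro: MF.intros)
qed

text \<open>The coefficients of v, v^3 and v^5 in the heat equation.\<close>

lemma ramanujan:
  assumes "q \<in> pdisc"
  shows "eisD 1 2 q = 5 * eis 4 q + eis 2 q ^ 2"
    and "eisD 1 4 q = 4 * eis 2 q * eis 4 q + 14 * eis 6 q"
    and "eisD 1 6 q = 6 * eis 2 q * eis 6 q + 27 * eis 8 q + 3 * eis 4 q ^ 2"
proof -
  interpret nome q "Ln q" using nome_Ln assms .
  have h: "fps_nth TF n = 1/2 * fps_nth AF2 n + fps_nth AF1 (n + 1) - fps_nth AF (n + 2) + fps_nth (AF * AF1) n" for n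
  proof -
    have "fps_nth (fps_X ^ 2 * TF - fps_const (1/2) * fps_X ^ 2 * AF2 - fps_X * AF1 + AF - fps_X ^ 2 * AF * AF1) (n + 2) = 0"
      unfolding heat_fps by simp
    then show ?thesis by (simp add: mult.assoc fps_X_power_mult_nth) (simp add: algebra_simps)
  qed
  have t: "fps_nth TF 1 = eisD 1 2 q" "fps_nth TF 3 = eisD 1 4 q" "fps_nth TF 5 = eisD 1 6 q"
    by (simp_all add: TF_def numeral_2_eq_2[symmetric])
  have "fps_nth (AF * AF1) 1 = eis 2 q * eis 2 q"
    by (simp add: fps_mult_nth atLeast0_atMost_Suc AF_coeffs AF1_coeffs)
  then show "eisD 1 2 q = 5 * eis 4 q + eis 2 q ^ 2"
    using h[of 1] t(1) by (simp add: AF2_coeffs AF1_coeffs AF_coeffs power2_eq_square numeral_2_eq_2[symmetric] numeral_3_eq_3[symmetric])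
  have s3: "{0..3::nat} = {0, 1, 2, 3}" and s5: "{0..5::nat} = {0, 1, 2, 3, 4, 5}" by auto
  have "fps_nth (AF * AF1) 3 = 4 * eis 2 q * eis 4 q"
    unfolding fps_mult_nth s3 by (simp add: AF_coeffs AF1_coeffs)
  then show "eisD 1 4 q = 4 * eis 2 q * eis 4 q + 14 * eis 6 q"
    using h[of 3] t(2) by (simp add: AF2_coeffs AF1_coeffs AF_coeffs)
  have "fps_nth (AF * AF1) 5 = 6 * eis 2 q * eis 6 q + 3 * eis 4 q ^ 2"
    unfolding fps_mult_nth s5 by (simp add: AF_coeffs AF1_coeffs power2_eq_square)
  moreover have "fps_nth AF2 5 = 42 * eis 8 q" "fps_nth AF1 6 = 7 * eis 8 q" "fps_nth AF 7 = eis 8 q"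
    by (simp_all add: AF2_def AF1_def AF_def)
  ultimately show "eisD 1 6 q = 6 * eis 2 q * eis 6 q + 27 * eis 8 q + 3 * eis 4 q ^ 2"
    using h[of 5] t(3) by simp
qed

text \<open>The Serre derivative: since \<open>eis 2\<close> is E_2 / 12, the form q f' - w
  \<open>eis 2\<close> f is again modular, of weight w + 2. Ramanujan's equations give this on
  generators, and the product rule respects it because weights add.\<close>

lemma MF_deriv:
  assumes "MF w f"
  shows "\<exists>g. MF (w + 2) g \<and> (\<forall>q\<in>pdisc. (f has_field_derivative (of_nat w * eis 2 q * f q + g q) / q) (at q))"
  using assms
proof (induction rule: MF.induct)
  case (zero w)
  then show ?case by (intro exI[of _ "\<lambda>_. 0"]) (auto intro: MF.zero)
next
  case (const r)
  then show ?case by (intro exI[of _ "\<lambda>_. 0"]) (auto intro: MF.zero)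
next
  case e4
  have "MF 6 (\<lambda>q. 14 * eis 6 q)" by (intro MF_numeral MF.e6)
  then show ?case using eis_deriv[of _ 4] ramanujan(2) by (intro exI[of _ "\<lambda>q. 14 * eis 6 q"]) auto
next
  case e6
  have "MF (4 + 4) (\<lambda>q. eis 4 q * eis 4 q)" by (intro MF.intros)
  then have "MF 8 (\<lambda>q. 27 * eis 8 q + 3 * (eis 4 q * eis 4 q))"
    by (intro MF.add MF_numeral MF_eis) auto
  then show ?case using eis_deriv[of _ 6] ramanujan(3)
    by (intro exI[of _ "\<lambda>q. 27 * eis 8 q + 3 * (eis 4 q * eis 4 q)"]) (auto simp: power2_eq_square add.assoc)
next
  case (add w f g)
  then obtain f' g' where fg: "MF (w + 2) f'" "MF (w + 2) g'"
    "\<And>q. q \<in> pdisc \<Longrightarrow> (f has_field_derivative (of_nat w * eis 2 q * f q + f' q) / q) (at q)"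
    "\<And>q. q \<in> pdisc \<Longrightarrow> (g has_field_derivative (of_nat w * eis 2 q * g q + g' q) / q) (at q)" by blast
  show ?case
  proof (intro exI[of _ "\<lambda>q. f' q + g' q"] conjI ballI)
    fix q assume q: "q \<in> pdisc"
    have "((\<lambda>q. f q + g q) has_field_derivative ((of_nat w * eis 2 q * f q + f' q) / q + (of_nat w * eis 2 q * g q + g' q) / q)) (at q)"
      by (intro DERIV_add fg q)
    then show "((\<lambda>q. f q + g q) has_field_derivative (of_nat w * eis 2 q * (f q + g q) + (f' q + g' q)) / q) (at q)"
      by (simp add: add_divide_distrib algebra_simps)
  qed (use fg in \<open>auto intro: MF.add\<close>)
next
  case (mult w f w' g)
  then obtain f' g' where fg: "MF (w + 2) f'" "MF (w' + 2) g'"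
    "\<And>q. q \<in> pdisc \<Longrightarrow> (f has_field_derivative (of_nat w * eis 2 q * f q + f' q) / q) (at q)"
    "\<And>q. q \<in> pdisc \<Longrightarrow> (g has_field_derivative (of_nat w' * eis 2 q * g q + g' q) / q) (at q)" by blast
  show ?case
  proof (intro exI[of _ "\<lambda>q. f' q * g q + f q * g' q"] conjI ballI)
    show "MF (w + w' + 2) (\<lambda>q. f' q * g q + f q * g' q)"
    proof (rule MF.add)
      show "MF (w + w' + 2) (\<lambda>q. f' q * g q)" using MF.mult[OF fg(1) mult.hyps(2)] by (simp add: add_ac)
      show "MF (w + w' + 2) (\<lambda>q. f q * g' q)" using MF.mult[OF mult.hyps(1) fg(2)] by (simp add: add_ac)
    qed
    fix q assume q: "q \<in> pdisc"
    have "((\<lambda>q. f q * g q) has_field_derivative ((of_nat w * eis 2 q * f q + f' q) / q * g q + (of_nat w' * eis 2 q * g q + g' q) / q * f q)) (at q)"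
      by (intro DERIV_mult fg q)
    moreover have "(of_nat w * eis 2 q * f q + f' q) / q * g q + (of_nat w' * eis 2 q * g q + g' q) / q * f q =
       (of_nat (w + w') * eis 2 q * (f q * g q) + (f' q * g q + f q * g' q)) / q"
      using q by (simp add: pdisc_def field_simps)
    ultimately show "((\<lambda>q. f q * g q) has_field_derivative (of_nat (w + w') * eis 2 q * (f q * g q) + (f' q * g q + f q * g' q)) / q) (at q)"
      by simp
  qed
next
  case (cong w f g)
  then obtain f' where f': "MF (w + 2) f'" "\<And>q. q \<in> pdisc \<Longrightarrow> (f has_field_derivative (of_nat w * eis 2 q * f q + f' q) / q) (at q)"
    by blast
  have "(g has_field_derivative (of_nat w * eis 2 q * g q + f' q) / q) (at q)" if q: "q \<in> pdisc" for q
    using has_field_derivative_transform_within_open[OF f'(2)[OF q] open_pdisc q cong.hyps(2)] cong.hyps(2)[OF q] by simp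
  then show ?case using f' by blast
qed

text \<open>Dividing by l^w evaluates the form on a rescaled lattice; by homogeneity the rescaled
  E_4 and E_6 generate all such values.\<close>

lemma MF_value:
  assumes "MF w f" and q: "q \<in> pdisc" and "l \<noteq> 0"
    and V: "\<And>r. of_rat r \<in> V" "\<And>x y. x \<in> V \<Longrightarrow> y \<in> V \<Longrightarrow> x + y \<in> V" "\<And>x y. x \<in> V \<Longrightarrow> y \<in> V \<Longrightarrow> x * y \<in> V"
    and "eis 4 q / l ^ 4 \<in> V" "eis 6 q / l ^ 6 \<in> V"
  shows "f q / l ^ w \<in> V"
  using assms(1)
proof (induction rule: MF.induct)
  case (zero w) then show ?case using V(1)[of 0] by simp
next
  case (const r) then show ?case using V(1)[of r] by simp
next
  case (mult w f w' g)
  have "f q * g q / l ^ (w + w') = (f q / l ^ w) * (g q / l ^ w')" by (simp add: power_add)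
  then show ?case using mult.IH V(3) by metis
qed (use assms q in \<open>auto simp: add_divide_distrib\<close>)

lemma Rats_coeff_mult:
  fixes p r :: "complex poly"
  assumes "\<And>i. coeff p i \<in> \<rat>" "\<And>i. coeff r i \<in> \<rat>" shows "coeff (p * r) i \<in> \<rat>"
proof -
  have s: "(\<Sum>i\<le>n. f i) \<in> \<rat>" if "\<And>i. f i \<in> \<rat>" for n :: nat and f :: "nat \<Rightarrow> complex"
    using that by (induction n) auto
  show ?thesis unfolding coeff_mult by (rule s) (use assms in auto)
qed

text \<open>Scale by l^2 = \<open>eis 6 q / eis 4 q\<close>. Then E_4 / l^4 and E_6 / l^6 become the
  same number X = \<open>eis 4 q ^ 3 / eis 6 q ^ 2\<close>, so every form turns into a polynomial in
  one variable.\<close>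

lemma MF_poly:
  assumes "MF w f"
  shows "\<exists>p :: complex poly. (\<forall>i. coeff p i \<in> \<rat>) \<and> (\<forall>q\<in>pdisc. eis 4 q \<noteq> 0 \<longrightarrow> eis 6 q \<noteq> 0 \<longrightarrow>
     f q = (eis 6 q / eis 4 q) ^ (w div 2) * poly p (eis 4 q ^ 3 / eis 6 q ^ 2))"
  using assms
proof (induction rule: MF.induct)
  case (zero w)
  show ?case by (rule exI[of _ 0]) auto
next
  case (const r)
  have "coeff [:of_rat r :: complex:] i \<in> \<rat>" for i by (cases i) auto
  then show ?case by (intro exI[of _ "[:of_rat r:]"]) auto
next
  case e4
  have "coeff [:0, 1 :: complex:] i \<in> \<rat>" for i by (cases i; cases "i - 1") auto
  then show ?case by (intro exI[of _ "[:0, 1:]"]) (auto simp: power_divide power2_eq_square power3_eq_cube)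
next
  case e6
  have "coeff [:0, 1 :: complex:] i \<in> \<rat>" for i by (cases i; cases "i - 1") auto
  then show ?case by (intro exI[of _ "[:0, 1:]"]) (auto simp: power_divide power2_eq_square power3_eq_cube)
next
  case (add w f g)
  then obtain p r where pr: "\<forall>i. coeff p i \<in> \<rat>" "\<forall>i. coeff r i \<in> \<rat>"
    "\<forall>q\<in>pdisc. eis 4 q \<noteq> 0 \<longrightarrow> eis 6 q \<noteq> 0 \<longrightarrow> f q = (eis 6 q / eis 4 q) ^ (w div 2) * poly p (eis 4 q ^ 3 / eis 6 q ^ 2)"
    "\<forall>q\<in>pdisc. eis 4 q \<noteq> 0 \<longrightarrow> eis 6 q \<noteq> 0 \<longrightarrow> g q = (eis 6 q / eis 4 q) ^ (w div 2) * poly r (eis 4 q ^ 3 / eis 6 q ^ 2)"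
    by blast
  show ?case by (rule exI[of _ "p + r"]) (use pr in \<open>auto simp: algebra_simps\<close>)
next
  case (mult w f w' g)
  then obtain p r where pr: "\<forall>i. coeff p i \<in> \<rat>" "\<forall>i. coeff r i \<in> \<rat>"
    "\<forall>q\<in>pdisc. eis 4 q \<noteq> 0 \<longrightarrow> eis 6 q \<noteq> 0 \<longrightarrow> f q = (eis 6 q / eis 4 q) ^ (w div 2) * poly p (eis 4 q ^ 3 / eis 6 q ^ 2)"
    "\<forall>q\<in>pdisc. eis 4 q \<noteq> 0 \<longrightarrow> eis 6 q \<noteq> 0 \<longrightarrow> g q = (eis 6 q / eis 4 q) ^ (w' div 2) * poly r (eis 4 q ^ 3 / eis 6 q ^ 2)"
    by blast
  have d: "(w + w') div 2 = w div 2 + w' div 2" using MF_even mult.hyps by (simp add: div_add)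
  show ?case by (rule exI[of _ "p * r"]) (use pr Rats_coeff_mult in \<open>auto simp: d power_add\<close>)
next
  case (cong w f g)
  then show ?case by (metis (no_types, lifting))
qed

lemma eis_at_0: "((\<lambda>q. eis k q) \<longlongrightarrow> of_real (bernoulli k) / fact k) (at 0)"
proof -
  have "((\<lambda>q. of_real (bernoulli k) / fact k - 2 / fact (k - 1) * lam 0 (k - 1) q) \<longlongrightarrow>
      of_real (bernoulli k) / fact k - 2 / fact (k - 1) * 0) (at 0)"
    by (intro tendsto_intros lam_at_0)
  then show ?thesis by (simp add: eis_def[abs_def])
qed

lemma eisD_at_0: "((\<lambda>q. eisD p k q / q) \<longlongrightarrow> - 2 / fact (k - 1)) (at 0)" "((\<lambda>q. eisD p k q) \<longlongrightarrow> 0) (at 0)"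
proof -
  have "((\<lambda>q. - 2 / fact (k - 1) * (lam p (k - 1) q / q)) \<longlongrightarrow> - 2 / fact (k - 1) * 1) (at 0)"
    by (intro tendsto_intros lam_at_0)
  then show "((\<lambda>q. eisD p k q / q) \<longlongrightarrow> - 2 / fact (k - 1)) (at 0)" by (simp add: eisD_def[abs_def])
  have "((\<lambda>q. - 2 / fact (k - 1) * lam p (k - 1) q) \<longlongrightarrow> - 2 / fact (k - 1) * 0) (at 0)"
    by (intro tendsto_intros lam_at_0)
  then show "((\<lambda>q. eisD p k q) \<longlongrightarrow> 0) (at 0)" by (simp add: eisD_def[abs_def])
qed

text \<open>\<open>h\<close> is the Serre derivative of \<open>eis k\<close> and \<open>j\<close>
  that of \<open>h\<close>; the derivative of \<open>eis 2\<close> comes from Ramanujan's first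
  equation.\<close>

lemma second_order:
  assumes k: "even k" "k \<ge> 4"
  obtains h j where "MF (k + 2) h" "MF (k + 4) j"
    "\<And>q. q \<in> pdisc \<Longrightarrow> eisD 1 k q = of_nat k * eis 2 q * eis k q + h q"
    "\<And>q. q \<in> pdisc \<Longrightarrow> eisD 2 k q = of_nat k * ((5 * eis 4 q + eis 2 q ^ 2) * eis k q + eis 2 q * eisD 1 k q) +
       of_nat (k + 2) * eis 2 q * h q + j q"
proof -
  obtain h where h: "MF (k + 2) h"
    "\<And>q. q \<in> pdisc \<Longrightarrow> (eis k has_field_derivative (of_nat k * eis 2 q * eis k q + h q) / q) (at q)"
    using MF_deriv[OF MF_eis[OF k]] by blast
  obtain j where j: "MF (k + 2 + 2) j"
    "\<And>q. q \<in> pdisc \<Longrightarrow> (h has_field_derivative (of_nat (k + 2) * eis 2 q * h q + j q) / q) (at q)"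
    using MF_deriv[OF h(1)] by blast
  have 1: "eisD 1 k q = of_nat k * eis 2 q * eis k q + h q" if q: "q \<in> pdisc" for q
  proof -
    have "eisD 1 k q / q = (of_nat k * eis 2 q * eis k q + h q) / q"
      using DERIV_unique[OF eis_deriv[OF q] h(2)[OF q]] .
    then show ?thesis using q by (auto simp: pdisc_def)
  qed
  have 2: "eisD 2 k q = of_nat k * ((5 * eis 4 q + eis 2 q ^ 2) * eis k q + eis 2 q * eisD 1 k q) +
       of_nat (k + 2) * eis 2 q * h q + j q" if q: "q \<in> pdisc" for q
  proof -
    have "((\<lambda>q. of_nat k * (eis 2 q * eis k q) + h q) has_field_derivative
        of_nat k * ((eisD 1 2 q / q) * eis k q + (eisD 1 k q / q) * eis 2 q) + (of_nat (k + 2) * eis 2 q * h q + j q) / q) (at q)"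
      by (intro DERIV_add DERIV_cmult DERIV_mult eis_deriv q j)
    then have "(eisD 1 k has_field_derivative
        of_nat k * ((eisD 1 2 q / q) * eis k q + (eisD 1 k q / q) * eis 2 q) + (of_nat (k + 2) * eis 2 q * h q + j q) / q) (at q)"
      by (rule has_field_derivative_transform_within_open[OF _ open_pdisc q]) (simp only: 1 mult.assoc)
    moreover have "(eisD 1 k has_field_derivative eisD 2 k q / q) (at q)"
      using eisD_deriv[OF q, of 1 k] by (simp add: numeral_2_eq_2)
    ultimately have "eisD 2 k q / q = of_nat k * ((eisD 1 2 q / q) * eis k q + (eisD 1 k q / q) * eis 2 q) + (of_nat (k + 2) * eis 2 q * h q + j q) / q"
      using DERIV_unique by blast
    also have "\<dots> = (of_nat k * (eisD 1 2 q * eis k q + eis 2 q * eisD 1 k q) + of_nat (k + 2) * eis 2 q * h q + j q) / q"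
      by (simp add: add_divide_distrib algebra_simps)
    finally show ?thesis using q unfolding ramanujan(1)[OF q] by (auto simp: pdisc_def add.assoc)
  qed
  have e: "k + 2 + 2 = k + 4" by simp
  show thesis by (rule that[OF h(1) j(1)[unfolded e] 1 2])
qed


section \<open>A theta function that clears the poles, and its growth\<close>

context nome
begin

text \<open>Euler's expansion: \<open>pr x\<close> is the product of all \<open>1 - q\<^sup>m x\<close>.\<close>

fun prc :: "nat \<Rightarrow> complex" where
  "prc 0 = 1"
| "prc (Suc n) = - prc n * q ^ n / (1 - q ^ Suc n)"

definition pr :: "complex \<Rightarrow> complex" where "pr x = (\<Sum>n. prc n * x ^ n)"

lemma q_power_ne_1: "q ^ Suc n \<noteq> 1"
proof
  assume "q ^ Suc n = 1"
  then have "norm q ^ Suc n = 1" by (metis norm_one norm_power)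
  moreover have "norm q ^ Suc n < 1" using q1 q0 by (intro power_Suc_less_one) auto
  ultimately show False by simp
qed

lemma pr_summable: "summable (\<lambda>n. prc n * x ^ n)"
proof -
  define b where "b = 1 - norm q"
  have b: "b > 0" using q1 by (simp add: b_def)
  have "(\<lambda>n. norm q ^ n * (norm x / b)) \<longlonglongrightarrow> 0 * (norm x / b)"
    by (intro tendsto_intros LIMSEQ_power_zero) (use q1 in auto)
  then have "\<forall>\<^sub>F n in sequentially. norm q ^ n * (norm x / b) < 1/2" by (rule order_tendstoD) auto
  then obtain N where N: "\<And>n. n \<ge> N \<Longrightarrow> norm q ^ n * (norm x / b) < 1/2"
    unfolding eventually_sequentially by blast
  show ?thesis
  proof (rule summable_ratio_test[of "1/2" N])
    fix n assume "N \<le> n"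
    have "norm (1 - q ^ Suc n) \<ge> 1 - norm q ^ Suc n" by (metis norm_one norm_power norm_triangle_ineq2)
    moreover have "norm q ^ Suc n \<le> norm q ^ 1" using q1 by (intro power_decreasing) auto
    ultimately have ge: "norm (1 - q ^ Suc n) \<ge> b" by (simp add: b_def)
    have "norm (prc (Suc n) * x ^ Suc n) = norm (prc n * x ^ n) * (norm q ^ n * (norm x / norm (1 - q ^ Suc n)))"
      by (simp add: norm_mult norm_divide norm_power mult_ac del: power_Suc) simp
    also have "\<dots> \<le> norm (prc n * x ^ n) * (norm q ^ n * (norm x / b))"
      using ge b by (intro mult_left_mono divide_left_mono mult_pos_pos) auto
    also have "\<dots> \<le> norm (prc n * x ^ n) * (1/2)"
      using N[OF \<open>N \<le> n\<close>] by (intro mult_left_mono) auto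
    finally show "norm (prc (Suc n) * x ^ Suc n) \<le> 1/2 * norm (prc n * x ^ n)" by simp
  qed simp
qed

lemma pr_0: "pr 0 = 1"
proof -
  have "(\<lambda>n. prc n * 0 ^ n) sums prc 0" by (rule powser_sums_zero)
  then show ?thesis unfolding pr_def by (simp add: sums_iff)
qed

lemma pr_deriv: "(pr has_field_derivative deriv pr x) (at x)"
proof -
  have "(pr has_field_derivative (\<Sum>n. diffs prc n * x ^ n)) (at x)"
    unfolding pr_def[abs_def] by (rule termdiffs_strong_converges_everywhere) (rule pr_summable)
  then show ?thesis by (simp add: DERIV_deriv_iff_has_field_derivative DERIV_imp_deriv)
qed

lemma pr_holo: "pr holomorphic_on A"
  unfolding holomorphic_on_def field_differentiable_def using has_field_derivative_at_within[OF pr_deriv] by blast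

text \<open>Coefficientwise this is the recursion defining \<open>prc\<close>.\<close>

lemma pr_feq: "pr x = (1 - x) * pr (q * x)"
proof -
  define a where "a n = prc n * (q * x) ^ n" for n
  have a: "summable a" unfolding a_def by (rule pr_summable)
  have sx: "summable (\<lambda>n. x * a n)" using a by (rule summable_mult)
  have step: "prc (Suc n) * x ^ Suc n = a (Suc n) - x * a n" for n
  proof -
    have "prc (Suc n) * (1 - q ^ Suc n) = - prc n * q ^ n" using q_power_ne_1[of n] by simp
    then have "prc (Suc n) * (1 - q ^ Suc n) * x ^ Suc n = - prc n * q ^ n * x ^ Suc n" by simp
    then show ?thesis unfolding a_def by (simp add: power_mult_distrib algebra_simps del: prc.simps)
  qed
  have "pr x = prc 0 * x ^ 0 + (\<Sum>n. prc (Suc n) * x ^ Suc n)"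
    unfolding pr_def using suminf_split_head[OF pr_summable[of x]] by simp
  also have "(\<Sum>n. prc (Suc n) * x ^ Suc n) = (\<Sum>n. a (Suc n)) - (\<Sum>n. x * a n)"
    unfolding step using a by (intro suminf_diff[symmetric] sx) (simp add: summable_Suc_iff)
  also have "(\<Sum>n. a (Suc n)) = suminf a - a 0" using suminf_split_head[OF a] by simp
  also have "(\<Sum>n. x * a n) = x * suminf a" by (rule suminf_mult[OF a])
  finally have "pr x = prc 0 * x ^ 0 + (suminf a - a 0 - x * suminf a)" .
  moreover have "a 0 = 1" by (simp add: a_def)
  moreover have "suminf a = pr (q * x)" by (simp add: pr_def a_def[abs_def])
  ultimately show ?thesis by (simp add: algebra_simps)
qed

lemma pr_feq_iter: "pr x = (\<Prod>m<N. 1 - q ^ m * x) * pr (q ^ N * x)"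
proof (induction N)
  case (Suc N)
  have "pr (q ^ N * x) = (1 - q ^ N * x) * pr (q ^ Suc N * x)"
    using pr_feq[of "q ^ N * x"] by (simp add: mult_ac)
  then show ?case using Suc by simp
qed simp

lemma q_power_tendsto: "(\<lambda>N. q ^ N * x) \<longlonglongrightarrow> 0"
proof -
  have "(\<lambda>N. q ^ N * x) \<longlonglongrightarrow> 0 * x" by (intro tendsto_intros LIMSEQ_power_zero) (use q1 in auto)
  then show ?thesis by simp
qed

text \<open>Split off finitely many non-zero factors; the remaining value
  \<open>pr (q ^ N * x)\<close> tends to \<open>pr 0 = 1\<close>.\<close>

lemma pr_nonzero: assumes "\<And>m. q ^ m * x \<noteq> 1" shows "pr x \<noteq> 0"
proof -
  have "isCont pr 0" using pr_deriv DERIV_isCont by blast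
  then have "(\<lambda>N. pr (q ^ N * x)) \<longlonglongrightarrow> pr 0" by (rule isCont_tendsto_compose) (rule q_power_tendsto)
  then have "(\<lambda>N. pr (q ^ N * x)) \<longlonglongrightarrow> 1" by (simp add: pr_0)
  then have "\<forall>\<^sub>F N in sequentially. pr (q ^ N * x) \<noteq> 0" by (rule tendsto_imp_eventually_ne) simp
  then obtain N where "pr (q ^ N * x) \<noteq> 0" by (auto simp: eventually_sequentially)
  then show ?thesis using assms by (subst pr_feq_iter[of x N]) auto
qed

text \<open>The functional equation makes l y = - y pr' (y) / pr y satisfy l y = \<open>fa y\<close>
  + l (q y), so the partial sums telescope, and l (q^N x) tends to l 0 = 0.\<close>

lemma pr_logderiv:
  assumes x: "\<And>m. q ^ m * x \<noteq> 1"
  shows "(\<lambda>m. fa (q ^ m * x)) sums (- x * deriv pr x / pr x)"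
proof -
  define l where "l y = - y * deriv pr y / pr y" for y
  have step: "l y = fa y + l (q * y)" if "\<And>m. q ^ m * y \<noteq> 1" for y
  proof -
    have y1: "y \<noteq> 1" using that[of 0] by simp
    have qy: "pr (q * y) \<noteq> 0"
    proof (rule pr_nonzero)
      fix m show "q ^ m * (q * y) \<noteq> 1" using that[of "Suc m"] by (simp add: mult_ac)
    qed
    have "((\<lambda>y. (1 - y) * pr (q * y)) has_field_derivative (0 - 1) * pr (q * y) + (deriv pr (q * y) * q) * (1 - y)) (at y)"
      by (intro DERIV_mult DERIV_diff DERIV_const DERIV_ident DERIV_chain2[OF pr_deriv]) (auto intro!: derivative_eq_intros)
    moreover have "(\<lambda>y. (1 - y) * pr (q * y)) = pr" by (rule ext) (rule pr_feq[symmetric])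
    ultimately have "(pr has_field_derivative (0 - 1) * pr (q * y) + (deriv pr (q * y) * q) * (1 - y)) (at y)" by simp
    then have d: "deriv pr y = - pr (q * y) + (deriv pr (q * y) * q) * (1 - y)" by (simp add: DERIV_imp_deriv)
    have p: "pr y = (1 - y) * pr (q * y)" by (rule pr_feq)
    have "1 - y \<noteq> 0" using y1 by simp
    have "l y = y * pr (q * y) / ((1 - y) * pr (q * y)) - y * (deriv pr (q * y) * q) * (1 - y) / ((1 - y) * pr (q * y))"
      unfolding l_def d p by (simp add: diff_divide_distrib[symmetric] algebra_simps)
    also have "\<dots> = fa y + l (q * y)"
      using qy \<open>1 - y \<noteq> 0\<close> unfolding fa_def l_def by (simp add: mult_ac)
    finally show ?thesis .
  qed
  have part: "(\<Sum>m<N. fa (q ^ m * x)) = l x - l (q ^ N * x)" for N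
  proof (induction N)
    case (Suc N)
    have "l (q ^ N * x) = fa (q ^ N * x) + l (q * (q ^ N * x))"
    proof (rule step)
      fix m show "q ^ m * (q ^ N * x) \<noteq> 1" using x[of "m + N"] by (simp add: power_add mult_ac)
    qed
    then show ?case using Suc by (simp add: mult_ac)
  qed simp
  have "isCont l 0" unfolding l_def[abs_def]
  proof (intro continuous_intros)
    show "isCont (deriv pr) 0"
      using holomorphic_deriv[OF pr_holo[of UNIV] open_UNIV] holomorphic_on_imp_continuous_on continuous_on_eq_continuous_at
      by blast
    show "isCont pr 0" using pr_deriv DERIV_isCont by blast
  qed (simp add: pr_0)
  then have "(\<lambda>N. l (q ^ N * x)) \<longlonglongrightarrow> l 0" by (rule isCont_tendsto_compose) (rule q_power_tendsto)
  then have "(\<lambda>N. l x - l (q ^ N * x)) \<longlonglongrightarrow> l x - l 0" by (intro tendsto_intros)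
  then show ?thesis unfolding sums_def part by (simp add: l_def)
qed

text \<open>About r / |Re t| factors, each at most exp (1 + r), bring the argument into the unit
  disc, where \<open>pr\<close> is bounded. This is where the quadratic exponent comes from.\<close>

lemma pr_growth: "\<exists>C>0. \<forall>r\<ge>0. \<forall>x. norm x \<le> exp r \<longrightarrow> norm (pr x) \<le> exp (C * (1 + r) ^ 2)"
proof -
  have "compact (pr ` cball 0 1)"
    by (intro compact_continuous_image compact_cball holomorphic_on_imp_continuous_on pr_holo)
  then obtain M where M: "M > 0" "\<And>x. norm x \<le> 1 \<Longrightarrow> norm (pr x) \<le> M"
    using compact_imp_bounded bounded_pos by (metis (no_types, lifting) imageI mem_cball_0)
  define C where "C = ln (max M 1) + 1 / (- Re t) + 2"
  have lnM: "ln (max M 1) \<ge> 0" by simp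
  have tp: "1 / (- Re t) > 0" using Ret by simp
  have C0: "C > 0" unfolding C_def using lnM tp by linarith
  have "norm (pr x) \<le> exp (C * (1 + r) ^ 2)" if r: "r \<ge> 0" and x: "norm x \<le> exp r" for r x
  proof -
    define N where "N = nat \<lceil>r / (- Re t)\<rceil>"
    have N1: "r / (- Re t) \<le> N" unfolding N_def by (rule real_nat_ceiling_ge)
    have N2: "real N \<le> r / (- Re t) + 1" unfolding N_def using r Ret by (simp add: divide_nonneg_neg) linarith
    have nq: "norm q = exp (Re t)" using expt norm_exp_eq_Re by metis
    have "norm (q ^ N * x) \<le> exp (Re t) ^ N * exp r" unfolding norm_mult norm_power nq
      using x by (intro mult_left_mono) auto
    also have "\<dots> = exp (real N * Re t + r)" by (simp add: exp_of_nat_mult exp_add)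
    also have "\<dots> \<le> exp 0"
    proof -
      have "real N * Re t + r \<le> 0" using N1 Ret by (simp add: field_simps)
      then show ?thesis by simp
    qed
    finally have "norm (pr (q ^ N * x)) \<le> M" using M(2) by simp
    moreover have "norm (\<Prod>m<N. 1 - q ^ m * x) \<le> exp (1 + r) ^ N"
    proof -
      have "norm (1 - q ^ m * x) \<le> exp (1 + r)" for m
      proof -
        have "norm (q ^ m * x) \<le> 1 * exp r" unfolding norm_mult norm_power
          using x q1 by (intro mult_mono power_le_one) auto
        then have "norm (1 - q ^ m * x) \<le> 1 + exp r"
          using norm_triangle_ineq4[of 1 "q ^ m * x"] by simp
        also have "\<dots> \<le> exp r + exp r" using r by simp
        also have "\<dots> \<le> exp 1 * exp r" using exp_ge_add_one_self[of 1] by simp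
        finally show ?thesis by (simp add: exp_add)
      qed
      then have "(\<Prod>m<N. norm (1 - q ^ m * x)) \<le> (\<Prod>m<N. exp (1 + r))" by (intro prod_mono) auto
      then show ?thesis by (simp add: prod_norm)
    qed
    ultimately have "norm (pr x) \<le> exp (1 + r) ^ N * M"
      by (subst pr_feq_iter[of x N], subst norm_mult) (intro mult_mono, auto)
    also have "\<dots> \<le> exp (1 + r) ^ N * exp (ln (max M 1))" by (intro mult_left_mono) auto
    also have "exp (1 + r) ^ N = exp (real N * (1 + r))" by (rule exp_of_nat_mult[symmetric])
    also have "exp (real N * (1 + r)) * exp (ln (max M 1)) = exp (real N * (1 + r) + ln (max M 1))"
      by (rule exp_add[symmetric])
    also have "\<dots> \<le> exp (C * (1 + r) ^ 2)"
    proof -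
      define s where "s = 1 + r"
      have s: "s \<ge> 1" using r by (simp add: s_def)
      have "r * (1 / (- Re t)) \<le> s * (1 / (- Re t))" using tp r by (intro mult_right_mono) (auto simp: s_def)
      then have "real N \<le> s * (1 / (- Re t)) + 1" using N2 by simp
      then have "real N * s \<le> (s * (1 / (- Re t)) + 1) * s" using s by (intro mult_right_mono) auto
      also have "\<dots> \<le> (1 / (- Re t) + 1) * s^2" using s by (simp add: power2_eq_square algebra_simps)
      finally have 1: "real N * s \<le> (1 / (- Re t) + 1) * s^2" .
      have "1 \<le> s^2" using s by (simp add: one_le_power)
      then have "ln (max M 1) * 1 \<le> (ln (max M 1) + 1) * s^2" using lnM by (intro mult_mono) auto
      then have "real N * s + ln (max M 1) \<le> C * s^2" using 1 unfolding C_def by (simp add: algebra_simps)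
      then show ?thesis by (simp add: s_def)
    qed
    finally show ?thesis .
  qed
  then show ?thesis using C0 by blast
qed

text \<open>A theta function: entire with simple zeros exactly on the lattice, so that \<open>HZ / H = Z\<close> and \<open>HW / H\<^sup>2 = \<wp>\<close>.\<close>

definition H :: "complex \<Rightarrow> complex" where "H v = pr (exp (- v)) * pr (q * exp v)"
definition HZ :: "complex \<Rightarrow> complex" where "HZ v = deriv H v + H v / 2"
definition HW :: "complex \<Rightarrow> complex" where
  "HW v = eis 2 q * H v ^ 2 - (deriv (deriv H) v * H v - deriv H v ^ 2)"

lemma H_holo: "H holomorphic_on A"
proof -
  have "pr \<circ> (\<lambda>v. exp (- v)) holomorphic_on A" "pr \<circ> (\<lambda>v. q * exp v) holomorphic_on A"
    by (rule holomorphic_on_compose[OF _ pr_holo], intro holomorphic_intros)+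
  then have "(\<lambda>v. pr (exp (- v))) holomorphic_on A" "(\<lambda>v. pr (q * exp v)) holomorphic_on A"
    by (simp_all add: o_def)
  then show ?thesis unfolding H_def[abs_def] by (rule holomorphic_on_mult)
qed

lemma entire_deriv: "(\<And>A. f holomorphic_on A) \<Longrightarrow> deriv f holomorphic_on (A :: complex set)"
  by (rule holomorphic_on_subset[OF holomorphic_deriv[of f UNIV]]) auto

lemma HZ_holo: "HZ holomorphic_on A"
  unfolding HZ_def[abs_def] by (intro holomorphic_intros entire_deriv H_holo) auto
lemma HW_holo: "HW holomorphic_on A"
  unfolding HW_def[abs_def] by (intro holomorphic_intros entire_deriv H_holo)

lemma H_nonzero: assumes "v \<notin> \<Lambda>" shows "H v \<noteq> 0"
proof -
  have v: "v \<in> - \<Lambda>" using assms by simp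
  have "pr (exp (- v)) \<noteq> 0" using nl1[OF v] by (intro pr_nonzero) auto
  moreover have "pr (q * exp v) \<noteq> 0" using nl2[OF v] by (intro pr_nonzero) (auto simp: mult.assoc)
  ultimately show ?thesis by (simp add: H_def)
qed

text \<open>The logarithmic derivatives of the two products are the two series in \<open>Z\<close>;
  the summand 1/2 of \<open>Z\<close> is not among them.\<close>

lemma H_deriv_eq: assumes "v \<notin> \<Lambda>" shows "deriv H v = (Z v - 1/2) * H v"
proof -
  have v: "v \<in> - \<Lambda>" using assms by simp
  define x y where "x = exp (- v)" and "y = q * exp v"
  have nx: "q ^ m * x \<noteq> 1" for m using nl1[OF v] by (auto simp: x_def)
  have ny: "q ^ m * y \<noteq> 1" for m using nl2[OF v] by (auto simp: y_def mult.assoc)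
  have px: "pr x \<noteq> 0" "pr y \<noteq> 0" using pr_nonzero nx ny by auto
  have "((\<lambda>v. pr (exp (- v)) * pr (q * exp v)) has_field_derivative
     (deriv pr x * (- x)) * pr y + (deriv pr y * y) * pr x) (at v)"
    unfolding x_def y_def
    by (intro DERIV_mult DERIV_chain2[OF pr_deriv]) (auto intro!: derivative_eq_intros)
  then have d: "deriv H v = (deriv pr x * (- x)) * pr y + (deriv pr y * y) * pr x"
    unfolding H_def[abs_def] by (rule DERIV_imp_deriv)
  have "Lser q 0 fa 1 (-1) v = - x * deriv pr x / pr x"
    unfolding Lser_def using pr_logderiv[OF nx] by (simp add: sums_iff x_def)
  moreover have "Lser q 0 fa q 1 v = - y * deriv pr y / pr y"
    unfolding Lser_def using pr_logderiv[OF ny] by (simp add: sums_iff y_def mult.assoc)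
  ultimately have "Z v - 1/2 = - x * deriv pr x / pr x + y * deriv pr y / pr y" by (simp add: Z_def)
  then have "(Z v - 1/2) * H v = (- x * deriv pr x / pr x + y * deriv pr y / pr y) * (pr x * pr y)"
    by (simp add: H_def x_def y_def)
  also have "\<dots> = (deriv pr x * (- x)) * pr y + (deriv pr y * y) * pr x"
    using px by (simp add: algebra_simps)
  finally show ?thesis using d by simp
qed

lemma HZ_eq: "v \<notin> \<Lambda> \<Longrightarrow> HZ v = H v * Z v"
  unfolding HZ_def by (simp add: H_deriv_eq algebra_simps)

lemma HW_eq: assumes "v \<notin> \<Lambda>" shows "HW v = H v ^ 2 * wp v"
proof -
  have dH: "(H has_field_derivative deriv H v) (at v)" for v
    by (rule holomorphic_derivI[OF H_holo open_UNIV]) simp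
  have "((\<lambda>v. (Z v - 1/2) * H v) has_field_derivative (Z1 v - 0) * H v + deriv H v * (Z v - 1/2)) (at v)"
    by (intro DERIV_mult DERIV_diff Z_deriv assms DERIV_const dH)
  then have "(deriv H has_field_derivative (Z1 v - 0) * H v + deriv H v * (Z v - 1/2)) (at v)"
    by (rule has_field_derivative_transform_within_open[OF _ open_compl_\<Lambda>]) (use assms H_deriv_eq in auto)
  then have dd: "deriv (deriv H) v = Z1 v * H v + deriv H v * (Z v - 1/2)" by (simp add: DERIV_imp_deriv)
  show ?thesis unfolding HW_def dd H_deriv_eq[OF assms] wp_def by (simp add: algebra_simps power2_eq_square)
qed

lemma H_growth: "\<exists>C>0. \<forall>v. norm (H v) \<le> exp (C * (1 + \<bar>Re v\<bar>) ^ 2)"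
proof -
  obtain C where C: "C > 0" "\<And>r x. r \<ge> 0 \<Longrightarrow> norm x \<le> exp r \<Longrightarrow> norm (pr x) \<le> exp (C * (1 + r) ^ 2)"
    using pr_growth by blast
  have "norm (H v) \<le> exp (2 * C * (1 + \<bar>Re v\<bar>) ^ 2)" for v
  proof -
    have "norm (pr (exp (- v))) \<le> exp (C * (1 + \<bar>Re v\<bar>) ^ 2)" by (rule C(2)) auto
    moreover have "norm (q * exp v) \<le> 1 * exp \<bar>Re v\<bar>" unfolding norm_mult using q1 by (intro mult_mono) auto
    then have "norm (pr (q * exp v)) \<le> exp (C * (1 + \<bar>Re v\<bar>) ^ 2)" by (intro C(2)) auto
    ultimately have "norm (H v) \<le> exp (C * (1 + \<bar>Re v\<bar>) ^ 2) * exp (C * (1 + \<bar>Re v\<bar>) ^ 2)"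
      unfolding H_def norm_mult by (intro mult_mono) auto
    then show ?thesis by (simp add: exp_add[symmetric] mult.assoc)
  qed
  then show ?thesis using C(1) by (intro exI[of _ "2 * C"]) auto
qed

text \<open>The bound involves Re v alone, hence is uniform along vertical lines, as the maximum
  principle on a strip demands.\<close>

definition quadratic_growth :: "(complex \<Rightarrow> complex) \<Rightarrow> bool" where
  "quadratic_growth f \<longleftrightarrow> (\<exists>C>0. \<forall>v. norm (f v) \<le> exp (C * (1 + \<bar>Re v\<bar>) ^ 2))"

text \<open>Cauchy's estimate on a unit circle: moving Re v by at most 1 at most doubles 1 + |Re v|,
  whence the factor 4 in the exponent.\<close>

lemma quadratic_growth_deriv:
  assumes "quadratic_growth f" "f holomorphic_on UNIV" shows "quadratic_growth (deriv f)"
proof -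
  obtain C where C: "C > 0" "\<And>v. norm (f v) \<le> exp (C * (1 + \<bar>Re v\<bar>) ^ 2)"
    using assms unfolding quadratic_growth_def by blast
  have "norm (deriv f v) \<le> exp (4 * C * (1 + \<bar>Re v\<bar>) ^ 2)" for v
  proof -
    have "norm ((deriv ^^ 1) f v) \<le> fact 1 * exp (4 * C * (1 + \<bar>Re v\<bar>) ^ 2) / 1 ^ 1"
    proof (rule Cauchy_inequality)
      show "f holomorphic_on ball v 1" "continuous_on (cball v 1) f"
        using assms(2) holomorphic_on_subset holomorphic_on_imp_continuous_on by blast+
      fix w assume w: "norm (v - w) = 1"
      have "\<bar>Re w\<bar> \<le> \<bar>Re v\<bar> + 1" using abs_Re_le_cmod[of "v - w"] w by simp
      then have "(1 + \<bar>Re w\<bar>) ^ 2 \<le> (2 * (1 + \<bar>Re v\<bar>)) ^ 2" by (intro power_mono) auto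
      then have "C * (1 + \<bar>Re w\<bar>) ^ 2 \<le> C * (2 * (1 + \<bar>Re v\<bar>)) ^ 2" using C by (intro mult_left_mono) auto
      also have "\<dots> = 4 * C * (1 + \<bar>Re v\<bar>) ^ 2" by (simp only: power_mult_distrib) simp
      finally have "C * (1 + \<bar>Re w\<bar>) ^ 2 \<le> 4 * C * (1 + \<bar>Re v\<bar>) ^ 2" .
      then have "exp (C * (1 + \<bar>Re w\<bar>) ^ 2) \<le> exp (4 * C * (1 + \<bar>Re v\<bar>) ^ 2)" by simp
      then show "norm (f w) \<le> exp (4 * C * (1 + \<bar>Re v\<bar>) ^ 2)" using C(2)[of w] by linarith
    qed simp
    then show ?thesis by simp
  qed
  then show ?thesis unfolding quadratic_growth_def using C(1) by (intro exI[of _ "4 * C"]) auto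
qed

lemma quadratic_growth_mult:
  assumes "quadratic_growth f" "quadratic_growth g" shows "quadratic_growth (\<lambda>v. f v * g v)"
proof -
  obtain C D where C: "C > 0" "\<And>v. norm (f v) \<le> exp (C * (1 + \<bar>Re v\<bar>) ^ 2)"
    and D: "D > 0" "\<And>v. norm (g v) \<le> exp (D * (1 + \<bar>Re v\<bar>) ^ 2)"
    using assms unfolding quadratic_growth_def by blast
  have "norm (f v * g v) \<le> exp ((C + D) * (1 + \<bar>Re v\<bar>) ^ 2)" for v
    unfolding norm_mult distrib_right exp_add using C D by (intro mult_mono) auto
  then show ?thesis unfolding quadratic_growth_def using C D by (intro exI[of _ "C + D"]) auto
qed

lemma quadratic_growth_add:
  assumes "quadratic_growth f" "quadratic_growth g" shows "quadratic_growth (\<lambda>v. f v + g v)"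
proof -
  obtain C D where C: "C > 0" "\<And>v. norm (f v) \<le> exp (C * (1 + \<bar>Re v\<bar>) ^ 2)"
    and D: "D > 0" "\<And>v. norm (g v) \<le> exp (D * (1 + \<bar>Re v\<bar>) ^ 2)"
    using assms unfolding quadratic_growth_def by blast
  have "norm (f v + g v) \<le> exp ((C + D + 1) * (1 + \<bar>Re v\<bar>) ^ 2)" for v
  proof -
    define s where "s = (1 + \<bar>Re v\<bar>) ^ 2"
    have s: "s \<ge> 1" by (simp add: s_def one_le_power)
    have "norm (f v + g v) \<le> exp (C * s) + exp (D * s)"
      using norm_triangle_ineq[of "f v" "g v"] C(2)[of v] D(2)[of v] by (simp add: s_def)
    also have "\<dots> \<le> exp ((C + D) * s) + exp ((C + D) * s)"
      using C D s by (intro add_mono) (auto simp: algebra_simps)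
    also have "\<dots> \<le> exp 1 * exp ((C + D) * s)" using exp_ge_add_one_self[of 1] by simp
    also have "\<dots> \<le> exp s * exp ((C + D) * s)" using s by simp
    also have "\<dots> = exp ((C + D + 1) * s)" by (simp add: exp_add[symmetric] algebra_simps)
    finally show ?thesis by (simp add: s_def)
  qed
  then show ?thesis unfolding quadratic_growth_def using C D by (intro exI[of _ "C + D + 1"]) auto
qed

lemma quadratic_growth_const: "quadratic_growth (\<lambda>_. c)"
proof -
  have "norm c \<le> exp ((norm c + 1) * (1 + \<bar>Re v\<bar>) ^ 2)" for v
  proof -
    have "1 \<le> (1 + \<bar>Re v\<bar>) ^ 2" by (simp add: one_le_power)
    then have "(norm c + 1) * 1 \<le> (norm c + 1) * (1 + \<bar>Re v\<bar>) ^ 2" by (rule mult_left_mono) simp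
    then have le: "norm c + 1 \<le> (norm c + 1) * (1 + \<bar>Re v\<bar>) ^ 2" by (simp only: mult_1_right)
    have "x + 1 \<le> y \<Longrightarrow> x \<le> exp y" for x y :: real using exp_ge_add_one_self[of y] by linarith
    from this[OF le] show ?thesis .
  qed
  then show ?thesis unfolding quadratic_growth_def
    by (intro exI[of _ "norm c + 1"]) (auto simp: add_nonneg_pos)
qed

lemma growths: "quadratic_growth H" "quadratic_growth HZ" "quadratic_growth HW"
proof -
  show h: "quadratic_growth H" using H_growth unfolding quadratic_growth_def .
  have h1: "quadratic_growth (deriv H)" by (intro quadratic_growth_deriv h H_holo)
  have h2: "quadratic_growth (deriv (deriv H))" by (intro quadratic_growth_deriv h1 entire_deriv H_holo)
  have "quadratic_growth (\<lambda>v. deriv H v + H v * (1/2))"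
    by (intro quadratic_growth_add quadratic_growth_mult quadratic_growth_const h h1)
  then show "quadratic_growth HZ" by (simp add: HZ_def[abs_def])
  have "quadratic_growth (\<lambda>v. eis 2 q * (H v * H v) + ((-1) * (deriv (deriv H) v * H v) + deriv H v * deriv H v))"
    by (intro quadratic_growth_add quadratic_growth_mult quadratic_growth_const h h1 h2)
  then show "quadratic_growth HW" by (simp add: HW_def[abs_def] power2_eq_square algebra_simps)
qed

lemma H_period: "H (v + 2 * pi * \<i>) = H v"
proof -
  have "exp (- (v + 2 * pi * \<i>)) = exp (- v)" using exp_2pi[of "-1" v] by simp
  moreover have "exp (v + 2 * pi * \<i>) = exp v" using exp_2pi[of 1 v] by simp
  ultimately show ?thesis unfolding H_def by (simp only:)
qed

end


section \<open>Denominators and sizes of the Taylor coefficients\<close>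

context number_order
begin

text \<open>Denominators of the \<open>n\<close>-th coefficient divide \<open>N\<^bsup>n+l\<^esup> n!\<close>, and the cleared coefficient has size at most \<open>B n! \<rho>\<^sup>n\<close>.\<close>

definition arith :: "real \<Rightarrow> nat \<Rightarrow> nat \<Rightarrow> real \<Rightarrow> complex fps \<Rightarrow> bool" where
  "arith \<rho> N l B F \<longleftrightarrow> (\<forall>n. bdd (of_nat N ^ (n + l) * fact n * fps_nth F n) (B * fact n * \<rho> ^ n))"

lemma binomial_fact_complex:
  "i \<le> n \<Longrightarrow> (fact n :: complex) = of_nat (n choose i) * fact i * fact (n - i)"
  by (simp add: binomial_fact)

lemma binomial_fact_real:
  "i \<le> n \<Longrightarrow> (fact n :: real) = of_nat (n choose i) * fact i * fact (n - i)"
  by (simp add: binomial_fact)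

text \<open>With equal ratios the Leibniz sum would cost a factor n + 1 for every multiplication.
  Giving \<open>F\<close> twice the ratio of \<open>G\<close> turns it into a geometric sum below 2
  * 2^n, so a product costs only the factor 2 A and long powers stay exponential.\<close>

lemma arith_mult:
  assumes F: "arith (2 * \<rho>) N l B F" and G: "arith \<rho> N 1 A G" and "\<rho> \<ge> 0" "A \<ge> 0" "B \<ge> 0"
  shows "arith (2 * \<rho>) N (l + 1) (2 * A * B) (F * G)"
  unfolding arith_def
proof
  fix n
  define f where "f i = of_nat N ^ (i + l) * fact i * fps_nth F i" for i
  define g where "g i = of_nat N ^ (i + 1) * fact i * fps_nth G i" for i
  have "of_nat N ^ (n + (l + 1)) * fact n * fps_nth (F * G) n = (\<Sum>i=0..n. of_nat (n choose i) * (f i * g (n - i)))"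
    unfolding fps_mult_nth sum_distrib_left
  proof (intro sum.cong refl)
    fix i assume "i \<in> {0..n}"
    then have i: "i \<le> n" by simp
    have "n + (l + 1) = (i + l) + (n - i + 1)" using i by simp
    then have p: "of_nat N ^ (n + (l + 1)) = (of_nat N ^ (i + l) * of_nat N ^ (n - i + 1) :: complex)"
      by (metis power_add)
    show "of_nat N ^ (n + (l + 1)) * fact n * (fps_nth F i * fps_nth G (n - i)) = of_nat (n choose i) * (f i * g (n - i))"
      unfolding p binomial_fact_complex[OF i] f_def g_def by (simp only: mult_ac)
  qed
  moreover have "bdd (\<Sum>i=0..n. of_nat (n choose i) * (f i * g (n - i)))
      (\<Sum>i=0..n. of_nat (n choose i) * ((B * fact i * (2 * \<rho>) ^ i) * (A * fact (n - i) * \<rho> ^ (n - i))))"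
  proof -
    have fb: "bdd (f i) (B * fact i * (2 * \<rho>) ^ i)" "bdd (g i) (A * fact i * \<rho> ^ i)" for i
      using F G unfolding arith_def f_def g_def by blast+
    show ?thesis by (intro bdd_sum bdd_nat bdd_mult fb) auto
  qed
  moreover have "(\<Sum>i=0..n. of_nat (n choose i) * ((B * fact i * (2 * \<rho>) ^ i) * (A * fact (n - i) * \<rho> ^ (n - i))))
     \<le> 2 * A * B * fact n * (2 * \<rho>) ^ n"
  proof -
    have "(\<Sum>i=0..n. of_nat (n choose i) * ((B * fact i * (2 * \<rho>) ^ i) * (A * fact (n - i) * \<rho> ^ (n - i)))) =
       (\<Sum>i=0..n. A * B * fact n * \<rho> ^ n * 2 ^ i)"
    proof (intro sum.cong refl)
      fix i assume "i \<in> {0..n}"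
      then have i: "i \<le> n" by simp
      have p: "\<rho> ^ n = \<rho> ^ i * \<rho> ^ (n - i)" using i by (simp flip: power_add)
      show "of_nat (n choose i) * ((B * fact i * (2 * \<rho>) ^ i) * (A * fact (n - i) * \<rho> ^ (n - i))) = A * B * fact n * \<rho> ^ n * 2 ^ i"
        unfolding p binomial_fact_real[OF i] power_mult_distrib by (simp only: mult_ac)
    qed
    also have "\<dots> = A * B * fact n * \<rho> ^ n * (\<Sum>i=0..n. 2 ^ i)" by (rule sum_distrib_left[symmetric])
    also have "(\<Sum>i=0..n. (2::real) ^ i) = 2 ^ Suc n - 1" by (induction n) auto
    also have "A * B * fact n * \<rho> ^ n * (2 ^ Suc n - 1) \<le> A * B * fact n * \<rho> ^ n * 2 ^ Suc n"
      using assms by (intro mult_left_mono) auto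
    finally show ?thesis by (simp add: power_mult_distrib mult_ac)
  qed
  ultimately show "bdd (of_nat N ^ (n + (l + 1)) * fact n * fps_nth (F * G) n) (2 * A * B * fact n * (2 * \<rho>) ^ n)"
    using bdd_mono by simp
qed

lemma arith_mono:
  assumes "arith \<rho> N l B F" "0 \<le> \<rho>" "\<rho> \<le> \<rho>'" "B \<le> B'" "0 \<le> B"
  shows "arith \<rho>' N l B' F"
  unfolding arith_def
proof
  fix n
  have "B * fact n * \<rho> ^ n \<le> B' * fact n * \<rho>' ^ n"
    using assms by (intro mult_mono power_mono) auto
  then show "bdd (of_nat N ^ (n + l) * fact n * fps_nth F n) (B' * fact n * \<rho>' ^ n)"
    using assms(1) bdd_mono unfolding arith_def by blast
qed

lemma arith_raise:
  assumes "arith \<rho> N l B F" shows "arith \<rho> N (l + k) (of_nat N ^ k * B) F"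
  unfolding arith_def
proof
  fix n
  have "bdd (of_nat (N ^ k) * (of_nat N ^ (n + l) * fact n * fps_nth F n)) (of_nat (N ^ k) * (B * fact n * \<rho> ^ n))"
    using assms unfolding arith_def by (intro bdd_nat) auto
  then show "bdd (of_nat N ^ (n + (l + k)) * fact n * fps_nth F n) (of_nat N ^ k * B * fact n * \<rho> ^ n)"
    by (simp add: power_add mult_ac)
qed

lemma arith_power:
  assumes F: "arith (2 * \<rho>) N l B F" and G: "arith \<rho> N 1 A G" and "\<rho> \<ge> 0" "A \<ge> 0" "B \<ge> 0"
  shows "arith (2 * \<rho>) N (l + i) ((2 * A) ^ i * B) (F * G ^ i)"
proof (induction i)
  case 0 then show ?case using F by simp
next
  case (Suc i)
  have "arith (2 * \<rho>) N (l + i + 1) (2 * A * ((2 * A) ^ i * B)) (F * G ^ i * G)"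
    by (rule arith_mult[OF Suc G]) (use assms in auto)
  then show ?case by (simp add: mult_ac)
qed

text \<open>The second order equation computes the coefficients of \<open>XF\<close> recursively,
  using one denominator N per product; \<open>UF\<close> follows by one integration. The factorials
  absorb the number of terms in the convolution. The constant E serves all n, L, i, j at
  once.\<close>

lemma arith_monomials:
  fixes UF XF :: "complex fps" and p g x0 :: complex
  assumes X: "fps_deriv (fps_deriv XF) = 6 * XF ^ 2 + fps_const g" "fps_nth XF 0 = x0" "fps_nth XF 1 = 0"
    and U: "fps_deriv UF = fps_const p - XF" "fps_nth UF 0 = 0"
    and N: "N > 0" "bdd (of_nat N) b" "bdd (of_nat N * x0) b" "bdd (of_nat N * g) b" "bdd (of_nat N * p) b" and b: "b \<ge> 1"
  shows "\<exists>E::nat. E \<ge> 1 \<and> (\<forall>L n i j. i < L \<longrightarrow> j < L \<longrightarrow>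
     bdd (of_nat N ^ (n + 2 * L) * fact n * fps_nth (UF ^ i * XF ^ j) n) (of_nat (E ^ (n + L) * fact n)))"
proof -
  define A where "A = b"
  \<comment> \<open>Large enough for both recursions: \<rho>^2 has to dominate 6 N A + N^2 from the
    equation for \<open>XF\<close>, and \<rho> has to dominate 2 N from the one for
    \<open>UF\<close>.\<close>
  define \<rho> where "\<rho> = 6 * real N * A + real N ^ 2 + 2 * real N + 1"
  have A1: "A \<ge> 1" using b by (simp add: A_def)
  have N1: "real N \<ge> 1" using N(1) by simp
  have \<rho>1: "\<rho> \<ge> 1" "\<rho> \<ge> 2 * real N" "\<rho> \<ge> 6 * real N * A + real N ^ 2" unfolding \<rho>_def using A1 N1 by auto
  have \<rho>2: "\<rho> ^ 2 \<ge> 6 * real N * A + real N ^ 2"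
  proof -
    have "\<rho> * 1 \<le> \<rho> * \<rho>" using \<rho>1 by (intro mult_left_mono) auto
    then show ?thesis using \<rho>1(3) by (simp add: power2_eq_square)
  qed
  define y where "y n = of_nat N ^ (n + 1) * fact n * fps_nth XF n" for n
  have ybd: "bdd (y n) (A * fact n * \<rho> ^ n)" for n
  proof (induction n rule: less_induct)
    case (less n)
    consider "n = 0" | "n = 1" | m where "n = m + 2"
      by (metis One_nat_def Suc_1 add.commute add_2_eq_Suc' not0_implies_Suc)
    then show ?case
    proof cases
      case 1
      then show ?thesis using N(3) X(2) by (simp add: y_def A_def)
    next
      case 2
      then have "y n = 0" using X(3) by (simp add: y_def)
      then show ?thesis using A1 \<rho>1 by (simp add: bdd_0)
    next
      case 3
      have "fps_nth (fps_deriv (fps_deriv XF)) m = of_nat (m + 1) * of_nat (m + 2) * fps_nth XF (m + 2)"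
        by (simp add: mult.assoc)
      then have rec: "of_nat (m + 1) * of_nat (m + 2) * fps_nth XF (m + 2) = 6 * fps_nth (XF ^ 2) m + (if m = 0 then g else 0)"
        unfolding X(1) by simp
      have f2: "(fact (m + 2) :: complex) = fact m * (of_nat (m + 1) * of_nat (m + 2))" by (simp add: algebra_simps)
      have "y n = of_nat N ^ (m + 3) * fact m * (of_nat (m + 1) * of_nat (m + 2) * fps_nth XF (m + 2))"
        unfolding y_def 3 f2 by (simp only: mult_ac) (simp add: numeral_3_eq_3)
      also have "\<dots> = of_nat (6 * N) * (of_nat N ^ (m + 2) * fact m * fps_nth (XF ^ 2) m) +
          (if m = 0 then of_nat (N ^ 2) * (of_nat N * g) else 0)"
        unfolding rec by (auto simp: algebra_simps power_add power2_eq_square power3_eq_cube)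
      also have "of_nat N ^ (m + 2) * fact m * fps_nth (XF ^ 2) m = (\<Sum>i=0..m. of_nat (m choose i) * (y i * y (m - i)))"
        unfolding power2_eq_square fps_mult_nth sum_distrib_left
      proof (intro sum.cong refl)
        fix i assume "i \<in> {0..m}"
        then have i: "i \<le> m" by simp
        have "m + 2 = (i + 1) + (m - i + 1)" using i by simp
        then have p: "of_nat N ^ (m + 2) = (of_nat N ^ (i + 1) * of_nat N ^ (m - i + 1) :: complex)"
          by (metis power_add)
        show "of_nat N ^ (m + 2) * fact m * (fps_nth XF i * fps_nth XF (m - i)) = of_nat (m choose i) * (y i * y (m - i))"
          unfolding p binomial_fact_complex[OF i] y_def by (simp only: mult_ac)
      qed
      finally have yn: "y n = of_nat (6 * N) * (\<Sum>i=0..m. of_nat (m choose i) * (y i * y (m - i))) +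
          (if m = 0 then of_nat (N ^ 2) * (of_nat N * g) else 0)" .
      have bs: "bdd (\<Sum>i=0..m. of_nat (m choose i) * (y i * y (m - i)))
         (\<Sum>i=0..m. of_nat (m choose i) * ((A * fact i * \<rho> ^ i) * (A * fact (m - i) * \<rho> ^ (m - i))))"
        using less.IH 3 by (intro bdd_sum bdd_nat bdd_mult) auto
      have es: "(\<Sum>i=0..m. of_nat (m choose i) * ((A * fact i * \<rho> ^ i) * (A * fact (m - i) * \<rho> ^ (m - i)))) = (\<Sum>i=0..m. A * A * fact m * \<rho> ^ m)"
      proof (intro sum.cong refl)
        fix i assume "i \<in> {0..m}"
        then have i: "i \<le> m" by simp
        have p: "\<rho> ^ m = \<rho> ^ i * \<rho> ^ (m - i)" using i by (simp flip: power_add)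
        show "of_nat (m choose i) * ((A * fact i * \<rho> ^ i) * (A * fact (m - i) * \<rho> ^ (m - i))) = A * A * fact m * \<rho> ^ m"
          unfolding p binomial_fact_real[OF i] by (simp only: mult_ac)
      qed
      have b2: "bdd (if m = 0 then of_nat (N ^ 2) * (of_nat N * g) else 0) (of_nat (N ^ 2) * A)"
        using bdd_nat[OF N(4), of "N ^ 2"] A1 by (auto simp: A_def intro: bdd_0)
      have "bdd (y n) (of_nat (6 * N) * (of_nat (m + 1) * (A * A * fact m * \<rho> ^ m)) + of_nat (N ^ 2) * A)"
        unfolding yn by (intro bdd_add bdd_nat b2) (use bs es in simp)
      moreover have "of_nat (6 * N) * (of_nat (m + 1) * (A * A * fact m * \<rho> ^ m)) + of_nat (N ^ 2) * A \<le> A * fact n * \<rho> ^ n"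
      proof -
        \<comment> \<open>The m + 1 convolution terms are equal after bounding, and (m + 1) m! = (m
          + 1)! is still at most n!.\<close>
        have fm: "real (m + 1) * fact m \<le> fact n" "1 \<le> fact n * \<rho> ^ m" "(0::real) \<le> fact n"
        proof -
          have "real (m + 1) * fact m = fact (m + 1)" by simp
          also have "\<dots> \<le> (fact n :: real)" unfolding 3 by (rule fact_mono) simp
          finally show "real (m + 1) * fact m \<le> fact n" .
          show "1 \<le> fact n * \<rho> ^ m" using mult_mono[of 1 "fact n" 1 "\<rho> ^ m"] \<rho>1 by (simp add: one_le_power fact_ge_1)
        qed simp
        have "of_nat (6 * N) * (of_nat (m + 1) * (A * A * fact m * \<rho> ^ m)) = (6 * real N * A) * A * ((real (m + 1) * fact m) * \<rho> ^ m)"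
          by (simp add: algebra_simps)
        also have "\<dots> \<le> (6 * real N * A) * A * (fact n * \<rho> ^ m)"
          using fm A1 N1 \<rho>1 by (intro mult_left_mono mult_right_mono) auto
        finally have 1: "of_nat (6 * N) * (of_nat (m + 1) * (A * A * fact m * \<rho> ^ m)) \<le> (6 * real N * A) * A * (fact n * \<rho> ^ m)" .
        have "of_nat (N ^ 2) * A * 1 \<le> real N ^ 2 * A * (fact n * \<rho> ^ m)"
          using fm A1 by (simp only: of_nat_power) (intro mult_left_mono, auto)
        with 1 have "of_nat (6 * N) * (of_nat (m + 1) * (A * A * fact m * \<rho> ^ m)) + of_nat (N ^ 2) * A \<le>
          (6 * real N * A + real N ^ 2) * (A * (fact n * \<rho> ^ m))" by (simp add: algebra_simps)
        also have "\<dots> \<le> \<rho> ^ 2 * (A * (fact n * \<rho> ^ m))"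
          using \<rho>2 A1 \<rho>1 by (intro mult_right_mono) auto
        also have "\<dots> = A * fact n * \<rho> ^ n" by (simp add: 3 power_add power2_eq_square mult_ac)
        finally show ?thesis .
      qed
      ultimately show ?thesis by (rule bdd_mono)
    qed
  qed
  have aX: "arith \<rho> N 1 A XF" unfolding arith_def using ybd by (simp add: y_def)
  have aU: "arith \<rho> N 1 A UF" unfolding arith_def
  proof
    fix n
    show "bdd (of_nat N ^ (n + 1) * fact n * fps_nth UF n) (A * fact n * \<rho> ^ n)"
    proof (cases n)
      case 0 then show ?thesis using U(2) A1 by (simp add: bdd_0)
    next
      case (Suc m)
      have "fps_nth (fps_deriv UF) m = of_nat (m + 1) * fps_nth UF (m + 1)" by simp
      then have "of_nat (m + 1) * fps_nth UF (m + 1) = (if m = 0 then p else 0) - fps_nth XF m"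
        unfolding U(1) by simp
      moreover have "of_nat N ^ (n + 1) * fact n * fps_nth UF n = of_nat N ^ (m + 2) * fact m * (of_nat (m + 1) * fps_nth UF (m + 1))"
        unfolding Suc by (simp add: mult_ac)
      ultimately have "of_nat N ^ (n + 1) * fact n * fps_nth UF n = of_nat N ^ (m + 2) * fact m * ((if m = 0 then p else 0) - fps_nth XF m)"
        by simp
      also have "\<dots> = of_nat N * ((if m = 0 then of_nat N * p else 0) + of_int (- 1) * y m)"
        by (auto simp: y_def algebra_simps)
      finally have eq: "of_nat N ^ (n + 1) * fact n * fps_nth UF n = of_nat N * ((if m = 0 then of_nat N * p else 0) + of_int (- 1) * y m)" .
      have "bdd (of_nat N * ((if m = 0 then of_nat N * p else 0) + of_int (- 1) * y m)) (of_nat N * (A + \<bar>of_int (-1)\<bar> * (A * fact m * \<rho> ^ m)))"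
        using N(5) A1 by (intro bdd_nat bdd_add bdd_int ybd) (auto simp: A_def intro: bdd_0)
      moreover have "of_nat N * (A + \<bar>of_int (-1)\<bar> * (A * fact m * \<rho> ^ m)) \<le> A * fact n * \<rho> ^ n"
      proof -
        have f1: "1 \<le> fact m * \<rho> ^ m" using mult_mono[of 1 "fact m" 1 "\<rho> ^ m"] \<rho>1 by (simp add: one_le_power fact_ge_1)
        have "A * 1 \<le> A * (fact m * \<rho> ^ m)" using f1 A1 by (intro mult_left_mono) auto
        then have "of_nat N * (A + A * fact m * \<rho> ^ m) \<le> of_nat N * (2 * (A * (fact m * \<rho> ^ m)))"
          by (intro mult_left_mono) auto
        also have "\<dots> = (2 * real N) * (A * (fact m * \<rho> ^ m))" by simp
        also have "\<dots> \<le> \<rho> * (A * (fact m * \<rho> ^ m))" using \<rho>1 A1 by (intro mult_right_mono) auto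
        also have "\<dots> = A * \<rho> ^ n * fact m" by (simp add: Suc mult_ac)
        also have "\<dots> \<le> A * \<rho> ^ n * fact n" using A1 \<rho>1 by (intro mult_left_mono) (auto simp: Suc fact_mono)
        finally show ?thesis by (simp add: mult_ac)
      qed
      ultimately show ?thesis unfolding eq by (rule bdd_mono)
    qed
  qed
  have a1: "arith \<rho> N 1 A 1" unfolding arith_def
  proof
    fix n show "bdd (of_nat N ^ (n + 1) * fact n * fps_nth 1 n) (A * fact n * \<rho> ^ n)"
      using N(2) A1 \<rho>1 by (cases n) (auto simp: A_def intro: bdd_0)
  qed
  \<comment> \<open>The first entry covers the ratio per Taylor index, the second the factor (2 A
    N)^2 per unit of L left by powers and denominators.\<close>
  define E where "E = nat \<lceil>max (2 * \<rho>) ((2 * A * real N) ^ 2)\<rceil>"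
  have E: "2 * \<rho> \<le> real E" "(2 * A * real N) ^ 2 \<le> real E" unfolding E_def by linarith+
  have E1: "E \<ge> 1" using E \<rho>1 by linarith
  have "bdd (of_nat N ^ (n + 2 * L) * fact n * fps_nth (UF ^ i * XF ^ j) n) (of_nat (E ^ (n + L) * fact n))"
    if ij: "i < L" "j < L" for L n i j
  proof -
    have "arith (2 * \<rho>) N 1 A 1" using arith_mono[OF a1] \<rho>1 A1 by simp
    from arith_power[OF this aU] have "arith (2 * \<rho>) N (1 + i) ((2 * A) ^ i * A) (1 * UF ^ i)" using \<rho>1 A1 by simp
    from arith_power[OF this aX] have "arith (2 * \<rho>) N (1 + i + j) ((2 * A) ^ j * ((2 * A) ^ i * A)) (1 * UF ^ i * XF ^ j)" using \<rho>1 A1 by simp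
    from arith_raise[OF this, of "2 * L - (1 + i + j)"]
    have a: "arith (2 * \<rho>) N (2 * L) (of_nat N ^ (2 * L - (1 + i + j)) * ((2 * A) ^ j * ((2 * A) ^ i * A))) (UF ^ i * XF ^ j)"
      using ij by simp
    have "of_nat N ^ (2 * L - (1 + i + j)) * ((2 * A) ^ j * ((2 * A) ^ i * A)) \<le> real N ^ (2 * L) * (2 * A) ^ (2 * L)"
    proof (intro mult_mono power_increasing)
      have "(2 * A) ^ j * ((2 * A) ^ i * A) \<le> (2 * A) ^ j * ((2 * A) ^ i * (2 * A))"
        using A1 by (intro mult_left_mono) auto
      also have "\<dots> = (2 * A) ^ (j + i + 1)" by (simp add: power_add)
      also have "\<dots> \<le> (2 * A) ^ (2 * L)" using A1 ij by (intro power_increasing) auto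
      finally show "(2 * A) ^ j * ((2 * A) ^ i * A) \<le> (2 * A) ^ (2 * L)" .
    qed (use A1 N1 in auto)
    also have "\<dots> = ((2 * A * real N) ^ 2) ^ L" by (simp only: power_mult[symmetric] power_mult_distrib mult_ac)
    also have "\<dots> \<le> real E ^ L" using E by (intro power_mono) auto
    finally have "arith (real E) N (2 * L) (real E ^ L) (UF ^ i * XF ^ j)"
      using arith_mono[OF a] E \<rho>1 A1 by simp
    from spec[OF this[unfolded arith_def], of n] show ?thesis by (simp add: power_add mult_ac)
  qed
  then show ?thesis using E1 by blast
qed

text \<open>One vanishing coefficient is d integer equations, so T coefficients give T d equations
  in L^2 = 2 d T unknowns. With twice as many unknowns as equations the Siegel exponent is 1, and
  solutions are bounded by L^2 times the coefficient bound.\<close>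

lemma siegel_vanishing:
  fixes UF XF :: "complex fps"
  assumes mono: "\<And>n i j. i < L \<Longrightarrow> j < L \<Longrightarrow>
     bdd (of_nat N ^ (n + 2 * L) * fact n * fps_nth (UF ^ i * XF ^ j) n) (of_nat (E ^ (n + L) * fact n))"
    and N: "N > 0" and E: "E \<ge> (1::nat)" and L: "L ^ 2 = 2 * d * T" and T: "T > 0"
  shows "\<exists>x :: nat \<Rightarrow> nat \<Rightarrow> int. (\<exists>i<L. \<exists>j<L. x i j \<noteq> 0) \<and>
    (\<forall>i<L. \<forall>j<L. \<bar>x i j\<bar> \<le> int (L ^ 2 * (E ^ (T + L) * fact T))) \<and>
    (\<forall>n<T. fps_nth (\<Sum>i<L. \<Sum>j<L. fps_const (of_int (x i j)) * (UF ^ i * XF ^ j)) n = 0)"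
proof -
  define z where "z n i j = of_nat N ^ (n + 2 * L) * fact n * fps_nth (UF ^ i * XF ^ j) n" for n i j
  have "\<forall>n i j. \<exists>c :: nat \<Rightarrow> int. i < L \<longrightarrow> j < L \<longrightarrow> z n i j = (\<Sum>k<d. of_int (c k) * \<omega> k) \<and>
       (\<forall>k<d. \<bar>real_of_int (c k)\<bar> \<le> of_nat (E ^ (n + L) * fact n))"
  proof (intro allI)
    fix n i j
    show "\<exists>c :: nat \<Rightarrow> int. i < L \<longrightarrow> j < L \<longrightarrow> z n i j = (\<Sum>k<d. of_int (c k) * \<omega> k) \<and>
       (\<forall>k<d. \<bar>real_of_int (c k)\<bar> \<le> of_nat (E ^ (n + L) * fact n))"
    proof (cases "i < L \<and> j < L")
      case True
      then obtain c :: "nat \<Rightarrow> int" where c: "z n i j = (\<Sum>k<d. of_int (c k) * \<omega> k)"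
         "\<forall>k<d. \<kappa> * \<bar>real_of_int (c k)\<bar> \<le> of_nat (E ^ (n + L) * fact n)"
        using mono unfolding bdd_def z_def by blast
      have "\<bar>real_of_int (c k)\<bar> \<le> of_nat (E ^ (n + L) * fact n)" if "k < d" for k
      proof -
        have "1 * \<bar>real_of_int (c k)\<bar> \<le> \<kappa> * \<bar>real_of_int (c k)\<bar>" using \<kappa>_ge1 by (intro mult_right_mono) auto
        then show ?thesis using c(2) that by fastforce
      qed
      then show ?thesis using c(1) by blast
    qed auto
  qed
  then obtain c :: "nat \<Rightarrow> nat \<Rightarrow> nat \<Rightarrow> nat \<Rightarrow> int" where
    c: "\<And>n i j. i < L \<Longrightarrow> j < L \<Longrightarrow> z n i j = (\<Sum>k<d. of_int (c n i j k) * \<omega> k)"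
       "\<And>n i j k. i < L \<Longrightarrow> j < L \<Longrightarrow> k < d \<Longrightarrow> \<bar>real_of_int (c n i j k)\<bar> \<le> of_nat (E ^ (n + L) * fact n)"
    by metis
  define Ix where "Ix = {..<L} \<times> {..<L}"
  define Eq where "Eq = {..<T} \<times> {..<d}"
  define a where "a e u = c (fst e) (fst u) (snd u) (snd e)" for e u
  define B where "B = E ^ (T + L) * fact T"
  define HH where "HH = L ^ 2 * B"
  have cardIx: "card Ix = L ^ 2" by (simp add: Ix_def power2_eq_square)
  have cardEq: "card Eq = T * d" by (simp add: Eq_def)
  have bnd: "\<bar>a e u\<bar> \<le> int B" if "e \<in> Eq" "u \<in> Ix" for e u
  proof -
    have eu: "fst e < T" "snd e < d" "fst u < L" "snd u < L" using that by (auto simp: Eq_def Ix_def)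
    have "\<bar>real_of_int (a e u)\<bar> \<le> of_nat (E ^ (fst e + L) * fact (fst e))" unfolding a_def using c(2) eu by blast
    also have "\<dots> \<le> real B" unfolding B_def using eu E
      by (intro of_nat_mono mult_le_mono power_increasing fact_mono) auto
    finally show ?thesis by linarith
  qed
  have big: "(card Ix * B * HH + 1) ^ card Eq < (HH + 1) ^ card Ix"
  proof -
    have "HH \<ge> 1" unfolding HH_def B_def using L T d_pos E by (simp add: Suc_le_eq)
    then have "HH * HH + 1 < (HH + 1) ^ 2" by (simp add: power2_eq_square)
    then have "(HH * HH + 1) ^ (T * d) < ((HH + 1) ^ 2) ^ (T * d)"
      using T d_pos by (intro power_strict_mono) auto
    moreover have "(card Ix * B * HH + 1) ^ card Eq = (HH * HH + 1) ^ (T * d)" by (simp add: cardIx cardEq HH_def)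
    moreover have "(HH + 1) ^ card Ix = ((HH + 1) ^ 2) ^ (T * d)"
      unfolding cardIx L by (simp only: power_mult[symmetric] mult_ac)
    ultimately show ?thesis by (simp only:)
  qed
  have fin: "finite Eq" "finite Ix" by (auto simp: Eq_def Ix_def)
  have "\<exists>x. (\<exists>u\<in>Ix. x u \<noteq> 0) \<and> (\<forall>u\<in>Ix. \<bar>x u\<bar> \<le> int HH) \<and> (\<forall>e\<in>Eq. (\<Sum>u\<in>Ix. a e u * x u) = 0)"
    by (rule siegel_pigeonhole[OF fin bnd big])
  then obtain x where x: "\<exists>u\<in>Ix. x u \<noteq> 0" "\<forall>u\<in>Ix. \<bar>x u\<bar> \<le> int HH" "\<forall>e\<in>Eq. (\<Sum>u\<in>Ix. a e u * x u) = 0" by blast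
  have "fps_nth (\<Sum>i<L. \<Sum>j<L. fps_const (of_int (x (i, j))) * (UF ^ i * XF ^ j)) n = 0" if n: "n < T" for n
  proof -
    have "of_nat N ^ (n + 2 * L) * fact n * fps_nth (\<Sum>i<L. \<Sum>j<L. fps_const (of_int (x (i, j))) * (UF ^ i * XF ^ j)) n =
       (\<Sum>i<L. \<Sum>j<L. of_int (x (i, j)) * z n i j)"
      by (simp add: fps_sum_nth sum_distrib_left z_def) (simp add: mult_ac)
    also have "\<dots> = (\<Sum>u\<in>Ix. of_int (x u) * z n (fst u) (snd u))"
      unfolding Ix_def by (simp add: sum.cartesian_product case_prod_unfold)
    also have "\<dots> = (\<Sum>u\<in>Ix. \<Sum>k<d. of_int (a (n, k) u * x u) * \<omega> k)"
      by (intro sum.cong refl) (auto simp: c(1) Ix_def a_def sum_distrib_left mult_ac)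
    also have "\<dots> = (\<Sum>k<d. \<Sum>u\<in>Ix. of_int (a (n, k) u * x u) * \<omega> k)" by (rule sum.swap)
    also have "\<dots> = (\<Sum>k<d. of_int (\<Sum>u\<in>Ix. a (n, k) u * x u) * \<omega> k)"
      by (simp only: of_int_sum sum_distrib_right)
    also have "\<dots> = 0" using x(3) n by (intro sum.neutral ballI) (auto simp: Eq_def)
    finally show ?thesis using N by simp
  qed
  moreover have "\<exists>i<L. \<exists>j<L. x (i, j) \<noteq> 0" using x(1) by (auto simp: Ix_def)
  moreover have "\<bar>x (i, j)\<bar> \<le> int (L ^ 2 * (E ^ (T + L) * fact T))" if "i < L" "j < L" for i j
    using x(2) that by (auto simp: Ix_def HH_def B_def)
  ultimately show ?thesis by (intro exI[of _ "\<lambda>i j. x (i, j)"]) auto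
qed

end


section \<open>The auxiliary function and the maximum principle on a strip\<close>

lemma has_fps_expansion_div_power_tendsto:
  fixes h :: "complex \<Rightarrow> complex"
  assumes H: "h has_fps_expansion H" and z: "\<And>i. i < n \<Longrightarrow> fps_nth H i = 0"
  shows "((\<lambda>v. h v / v ^ n) \<longlongrightarrow> fps_nth H n) (at 0)"
proof -
  define G where "G = H - fps_const (fps_nth H n) * fps_X ^ n"
  have "(\<lambda>v. h v - fps_nth H n * v ^ n) has_fps_expansion G"
    unfolding G_def by (intro fps_expansion_intros H)
  then have "((\<lambda>v. (h v - fps_nth H n * v ^ n) / v ^ n) \<longlongrightarrow> 0) (at 0)"
    by (rule has_fps_expansion_div_power_tendsto_0) (use z in \<open>auto simp: G_def fps_X_power_nth le_less\<close>)
  then have "((\<lambda>v. (h v - fps_nth H n * v ^ n) / v ^ n + fps_nth H n) \<longlongrightarrow> 0 + fps_nth H n) (at 0)"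
    by (intro tendsto_intros)
  moreover have "\<forall>\<^sub>F v in at 0. (h v - fps_nth H n * v ^ n) / v ^ n + fps_nth H n = h v / v ^ n"
    by (auto simp: eventually_at_filter field_simps intro: always_eventually)
  ultimately show ?thesis by (auto intro: Lim_transform_eventually)
qed

text \<open>Periodicity replaces a Phragmen-Lindelof argument: the supremum over the infinite strip
  is attained in one compact rectangle. Only the norm is assumed periodic, because the function to
  come picks up a sign.\<close>

lemma strip_maximum:
  fixes f :: "complex \<Rightarrow> complex"
  assumes hol: "f holomorphic_on UNIV" and per: "\<And>v. norm (f (v + 2 * pi * \<i>)) = norm (f v)"
    and r: "r > 0" and B: "\<And>v. \<bar>Re v\<bar> = r \<Longrightarrow> norm (f v) \<le> B" and v: "\<bar>Re v\<bar> \<le> r"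
  shows "norm (f v) \<le> B"
proof -
  define K where "K = cbox (Complex (- r) 0) (Complex r (2 * pi))"
  have cont: "continuous_on A f" for A
    using hol holomorphic_on_imp_continuous_on continuous_on_subset by blast
  have "Complex r 0 \<in> K" using r by (simp add: K_def in_cbox_complex_iff)
  then obtain \<xi> where \<xi>: "\<xi> \<in> K" "\<And>y. y \<in> K \<Longrightarrow> norm (f y) \<le> norm (f \<xi>)"
    using continuous_attains_sup[of K "\<lambda>v. norm (f v)"] cont unfolding K_def
    by (metis compact_cbox continuous_on_norm empty_iff)
  have perk: "norm (f (v + of_int k * (2 * pi * \<i>))) = norm (f v)" for v k
  proof (induction k rule: int_induct[where k = 0])
    case (step1 i) then show ?case using per[of "v + of_int i * (2 * pi * \<i>)"] by (simp add: algebra_simps)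
  next
    case (step2 i) then show ?case using per[of "v + of_int (i - 1) * (2 * pi * \<i>)"] by (simp add: algebra_simps)
  qed simp
  have all: "norm (f y) \<le> norm (f \<xi>)" if y: "\<bar>Re y\<bar> \<le> r" for y
  proof -
    define k where "k = \<lfloor>Im y / (2 * pi)\<rfloor>"
    define w where "w = y - of_int k * (2 * pi * \<i>)"
    have "of_int k \<le> Im y / (2 * pi)" "Im y / (2 * pi) < of_int k + 1" unfolding k_def by linarith+
    then have "0 \<le> Im w" "Im w \<le> 2 * pi" by (auto simp: w_def field_simps)
    then have "w \<in> K" using y by (simp add: K_def in_cbox_complex_iff w_def abs_le_iff)
    moreover have "norm (f y) = norm (f w)" using perk[of w k] by (simp add: w_def)
    ultimately show ?thesis using \<xi>(2) by simp
  qed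
  have "norm (f \<xi>) \<le> B"
  proof (cases "\<bar>Re \<xi>\<bar> = r")
    case True then show ?thesis by (rule B)
  next
    case False
    have "\<bar>Re \<xi>\<bar> < r" 
    proof -
      have "- r \<le> Re \<xi>" "Re \<xi> \<le> r" using \<xi>(1) by (auto simp: K_def in_cbox_complex_iff)
      then show ?thesis using False by linarith
    qed
    define S where "S = {z. Re z < r} \<inter> {z. Re z > - r}"
    have S: "open S" "connected S" "\<xi> \<in> S" unfolding S_def using \<open>\<bar>Re \<xi>\<bar> < r\<close>
      by (auto intro!: open_Int open_halfspace_Re_lt open_halfspace_Re_gt convex_connected convex_Int convex_halfspace_Re_lt convex_halfspace_Re_gt)
    have "f constant_on S"
    proof (rule maximum_modulus_principle[OF _ S(1,2,1) order_refl S(3)])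
      show "f holomorphic_on S" using hol by (rule holomorphic_on_subset) simp
      show "norm (f z) \<le> norm (f \<xi>)" if "z \<in> S" for z using all[of z] that by (auto simp: S_def)
    qed
    then obtain c where c: "\<And>z. z \<in> S \<Longrightarrow> f z = c" by (auto simp: constant_on_def)
    \<comment> \<open>An interior maximum makes f constant on the open strip; continuity carries the
      value to the edge point r, where the bound applies.\<close>
    have "((\<lambda>e. f (of_real e)) \<longlongrightarrow> f (of_real r)) (at_left r)"
    proof (rule isCont_tendsto_compose[of _ f])
      show "isCont f (of_real r)" using cont[of UNIV] by (simp add: continuous_on_eq_continuous_at)
    qed (intro tendsto_intros)
    moreover have "\<forall>\<^sub>F e in at_left r. f (of_real e) = c"
    proof -
      have "\<forall>\<^sub>F e in at_left r. e \<in> {- r<..<r}" using r by (intro eventually_at_left_real) auto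
      then show ?thesis by eventually_elim (auto intro!: c simp: S_def)
    qed
    ultimately have "((\<lambda>_. c) \<longlongrightarrow> f (of_real r)) (at_left r)" by (rule Lim_transform_eventually)
    then have "f (of_real r) = c" by (simp add: tendsto_const_iff)
    then have "f \<xi> = f (of_real r)" using c S(3) by simp
    then show ?thesis using B[of "of_real r"] r by simp
  qed
  then show ?thesis using all[OF v] by linarith
qed

context nome
begin

definition w0 :: complex where "w0 = of_real pi * \<i>"

lemma w0_notin: "w0 \<notin> \<Lambda>" using pi_i_notin_\<Lambda> by (simp add: w0_def)
lemma exp_w0: "exp w0 = -1" by (simp add: w0_def)

lemma deriv_entire_period:
  assumes f: "f holomorphic_on UNIV" and p: "\<And>v. f (v + c) = f (v :: complex)"
  shows "deriv f (v + c) = deriv f v"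
proof -
  have "(f has_field_derivative deriv f (v + c)) (at (v + c))" by (rule holomorphic_derivI[OF f open_UNIV]) simp
  then have "((\<lambda>v. f (v + c)) has_field_derivative deriv f (v + c)) (at v)" by (simp add: DERIV_shift)
  then show ?thesis unfolding p by (simp add: DERIV_imp_deriv)
qed

lemma HZ_period: "HZ (v + 2 * pi * \<i>) = HZ v" and HW_period: "HW (v + 2 * pi * \<i>) = HW v"
proof -
  have 1: "deriv H (v + 2 * pi * \<i>) = deriv H v" for v by (rule deriv_entire_period[OF H_holo H_period])
  have 2: "deriv (deriv H) (v + 2 * pi * \<i>) = deriv (deriv H) v" for v
    by (rule deriv_entire_period[OF entire_deriv[OF H_holo] 1])
  show "HZ (v + 2 * pi * \<i>) = HZ v" unfolding HZ_def by (simp only: 1 H_period)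
  show "HW (v + 2 * pi * \<i>) = HW v" unfolding HW_def by (simp only: 1 2 H_period)
qed

text \<open>The auxiliary function, multiplied by a power of \<open>H\<close> clearing all poles.\<close>

definition Phi :: "complex \<Rightarrow> nat \<Rightarrow> (nat \<Rightarrow> nat \<Rightarrow> int) \<Rightarrow> complex \<Rightarrow> complex" where
  "Phi l L x v = (\<Sum>i<L. \<Sum>j<L. of_int (x i j) * ((HZ v / l) ^ i * (HW v / l ^ 2) ^ j * H v ^ (3 * L - i - 2 * j)))"

lemma Phi_holo: "l \<noteq> 0 \<Longrightarrow> Phi l L x holomorphic_on A"
  unfolding Phi_def[abs_def] by (intro holomorphic_intros HZ_holo HW_holo H_holo) auto

lemma Phi_period: "Phi l L x (v + 2 * pi * \<i>) = Phi l L x v"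
  unfolding Phi_def by (simp only: HZ_period HW_period H_period)

lemma Phi_eq:
  assumes "v \<notin> \<Lambda>"
  shows "Phi l L x v = H v ^ (3 * L) * (\<Sum>i<L. \<Sum>j<L. of_int (x i j) * ((Z v / l) ^ i * (wp v / l ^ 2) ^ j))"
  unfolding Phi_def sum_distrib_left
proof (intro sum.cong refl)
  fix i j assume "i \<in> {..<L}" "j \<in> {..<L}"
  \<comment> \<open>Since i, j < L, the truncated subtraction in the exponent is genuine.\<close>
  then have "3 * L = i + 2 * j + (3 * L - i - 2 * j)" by auto
  then have e: "H v ^ (3 * L) = H v ^ i * (H v ^ 2) ^ j * H v ^ (3 * L - i - 2 * j)"
    by (metis power_add power_mult)
  show "of_int (x i j) * ((HZ v / l) ^ i * (HW v / l ^ 2) ^ j * H v ^ (3 * L - i - 2 * j)) =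
     H v ^ (3 * L) * (of_int (x i j) * ((Z v / l) ^ i * (wp v / l ^ 2) ^ j))"
    unfolding e HZ_eq[OF assms] HW_eq[OF assms] by (simp add: power_mult_distrib power_divide mult_ac)
qed

lemma wp_unbounded: "\<nexists>K. \<forall>v. v \<notin> \<Lambda> \<longrightarrow> norm (wp v) \<le> K"
proof
  assume "\<exists>K. \<forall>v. v \<notin> \<Lambda> \<longrightarrow> norm (wp v) \<le> K"
  then obtain K where K: "\<And>v. v \<notin> \<Lambda> \<Longrightarrow> norm (wp v) \<le> K" by blast
  have "isCont A1 0" by (rule has_fps_expansion_imp_continuous[OF expansions(1)])
  then have "(A1 \<longlongrightarrow> A1 0) (at 0)" by (simp add: isCont_def)
  then have "((\<lambda>v. 1 + v^2 * (eis 2 q - A1 v)) \<longlongrightarrow> 1 + 0^2 * (eis 2 q - A1 0)) (at 0)" by (intro tendsto_intros)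
  moreover have "\<forall>\<^sub>F v in at 0. 1 + v^2 * (eis 2 q - A1 v) = v^2 * wp v"
  proof -
    have "\<forall>\<^sub>F v in at 0. v \<noteq> (0::complex)" by (simp add: eventually_at_filter)
    with laurent show ?thesis by eventually_elim (simp add: wp_def field_simps)
  qed
  ultimately have "((\<lambda>v. v^2 * wp v) \<longlongrightarrow> 1) (at 0)" by (auto intro: Lim_transform_eventually)
  moreover have "((\<lambda>v. v^2 * wp v) \<longlongrightarrow> 0) (at 0)"
  proof (rule Lim_null_comparison)
    show "\<forall>\<^sub>F v in at 0. norm (v^2 * wp v) \<le> norm v ^ 2 * K"
      using laurent by eventually_elim (auto simp: norm_mult norm_power intro!: mult_left_mono K)
    have "((\<lambda>v::complex. norm v ^ 2 * K) \<longlongrightarrow> norm (0::complex) ^ 2 * K) (at 0)" by (intro tendsto_intros)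
    then show "((\<lambda>v::complex. norm v ^ 2 * K) \<longlongrightarrow> 0) (at 0)" by simp
  qed
  ultimately show False using LIM_unique by fastforce
qed

lemma poly_sum_monom: "poly (\<Sum>j<L. monom (c j) j) x = (\<Sum>j<L. c j * x ^ j)" for x :: complex
  by (simp add: poly_sum poly_monom)

lemma coeff_sum_monom: "j < L \<Longrightarrow> coeff (\<Sum>j<L. monom (c j) j) j = (c j :: complex)"
  by (simp add: coeff_sum)

text \<open>Algebraic independence of \<open>Z\<close> and \<open>wp\<close>. Steps by t lower
  \<open>Z\<close> by 1 and fix \<open>wp\<close>, so a relation, read as a polynomial in
  \<open>Z\<close>, has infinitely many roots and all its coefficients vanish. Each coefficient is a
  polynomial in \<open>wp\<close>; if non-zero, it would leave \<open>wp\<close> finitely many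
  values, against its pole.\<close>

lemma Phi_nonzero:
  assumes l: "l \<noteq> 0" and nz: "i < L" "j < L" "x i j \<noteq> 0"
  shows "\<not> (\<forall>\<^sub>F v in nhds w0. Phi l L x v = 0)"
proof
  assume "\<forall>\<^sub>F v in nhds w0. Phi l L x v = 0"
  then obtain S where S: "open S" "w0 \<in> S" "\<And>v. v \<in> S \<Longrightarrow> Phi l L x v = 0" by (auto simp: eventually_nhds)
  have P0: "Phi l L x v = 0" for v
    by (rule analytic_continuation_open[of S UNIV _ "\<lambda>_. 0"]) (use S l in \<open>auto intro!: Phi_holo\<close>)
  define c where "c i v = (\<Sum>j<L. of_int (x i j) * (wp v / l ^ 2) ^ j)" for i v
  have eq0: "(\<Sum>i<L. c i v * (Z v / l) ^ i) = 0" if "v \<notin> \<Lambda>" for v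
  proof -
    have "(\<Sum>i<L. \<Sum>j<L. of_int (x i j) * ((Z v / l) ^ i * (wp v / l ^ 2) ^ j)) = 0"
      using P0[of v] Phi_eq[OF that] H_nonzero[OF that] by simp
    then show ?thesis unfolding c_def sum_distrib_right by (simp add: mult_ac)
  qed
  have ci: "c i v = 0" if v: "v \<notin> \<Lambda>" for v
  proof -
    have sh: "v + of_nat m * t \<notin> \<Lambda> \<and> Z (v + of_nat m * t) = Z v - of_nat m \<and> wp (v + of_nat m * t) = wp v" for m
    proof (induction m)
      case (Suc m)
      have e: "v + of_nat (Suc m) * t = (v + of_nat m * t) + t" by (simp add: algebra_simps)
      show ?case unfolding e using Suc \<Lambda>_add_iff[OF t_in_\<Lambda>] Z_period_t Z1_period_t by (auto simp: wp_def)
    qed (use v in simp)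
    define p where "p = (\<Sum>i<L. monom (c i v) i)"
    have root: "poly p ((Z v - of_nat m) / l) = 0" for m
    proof -
      have "c i (v + of_nat m * t) = c i v" for i using sh by (simp add: c_def)
      then show ?thesis using eq0[of "v + of_nat m * t"] sh unfolding p_def poly_sum_monom by simp
    qed
    have "p = 0"
    proof (rule ccontr)
      assume "p \<noteq> 0"
      then have "finite {y. poly p y = 0}" by (rule poly_roots_finite)
      moreover have "range (\<lambda>m. (Z v - of_nat m) / l) \<subseteq> {y. poly p y = 0}" using root by auto
      ultimately have "finite (range (\<lambda>m::nat. (Z v - of_nat m) / l))" using finite_subset by blast
      moreover have "inj (\<lambda>m::nat. (Z v - of_nat m) / l)" using l by (auto simp: inj_on_def)
      ultimately show False using finite_imageD by fastforce
    qed
    then show ?thesis using coeff_sum_monom[OF nz(1), of "\<lambda>i. c i v"] by (simp add: p_def)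
  qed
  define p where "p = (\<Sum>j<L. monom (of_int (x i j)) j :: complex poly)"
  have "p \<noteq> 0" using coeff_sum_monom[OF nz(2), of "\<lambda>j. of_int (x i j)"] nz(3) unfolding p_def by (metis coeff_0 of_int_eq_0_iff)
  then have fin: "finite {y. poly p y = 0}" by (rule poly_roots_finite)
  define K where "K = Max (norm ` {y. poly p y = 0})"
  have "norm (wp v) \<le> K * norm (l ^ 2)" if v: "v \<notin> \<Lambda>" for v
  proof -
    have "poly p (wp v / l ^ 2) = 0" using ci[OF v] unfolding p_def poly_sum_monom c_def .
    then have "norm (wp v / l ^ 2) \<le> K" unfolding K_def using fin by (intro Max_ge) auto
    then show ?thesis using l by (simp add: norm_divide field_simps)
  qed
  then show False using wp_unbounded by blast
qed

lemma Phi_bound: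
  assumes l: "l \<noteq> 0"
  shows "\<exists>C\<ge>1. \<forall>L x A r v. r \<ge> 1 \<longrightarrow> \<bar>Re v\<bar> = r \<longrightarrow> A \<ge> 0 \<longrightarrow> (\<forall>i<L. \<forall>j<L. \<bar>of_int (x i j)\<bar> \<le> A) \<longrightarrow>
     norm (Phi l L x v) \<le> of_nat L ^ 2 * A * exp (C * of_nat L * r ^ 2)"
proof -
  have "quadratic_growth (\<lambda>v. HZ v * (1 / l))" "quadratic_growth (\<lambda>v. HW v * (1 / l ^ 2))"
    by (intro quadratic_growth_mult growths quadratic_growth_const)+
  then obtain C1 C2 C3 where C: "C1 > 0" "\<And>v. norm (H v) \<le> exp (C1 * (1 + \<bar>Re v\<bar>) ^ 2)"
     "C2 > 0" "\<And>v. norm (HZ v * (1 / l)) \<le> exp (C2 * (1 + \<bar>Re v\<bar>) ^ 2)"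
     "C3 > 0" "\<And>v. norm (HW v * (1 / l ^ 2)) \<le> exp (C3 * (1 + \<bar>Re v\<bar>) ^ 2)"
    using growths(1) unfolding quadratic_growth_def by metis
  define C0 where "C0 = C1 + C2 + C3"
  \<comment> \<open>12 = 3 * 4: the exponent of the growth factor is 3 L, and (1 + r)^2 <= 4 r^2 for
    r >= 1.\<close>
  define C where "C = 1 + 12 * C0"
  have "norm (Phi l L x v) \<le> of_nat L ^ 2 * A * exp (C * of_nat L * r ^ 2)"
    if r: "r \<ge> 1" "\<bar>Re v\<bar> = r" and A: "A \<ge> 0" "\<forall>i<L. \<forall>j<L. \<bar>of_int (x i j)\<bar> \<le> A" for L x A r v
  proof -
    define s where "s = (1 + r) ^ 2"
    define G where "G = exp (C0 * s)"
    have s0: "s \<ge> 0" by (simp add: s_def)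
    have G1: "G \<ge> 1" using C s0 by (simp add: G_def C0_def)
    have le: "norm (H v) \<le> G" "norm (HZ v / l) \<le> G" "norm (HW v / l ^ 2) \<le> G"
    proof -
      have "exp (C1 * s) \<le> G" "exp (C2 * s) \<le> G" "exp (C3 * s) \<le> G"
        using C s0 by (auto simp: G_def C0_def intro!: mult_right_mono)
      then show "norm (H v) \<le> G" "norm (HZ v / l) \<le> G" "norm (HW v / l ^ 2) \<le> G"
        using C(2)[of v] C(4)[of v] C(6)[of v] r by (auto simp: s_def)
    qed
    have "norm (Phi l L x v) \<le> (\<Sum>i<L. \<Sum>j<L. norm (of_int (x i j) * ((HZ v / l) ^ i * (HW v / l ^ 2) ^ j * H v ^ (3 * L - i - 2 * j))))"
      unfolding Phi_def by (rule order_trans[OF norm_sum]) (intro sum_mono norm_sum)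
    also have "\<dots> \<le> (\<Sum>i<L. \<Sum>j<L. A * G ^ (3 * L))"
    proof (intro sum_mono)
      fix i j assume ij: "i \<in> {..<L}" "j \<in> {..<L}"
      have "norm ((HZ v / l) ^ i * (HW v / l ^ 2) ^ j * H v ^ (3 * L - i - 2 * j)) \<le> G ^ i * G ^ j * G ^ (3 * L - i - 2 * j)"
        unfolding norm_mult norm_power using le G1 by (intro mult_mono power_mono) auto
      also have "\<dots> = G ^ (i + j + (3 * L - i - 2 * j))" by (simp add: power_add)
      also have "\<dots> \<le> G ^ (3 * L)" using G1 ij by (intro power_increasing) auto
      finally show "norm (of_int (x i j) * ((HZ v / l) ^ i * (HW v / l ^ 2) ^ j * H v ^ (3 * L - i - 2 * j))) \<le> A * G ^ (3 * L)"
        using A ij by (subst norm_mult, intro mult_mono) auto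
    qed
    also have "\<dots> = of_nat L ^ 2 * A * G ^ (3 * L)" by (simp add: power2_eq_square)
    also have "G ^ (3 * L) = exp (3 * of_nat L * (C0 * s))" unfolding G_def by (simp add: exp_of_nat_mult[symmetric])
    also have "\<dots> \<le> exp (C * of_nat L * r ^ 2)"
    proof -
      have "s \<le> (2 * r) ^ 2" unfolding s_def using r by (intro power_mono) auto
      then have "C0 * s \<le> C0 * (4 * r ^ 2)" using C by (intro mult_left_mono) (auto simp: C0_def power_mult_distrib)
      then have "3 * of_nat L * (C0 * s) \<le> 3 * of_nat L * (C0 * (4 * r ^ 2))" by (rule mult_left_mono) simp
      also have "\<dots> \<le> C * of_nat L * r ^ 2" unfolding C_def by (simp add: algebra_simps)
      finally show ?thesis by simp
    qed
    finally show ?thesis using A by (simp add: mult_left_mono)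
  qed
  moreover have "C \<ge> 1" using C by (simp add: C_def C0_def)
  ultimately show ?thesis by blast
qed

text \<open>By periodicity the zero of order n at \<open>w0\<close> recurs at every zero of 1 + exp
  v, so dividing by (1 + exp v)^n leaves an entire function. Its value at \<open>w0\<close> is the
  n-th coefficient up to explicit factors, and the maximum principle bounds it from the edges of the
  strip.\<close>

lemma vanishing_bound:
  fixes F :: "complex fps"
  assumes l: "l \<noteq> 0" and FF: "(\<lambda>s. \<Sum>i<L. \<Sum>j<L. of_int (x i j) * ((Z (w0 + s / l) / l) ^ i * (wp (w0 + s / l) / l ^ 2) ^ j)) has_fps_expansion F"
    and van: "\<And>m. m < n \<Longrightarrow> fps_nth F m = 0" and r: "r \<ge> 1"
    and B: "\<And>v. \<bar>Re v\<bar> = r \<Longrightarrow> norm (Phi l L x v) \<le> B"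
  shows "norm (H w0) ^ (3 * L) * norm (fps_nth F n) * norm l ^ n \<le> B / (exp (r / 2) - exp (- r / 2)) ^ n"
proof -
  \<comment> \<open>The limit at \<open>w0\<close>: with s = l (v - w0) one has 1 + exp v = 1 - exp
    (s / l), which behaves like - s / l.\<close>
  define c where "c = H w0 ^ (3 * L) * fps_nth F n * (- l) ^ n"
  define \<Psi> where "\<Psi> v = (if exp v = -1 then c else Phi l L x v / (1 + exp v) ^ n)" for v
  define D where "D = {v::complex. exp v \<noteq> -1}"
  have opD: "open D" unfolding D_def
    by (intro open_Collect_neq continuous_intros)
  have holD: "\<Psi> holomorphic_on D"
  proof (rule holomorphic_transform)
    show "(\<lambda>v. Phi l L x v / (1 + exp v) ^ n) holomorphic_on D"
      by (intro holomorphic_intros Phi_holo l) (auto simp: D_def add_eq_0_iff)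
  qed (simp add: \<Psi>_def D_def)
  have iso: "v = w0" if "exp v = -1" "dist w0 v < 1" for v
  proof -
    have "exp (v - w0) = 1" using that by (simp add: exp_diff exp_w0)
    then obtain k :: int where k: "Re (v - w0) = 0" "Im (v - w0) = of_int (2 * k) * pi"
      by (auto simp: exp_eq_1)
    have "\<bar>Im (v - w0)\<bar> < 1" using that(2) abs_Im_le_cmod[of "v - w0"] by (simp add: dist_norm norm_minus_commute)
    then have "\<bar>of_int (2 * k) * pi\<bar> < 1" using k(2) by simp
    then have "\<bar>of_int (2 * k)\<bar> * pi < 1" by (simp add: abs_mult)
    then have "\<bar>of_int (2 * k)\<bar> * pi < 1 * pi" using pi_gt3 by linarith
    then have "\<bar>real_of_int (2 * k)\<bar> < 1" by (simp only: mult_less_cancel_right_pos pi_gt_zero)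
    then have "k = 0" by linarith
    then show ?thesis using k by (simp add: complex_eq_iff)
  qed
  have lim: "(\<Psi> \<longlongrightarrow> c) (at w0)"
  proof -
    \<comment> \<open>The quotient in the variable s, grouped into three factors that each have a
      limit: the theta factor, the Taylor quotient and the inverse of (1 + exp v) / s.\<close>
    define g where "g s = H (w0 + s / l) ^ (3 * L) *
       ((\<Sum>i<L. \<Sum>j<L. of_int (x i j) * ((Z (w0 + s / l) / l) ^ i * (wp (w0 + s / l) / l ^ 2) ^ j)) / s ^ n) * (s / (1 - exp (s / l))) ^ n" for s
    have "((\<lambda>s. (1 - exp (s / l)) / s) \<longlongrightarrow> - (1 / l)) (at 0)"
    proof -
      have "((\<lambda>s. 1 - exp (s / l)) has_field_derivative - (1 / l)) (at 0)"
        using l by (auto intro!: derivative_eq_intros)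
      then show ?thesis by (simp add: has_field_derivative_iff)
    qed
    then have "((\<lambda>s. 1 / ((1 - exp (s / l)) / s)) \<longlongrightarrow> 1 / (- (1 / l))) (at 0)"
      using l by (intro tendsto_intros) auto
    then have l1: "((\<lambda>s. s / (1 - exp (s / l))) \<longlongrightarrow> - l) (at 0)" using l by simp
    have "isCont H w0" using holomorphic_on_imp_continuous_on[OF H_holo[of UNIV]] by (simp add: continuous_on_eq_continuous_at)
    moreover have "((\<lambda>s. w0 + s / l) \<longlongrightarrow> w0 + 0 / l) (at 0)" using l by (intro tendsto_intros) auto
    ultimately have l2: "((\<lambda>s. H (w0 + s / l)) \<longlongrightarrow> H w0) (at 0)" using isCont_tendsto_compose by fastforce
    have "(g \<longlongrightarrow> H w0 ^ (3 * L) * fps_nth F n * (- l) ^ n) (at 0)"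
      unfolding g_def by (intro tendsto_intros l1 l2 has_fps_expansion_div_power_tendsto FF van)
    then have g: "(g \<longlongrightarrow> c) (at 0)" by (simp add: c_def)
    have "filterlim (\<lambda>v. l * (v - w0)) (at 0) (at w0)"
    proof (subst filterlim_at, intro conjI)
      have "((\<lambda>v. l * (v - w0)) \<longlongrightarrow> l * (w0 - w0)) (at w0)" by (intro tendsto_intros)
      then show "((\<lambda>v. l * (v - w0)) \<longlongrightarrow> 0) (at w0)" by simp
      show "\<forall>\<^sub>F v in at w0. l * (v - w0) \<in> UNIV \<and> l * (v - w0) \<noteq> 0" using l by (auto simp: eventually_at_filter)
    qed
    then have "((\<lambda>v. g (l * (v - w0))) \<longlongrightarrow> c) (at w0)" using g by (rule filterlim_compose[rotated])
    moreover have "\<forall>\<^sub>F v in at w0. g (l * (v - w0)) = \<Psi> v"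
    proof -
      have "\<forall>\<^sub>F v in at w0. v \<in> ball w0 1 \<inter> - \<Lambda>"
        using w0_notin by (intro eventually_at_in_open' open_Int open_compl_\<Lambda>) auto
      moreover have "\<forall>\<^sub>F v in at w0. v \<noteq> w0" by (simp add: eventually_at_filter)
      ultimately show ?thesis
      proof eventually_elim
        case (elim v)
        have e: "w0 + l * (v - w0) / l = v" "l * (v - w0) / l = v - w0" using l by simp_all
        have ev: "exp v \<noteq> -1" using iso[of v] elim by auto
        have "exp (v - w0) = - exp v" by (simp add: exp_diff exp_w0)
        then have "g (l * (v - w0)) = H v ^ (3 * L) * (\<Sum>i<L. \<Sum>j<L. of_int (x i j) * ((Z v / l) ^ i * (wp v / l ^ 2) ^ j)) *
            (1 / (l * (v - w0)) ^ n * (l * (v - w0) / (1 + exp v)) ^ n)"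
          unfolding g_def e by simp
        also have "1 / (l * (v - w0)) ^ n * (l * (v - w0) / (1 + exp v)) ^ n = 1 / (1 + exp v) ^ n"
          using l elim by (simp add: power_divide)
        finally have "g (l * (v - w0)) = Phi l L x v * (1 / (1 + exp v) ^ n)" using Phi_eq[of v l L x] elim by simp
        then show ?case using ev by (simp add: \<Psi>_def)
      qed
    qed
    ultimately show ?thesis by (rule Lim_transform_eventually)
  qed
  have \<Psi>w0: "\<Psi> w0 = c" by (simp add: \<Psi>_def exp_w0)
  have hol0: "\<Psi> holomorphic_on ball w0 1"
  proof (rule no_isolated_singularity'[where K = "{w0}"])
    show "(\<Psi> \<longlongrightarrow> \<Psi> z) (at z within ball w0 1)" if "z \<in> {w0}" for z
      using lim that \<Psi>w0 by (auto intro: tendsto_within_subset)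
    show "\<Psi> holomorphic_on ball w0 1 - {w0}"
      using holD by (rule holomorphic_on_subset) (use iso in \<open>auto simp: D_def\<close>)
  qed auto
  have per: "\<Psi> (v + 2 * pi * \<i>) = \<Psi> v" for v
    using Phi_period[of l L x v] exp_2pi[of 1 v] by (simp add: \<Psi>_def)
  have hol: "\<Psi> holomorphic_on UNIV"
  proof (subst holomorphic_on_open)
    show "\<forall>v\<in>UNIV. \<exists>f'. (\<Psi> has_field_derivative f') (at v)"
    proof
      fix v
      show "\<exists>f'. (\<Psi> has_field_derivative f') (at v)"
      proof (cases "exp v = -1")
        case False
        then show ?thesis using holD opD by (auto simp: holomorphic_on_open D_def)
      next
        case True
        then have "exp v = exp w0" by (simp add: exp_w0)
        then obtain k :: int where k: "v = w0 + of_int (2 * k) * of_real pi * \<i>" by (auto simp: exp_eq)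
        obtain f' where f': "(\<Psi> has_field_derivative f') (at w0)"
          using hol0 unfolding holomorphic_on_open[OF open_ball] by (metis centre_in_ball zero_less_one)
        have "((\<lambda>x. \<Psi> (x + (w0 - v))) has_field_derivative f') (at v)"
          by (rule iffD1[OF DERIV_shift]) (use f' in simp)
        moreover have "\<Psi> (x + (w0 - v)) = \<Psi> x" for x
          using periodic_int[of \<Psi> "2 * pi * \<i>" "x + (w0 - v)" k, OF per] by (simp add: k algebra_simps)
        ultimately show ?thesis by auto
      qed
    qed
  qed auto
  \<comment> \<open>(1 + exp v)^n equals exp (n v / 2) times (exp (v / 2) + exp (- v / 2))^n. The
    compensating exponential makes the two edges symmetric and has norm 1 at \<open>w0\<close>; for
    odd n it changes sign under the period.\<close>
  define f where "f v = \<Psi> v * exp (of_nat n * (v / 2))" for v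
  have fhol: "f holomorphic_on UNIV" unfolding f_def[abs_def] by (intro holomorphic_intros hol) auto
  have fper: "norm (f (v + 2 * pi * \<i>)) = norm (f v)" for v
  proof -
    have "Re (of_nat n * ((v + 2 * pi * \<i>) / 2)) = Re (of_nat n * (v / 2))" by simp
    then show ?thesis unfolding f_def norm_mult per norm_exp_eq_Re by (simp only:)
  qed
  define dl where "dl = exp (r / 2) - exp (- r / 2)"
  have dl: "dl > 0" using r by (simp add: dl_def)
  have fb: "norm (f v) \<le> B / dl ^ n" if v: "\<bar>Re v\<bar> = r" for v
  proof -
    have ne: "exp v \<noteq> -1"
    proof
      assume "exp v = -1"
      then have "norm (exp v) = 1" by simp
      then show False using v r by simp
    qed
    have "norm (exp (- v / 2) + exp (v / 2)) \<ge> dl"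
    proof -
      have a: "norm (exp (v / 2)) = exp (Re v / 2)" "norm (exp (- v / 2)) = exp (- Re v / 2)" by simp_all
      consider "Re v = r" | "Re v = - r" using v by linarith
      then show ?thesis
      proof cases
        case 1
        then show ?thesis using norm_diff_ineq[of "exp (v / 2)" "exp (- v / 2)"] unfolding a dl_def by (simp add: add.commute)
      next
        case 2
        then show ?thesis using norm_diff_ineq[of "exp (- v / 2)" "exp (v / 2)"] unfolding a dl_def by simp
      qed
    qed
    then have "dl ^ n \<le> norm (exp (- v / 2) + exp (v / 2)) ^ n" using dl by (intro power_mono) auto
    moreover have "f v = Phi l L x v / (exp (- v / 2) + exp (v / 2)) ^ n"
    proof -
      have "1 + exp v = exp (v / 2) * (exp (- v / 2) + exp (v / 2))"
        by (simp add: distrib_left exp_add[symmetric])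
      then have "(1 + exp v) ^ n = exp (of_nat n * (v / 2)) * (exp (- v / 2) + exp (v / 2)) ^ n"
        by (simp only: power_mult_distrib exp_of_nat_mult)
      then show ?thesis using ne by (simp add: f_def \<Psi>_def)
    qed
    ultimately have "norm (f v) \<le> norm (Phi l L x v) / dl ^ n"
      using dl by (auto simp: norm_divide norm_power intro!: frac_le)
    also have "\<dots> \<le> B / dl ^ n" using B[OF v] dl by (simp add: divide_right_mono)
    finally show ?thesis .
  qed
  have "norm (f w0) \<le> B / dl ^ n" by (rule strip_maximum[OF fhol fper _ fb]) (use r in \<open>auto simp: w0_def\<close>)
  moreover have "norm (f w0) = norm c"
  proof -
    have "norm (exp (of_nat n * (w0 / 2))) = 1" by (simp add: w0_def)
    then show ?thesis by (simp add: f_def \<Psi>w0 norm_mult)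
  qed
  ultimately show ?thesis by (simp add: c_def dl_def norm_mult norm_power)
qed

end


subsection \<open>Schneider's method\<close>

lemma has_fps_expansion_power:
  fixes f :: "complex \<Rightarrow> complex"
  assumes "f has_fps_expansion F" shows "(\<lambda>x. f x ^ n) has_fps_expansion F ^ n"
  by (induction n) (auto intro!: fps_expansion_intros assms)

lemma has_fps_expansion_deriv_eq:
  fixes f f' :: "complex \<Rightarrow> complex"
  assumes F: "f has_fps_expansion F" and S: "open S" "0 \<in> S"
    and d: "\<And>s. s \<in> S \<Longrightarrow> (f has_field_derivative f' s) (at s)"
  shows "f' has_fps_expansion fps_deriv F"
proof -
  have "deriv f has_fps_expansion fps_deriv F" using F by (rule has_fps_expansion_deriv)
  moreover have "\<forall>\<^sub>F s in nhds 0. s \<in> S" using S by (intro eventually_nhds_in_open)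
  then have "\<forall>\<^sub>F s in nhds 0. deriv f s = f' s" by eventually_elim (use d DERIV_imp_deriv in blast)
  ultimately show ?thesis unfolding has_fps_expansion_def
    by (auto elim: eventually_elim2)
qed

text \<open>Below, \<open>w = n ln n\<close> and all arithmetic quantities are at most \<open>exp (K w)\<close>.\<close>

lemma exp_bound_mult: "0 \<le> x \<Longrightarrow> 0 \<le> y \<Longrightarrow> x \<le> exp (a * w) \<Longrightarrow> y \<le> exp (b * w) \<Longrightarrow> x * y \<le> exp ((a + b) * w)"
  for x y a b w :: real
  unfolding distrib_right exp_add by (intro mult_mono) auto

lemma exp_bound_power:
  fixes c w :: real assumes "c \<ge> 0" "real k \<le> b * w"
  shows "c ^ k \<le> exp (c * b * w)"
proof -
  have "c ^ k \<le> exp c ^ k" using assms exp_ge_add_one_self[of c] by (intro power_mono) linarith+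
  also have "\<dots> = exp (real k * c)" by (simp add: exp_of_nat_mult)
  also have "\<dots> \<le> exp (c * b * w)" using mult_right_mono[OF assms(2,1)] by (simp add: mult_ac)
  finally show ?thesis .
qed

text \<open>In terms of y = n^(1/8), with r = y^2 and ln n = 8 ln y <= 8 y, the inequality reduces
  to y^2 / 4 <= 8 K y, that is n <= (32 K)^8. The bound n >= 256 gives r >= 4, so that exp (r / 2) -
  exp (- r / 2) is at least exp (r / 4).\<close>

lemma growth_contradiction:
  fixes K :: real and n :: nat
  assumes n: "real n \<ge> (32 * K) ^ 8 + 1" "n \<ge> 256" and K: "K \<ge> 1"
    and le: "(exp ((real n powr (1/4)) / 2) - exp (- (real n powr (1/4)) / 2)) ^ n \<le> exp (K * (real n * ln (real n)))"
  shows False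
proof -
  define y where "y = real n powr (1/8)"
  define r where "r = real n powr (1/4)"
  have n0: "real n > 0" using n(2) by simp
  have y0: "y > 0" unfolding y_def using n0 by simp
  have ry: "r = y ^ 2" unfolding r_def y_def by (simp add: power2_eq_square flip: powr_add)
  have y8: "y ^ 8 = real n" unfolding y_def using n0 by (simp add: powr_power)
  have "y \<ge> 2"
  proof (rule ccontr)
    assume "\<not> y \<ge> 2"
    then have "y ^ 8 < 2 ^ 8" using y0 by (intro power_strict_mono) auto
    then show False using y8 n(2) by simp
  qed
  then have r4: "r \<ge> 4" unfolding ry using power_mono[of 2 y 2] by simp
  define z where "z = exp (r / 4)"
  have z: "z \<ge> 2" unfolding z_def using r4 exp_ge_add_one_self[of "r / 4"] by linarith
  have "exp (r / 2) = z ^ 2" unfolding z_def by (simp add: exp_of_nat_mult[symmetric])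
  moreover have "exp (- r / 2) \<le> 1" using r4 by simp
  moreover have "z ^ 2 - 1 \<ge> z"
  proof -
    have "(z - 2) * (z + 1) \<ge> 0" using z by simp
    then show ?thesis by (simp add: power2_eq_square algebra_simps)
  qed
  ultimately have "z \<le> exp (r / 2) - exp (- r / 2)" by linarith
  then have "z ^ n \<le> (exp (r / 2) - exp (- r / 2)) ^ n" using z by (intro power_mono) auto
  also have "\<dots> \<le> exp (K * (real n * ln (real n)))" using le by (simp add: r_def)
  finally have "exp (real n * (r / 4)) \<le> exp (K * (real n * ln (real n)))" by (simp only: z_def exp_of_nat_mult)
  then have "real n * (r / 4) \<le> real n * (K * ln (real n))" by (simp add: mult_ac)
  then have "r / 4 \<le> K * ln (real n)" using n0 by (simp only: mult_le_cancel_left_pos)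
  also have "ln (real n) = 8 * ln y" unfolding y8[symmetric] using y0 by (simp add: ln_realpow)
  also have "K * (8 * ln y) \<le> K * (8 * y)" using K y0 ln_le_minus_one[of y] by (intro mult_left_mono) auto
  finally have "y * y \<le> (32 * K) * y" unfolding ry by (simp add: power2_eq_square)
  then have "y \<le> 32 * K" using y0 by (simp only: mult_le_cancel_right_pos)
  then have "y ^ 8 \<le> (32 * K) ^ 8" using y0 by (intro power_mono) auto
  then show False using y8 n(1) by linarith
qed

text \<open>The three memberships say that the rescaled quasi-period, the invariant in the
  differential equation and the initial value at the half period lie, up to a common denominator, in
  the order. Being of second order, the differential equation for \<open>wp\<close> involves
  \<open>eis 4\<close> only.\<close>

theorem schneider:
  fixes q t l :: complex and N0 :: nat
  assumes nm: "nome q t" and no: "number_order d \<omega> M" and l: "l \<noteq> 0" and N0: "N0 > 0"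
    and mem: "\<exists>B. number_order.bdd d \<omega> (of_nat N0 * (eis 2 q / l ^ 2)) B"
      "\<exists>B. number_order.bdd d \<omega> (of_nat N0 * (eis 4 q / l ^ 4)) B"
      "\<exists>B. number_order.bdd d \<omega> (of_nat N0 * (nome.wp q (of_real pi * \<i>) / l ^ 2)) B"
  shows False
proof -
  interpret nome q t by (rule nm)
  interpret O: number_order d \<omega> M by (rule no)
  \<comment> \<open>In the variable s = l (v - w0) the functions satisfy U' = E_2-term - X and X'' =
    6 X^2 + 30 E_4-term with coefficients from the order; the powers of l are dictated by
    homogeneity.\<close>
  define X where "X s = wp (w0 + s / l) / l ^ 2" for s
  define U where "U s = Z (w0 + s / l) / l" for s
  define X1 where "X1 s = - Z2 (w0 + s / l) / l ^ 3" for s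
  define S where "S = (\<lambda>s. w0 + s / l) -` (- \<Lambda>)"
  have S: "open S" "0 \<in> S" "\<And>s. s \<in> S \<Longrightarrow> w0 + s / l \<notin> \<Lambda>"
  proof -
    show "open S" unfolding S_def using l by (intro open_vimage open_compl_\<Lambda> continuous_intros) auto
    show "0 \<in> S" using w0_notin by (simp add: S_def)
  qed (auto simp: S_def)
  have aff: "((\<lambda>s. w0 + s / l) has_field_derivative 1 / l) (at s)" for s
    using l by (auto intro!: derivative_eq_intros)
  have dU: "(U has_field_derivative (eis 2 q / l ^ 2 - X s)) (at s)" if "s \<in> S" for s
  proof -
    have "((\<lambda>s. Z (w0 + s / l) / l) has_field_derivative (Z1 (w0 + s / l) * (1 / l)) / l) (at s)"
      by (intro DERIV_cdivide DERIV_chain2[OF Z_deriv[OF S(3)[OF that]] aff])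
    then show ?thesis unfolding U_def[abs_def] X_def wp_def by (simp add: power2_eq_square diff_divide_distrib)
  qed
  have dX: "(X has_field_derivative X1 s) (at s)" if "s \<in> S" for s
  proof -
    have "((\<lambda>s. (eis 2 q - Z1 (w0 + s / l)) / l ^ 2) has_field_derivative (0 - Z2 (w0 + s / l) * (1 / l)) / l ^ 2) (at s)"
      by (intro DERIV_cdivide DERIV_diff DERIV_const DERIV_chain2[OF Z1_deriv[OF S(3)[OF that]] aff])
    then show ?thesis unfolding X_def[abs_def] X1_def wp_def[abs_def] by (simp add: power2_eq_square power3_eq_cube mult.assoc)
  qed
  have dX1: "(X1 has_field_derivative (6 * X s ^ 2 + 30 * (eis 4 q / l ^ 4))) (at s)" if "s \<in> S" for s
  proof -
    have "((\<lambda>s. - Z2 (w0 + s / l) / l ^ 3) has_field_derivative (- (Z3 (w0 + s / l) * (1 / l))) / l ^ 3) (at s)"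
      by (intro DERIV_cdivide DERIV_minus DERIV_chain2[OF Z2_deriv[OF S(3)[OF that]] aff])
    moreover have "(- (Z3 (w0 + s / l) * (1 / l))) / l ^ 3 = (- Z3 (w0 + s / l)) / l ^ 4"
      by (simp add: eval_nat_numeral)
    moreover have "\<dots> = 6 * X s ^ 2 + 30 * (eis 4 q / l ^ 4)"
      unfolding wp_ode(1)[OF S(3)[OF that]] X_def by (simp add: add_divide_distrib power_divide power_mult[symmetric])
    ultimately show ?thesis unfolding X1_def[abs_def] by (simp only:)
  qed
  define UF where "UF = fps_expansion U 0"
  define XF where "XF = fps_expansion X 0"
  have UF: "U has_fps_expansion UF" unfolding UF_def
    by (rule has_fps_expansion_fps_expansion[OF S(1,2)]) (use dU S(1) in \<open>auto simp: holomorphic_on_open\<close>)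
  have XF: "X has_fps_expansion XF" unfolding XF_def
    by (rule has_fps_expansion_fps_expansion[OF S(1,2)]) (use dX S(1) in \<open>auto simp: holomorphic_on_open\<close>)
  have X1F: "X1 has_fps_expansion fps_deriv XF" by (rule has_fps_expansion_deriv_eq[OF XF S(1,2) dX])
  have eqU: "fps_deriv UF = fps_const (eis 2 q / l ^ 2) - XF"
  proof (rule fps_expansion_unique_complex)
    show "(\<lambda>s. eis 2 q / l ^ 2 - X s) has_fps_expansion fps_deriv UF"
      by (rule has_fps_expansion_deriv_eq[OF UF S(1,2) dU])
    show "(\<lambda>s. eis 2 q / l ^ 2 - X s) has_fps_expansion fps_const (eis 2 q / l ^ 2) - XF"
      by (intro fps_expansion_intros XF)
  qed
  have eqX: "fps_deriv (fps_deriv XF) = 6 * XF ^ 2 + fps_const (30 * (eis 4 q / l ^ 4))"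
  proof (rule fps_expansion_unique_complex)
    show "(\<lambda>s. 6 * X s ^ 2 + 30 * (eis 4 q / l ^ 4)) has_fps_expansion fps_deriv (fps_deriv XF)"
      by (rule has_fps_expansion_deriv_eq[OF X1F S(1,2) dX1])
    show "(\<lambda>s. 6 * X s ^ 2 + 30 * (eis 4 q / l ^ 4)) has_fps_expansion 6 * XF ^ 2 + fps_const (30 * (eis 4 q / l ^ 4))"
      by (intro fps_expansion_intros has_fps_expansion_power XF)
  qed
  have X0: "fps_nth XF 0 = wp w0 / l ^ 2" using fps_nth_fps_expansion[OF XF, of 0] by (simp add: X_def)
  have U0: "fps_nth UF 0 = 0" using fps_nth_fps_expansion[OF UF, of 0] half_period by (simp add: U_def w0_def)
  have X10: "fps_nth XF 1 = 0" using fps_nth_fps_expansion[OF X1F, of 0] half_period by (simp add: X1_def w0_def)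
  \<comment> \<open>The order may miss the integer N0; the factor M puts N itself into it.\<close>
  define N where "N = N0 * M"
  have N: "N > 0" unfolding N_def using N0 O.M_pos by simp
  obtain b0 where b0: "O.bdd (of_nat M) b0"
  proof -
    obtain c :: "nat \<Rightarrow> int" where c: "of_nat M = (\<Sum>k<d. of_int (c k) * \<omega> k)" using O.M_mem by blast
    have "O.\<kappa> * \<bar>of_int (c i)\<bar> \<le> (\<Sum>k<d. O.\<kappa> * \<bar>of_int (c k)\<bar>)" if "i < d" for i
      using that O.\<kappa>_ge1 by (intro member_le_sum[of i "{..<d}" "\<lambda>i. O.\<kappa> * \<bar>of_int (c i)\<bar>"]) auto
    then show thesis using c that unfolding O.bdd_def by blast
  qed
  obtain b1 b2 b3 where b: "O.bdd (of_nat N0 * (eis 2 q / l ^ 2)) b1" "O.bdd (of_nat N0 * (eis 4 q / l ^ 4)) b2"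
      "O.bdd (of_nat N0 * (wp w0 / l ^ 2)) b3" using mem unfolding w0_def by blast
  have bN: "O.bdd (of_nat N) (of_nat N0 * b0)" unfolding N_def of_nat_mult by (rule O.bdd_nat[OF b0])
  have b1': "O.bdd (of_nat N * (eis 2 q / l ^ 2)) (of_nat M * b1)"
    using O.bdd_nat[OF b(1), of M] by (simp add: N_def mult_ac)
  have b2': "O.bdd (of_nat N * (30 * (eis 4 q / l ^ 4))) (of_nat (30 * M) * b2)"
    using O.bdd_nat[OF b(2), of "30 * M"] by (simp add: N_def mult_ac)
  have b3': "O.bdd (of_nat N * (wp w0 / l ^ 2)) (of_nat M * b3)"
    using O.bdd_nat[OF b(3), of M] by (simp add: N_def mult_ac)
  define bb where "bb = max 1 (max (max (of_nat N0 * b0) (of_nat M * b1)) (max (of_nat (30 * M) * b2) (of_nat M * b3)))"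
  have bbs: "O.bdd (of_nat N) bb" "O.bdd (of_nat N * (wp w0 / l ^ 2)) bb" "O.bdd (of_nat N * (30 * (eis 4 q / l ^ 4))) bb"
      "O.bdd (of_nat N * (eis 2 q / l ^ 2)) bb" "bb \<ge> 1"
    unfolding bb_def by (rule O.bdd_mono[OF bN] O.bdd_mono[OF b1'] O.bdd_mono[OF b2'] O.bdd_mono[OF b3'], simp add: le_max_iff_disj)+ simp
  obtain E :: nat where E: "E \<ge> 1" "\<And>L n i j. i < L \<Longrightarrow> j < L \<Longrightarrow>
     O.bdd (of_nat N ^ (n + 2 * L) * fact n * fps_nth (UF ^ i * XF ^ j) n) (of_nat (E ^ (n + L) * fact n))"
    using O.arith_monomials[OF eqX X0 X10 eqU U0 N bbs] by blast
  obtain C where C: "C \<ge> 1" "\<And>\<alpha> B. O.bdd \<alpha> B \<Longrightarrow> \<alpha> \<noteq> 0 \<Longrightarrow> norm \<alpha> \<ge> 1 / (C * (B + 1) ^ d)"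
    using O.liouville_bound by blast
  obtain C1 where C1: "C1 \<ge> 1" "\<And>L x A r v. r \<ge> 1 \<Longrightarrow> \<bar>Re v\<bar> = r \<Longrightarrow> A \<ge> 0 \<Longrightarrow> (\<forall>i<L. \<forall>j<L. \<bar>of_int (x i j)\<bar> \<le> A) \<Longrightarrow>
     norm (Phi l L x v) \<le> of_nat L ^ 2 * A * exp (C1 * of_nat L * r ^ 2)"
    using Phi_bound[OF l] by blast
  define h where "h = max 1 (1 / norm (H w0))"
  define m where "m = max 1 (1 / norm l)"
  \<comment> \<open>One summand for each factor of the final product: \<open>Bd\<close>,
    \<open>C\<close>, \<open>(SS + 1) ^ d\<close>, the power of N, n!, and the powers of
    \<open>h\<close> and \<open>m\<close>. All ingredients are fixed before the parameter
    \<open>ll\<close>, which may therefore depend on K.\<close>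
  define K where "K = (5 + 2 * real E + C1 * (2 * d)) + C + (7 + 4 * real E) * d + real N * 3 + 1 + h * 3 + m * 1"
  define ll where "ll = nat \<lceil>(32 * K) ^ 8 + 256\<rceil> + 1"
  have ll: "real ll \<ge> (32 * K) ^ 8 + 256" "ll \<ge> 256"
  proof -
    show 1: "real ll \<ge> (32 * K) ^ 8 + 256" unfolding ll_def by linarith
    have "(32 * K) ^ 8 \<ge> 0" by simp
    then show "ll \<ge> 256" using 1 by linarith
  qed
  \<comment> \<open>L grows like \<open>ll\<close> and T like its square, so that L^2 = 2 d T and L
    = O(sqrt n) for every n >= T.\<close>
  define L where "L = 2 * d * ll"
  define T where "T = 2 * d * ll ^ 2"
  have LT: "L ^ 2 = 2 * d * T" unfolding L_def T_def by (simp add: power2_eq_square)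
  have T0: "T > 0" unfolding T_def using O.d_pos ll by simp
  obtain x :: "nat \<Rightarrow> nat \<Rightarrow> int" where x: "\<exists>i<L. \<exists>j<L. x i j \<noteq> 0"
    "\<forall>i<L. \<forall>j<L. \<bar>x i j\<bar> \<le> int (L ^ 2 * (E ^ (T + L) * fact T))"
    "\<forall>n<T. fps_nth (\<Sum>i<L. \<Sum>j<L. fps_const (of_int (x i j)) * (UF ^ i * XF ^ j)) n = 0"
    using O.siegel_vanishing[OF E(2) N E(1) LT T0] by blast
  define F where "F = (\<Sum>i<L. \<Sum>j<L. fps_const (of_int (x i j)) * (UF ^ i * XF ^ j))"
  have FF: "(\<lambda>s. \<Sum>i<L. \<Sum>j<L. of_int (x i j) * ((Z (w0 + s / l) / l) ^ i * (wp (w0 + s / l) / l ^ 2) ^ j)) has_fps_expansion F"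
    unfolding F_def using UF XF unfolding U_def[abs_def] X_def[abs_def]
    by (intro fps_expansion_intros has_fps_expansion_power)
  have "F \<noteq> 0"
  proof
    assume "F = 0"
    then have "\<forall>\<^sub>F s in nhds 0. (\<Sum>i<L. \<Sum>j<L. of_int (x i j) * ((Z (w0 + s / l) / l) ^ i * (wp (w0 + s / l) / l ^ 2) ^ j)) = 0"
      using FF by (auto simp: has_fps_expansion_def elim: eventually_mono)
    moreover have "filterlim (\<lambda>v. l * (v - w0)) (nhds 0) (nhds w0)"
    proof -
      have "((\<lambda>v. l * (v - w0)) \<longlongrightarrow> l * (w0 - w0)) (nhds w0)" by (intro tendsto_mult tendsto_diff tendsto_const filterlim_ident)
      then show ?thesis by simp
    qed
    ultimately have "\<forall>\<^sub>F v in nhds w0. (\<Sum>i<L. \<Sum>j<L. of_int (x i j) * ((Z (w0 + (l * (v - w0)) / l) / l) ^ i * (wp (w0 + (l * (v - w0)) / l) / l ^ 2) ^ j)) = 0"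
      by (rule eventually_compose_filterlim)
    moreover have "\<forall>\<^sub>F v in nhds w0. v \<in> - \<Lambda>" using w0_notin by (intro eventually_nhds_in_open open_compl_\<Lambda>) auto
    ultimately have "\<forall>\<^sub>F v in nhds w0. Phi l L x v = 0"
      by eventually_elim (use l in \<open>simp add: Phi_eq\<close>)
    then show False using x(1) Phi_nonzero[OF l] by blast
  qed
  \<comment> \<open>The true order may far exceed T. All estimates below are in terms of n, so the
    order need not be bounded above.\<close>
  define n where "n = subdegree F"
  have Fn: "fps_nth F n \<noteq> 0" "\<And>i. i < n \<Longrightarrow> fps_nth F i = 0"
    using \<open>F \<noteq> 0\<close> by (auto simp: n_def)
  have nT: "n \<ge> T" unfolding n_def by (rule subdegree_geI[OF \<open>F \<noteq> 0\<close>]) (use x(3) in \<open>auto simp: F_def\<close>)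
  have llT: "ll ^ 2 \<le> T" unfolding T_def using O.d_pos by simp
  have "ll \<le> ll ^ 2" by (simp add: power2_eq_square)
  then have nll: "n \<ge> ll" using nT llT by linarith
  have n256: "n \<ge> 256" using nll ll by simp
  have Ln: "L \<le> n"
  proof -
    have "L \<le> T" unfolding L_def T_def by (simp add: power2_eq_square)
    then show ?thesis using nT by simp
  qed
  define w where "w = real n * ln (real n)"
  have ln1: "ln (real n) \<ge> 1"
  proof -
    have "exp 1 \<le> (3::real)" by (rule exp_le)
    then have "ln (exp 1) \<le> ln (real n)" using n256 by (subst ln_le_cancel_iff) auto
    then show ?thesis by simp
  qed
  have wn: "real n \<le> w" unfolding w_def using mult_left_mono[OF ln1, of "real n"] by simp
  have w1: "w \<ge> 1" using wn n256 by linarith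
  \<comment> \<open>With L = O(sqrt n) this exponent keeps the growth L r^2 at O(n), while n r still
    outgrows n ln n.\<close>
  define r where "r = real n powr (1/4)"
  have r1: "r \<ge> 1" unfolding r_def using n256 by (intro ge_one_powr_ge_zero) auto
  have r2: "r ^ 2 = sqrt (real n)" unfolding r_def using n256 by (simp add: powr_half_sqrt[symmetric] power2_eq_square flip: powr_add)
  have Lr: "real L * r ^ 2 \<le> 2 * d * real n"
  proof -
    have "real ll \<le> sqrt (real n)" using llT nT by (intro real_le_rsqrt) (metis le_trans of_nat_le_iff of_nat_power)
    then have "real ll * sqrt (real n) \<le> sqrt (real n) * sqrt (real n)" by (intro mult_right_mono) auto
    then have "real ll * sqrt (real n) \<le> real n" by simp
    then have "(2 * d) * (real ll * sqrt (real n)) \<le> (2 * d) * real n" by (intro mult_left_mono) auto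
    then show ?thesis unfolding r2 L_def by (simp add: mult_ac)
  qed
  have nw: "real n ^ k \<le> exp (real k * w)" for k
  proof -
    have "real n \<le> exp w" using wn exp_ge_add_one_self[of w] by linarith
    then have "real n ^ k \<le> exp w ^ k" by (intro power_mono) auto
    then show ?thesis by (simp add: exp_of_nat_mult)
  qed
  have cw: "c \<le> exp (c * w)" if "c \<ge> 0" for c :: real
  proof -
    have "c * 1 \<le> c * w" using that w1 by (intro mult_left_mono) auto
    then show ?thesis using exp_ge_add_one_self[of "c * w"] by linarith
  qed
  have factw: "fact k \<le> exp (1 * w)" if "k \<le> n" for k
  proof -
    have "(fact k :: real) \<le> fact n" using that by (rule fact_mono)
    also have "\<dots> \<le> real n ^ n" using fact_le_power[of n, where ?'a = real] by simp
    also have "\<dots> = exp (ln (real n)) ^ n" using n256 by simp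
    also have "\<dots> = exp (1 * w)" by (simp only: exp_of_nat_mult[symmetric] w_def mult_1)
    finally show ?thesis .
  qed
  have Ew: "real E ^ k \<le> exp (2 * real E * w)" if "k \<le> 2 * n" for k
  proof -
    have "real k \<le> 2 * w" using that wn by linarith
    from exp_bound_power[OF _ this, of "real E"] show ?thesis by (simp add: mult_ac)
  qed
  have L2w: "real L ^ 2 \<le> exp (2 * w)"
  proof -
    have "real L ^ 2 \<le> real n ^ 2" using Ln by (intro power_mono) auto
    also have "\<dots> \<le> exp (2 * w)" using nw[of 2] by simp
    finally show ?thesis .
  qed
  define A where "A = real (L ^ 2 * (E ^ (T + L) * fact T))"
  have A0: "A \<ge> 0" by (simp add: A_def)
  have xA: "\<bar>real_of_int (x i j)\<bar> \<le> A" if "i < L" "j < L" for i j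
  proof -
    have "real_of_int \<bar>x i j\<bar> \<le> real_of_int (int (L ^ 2 * (E ^ (T + L) * fact T)))"
      using x(2) that by (intro of_int_le_iff[THEN iffD2]) blast
    then show ?thesis by (simp only: A_def of_int_of_nat_eq of_int_abs)
  qed
  have Aw: "A \<le> exp ((2 + (2 * real E + 1)) * w)"
    unfolding A_def of_nat_mult of_nat_power of_nat_fact
    by (intro exp_bound_mult L2w Ew factw) (use Ln nT in auto)
  \<comment> \<open>The first non-zero coefficient with its denominator cleared: a non-zero element
    of the order, hence subject to the Liouville bound from below.\<close>
  define \<gamma> where "\<gamma> = of_nat N ^ (n + 2 * L) * fact n * fps_nth F n"
  have \<gamma>0: "\<gamma> \<noteq> 0" using N Fn by (simp add: \<gamma>_def)
  define G where "G = real (E ^ (n + L) * fact n)"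
  have G0: "G \<ge> 0" by (simp add: G_def)
  have Gw: "G \<le> exp ((2 * real E + 1) * w)"
    unfolding G_def of_nat_mult of_nat_power of_nat_fact
    by (intro exp_bound_mult Ew factw) (use Ln in auto)
  define SS where "SS = real L ^ 2 * (A * G)"
  have "O.bdd \<gamma> SS"
  proof -
    have eq: "\<gamma> = (\<Sum>i<L. \<Sum>j<L. of_int (x i j) * (of_nat N ^ (n + 2 * L) * fact n * fps_nth (UF ^ i * XF ^ j) n))"
      unfolding \<gamma>_def F_def by (simp add: fps_sum_nth sum_distrib_left) (simp add: mult_ac)
    have "O.bdd \<gamma> (\<Sum>i<L. \<Sum>j<L. \<bar>of_int (x i j)\<bar> * G)"
      unfolding eq G_def by (intro O.bdd_sum O.bdd_int E(2)) auto
    moreover have "(\<Sum>i<L. \<Sum>j<L. \<bar>of_int (x i j)\<bar> * G) \<le> (\<Sum>i<L. \<Sum>j<L. A * G)"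
    proof (intro sum_mono mult_right_mono G0)
      show "\<bar>real_of_int (x i j)\<bar> \<le> A" if "i \<in> {..<L}" "j \<in> {..<L}" for i j
        using xA that by simp
    qed
    moreover have "(\<Sum>i<L. \<Sum>j<L. A * G) = SS" by (simp add: SS_def power2_eq_square)
    ultimately show ?thesis using O.bdd_mono by simp
  qed
  then have lower: "1 / (C * (SS + 1) ^ d) \<le> norm \<gamma>" using C(2) \<gamma>0 by blast
  have SS0: "SS \<ge> 0" unfolding SS_def using A0 G0 by simp
  have SSw: "SS \<le> exp ((2 + ((2 + (2 * real E + 1)) + (2 * real E + 1))) * w)"
    unfolding SS_def by (intro exp_bound_mult L2w Aw Gw mult_nonneg_nonneg A0 G0) auto
  have SS1: "(SS + 1) ^ d \<le> exp ((7 + 4 * real E) * d * w)"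
  proof -
    define a where "a = (2 + ((2 + (2 * real E + 1)) + (2 * real E + 1))) * w"
    have "a \<ge> 0" unfolding a_def using w1 by (intro mult_nonneg_nonneg) auto
    then have "1 \<le> exp a" by simp
    then have "SS + 1 \<le> exp a + exp a" using SSw unfolding a_def by linarith
    also have "\<dots> \<le> exp 1 * exp a" using exp_ge_add_one_self[of 1] by simp
    also have "\<dots> \<le> exp w * exp a" using w1 by simp
    also have "\<dots> = exp ((7 + 4 * real E) * w)" unfolding a_def by (simp add: exp_add[symmetric] algebra_simps)
    finally have "(SS + 1) ^ d \<le> exp ((7 + 4 * real E) * w) ^ d" using SS0 by (intro power_mono) auto
    then show ?thesis by (simp add: exp_of_nat_mult[symmetric] mult_ac)
  qed
  define dl where "dl = exp (r / 2) - exp (- r / 2)"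
  have dl: "dl > 0" using r1 by (simp add: dl_def)
  define Bd where "Bd = real L ^ 2 * A * exp (C1 * real L * r ^ 2)"
  have Bdle: "norm (Phi l L x v) \<le> Bd" if "\<bar>Re v\<bar> = r" for v
    unfolding Bd_def using that r1 A0
  proof (intro C1(2))
    show "\<forall>i<L. \<forall>j<L. \<bar>real_of_int (x i j)\<bar> \<le> A" using xA by blast
  qed auto
  have upper: "norm (H w0) ^ (3 * L) * norm (fps_nth F n) * norm l ^ n \<le> Bd / dl ^ n"
    unfolding dl_def by (rule vanishing_bound[OF l FF Fn(2) r1 Bdle])
  have Bdw: "Bd \<le> exp ((5 + 2 * real E + C1 * (2 * d)) * w)"
  proof -
    have "C1 * (real L * r ^ 2) \<le> C1 * (2 * d * real n)" using Lr C1 by (intro mult_left_mono) auto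
    also have "\<dots> \<le> C1 * (2 * d * w)" using wn C1 by (intro mult_left_mono) auto
    finally have "exp (C1 * real L * r ^ 2) \<le> exp ((C1 * (2 * d)) * w)" by (simp add: mult_ac)
    then have "Bd \<le> exp (((2 + (2 + (2 * real E + 1))) + C1 * (2 * d)) * w)"
      unfolding Bd_def by (intro exp_bound_mult L2w Aw mult_nonneg_nonneg A0) auto
    then show ?thesis by (simp add: algebra_simps)
  qed
  have Bd0: "Bd \<ge> 0" unfolding Bd_def using A0 by simp
  have Hn: "norm (H w0) > 0" "norm l > 0" using H_nonzero[OF w0_notin] l by auto
  have nF: "norm (fps_nth F n) = norm \<gamma> / (real N ^ (n + 2 * L) * fact n)"
    unfolding \<gamma>_def using N by (simp add: norm_mult norm_power)
  \<comment> \<open>Liouville's lower bound confronted with the upper bound from the strip;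
    \<open>h\<close> and \<open>m\<close> replace division by norms of \<open>H w0\<close> and
    \<open>l\<close> with multiplication.\<close>
  have "dl ^ n \<le> Bd * C * (SS + 1) ^ d * real N ^ (n + 2 * L) * fact n * h ^ (3 * L) * m ^ n"
  proof -
    have hH: "1 \<le> h ^ (3 * L) * norm (H w0) ^ (3 * L)"
    proof -
      have "1 \<le> h * norm (H w0)" unfolding h_def using Hn by (cases "1 \<le> 1 / norm (H w0)") (auto simp: max_def field_simps)
      then have "1 \<le> (h * norm (H w0)) ^ (3 * L)" by (rule one_le_power)
      then show ?thesis by (simp add: power_mult_distrib)
    qed
    have ml: "1 \<le> m ^ n * norm l ^ n"
    proof -
      have "1 \<le> m * norm l" unfolding m_def using Hn by (cases "1 \<le> 1 / norm l") (auto simp: max_def field_simps)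
      then have "1 \<le> (m * norm l) ^ n" by (rule one_le_power)
      then show ?thesis by (simp add: power_mult_distrib)
    qed
    have \<gamma>1: "1 \<le> norm \<gamma> * (C * (SS + 1) ^ d)"
      using lower C(1) SS0 by (simp add: field_simps)
    define a1 where "a1 = C * (SS + 1) ^ d"
    define a2 where "a2 = real N ^ (n + 2 * L) * fact n"
    define hh where "hh = h ^ (3 * L)"
    define mm where "mm = m ^ n"
    define Hh where "Hh = norm (H w0) ^ (3 * L)"
    define lh where "lh = norm l ^ n"
    have a2: "a2 > 0" unfolding a2_def using N by simp
    have pos: "a1 \<ge> 0" "hh \<ge> 0" "mm \<ge> 0" "Hh \<ge> 0" "lh \<ge> 0" "norm \<gamma> \<ge> 0"
      unfolding a1_def hh_def mm_def Hh_def lh_def h_def m_def using C(1) SS0 by auto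
    have u: "Hh * (norm \<gamma> / a2) * lh \<le> Bd / dl ^ n" using upper unfolding nF Hh_def lh_def a2_def .
    have "1 * 1 * 1 \<le> (norm \<gamma> * a1) * (hh * Hh) * (mm * lh)"
      using \<gamma>1 hH ml unfolding a1_def[symmetric] hh_def[symmetric] mm_def[symmetric] Hh_def[symmetric] lh_def[symmetric]
      by (intro mult_mono) auto
    also have "\<dots> = (Hh * (norm \<gamma> / a2) * lh) * (a1 * a2 * hh * mm)" using a2 by simp
    also have "\<dots> \<le> (Bd / dl ^ n) * (a1 * a2 * hh * mm)" using u pos a2 by (intro mult_right_mono) auto
    finally have "1 \<le> (Bd * (a1 * a2 * hh * mm)) / dl ^ n" by simp
    then have "dl ^ n \<le> Bd * (a1 * a2 * hh * mm)" using dl by (simp add: field_simps)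
    then show ?thesis unfolding a1_def a2_def hh_def mm_def by (simp add: mult_ac)
  qed
  also have "\<dots> \<le> exp (K * w)"
  proof -
    have h0: "h \<ge> 0" "m \<ge> 0" by (auto simp: h_def m_def)
    have p: "0 \<le> C" "C \<le> exp (C * w)" "0 \<le> (SS + 1) ^ d" "0 \<le> h ^ (3 * L)" "0 \<le> m ^ n"
      using C(1) cw SS0 h0 by auto
    have q: "real N ^ (n + 2 * L) \<le> exp (real N * 3 * w)" "h ^ (3 * L) \<le> exp (h * 3 * w)" "m ^ n \<le> exp (m * 1 * w)"
      by (rule exp_bound_power, use Ln wn h0 in simp, use Ln wn h0 in simp)+
    have p': "0 \<le> real N ^ (n + 2 * L)" "0 \<le> (fact n :: real)" by auto
    have f: "fact n \<le> exp (1 * w)" by (rule factw) simp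
    show ?thesis unfolding K_def
      by (intro exp_bound_mult mult_nonneg_nonneg Bd0 Bdw SS1 p p' q f)
  qed
  finally have fin: "dl ^ n \<le> exp (K * (real n * ln (real n)))" unfolding w_def .
  have K1: "K \<ge> 1"
  proof -
    have "C1 * (2 * d) \<ge> 0" "(7 + 4 * real E) * d \<ge> 0" "real N * 3 \<ge> 0" "h * 3 \<ge> 0" "m * 1 \<ge> 0"
      using C1 by (auto simp: h_def m_def)
    then show ?thesis unfolding K_def using C(1) by linarith
  qed
  have "real n \<ge> (32 * K) ^ 8 + 1" using nll ll by linarith
  then show False using growth_contradiction[OF _ n256 K1] fin unfolding dl_def r_def by blast
qed


subsection \<open>Algebraicity of the periods at an inflection point\<close>

interpretation Q: vector_space "\<lambda>(r::rat) (v::complex). of_rat r * v"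
  by unfold_locales (auto simp: algebra_simps of_rat_add of_rat_mult)

text \<open>A number field in disguise: a ring containing the rationals inside a finite-dimensional
  rational space. Inverses come for free, see \<open>fin_alg_inverse\<close>, and this form is easy
  to enlarge step by step.\<close>

definition fin_alg :: "complex set \<Rightarrow> bool" where
  "fin_alg V \<longleftrightarrow> (\<forall>r. of_rat r \<in> V) \<and> (\<forall>x\<in>V. \<forall>y\<in>V. x + y \<in> V \<and> x * y \<in> V) \<and>
     (\<exists>A. finite A \<and> V \<subseteq> Q.span A)"

lemma fin_alg_sum:
  assumes "fin_alg V" "finite A" "\<And>a. a \<in> A \<Longrightarrow> f a \<in> V" shows "sum f A \<in> V"
proof -
  have "of_rat 0 \<in> V" using assms(1) unfolding fin_alg_def by blast
  then have "0 \<in> V" by simp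
  with assms(2,3) show ?thesis
    by (induction A rule: finite_induct) (use assms(1) in \<open>auto simp: fin_alg_def\<close>)
qed

lemma fin_alg_Rats: "fin_alg (range of_rat)"
proof -
  have "range of_rat \<subseteq> Q.span {1}"
  proof (intro image_subsetI)
    fix r :: rat
    show "of_rat r \<in> Q.span {1}" using Q.span_scale[OF Q.span_base[of 1 "{1}"], of r] by simp
  qed
  moreover have "x + y \<in> range of_rat \<and> x * y \<in> range of_rat" if "x \<in> range of_rat" "y \<in> range of_rat" for x y :: complex
    using that by (auto simp flip: of_rat_add of_rat_mult)
  ultimately show ?thesis unfolding fin_alg_def by blast
qed

text \<open>W consists of the polynomials in x of degree below n over V. The monic relation closes
  it under multiplication by x, and the products of a spanning set of V with the powers of x span
  it.\<close>

lemma fin_alg_adjoin: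
  assumes V: "fin_alg V" and c: "\<And>j. c j \<in> V" and n: "n > 0" and x: "x ^ n = (\<Sum>j<n. c j * x ^ j)"
  obtains W where "fin_alg W" "V \<subseteq> W" "x \<in> W"
proof -
  define W where "W = {v. \<exists>a. (\<forall>j. a j \<in> V) \<and> v = (\<Sum>j<n. a j * x ^ j)}"
  have V0: "0 \<in> V" "1 \<in> V"
    using V unfolding fin_alg_def by (metis of_rat_0, metis of_rat_1)
  have Va: "a + b \<in> V" "a * b \<in> V" if "a \<in> V" "b \<in> V" for a b using V that unfolding fin_alg_def by auto
  have VW: "V \<subseteq> W"
  proof
    fix v assume v: "v \<in> V"
    have "(\<Sum>j<n. (if j = 0 then v else 0) * x ^ j) = (\<Sum>j<n. if j = 0 then v else 0)"
      by (intro sum.cong) auto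
    also have "\<dots> = v" using n by simp
    finally show "v \<in> W" unfolding W_def using v V0 by (intro CollectI exI[of _ "\<lambda>j. if j = 0 then v else 0"]) auto
  qed
  have add: "u + v \<in> W" if uv: "u \<in> W" "v \<in> W" for u v
  proof -
    obtain a where a: "\<forall>j. a j \<in> V" "u = (\<Sum>j<n. a j * x ^ j)" using uv unfolding W_def by blast
    obtain b where b: "\<forall>j. b j \<in> V" "v = (\<Sum>j<n. b j * x ^ j)" using uv unfolding W_def by blast
    from a b show ?thesis unfolding W_def
      by (intro CollectI exI[of _ "\<lambda>j. a j + b j"]) (auto simp: Va sum.distrib distrib_right)
  qed
  have scale: "u * v \<in> W" if uv: "u \<in> V" "v \<in> W" for u v
  proof -
    obtain b where "\<forall>j. b j \<in> V" "v = (\<Sum>j<n. b j * x ^ j)"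
      using uv unfolding W_def by blast
    then show ?thesis unfolding W_def using uv
      by (intro CollectI exI[of _ "\<lambda>j. u * b j"]) (auto simp: Va sum_distrib_left mult_ac)
  qed
  have mx: "x * v \<in> W" if uv: "v \<in> W" for v
  proof -
    obtain b where b: "\<forall>j. b j \<in> V" "v = (\<Sum>j<n. b j * x ^ j)"
      using uv unfolding W_def by blast
    obtain m where m: "n = Suc m" using n by (cases n) auto
    define b' where "b' j = (if j = 0 then 0 else b (j - 1))" for j
    have "x * v = (\<Sum>j<n. b j * x ^ Suc j)" unfolding b by (simp add: sum_distrib_left mult_ac)
    also have "\<dots> = (\<Sum>j<m. b j * x ^ Suc j) + b m * x ^ n" by (simp add: m)
    also have "(\<Sum>j<m. b j * x ^ Suc j) = (\<Sum>j<n. b' j * x ^ j)" unfolding m sum.lessThan_Suc_shift by (simp add: b'_def)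
    finally have e: "x * v = (\<Sum>j<n. b' j * x ^ j) + b m * x ^ n" .
    have "(\<Sum>j<n. b' j * x ^ j) \<in> W" unfolding W_def using b V0 by (intro CollectI exI[of _ b']) (auto simp: b'_def)
    moreover have "x ^ n \<in> W" unfolding W_def using x c by (intro CollectI exI[of _ c]) auto
    ultimately show ?thesis unfolding e using scale b by (intro add) auto
  qed
  have mxp: "x ^ j * v \<in> W" if "v \<in> W" for j v
    by (induction j) (use that mx in \<open>auto simp: mult.assoc\<close>)
  have W0: "0 \<in> W" using VW V0 by blast
  have sumW: "(\<Sum>j\<in>A. f j) \<in> W" if "finite A" "\<And>j. j \<in> A \<Longrightarrow> f j \<in> W" for f :: "nat \<Rightarrow> complex" and A
    using that by (induction A rule: finite_induct) (auto simp: add W0)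
  have mult: "u * v \<in> W" if uv: "u \<in> W" "v \<in> W" for u v
  proof -
    obtain a where a: "\<forall>j. a j \<in> V" "u = (\<Sum>j<n. a j * x ^ j)" using uv unfolding W_def by blast
    have "u * v = (\<Sum>j<n. a j * (x ^ j * v))" unfolding a sum_distrib_right by (simp add: mult_ac)
    also have "\<dots> \<in> W" using a uv by (intro sumW scale mxp) auto
    finally show ?thesis .
  qed
  obtain A where A: "finite A" "V \<subseteq> Q.span A" using V unfolding fin_alg_def by blast
  define S where "S = (\<lambda>(a, j). a * x ^ j) ` (A \<times> {..<n})"
  have sp: "v * x ^ j \<in> Q.span S" if "v \<in> V" "j < n" for v j
  proof -
    have "v \<in> Q.span A" using A that by blast
    then show ?thesis
    proof (induction v rule: Q.span_induct_alt)
      case base show ?case by (simp add: Q.span_zero)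
    next
      case (step r a y)
      have "a * x ^ j \<in> S" unfolding S_def using step that by force
      then have "of_rat r * (a * x ^ j) + y * x ^ j \<in> Q.span S"
        using step(2) by (intro Q.span_add[OF Q.span_scale[OF Q.span_base]])
      then show ?case by (simp add: algebra_simps)
    qed
  qed
  have "W \<subseteq> Q.span S"
    unfolding W_def by (auto intro!: Q.span_sum sp)
  moreover have "finite S" unfolding S_def using A by auto
  moreover have "of_rat r \<in> W" for r using V VW unfolding fin_alg_def by blast
  ultimately have "fin_alg W" unfolding fin_alg_def using add mult by blast
  moreover have "x \<in> W" using mx[of 1] VW V0 by auto
  ultimately show thesis using VW that by blast
qed

lemma fin_alg_algebraic:
  assumes V: "fin_alg V" and x: "algebraic x"
  obtains W where "fin_alg W" "V \<subseteq> W" "x \<in> W"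
proof -
  obtain p where p: "\<forall>i. coeff p i \<in> \<rat>" "p \<noteq> 0" "poly p x = 0" using x unfolding algebraic_altdef by blast
  define n where "n = degree p"
  define c where "c j = - coeff p j / lead_coeff p" for j
  have n: "n > 0"
  proof (rule ccontr)
    assume "\<not> n > 0"
    then obtain a where "p = [:a:]" unfolding n_def by (auto elim: degree_eq_zeroE)
    then show False using p by auto
  qed
  have "c j \<in> V" for j
  proof -
    have "c j \<in> \<rat>" unfolding c_def using p by auto
    then show ?thesis using V unfolding fin_alg_def by (auto elim!: Rats_cases)
  qed
  moreover have "x ^ n = (\<Sum>j<n. c j * x ^ j)"
  proof -
    have "0 = (\<Sum>j<n. coeff p j * x ^ j) + lead_coeff p * x ^ n"
      using p(3) unfolding poly_altdef n_def by (simp add: lessThan_Suc_atMost[symmetric])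
    moreover have "(\<Sum>j<n. c j * x ^ j) = - (\<Sum>j<n. coeff p j * x ^ j) / lead_coeff p"
      by (simp add: c_def sum_negf sum_divide_distrib)
    moreover have "lead_coeff p \<noteq> 0" using p by simp
    ultimately have "lead_coeff p * (x ^ n - (\<Sum>j<n. c j * x ^ j)) = 0" by (simp add: field_simps)
    then show ?thesis using p by simp
  qed
  ultimately show thesis using fin_alg_adjoin[OF V _ n] that by blast
qed

text \<open>Take a rational basis contained in V and clear the denominators of all structure
  constants at once. Every finite subset of V enters the resulting order after multiplication by
  some positive integer.\<close>

lemma fin_alg_number_order:
  assumes V: "fin_alg V"
  shows "\<exists>d \<omega> M. number_order d \<omega> M \<and> (\<forall>i<d. \<omega> i \<in> V) \<and>
    (\<forall>F. finite F \<longrightarrow> F \<subseteq> V \<longrightarrow> (\<exists>N>0. \<forall>v\<in>F. \<exists>c :: nat \<Rightarrow> int. of_nat N * v = (\<Sum>k<d. of_int (c k) * \<omega> k)))"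
proof -
  obtain A where A: "finite A" "V \<subseteq> Q.span A" using V unfolding fin_alg_def by blast
  obtain B where B: "B \<subseteq> V" "Q.independent B" "V \<subseteq> Q.span B"
    using Q.maximal_independent_subset by blast
  have "finite B" using Q.independent_span_bound[OF A(1) B(2)] B(1) A(2) by blast
  then obtain e where e: "bij_betw e {..<card B} B" by (metis bij_betw_from_nat_into_finite)
  define d where "d = card B"
  note e = e[folded d_def]
  have ex1: "\<exists>N>0. \<exists>c :: nat \<Rightarrow> int. of_nat N * v = (\<Sum>k<d. of_int (c k) * e k)" if v: "v \<in> V" for v
  proof -
    have "v \<in> Q.span B" using B v by blast
    then obtain u where u: "v = (\<Sum>b\<in>B. of_rat (u b) * b)"
      using Q.span_finite[OF \<open>finite B\<close>] by auto
    have ue: "v = (\<Sum>k<d. of_rat (u (e k)) * e k)" unfolding u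
      by (rule sum.reindex_bij_betw[OF e, symmetric])
    have "\<exists>N>0. \<forall>k<m. \<exists>c::int. of_nat N * u (e k) = of_int c" for m
    proof (induction m)
      case 0 show ?case by (intro exI[of _ 1]) auto
    next
      case (Suc m)
      then obtain N where N: "N > 0" "\<forall>k<m. \<exists>c::int. of_nat N * u (e k) = of_int c" by blast
      obtain a b where ab: "quotient_of (u (e m)) = (a, b)" by (cases "quotient_of (u (e m))") auto
      then have b0: "b > 0" using quotient_of_denom_pos by blast
      then have um: "of_int b * u (e m) = of_int a" using quotient_of_div[OF ab] by simp
      have "\<exists>c::int. of_nat (N * nat b) * u (e k) = of_int c" if k: "k < Suc m" for k
      proof (cases "k = m")
        case True
        have "of_nat (N * nat b) * u (e k) = of_int (int N * a)" using um b0 True by (simp add: mult.assoc)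
        then show ?thesis by blast
      next
        case False
        then obtain c where c: "of_nat N * u (e k) = of_int c" using N k by (metis less_SucE)
        have "of_nat (N * nat b) * u (e k) = of_int b * (of_nat N * u (e k))" using b0 by simp
        then show ?thesis unfolding c by (metis of_int_mult)
      qed
      then show ?case using N(1) b0 by (intro exI[of _ "N * nat b"]) auto
    qed
    then obtain N where N: "N > 0" "\<forall>k<d. \<exists>c::int. of_nat N * u (e k) = of_int c" by blast
    then obtain c where c: "\<And>k. k < d \<Longrightarrow> of_nat N * u (e k) = of_int (c k)" by metis
    have "of_nat N * v = (\<Sum>k<d. of_int (c k) * e k)"
      unfolding ue sum_distrib_left
    proof (intro sum.cong refl)
      fix k assume "k \<in> {..<d}"
      then have "of_rat (of_nat N * u (e k)) = (of_rat (of_int (c k)) :: complex)" using c by simp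
      then show "of_nat N * (of_rat (u (e k)) * e k) = of_int (c k) * e k" by (simp add: of_rat_mult)
    qed
    then show ?thesis using N by blast
  qed
  have exF: "\<exists>N>0. \<forall>v\<in>F. \<exists>c :: nat \<Rightarrow> int. of_nat N * v = (\<Sum>k<d. of_int (c k) * e k)" if "finite F" "F \<subseteq> V" for F
    using that
  proof (induction F rule: finite_induct)
    case empty show ?case by (intro exI[of _ 1]) auto
  next
    case (insert x F)
    then obtain N where N: "N > 0" "\<forall>v\<in>F. \<exists>c :: nat \<Rightarrow> int. of_nat N * v = (\<Sum>k<d. of_int (c k) * e k)" by auto
    obtain N' and c' :: "nat \<Rightarrow> int" where N': "N' > 0" "of_nat N' * x = (\<Sum>k<d. of_int (c' k) * e k)"
      using ex1[of x] insert.prems by blast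
    have "\<exists>c :: nat \<Rightarrow> int. of_nat (N * N') * v = (\<Sum>k<d. of_int (c k) * e k)" if v: "v \<in> insert x F" for v
    proof (cases "v = x")
      case True
      have "of_nat (N * N') * v = of_nat N * (of_nat N' * x)" using True by simp
      also have "\<dots> = (\<Sum>k<d. of_int (int N * c' k) * e k)" unfolding N' sum_distrib_left by (simp add: mult_ac)
      finally show ?thesis by (rule exI[of _ "\<lambda>k. int N * c' k"])
    next
      case False
      then obtain c :: "nat \<Rightarrow> int" where c: "of_nat N * v = (\<Sum>k<d. of_int (c k) * e k)" using N v by blast
      have "of_nat (N * N') * v = of_nat N' * (of_nat N * v)" by simp
      also have "\<dots> = (\<Sum>k<d. of_int (int N' * c k) * e k)" unfolding c sum_distrib_left by (simp add: mult_ac)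
      finally show ?thesis by (rule exI[of _ "\<lambda>k. int N' * c k"])
    qed
    then show ?case using N N' by (intro exI[of _ "N * N'"]) auto
  qed
  have eV: "e i \<in> V" if "i < d" for i using e B that by (auto simp: bij_betw_def)
  have Vm: "x * y \<in> V" if "x \<in> V" "y \<in> V" for x y using V that unfolding fin_alg_def by blast
  define P where "P = (\<lambda>(i, j). e i * e j) ` ({..<d} \<times> {..<d})"
  have P: "finite P" "P \<subseteq> V" unfolding P_def using eV Vm by auto
  obtain n where n: "n > 0" "\<And>v. v \<in> P \<Longrightarrow> \<exists>c :: nat \<Rightarrow> int. of_nat n * v = (\<Sum>k<d. of_int (c k) * e k)"
    using exF[OF P] by blast
  \<comment> \<open>The product of two rescaled basis elements is n times the integral combination
    that represents n times the product of the original ones; so one scaling by n suffices.\<close>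
  define \<omega> where "\<omega> i = of_nat n * e i" for i
  have resc: "\<exists>c :: nat \<Rightarrow> int. of_nat n * v = (\<Sum>k<d. of_int (c k) * \<omega> k)" if v: "\<exists>c :: nat \<Rightarrow> int. v = (\<Sum>k<d. of_int (c k) * e k)" for v
  proof -
    obtain c :: "nat \<Rightarrow> int" where c: "v = (\<Sum>k<d. of_int (c k) * e k)" using v by blast
    show ?thesis by (intro exI[of _ c]) (simp add: c \<omega>_def sum_distrib_left mult_ac)
  qed
  have fin: "\<exists>N>0. \<forall>v\<in>F. \<exists>c :: nat \<Rightarrow> int. of_nat N * v = (\<Sum>k<d. of_int (c k) * \<omega> k)" if F: "finite F" "F \<subseteq> V" for F
  proof -
    obtain N where N: "N > 0" "\<forall>v\<in>F. \<exists>c :: nat \<Rightarrow> int. of_nat N * v = (\<Sum>k<d. of_int (c k) * e k)" using exF[OF F] by blast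
    have "\<exists>c :: nat \<Rightarrow> int. of_nat (n * N) * v = (\<Sum>k<d. of_int (c k) * \<omega> k)" if "v \<in> F" for v
      using resc[OF bspec[OF N(2) that]] by (simp add: mult.assoc)
    then show ?thesis using N n by (intro exI[of _ "n * N"]) auto
  qed
  have V1: "{1} \<subseteq> V" using V unfolding fin_alg_def by (metis of_rat_1 empty_subsetI insert_subset)
  obtain M where M: "M > 0" "\<exists>c :: nat \<Rightarrow> int. of_nat M = (\<Sum>k<d. of_int (c k) * \<omega> k)" using fin[OF _ V1] by auto
  have no: "number_order d \<omega> M"
  proof
    show "M > 0" "\<exists>c :: nat \<Rightarrow> int. of_nat M = (\<Sum>k<d. of_int (c k) * \<omega> k)" by (rule M)+
    show "\<exists>c :: nat \<Rightarrow> int. \<omega> i * \<omega> j = (\<Sum>k<d. of_int (c k) * \<omega> k)" if "i < d" "j < d" for i j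
    proof -
      have "e i * e j \<in> P" unfolding P_def using that by force
      then have "\<exists>c :: nat \<Rightarrow> int. of_nat n * (of_nat n * (e i * e j)) = (\<Sum>k<d. of_int (c k) * \<omega> k)"
        by (intro resc n(2))
      then show ?thesis by (simp add: \<omega>_def mult_ac)
    qed
    show "\<forall>i<d. c i = 0" if "(\<Sum>i<d. of_int (c i) * \<omega> i) = 0" for c :: "nat \<Rightarrow> int"
    proof (intro allI impI)
      fix i assume i: "i < d"
      have "of_nat n * (\<Sum>i<d. of_int (c i) * e i) = 0" using that by (simp add: \<omega>_def sum_distrib_left mult_ac)
      then have z: "(\<Sum>i<d. of_int (c i) * e i) = 0" using n by simp
      define u where "u b = (of_int (c (inv_into {..<d} e b)) :: rat)" for b
      have inj: "inj_on e {..<d}" using e by (simp add: bij_betw_def)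
      have "(\<Sum>b\<in>B. of_rat (u b) * b) = (\<Sum>i<d. of_rat (u (e i)) * e i)"
        by (rule sum.reindex_bij_betw[OF e, symmetric])
      also have "\<dots> = (\<Sum>i<d. of_int (c i) * e i)" by (intro sum.cong) (auto simp: u_def inv_into_f_f[OF inj])
      finally have "(\<Sum>b\<in>B. of_rat (u b) * b) = 0" using z by simp
      moreover have "e i \<in> B" using e i by (auto simp: bij_betw_def)
      ultimately have "u (e i) = 0" using Q.independentD[OF B(2) \<open>finite B\<close> subset_refl] by blast
      then show "c i = 0" using i by (simp add: u_def inv_into_f_f[OF inj])
    qed
  qed
  have "of_rat (of_nat n) \<in> V" using V unfolding fin_alg_def by blast
  then have "\<omega> i \<in> V" if "i < d" for i unfolding \<omega>_def using Vm eV that by simp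
  then show ?thesis by (intro exI[of _ d] exI[of _ \<omega>] exI[of _ M] conjI allI impI no fin)
qed

lemma (in number_order) bdd_ex:
  assumes "\<exists>c :: nat \<Rightarrow> int. v = (\<Sum>k<d. of_int (c k) * \<omega> k)"
  shows "\<exists>b. \<forall>b'\<ge>b. bdd v (of_nat b')"
proof -
  obtain c :: "nat \<Rightarrow> int" where c: "v = (\<Sum>k<d. of_int (c k) * \<omega> k)" using assms by blast
  have "\<kappa> * \<bar>of_int (c i)\<bar> \<le> (\<Sum>k<d. \<kappa> * \<bar>of_int (c k)\<bar>)" if "i < d" for i
    using that \<kappa>_ge1 by (intro member_le_sum[of i "{..<d}" "\<lambda>i. \<kappa> * \<bar>of_int (c i)\<bar>"]) auto
  then have b: "bdd v (\<Sum>k<d. \<kappa> * \<bar>of_int (c k)\<bar>)" using c unfolding bdd_def by blast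
  obtain b :: nat where "(\<Sum>k<d. \<kappa> * \<bar>of_int (c k)\<bar>) \<le> of_nat b" using real_arch_simple by blast
  then have "\<forall>b'\<ge>b. bdd v (of_nat b')" using bdd_mono[OF b] by (meson of_nat_mono order_trans)
  then show ?thesis by blast
qed

text \<open>A multiple N x in the order has a cofactor \<beta> in the order whose product with it is
  a non-zero integer m, so 1 / x = N \<beta> / m.\<close>

lemma fin_alg_inverse:
  assumes V: "fin_alg V" and x: "x \<in> V" "x \<noteq> 0" shows "inverse x \<in> V"
proof -
  obtain d \<omega> M where no: "number_order d \<omega> M" and \<omega>V: "\<forall>i<d. \<omega> i \<in> V"
    and cl: "\<forall>F. finite F \<longrightarrow> F \<subseteq> V \<longrightarrow> (\<exists>N>0. \<forall>v\<in>F. \<exists>c :: nat \<Rightarrow> int. of_nat N * v = (\<Sum>k<d. of_int (c k) * \<omega> k))"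
    using fin_alg_number_order[OF V] by (elim exE conjE)
  interpret number_order d \<omega> M by (rule no)
  obtain N where N: "N > 0" "\<exists>c :: nat \<Rightarrow> int. of_nat N * x = (\<Sum>k<d. of_int (c k) * \<omega> k)"
    using cl[THEN spec, of "{x}"] x by auto
  obtain b1 where b1: "\<forall>b'\<ge>b1. bdd (of_nat N * x) (of_nat b')" using bdd_ex[OF N(2)] by blast
  obtain b2 where b2: "\<forall>b'\<ge>b2. bdd (of_nat M) (of_nat b')" using bdd_ex[OF M_mem] by blast
  have "\<exists>b. \<forall>b'\<ge>b. bdd (\<omega> i) (of_nat b')" if "i < d" for i
  proof (rule bdd_ex)
    have "(\<Sum>k<d. of_int (if k = i then 1 else 0) * \<omega> k) = (\<Sum>k<d. if k = i then \<omega> k else 0)"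
      by (intro sum.cong) auto
    then have "\<omega> i = (\<Sum>k<d. of_int (if k = i then 1 else 0) * \<omega> k)" using that by simp
    then show "\<exists>c :: nat \<Rightarrow> int. \<omega> i = (\<Sum>k<d. of_int (c k) * \<omega> k)" by (rule exI[of _ "\<lambda>k. if k = i then 1 else 0"])
  qed
  then obtain g where g: "\<And>i. i < d \<Longrightarrow> \<forall>b'\<ge>g i. bdd (\<omega> i) (of_nat b')" by metis
  define B0 where "B0 = Suc (\<Sum>i<d. g i)"
  have B0: "\<forall>i<d. bdd (\<omega> i) (of_nat B0)" "B0 \<ge> 1"
  proof (intro allI impI)
    fix i assume i: "i < d"
    then have "g i \<le> (\<Sum>i<d. g i)" by (intro member_le_sum) auto
    then have "g i \<le> B0" by (simp add: B0_def)
    then show "bdd (\<omega> i) (of_nat B0)" using g[OF i] by blast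
  qed (simp add: B0_def)
  have "of_nat N * x \<noteq> 0" using N x by simp
  then obtain \<beta> m where \<beta>: "m \<noteq> (0::int)" "of_nat N * x * \<beta> = of_int m" "\<exists>c :: nat \<Rightarrow> int. \<beta> = (\<Sum>i<d. of_int (c i) * \<omega> i)"
    using exists_multiple_int[OF _ _ _ refl B0, of "of_nat N * x" "max b1 b2"] b1 b2 by (auto simp del: of_nat_max)
  have Vm: "a * b \<in> V" if "a \<in> V" "b \<in> V" for a b using V that unfolding fin_alg_def by blast
  have Vr: "of_rat r \<in> V" for r using V unfolding fin_alg_def by blast
  obtain c :: "nat \<Rightarrow> int" where c: "\<beta> = (\<Sum>i<d. of_rat (of_int (c i)) * \<omega> i)" using \<beta>(3) by auto
  have "\<beta> \<in> V" unfolding c by (intro fin_alg_sum[OF V] Vm Vr) (use \<omega>V in auto)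
  then have "of_rat (of_nat N / of_int m) * \<beta> \<in> V" by (intro Vm Vr)
  moreover have "of_rat (of_nat N / of_int m) * \<beta> = inverse x"
    using \<beta>(1,2) x N by (simp add: of_rat_divide field_simps)
  ultimately show ?thesis by simp
qed


text \<open>In positive weight every monomial contains E_4 or E_6.\<close>

lemma MF_eq_0:
  assumes "MF w f" "w > 0" "q \<in> pdisc" "eis 4 q = 0" "eis 6 q = 0" shows "f q = 0"
  using assms(1,2) by (induction rule: MF.induct) (use assms(3-5) in auto)

text \<open>A combination of e D^2 e and (D e)^2 that is free of E_2 vanishes at q. By
  \<open>MF_poly\<close> the number is then a root of a rational polynomial; that this polynomial is
  not zero is seen near the cusp.\<close>

lemma eis_inflection_algebraic:
  assumes k: "even k" "k \<ge> 4" and q: "q \<in> pdisc"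
    and B: "bernoulli k \<noteq> 0" "bernoulli 4 \<noteq> 0" "bernoulli 6 \<noteq> 0"
    and z: "eisD 1 k q = 0" "eisD 2 k q = 0" and nz: "eis 4 q \<noteq> 0" "eis 6 q \<noteq> 0"
  shows "algebraic (eis 4 q ^ 3 / eis 6 q ^ 2)"
proof -
  obtain h j where h: "MF (k + 2) h" and j: "MF (k + 4) j"
    and D1: "\<And>q. q \<in> pdisc \<Longrightarrow> eisD 1 k q = of_nat k * eis 2 q * eis k q + h q"
    and D2: "\<And>q. q \<in> pdisc \<Longrightarrow> eisD 2 k q = of_nat k * ((5 * eis 4 q + eis 2 q ^ 2) * eis k q + eis 2 q * eisD 1 k q) +
       of_nat (k + 2) * eis 2 q * h q + j q"
    using second_order[OF k] by metis
  \<comment> \<open>The weight \<open>2 k + 4\<close> form \<open>k e D\<^sup>2 e - (k + 1) (D e)\<^sup>2\<close>, in which \<open>eis 2\<close> cancels.\<close>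
  define G where "G x = of_nat (5 * k ^ 2) * (eis 4 x * (eis k x * eis k x)) + (of_nat k * (eis k x * j x) + - of_nat (k + 1) * (h x * h x))" for x
  note e = MF_eis[OF k]
  have w: "4 + (k + k) = 2 * k + 4" "k + (k + 4) = 2 * k + 4" "(k + 2) + (k + 2) = 2 * k + 4" by simp_all
  have "MF (2 * k + 4) (\<lambda>x. of_nat (5 * k ^ 2) * (eis 4 x * (eis k x * eis k x)))"
    using MF_nat[OF MF.mult[OF MF.e4 MF.mult[OF e e]]] unfolding w .
  moreover have "MF (2 * k + 4) (\<lambda>x. of_nat k * (eis k x * j x))"
    using MF_nat[OF MF.mult[OF e j]] unfolding w .
  moreover have "MF (2 * k + 4) (\<lambda>x. - of_nat (k + 1) * (h x * h x))"
    using MF_neg_nat[OF MF.mult[OF h h]] unfolding w .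
  ultimately have G: "MF (2 * k + 4) G" unfolding G_def[abs_def] by (intro MF.add)
  have Geq: "G x = of_nat k * eis k x * eisD 2 k x - of_nat (k + 1) * eisD 1 k x ^ 2" if "x \<in> pdisc" for x
    unfolding G_def D2[OF that] D1[OF that] by (simp add: power2_eq_square algebra_simps)
  \<comment> \<open>As q tends to 0, e tends to B_k / k! and both D e / q and D^2 e / q tend to - 2
    / (k - 1)!. So G / q has a non-zero limit.\<close>
  have "((\<lambda>x. of_nat k * eis k x * (eisD 2 k x / x) - of_nat (k + 1) * eisD 1 k x * (eisD 1 k x / x)) \<longlongrightarrow>
      of_nat k * (of_real (bernoulli k) / fact k) * (- 2 / fact (k - 1)) - of_nat (k + 1) * 0 * (- 2 / fact (k - 1))) (at 0)"
    by (intro tendsto_intros eis_at_0 eisD_at_0)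
  moreover have "of_nat k * (of_real (bernoulli k) / fact k) * (- 2 / fact (k - 1)) - of_nat (k + 1) * 0 * (- 2 / fact (k - 1)) \<noteq> (0::complex)"
    using B(1) k by simp
  ultimately have "\<forall>\<^sub>F x in at 0. of_nat k * eis k x * (eisD 2 k x / x) - of_nat (k + 1) * eisD 1 k x * (eisD 1 k x / x) \<noteq> 0"
    by (rule tendsto_imp_eventually_ne)
  moreover have "\<forall>\<^sub>F x in at 0. eis 4 x \<noteq> 0" "\<forall>\<^sub>F x in at 0. eis 6 x \<noteq> 0"
    by (rule tendsto_imp_eventually_ne[OF eis_at_0], use B in simp)+
  moreover have "\<forall>\<^sub>F x in at (0::complex). x \<in> pdisc"
    unfolding eventually_at pdisc_def by (intro exI[of _ 1]) auto
  ultimately have "\<forall>\<^sub>F x in at 0. G x \<noteq> 0 \<and> eis 4 x \<noteq> 0 \<and> eis 6 x \<noteq> 0 \<and> x \<in> pdisc"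
  proof eventually_elim
    case (elim x)
    have "G x / x \<noteq> 0" using elim unfolding Geq[OF elim(4)] by (simp add: diff_divide_distrib power2_eq_square mult.assoc)
    then show ?case using elim by auto
  qed
  then obtain x where x: "G x \<noteq> 0" "eis 4 x \<noteq> 0" "eis 6 x \<noteq> 0" "x \<in> pdisc"
    using eventually_happens' at_neq_bot by blast
  obtain p :: "complex poly" where p: "\<forall>i. coeff p i \<in> \<rat>" "\<forall>q\<in>pdisc. eis 4 q \<noteq> 0 \<longrightarrow> eis 6 q \<noteq> 0 \<longrightarrow>
     G q = (eis 6 q / eis 4 q) ^ ((2 * k + 4) div 2) * poly p (eis 4 q ^ 3 / eis 6 q ^ 2)"
    using MF_poly[OF G] by blast
  have "p \<noteq> 0" using p(2) x by auto
  moreover have "poly p (eis 4 q ^ 3 / eis 6 q ^ 2) = 0"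
    using p(2) q nz Geq[OF q] z by auto
  ultimately show ?thesis using p(1) unfolding algebraic_altdef by blast
qed

text \<open>If both E_4 and E_6 are non-zero, l^2 = E_6 / E_4 turns both into one algebraic number.
  If only one is non-zero, a root of it as scale leaves the values 0 and 1. Both cannot vanish,
  since \<open>eis k q\<close> would vanish with them.\<close>

lemma eis_rescale:
  assumes k: "even k" "k \<ge> 4" and q: "q \<in> pdisc"
    and B: "bernoulli k \<noteq> 0" "bernoulli 4 \<noteq> 0" "bernoulli 6 \<noteq> 0"
    and z: "eis k q \<noteq> 0" "eisD 1 k q = 0" "eisD 2 k q = 0"
  obtains l V where "l \<noteq> 0" "fin_alg V" "eis 4 q / l ^ 4 \<in> V" "eis 6 q / l ^ 6 \<in> V"
proof -
  have r0: "0 \<in> range (of_rat :: rat \<Rightarrow> complex)" "1 \<in> range (of_rat :: rat \<Rightarrow> complex)"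
    by (rule range_eqI[of _ _ 0], simp, rule range_eqI[of _ _ 1], simp)
  have rt: "exp (Ln w / of_nat n) ^ n = w" if "w \<noteq> 0" "n > 0" for w n
    using that by (simp flip: exp_of_nat_mult)
  consider "eis 4 q \<noteq> 0" "eis 6 q \<noteq> 0" | "eis 4 q = 0" "eis 6 q \<noteq> 0" | "eis 4 q \<noteq> 0" "eis 6 q = 0"
    using MF_eq_0[OF MF_eis[OF k] _ q] z(1) k by force
  then show thesis
  proof cases
    case 1
    define l where "l = csqrt (eis 6 q / eis 4 q)"
    have l: "l \<noteq> 0" "l ^ 2 = eis 6 q / eis 4 q" using 1 by (auto simp: l_def)
    have "l ^ 4 = (l ^ 2) ^ 2" "l ^ 6 = (l ^ 2) ^ 3" by (simp_all flip: power_mult)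
    then have e: "eis 4 q / l ^ 4 = eis 4 q ^ 3 / eis 6 q ^ 2" "eis 6 q / l ^ 6 = eis 4 q ^ 3 / eis 6 q ^ 2"
      unfolding l using 1 by (simp_all add: power_divide power2_eq_square power3_eq_cube)
    obtain V where V: "fin_alg V" "eis 4 q ^ 3 / eis 6 q ^ 2 \<in> V"
      using fin_alg_algebraic[OF fin_alg_Rats eis_inflection_algebraic[OF k q B z(2,3) 1]] by blast
    show thesis using that[OF l(1) V(1)] V(2) unfolding e by blast
  next
    case 2
    define l where "l = exp (Ln (eis 6 q) / of_nat 6)"
    have "l ^ 6 = eis 6 q" unfolding l_def using 2 by (intro rt) auto
    then show thesis using that[OF _ fin_alg_Rats, of l] 2 r0 by (simp add: l_def)
  next
    case 3
    define l where "l = exp (Ln (eis 4 q) / of_nat 4)"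
    have "l ^ 4 = eis 4 q" unfolding l_def using 3 by (intro rt) auto
    then show thesis using that[OF _ fin_alg_Rats, of l] 3 r0 by (simp add: l_def)
  qed
qed

text \<open>The step that uses e not equal to 0: from k E_2 e = - 12 h the rescaled E_2 is a
  quotient of rescaled modular forms, hence lies in the same number field as the invariants and the
  half-period value.\<close>

theorem eis_no_inflection:
  assumes k: "even k" "k \<ge> 4" and q: "q \<in> pdisc"
    and B: "bernoulli k \<noteq> 0" "bernoulli 4 \<noteq> 0" "bernoulli 6 \<noteq> 0"
    and z: "eis k q \<noteq> 0" "eisD 1 k q = 0" "eisD 2 k q = 0"
  shows False
proof -
  obtain l V where l: "l \<noteq> 0" and V: "fin_alg V" "eis 4 q / l ^ 4 \<in> V" "eis 6 q / l ^ 6 \<in> V"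
    using eis_rescale[OF assms] by metis
  interpret nome q "Ln q" using nome_Ln q .
  define x where "x = wp (of_real pi * \<i>) / l ^ 2"
  \<comment> \<open>The cubic of \<open>wp\<close> at the half period, divided by 4 and rescaled:
    x^3 = - 15 (E_4-term) x - 35 (E_6-term).\<close>
  define c where "c j = (if j = 0 then of_rat (- 35) * (eis 6 q / l ^ 6) else if j = 1 then of_rat (- 15) * (eis 4 q / l ^ 4) else of_rat 0)" for j :: nat
  have Vr: "of_rat r \<in> V" for r using V(1) unfolding fin_alg_def by blast
  have Vm: "u * v \<in> V" if "u \<in> V" "v \<in> V" for u v using V(1) that unfolding fin_alg_def by blast
  have cV: "c j \<in> V" for j unfolding c_def by (simp only: Vr Vm V split: if_split) simp
  have "4 * wp (of_real pi * \<i>) ^ 3 + 60 * eis 4 q * wp (of_real pi * \<i>) + 140 * eis 6 q = 0"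
    using wp_cubic[OF pi_i_notin_\<Lambda>] half_period by simp
  then have "wp (of_real pi * \<i>) ^ 3 = - 35 * eis 6 q - 15 * eis 4 q * wp (of_real pi * \<i>)"
    by (simp add: algebra_simps) (algebra)
  then have "x ^ 3 = (- 35 * eis 6 q - 15 * eis 4 q * wp (of_real pi * \<i>)) / l ^ 6"
    by (simp add: x_def power_divide flip: power_mult)
  also have "\<dots> = (\<Sum>j<3. c j * x ^ j)"
    using l by (simp add: numeral_3_eq_3 c_def x_def diff_divide_distrib of_rat_minus flip: power_add)
  finally have x3: "x ^ 3 = (\<Sum>j<3. c j * x ^ j)" .
  obtain W where W: "fin_alg W" "V \<subseteq> W" "x \<in> W" using fin_alg_adjoin[OF V(1) cV zero_less_numeral x3] by blast
  have Wr: "of_rat r \<in> W" for r using W(1) unfolding fin_alg_def by blast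
  have Wa: "a + b \<in> W" "a * b \<in> W" if "a \<in> W" "b \<in> W" for a b using W(1) that unfolding fin_alg_def by blast+
  have W46: "eis 4 q / l ^ 4 \<in> W" "eis 6 q / l ^ 6 \<in> W" using V W by auto
  note val = MF_value[OF _ q l Wr Wa W46]
  obtain h where h: "MF (k + 2) h" and D1: "\<And>q. q \<in> pdisc \<Longrightarrow> eisD 1 k q = of_nat k * eis 2 q * eis k q + h q"
    using second_order[OF k] by metis
  define a where "a = of_rat (of_nat k) * (eis k q / l ^ k)"
  have a: "a \<in> W" unfolding a_def by (intro Wa(2) Wr val[OF MF_eis[OF k]])
  have a0: "a \<noteq> 0" unfolding a_def using k z l by auto
  have "of_nat k * eis 2 q * eis k q = - h q" using D1[OF q] z by (simp add: add_eq_0_iff2)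
  then have "eis 2 q / l ^ 2 = of_rat (- 1) * (h q / l ^ (k + 2)) * inverse a"
    using l k z(1) unfolding a_def by (simp add: field_simps power_add power2_eq_square of_rat_minus)
  moreover have "of_rat (- 1) * (h q / l ^ (k + 2)) * inverse a \<in> W"
    by (intro Wa(2) Wr val[OF h] fin_alg_inverse[OF W(1) a a0])
  ultimately have W2: "eis 2 q / l ^ 2 \<in> W" by simp
  obtain d \<omega> M where no: "number_order d \<omega> M"
    and cl: "\<forall>F. finite F \<longrightarrow> F \<subseteq> W \<longrightarrow> (\<exists>N>0. \<forall>v\<in>F. \<exists>c :: nat \<Rightarrow> int. of_nat N * v = (\<Sum>k<d. of_int (c k) * \<omega> k))"
    using fin_alg_number_order[OF W(1)] by (elim exE conjE)
  obtain N where N: "N > 0" "\<forall>v\<in>{eis 2 q / l ^ 2, eis 4 q / l ^ 4, x}. \<exists>c :: nat \<Rightarrow> int. of_nat N * v = (\<Sum>k<d. of_int (c k) * \<omega> k)"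
    using cl[THEN spec, of "{eis 2 q / l ^ 2, eis 4 q / l ^ 4, x}"] W2 W46 W by auto
  have bd: "\<exists>B. number_order.bdd d \<omega> (of_nat N * v) B" if "v \<in> {eis 2 q / l ^ 2, eis 4 q / l ^ 4, x}" for v
    using number_order.bdd_ex[OF no bspec[OF N(2) that]] by blast
  show False
    by (rule schneider[OF nome_Ln[OF q] no l N(1)]) (rule bd, simp add: x_def)+
qed


subsection \<open>Lattice sums at a triple zero\<close>

text \<open>The logarithmic derivative of 1 / (Gamma z Gamma (1 - z)) = sin (pi z) / pi, with the
  cotangent written in exponentials.\<close>

lemma Digamma_reflection:
  fixes z :: complex
  assumes "z \<notin> \<int>"
  shows "Digamma (1 - z) - Digamma z = pi * \<i> * (exp (2 * pi * \<i> * z) + 1) / (exp (2 * pi * \<i> * z) - 1)"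
proof -
  have z1: "z \<notin> \<int>\<^sub>\<le>\<^sub>0" using assms nonpos_Ints_Int by blast
  have "1 - z \<notin> \<int>" using assms Ints_diff[OF Ints_1, of "1 - z"] by auto
  then have z2: "1 - z \<notin> \<int>\<^sub>\<le>\<^sub>0" using nonpos_Ints_Int by blast
  have m: "((\<lambda>z. 1 - z) has_field_derivative (0 - 1)) (at z)" for z :: complex
    by (intro DERIV_diff DERIV_const DERIV_ident)
  have r: "((\<lambda>z. rGamma (1 - z)) has_field_derivative - rGamma (1 - z) * Digamma (1 - z) * (0 - 1)) (at z)"
    by (rule DERIV_chain2[of rGamma _ "\<lambda>z. 1 - z", OF has_field_derivative_rGamma_no_nonpos_int[OF z2] m])
  note a = has_field_derivative_rGamma_no_nonpos_int[OF z1, of UNIV]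
  note b = DERIV_mult[OF a r]
  have "((\<lambda>z. rGamma z * rGamma (1 - z)) has_field_derivative
      (- rGamma z * Digamma z) * rGamma (1 - z) + (- rGamma (1 - z) * Digamma (1 - z) * (0 - 1)) * rGamma z) (at z)"
    by (fact b)
  moreover have "((\<lambda>z. sin (of_real pi * z) / of_real pi) has_field_derivative (cos (of_real pi * z) * (of_real pi * 1)) / of_real pi) (at z)"
    by (rule DERIV_cdivide, rule DERIV_chain2, rule DERIV_sin, rule DERIV_cmult, rule DERIV_ident)
  ultimately have "(- rGamma z * Digamma z) * rGamma (1 - z) + (- rGamma (1 - z) * Digamma (1 - z) * (0 - 1)) * rGamma z
      = (cos (of_real pi * z) * (of_real pi * 1)) / of_real pi"
    unfolding rGamma_reflection_complex by (rule DERIV_unique)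
  then have "(rGamma z * rGamma (1 - z)) * (Digamma (1 - z) - Digamma z) = cos (of_real pi * z)"
    by (simp add: algebra_simps)
  then have eq: "sin (of_real pi * z) * (Digamma (1 - z) - Digamma z) = of_real pi * cos (of_real pi * z)"
    unfolding rGamma_reflection_complex by (simp add: field_simps)
  define u where "u = exp (\<i> * (of_real pi * z))"
  have u: "u \<noteq> 0" "exp (- (\<i> * (of_real pi * z))) = 1 / u" by (auto simp: u_def exp_minus field_simps)
  have u2: "exp (2 * pi * \<i> * z) = u ^ 2" unfolding u_def by (simp add: mult_ac flip: exp_of_nat_mult)
  have "u ^ 2 \<noteq> 1"
  proof
    assume "u ^ 2 = 1"
    then have "exp (2 * pi * \<i> * z) = 1" using u2 by simp
    then obtain n :: int where "Re (2 * pi * \<i> * z) = 0" "Im (2 * pi * \<i> * z) = of_int (2 * n) * pi" by (auto simp: exp_eq_1)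
    then have "z = of_int n" by (simp add: complex_eq_iff)
    then show False using assms by auto
  qed
  have "(u - 1 / u) / (2 * \<i>) * (Digamma (1 - z) - Digamma z) = pi * ((u + 1 / u) / 2)"
    using eq unfolding sin_exp_eq cos_exp_eq u_def[symmetric] u(2) by simp
  moreover have "(u ^ 2 - 1) * (Digamma (1 - z) - Digamma z) = (2 * \<i> * u) * ((u - 1 / u) / (2 * \<i>) * (Digamma (1 - z) - Digamma z))"
    using u(1) by (simp add: power2_eq_square) (simp add: field_simps)
  ultimately have "(u ^ 2 - 1) * (Digamma (1 - z) - Digamma z) = (2 * \<i> * u) * (pi * ((u + 1 / u) / 2))" by (simp only:)
  also have "\<dots> = pi * \<i> * (u ^ 2 + 1)" using u(1) by (simp add: power2_eq_square field_simps)
  finally have "(u ^ 2 - 1) * (Digamma (1 - z) - Digamma z) = pi * \<i> * (u ^ 2 + 1)" .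
  moreover have "u ^ 2 - 1 \<noteq> 0" using \<open>u ^ 2 \<noteq> 1\<close> by simp
  ultimately show ?thesis unfolding u2 by (subst eq_divide_eq) (simp add: mult.commute)
qed

text \<open>The polylogarithm of order - n, except that for n = 0 the term m = 0 contributes 0^0 =
  1.\<close>

definition pw :: "nat \<Rightarrow> complex \<Rightarrow> complex" where "pw n x = (\<Sum>m. of_nat m ^ n * x ^ m)"

lemma pw_summable: "norm x < 1 \<Longrightarrow> summable (\<lambda>m. norm (of_nat m ^ n * x ^ m :: complex))"
  using summable_power_geometric[of "norm x" n] by (simp add: norm_mult norm_power)

lemma pw_deriv:
  assumes "x \<noteq> 0" "norm x < 1"
  shows "(pw n has_field_derivative (pw (Suc n) x / x)) (at x)"
proof -
  obtain K where K: "norm x < K" "K < 1" using assms dense by blast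
  then have "K > 0" using norm_ge_zero[of x] by linarith
  then have nK: "norm x < norm (of_real K :: complex)" "norm (of_real K :: complex) < 1" using K by auto
  have d: "((\<lambda>x. \<Sum>m. of_nat m ^ n * x ^ m) has_field_derivative
     (\<Sum>m. diffs (\<lambda>m. of_nat m ^ n) m * x ^ m)) (at x)"
    by (rule termdiffs_strong[OF summable_norm_cancel[OF pw_summable[OF nK(2)]] nK(1)])
  have s: "summable (\<lambda>m. of_nat m ^ Suc n * x ^ m)" using summable_norm_cancel[OF pw_summable[OF assms(2)]] .
  have "(\<Sum>m. diffs (\<lambda>m. of_nat m ^ n) m * x ^ m) = (\<Sum>m. of_nat (Suc m) ^ Suc n * x ^ Suc m / x)"
    using assms by (intro suminf_cong) (simp add: diffs_def field_simps)
  also have "\<dots> = (\<Sum>m. of_nat (Suc m) ^ Suc n * x ^ Suc m) / x"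
    by (rule suminf_divide) (use s summable_Suc_iff[of "\<lambda>m. of_nat m ^ Suc n * x ^ m"] in blast)
  also have "(\<Sum>m. of_nat (Suc m) ^ Suc n * x ^ Suc m) = pw (Suc n) x"
    unfolding pw_def suminf_split_head[OF s] by simp
  finally show ?thesis using d unfolding pw_def[abs_def] by simp
qed

lemma Im_pos_not_nonpos_Int: "Im z \<noteq> 0 \<Longrightarrow> z \<notin> \<int>\<^sub>\<le>\<^sub>0" "Im z \<noteq> 0 \<Longrightarrow> 1 - z \<notin> \<int>\<^sub>\<le>\<^sub>0"
  by (auto elim!: nonpos_Ints_cases simp: complex_eq_iff)

lemma norm_exp_2pii_less: "Im z > 0 \<Longrightarrow> norm (exp (2 * pi * \<i> * z)) < 1"
  by (simp add: mult_pos_pos)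

text \<open>The case n = 0 is the reflection formula with the geometric series inserted;
  differentiating in z gives the rest. The subtracted 1 in that case removes the term m = 0 of
  \<open>pw\<close>.\<close>

lemma Polygamma_Fourier:
  assumes "Im z > 0"
  shows "(- 1) ^ n * Polygamma n (1 - z) - Polygamma n z =
    (if n = 0 then - pi * \<i> - 2 * pi * \<i> * (pw 0 (exp (2 * pi * \<i> * z)) - 1)
     else - ((2 * pi * \<i>) ^ Suc n) * pw n (exp (2 * pi * \<i> * z)))"
  using assms
proof (induction n arbitrary: z)
  case 0
  define q where "q = exp (2 * pi * \<i> * z)"
  have q: "norm q < 1" unfolding q_def by (rule norm_exp_2pii_less[OF 0])
  then have q1: "q \<noteq> 1" by auto
  have "z \<notin> \<int>" using 0 by (auto elim!: Ints_cases)
  then have "Digamma (1 - z) - Digamma z = pi * \<i> * ((q + 1) / (q - 1))"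
    using Digamma_reflection[of z] unfolding q_def[symmetric] by simp
  moreover have "pw 0 q = 1 / (1 - q)" unfolding pw_def using suminf_geometric[OF q] by simp
  moreover have "(q + 1) / (q - 1) = 1 - 2 * (1 / (1 - q))" using q1 by (simp add: divide_simps) (simp add: algebra_simps)
  ultimately have "Digamma (1 - z) - Digamma z = pi * \<i> * (1 - 2 * pw 0 q)" by (simp only:)
  then show ?case unfolding q_def[symmetric] by (simp add: algebra_simps)
next
  case (Suc n)
  define e where "e = (\<lambda>z. exp (2 * pi * \<i> * z))"
  let ?S = "{z. Im z > 0}"
  have S: "open ?S" "z \<in> ?S" using Suc.prems open_halfspace_Im_gt by auto
  have m: "((\<lambda>z. 1 - z) has_field_derivative (0 - 1)) (at z)" for z :: complex
    by (intro DERIV_diff DERIV_const DERIV_ident)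
  have r: "((\<lambda>z. Polygamma n (1 - z)) has_field_derivative Polygamma (Suc n) (1 - z) * (0 - 1)) (at z)"
    by (rule DERIV_chain2[of "Polygamma n" _ "\<lambda>z. 1 - z", OF has_field_derivative_Polygamma m])
      (rule Im_pos_not_nonpos_Int, use Suc.prems in simp)
  have L: "((\<lambda>z. (- 1) ^ n * Polygamma n (1 - z) - Polygamma n z) has_field_derivative
      (- 1) ^ n * (Polygamma (Suc n) (1 - z) * (0 - 1)) - Polygamma (Suc n) z) (at z)"
    by (intro DERIV_diff DERIV_cmult r has_field_derivative_Polygamma Im_pos_not_nonpos_Int) (use Suc.prems in auto)
  have e: "(e has_field_derivative (exp (2 * pi * \<i> * z) * (2 * pi * \<i> * 1))) (at z)" unfolding e_def
    by (rule DERIV_chain2, rule DERIV_exp, rule DERIV_cmult, rule DERIV_ident)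
  have en: "e z \<noteq> 0" "norm (e z) < 1" using norm_exp_2pii_less[OF Suc.prems] by (auto simp: e_def)
  have p: "((\<lambda>z. pw n (e z)) has_field_derivative (2 * pi * \<i> * pw (Suc n) (e z))) (at z)"
    using DERIV_chain2[of "pw n" _ e, OF pw_deriv[OF en] e] en by (simp add: e_def mult_ac)
  let ?R = "\<lambda>z. if n = 0 then - pi * \<i> - 2 * pi * \<i> * (pw 0 (e z) - 1) else - ((2 * pi * \<i>) ^ Suc n) * pw n (e z)"
  have R: "(?R has_field_derivative - ((2 * pi * \<i>) ^ Suc n) * (2 * pi * \<i> * pw (Suc n) (e z))) (at z)"
  proof (cases "n = 0")
    case True
    have "((\<lambda>z. - pi * \<i> - 2 * pi * \<i> * (pw n (e z) - 1)) has_field_derivative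
        0 - 2 * pi * \<i> * ((2 * pi * \<i> * pw (Suc n) (e z)) - 0)) (at z)"
      by (intro DERIV_diff DERIV_const DERIV_cmult p)
    then show ?thesis using True by simp
  next
    case False
    then show ?thesis using DERIV_cmult[OF p, of "- ((2 * pi * \<i>) ^ Suc n)"] by simp
  qed
  have "(- 1) ^ n * (Polygamma (Suc n) (1 - z) * (0 - 1)) - Polygamma (Suc n) z =
     - ((2 * pi * \<i>) ^ Suc n) * (2 * pi * \<i> * pw (Suc n) (e z))"
  proof (rule DERIV_unique[OF L])
    show "((\<lambda>z. (- 1) ^ n * Polygamma n (1 - z) - Polygamma n z) has_field_derivative
        - ((2 * pi * \<i>) ^ Suc n) * (2 * pi * \<i> * pw (Suc n) (e z))) (at z)"
      by (rule has_field_derivative_transform_within_open[OF R S]) (simp add: Suc.IH e_def)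
  qed
  then show ?case by (simp add: e_def)
qed

text \<open>Compare two expansions at z = 0: by reflection, v / (exp v - 1) at v = 2 pi i z equals 1
  - pi i z - z (Digamma (1 + z) - Digamma (1 - z)). Bernoulli numbers stand on the left, polygamma
  values at 1, that is zeta values, on the right.\<close>

theorem zeta_even:
  assumes k: "even k" "k \<ge> 2"
  shows "- of_real (bernoulli k) * (2 * pi * \<i>) ^ k / fact k = 2 * (\<Sum>i. 1 / of_nat (Suc i) ^ k)"
proof -
  define f where "f z = Digamma (1 + z) - Digamma (1 - z)" for z :: complex
  define F where "F = fps_expansion f 0"
  have T: "Digamma holomorphic_on ball (1::complex) 1"
  proof (intro holomorphic_intros)
    show "ball (1::complex) 1 \<inter> \<int>\<^sub>\<le>\<^sub>0 = {}"
    proof (safe, elim nonpos_Ints_cases)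
      fix x :: complex and n :: int
      assume x: "x \<in> ball 1 1" "x = of_int n" "n \<le> 0"
      have "norm (1 - x) \<ge> Re (1 - x)" by (rule complex_Re_le_cmod)
      then show "x \<in> {}" using x by (simp add: dist_norm)
    qed
  qed
  have b: "1 * w + 1 \<in> ball (1::complex) 1" "-1 * w + 1 \<in> ball (1::complex) 1" if "w \<in> ball 0 1" for w
    using that by (auto simp: dist_norm)
  have h1: "(\<lambda>w. Digamma (1 * w + 1)) holomorphic_on ball 0 1" "(\<lambda>w. Digamma (-1 * w + 1)) holomorphic_on ball (0::complex) 1"
    by (rule holomorphic_on_compose_gen[OF _ T, unfolded o_def], intro holomorphic_intros, use b in auto)+
  have fe: "f = (\<lambda>w. Digamma (1 * w + 1) - Digamma (-1 * w + 1))" by (rule ext) (simp add: f_def add.commute)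
  have fh: "f holomorphic_on ball 0 1" unfolding fe by (intro holomorphic_on_diff h1)
  have FF: "f has_fps_expansion F" unfolding F_def by (rule has_fps_expansion_fps_expansion[OF _ _ fh]) auto
  have d: "(deriv ^^ (k - 1)) f 0 = 2 * Polygamma (k - 1) 1"
  proof -
    have "(deriv ^^ (k - 1)) f 0 = (deriv ^^ (k - 1)) (\<lambda>w. Digamma (1 * w + 1)) 0 - (deriv ^^ (k - 1)) (\<lambda>w. Digamma (-1 * w + 1)) 0"
      unfolding fe by (rule higher_deriv_diff[OF h1]) auto
    also have "(deriv ^^ (k - 1)) (\<lambda>w. Digamma (1 * w + 1)) 0 = 1 ^ (k - 1) * (deriv ^^ (k - 1)) Digamma (1 * 0 + 1 :: complex)"
      by (rule higher_deriv_compose_linear'[OF T, of "ball 0 1"]) (use b in auto)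
    also have "(deriv ^^ (k - 1)) (\<lambda>w. Digamma (-1 * w + 1)) 0 = (-1) ^ (k - 1) * (deriv ^^ (k - 1)) Digamma (-1 * 0 + 1 :: complex)"
      by (rule higher_deriv_compose_linear'[OF T, of "ball 0 1"]) (use b in auto)
    also have "(-1) ^ (k - 1) = (-1 :: complex)" using k by simp
    finally show ?thesis by (simp add: higher_deriv_Polygamma)
  qed
  have Fk: "fps_nth F (k - 1) = 2 * (\<Sum>i. 1 / of_nat (Suc i) ^ k)"
  proof -
    have "fps_nth F (k - 1) = 2 * Polygamma (k - 1) 1 / fact (k - 1)" using fps_nth_fps_expansion[OF FF] d by simp
    also have "Polygamma (k - 1) 1 = (fact (k - 1) * (\<Sum>i. 1 / of_nat (Suc i) ^ k) :: complex)"
      using k by (simp add: Polygamma_def inverse_eq_divide add.commute)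
    finally show ?thesis by simp
  qed
  define c where "c = 2 * pi * \<i>"
  have B: "(\<lambda>z. (\<lambda>v. if v = 0 then 1 else v / (exp v - 1)) (c * z)) has_fps_expansion (Bf oo (fps_const c * fps_X))"
  proof -
    have "(\<lambda>z. c * z) has_fps_expansion (fps_const c * fps_X)" by (intro fps_expansion_intros)
    then have "((\<lambda>v. if v = 0 then 1 else v / (exp v - 1)) \<circ> (\<lambda>z. c * z)) has_fps_expansion (Bf oo (fps_const c * fps_X))"
      by (intro has_fps_expansion_compose[unfolded o_def[symmetric]] Bf_expansion) auto
    then show ?thesis by (simp only: o_def)
  qed
  have R: "(\<lambda>z. 1 - c / 2 * z - z * f z) has_fps_expansion (1 - fps_const (c / 2) * fps_X - fps_X * F)"
    by (intro fps_expansion_intros FF)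
  have "\<forall>\<^sub>F z in nhds 0. z \<in> ball (0::complex) 1" by (intro eventually_nhds_in_open) auto
  then have "\<forall>\<^sub>F z in nhds 0. (\<lambda>v. if v = 0 then 1 else v / (exp v - 1)) (c * z) = 1 - c / 2 * z - z * f z"
  proof eventually_elim
    case (elim z)
    show ?case
    proof (cases "z = 0")
      case False
      have zn: "z \<notin> \<int>"
      proof
        assume "z \<in> \<int>"
        then obtain n where n: "z = of_int n" by (elim Ints_cases)
        with False elim show False by (simp add: dist_norm)
      qed
      have c0: "c * z \<noteq> 0" using False by (simp add: c_def)
      have e1: "exp (c * z) \<noteq> 1"
      proof
        assume "exp (c * z) = 1"
        then obtain n :: int where "Re (c * z) = 0" "Im (c * z) = of_int (2 * n) * pi" by (auto simp: exp_eq_1)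
        then have "z = of_int n" by (simp add: complex_eq_iff c_def)
        then show False using zn by auto
      qed
      have "Digamma (z + 1) = Digamma z + 1 / z" using Digamma_plus1[OF False] by simp
      then have "f z = 1 / z - pi * \<i> * (exp (c * z) + 1) / (exp (c * z) - 1)"
        using Digamma_reflection[OF zn] unfolding f_def c_def by (simp add: add.commute algebra_simps)
      also have "pi * \<i> = c / 2" by (simp add: c_def)
      finally show ?thesis using c0 e1 False by (simp add: divide_simps) (simp add: algebra_simps)
    qed simp
  qed
  then have "(\<lambda>z. 1 - c / 2 * z - z * f z) has_fps_expansion (Bf oo (fps_const c * fps_X))"
    using B unfolding has_fps_expansion_def by (auto elim: eventually_elim2)
  then have "Bf oo (fps_const c * fps_X) = 1 - fps_const (c / 2) * fps_X - fps_X * F"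
    by (rule fps_expansion_unique_complex[OF _ R])
  then have "fps_nth (Bf oo (fps_const c * fps_X)) k = fps_nth (1 - fps_const (c / 2) * fps_X - fps_X * F) k" by simp
  moreover have "fps_nth (Bf oo (fps_const c * fps_X)) k = c ^ k * fps_nth Bf k"
    unfolding fps_compose_linear by simp
  moreover have "fps_nth (1 - fps_const (c / 2) * fps_X - fps_X * F) k = - fps_nth F (k - 1)"
    using k by (cases k) auto
  ultimately have "c ^ k * fps_nth Bf k = - fps_nth F (k - 1)" by simp
  then show ?thesis unfolding Bf_nth Fk c_def by (simp add: mult_ac)
qed

lemma bernoulli_even_nonzero:
  assumes k: "even k" "k \<ge> 2" shows "bernoulli k \<noteq> 0"
proof
  assume "bernoulli k = 0"
  then have z: "(\<Sum>i. 1 / of_nat (Suc i) ^ k) = (0 :: complex)" using zeta_even[OF k] by simp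
  have s: "summable (\<lambda>i. 1 / of_nat (Suc i) ^ k :: real)"
    using inverse_power_summable[OF k(2), where ?'a = real] summable_Suc_iff[of "\<lambda>n. inverse (of_nat n ^ k) :: real"]
    by (simp add: inverse_eq_divide)
  have "(\<Sum>i. 1 / of_nat (Suc i) ^ k :: real) > 0" by (rule suminf_pos[OF s]) simp
  moreover have "of_real (\<Sum>i. 1 / of_nat (Suc i) ^ k) = (0 :: complex)"
    using suminf_of_real[OF s, where ?'a = complex] z by simp
  ultimately show False by (simp only: of_real_eq_0_iff)
qed


section \<open>Eisenstein series and their derivatives as lattice sums\<close>

lemma has_sum_int_split:
  fixes f :: "int \<Rightarrow> complex"
  assumes "((\<lambda>i. f (int i)) has_sum a) UNIV" "((\<lambda>i. f (- int (Suc i))) has_sum b) UNIV"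
  shows "(f has_sum (a + b)) UNIV"
proof -
  have 1: "(f has_sum a) {0..}"
    by (rule iffD1[OF has_sum_reindex_bij_witness[of _ nat int] assms(1)]) auto
  have 2: "(f has_sum b) {..<0}"
    by (rule iffD1[OF has_sum_reindex_bij_witness[of _ "\<lambda>d. nat (- d - 1)" "\<lambda>i. - int (Suc i)"] assms(2)]) auto
  have "{0..} \<union> {..<0} = (UNIV :: int set)" by auto
  then show ?thesis using has_sum_Un_disjoint[OF 1 2] by (simp add: disjoint_iff)
qed

lemma summable_on_int_inverse_square: "(\<lambda>c. 1 / (1 + (of_int c :: real) ^ 2)) summable_on (UNIV :: int set)"
proof -
  have s: "(\<lambda>i::nat. 1 / (1 + (of_nat i :: real) ^ 2)) summable_on UNIV"
  proof (subst summable_on_UNIV_nonneg_real_iff)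
    have "summable (\<lambda>n. inverse (real n ^ 2))" by (rule inverse_power_summable) simp
    then have "summable (\<lambda>i. inverse (real (Suc i) ^ 2))" by (subst summable_Suc_iff)
    then have "summable (\<lambda>i. 1 / (1 + (of_nat (Suc i) :: real) ^ 2))"
    proof (rule summable_comparison_test'[where N = 0])
      fix i :: nat
      show "norm (1 / (1 + real (Suc i) ^ 2)) \<le> inverse (real (Suc i) ^ 2)"
        using frac_le[of 1 1 "real (Suc i) ^ 2" "1 + real (Suc i) ^ 2"] by (simp add: inverse_eq_divide del: of_nat_Suc)
    qed
    then show "summable (\<lambda>i. 1 / (1 + (of_nat i :: real) ^ 2))" by (subst (asm) summable_Suc_iff)
  qed simp
  have 1: "(\<lambda>c. 1 / (1 + (of_int c :: real) ^ 2)) summable_on range int"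
    by (subst summable_on_reindex) (use s in \<open>auto simp: o_def inj_def\<close>)
  have 2: "(\<lambda>c. 1 / (1 + (of_int c :: real) ^ 2)) summable_on range (\<lambda>i. - int i)"
    by (subst summable_on_reindex) (use s in \<open>auto simp: o_def inj_def\<close>)
  have "range int \<union> range (\<lambda>i. - int i) = UNIV"
  proof -
    have "x \<in> range int \<union> range (\<lambda>i. - int i)" for x :: int by (cases x rule: int_cases2) auto
    then show ?thesis by auto
  qed
  then show ?thesis using summable_on_Un_disjoint[OF 1, of "range (\<lambda>i. - int i) - range int"]
      summable_on_subset[OF 2, of "range (\<lambda>i. - int i) - range int"] by auto
qed

text \<open>Equivalence of norms on the plane; \<open>M\<close> comes from writing d as (c Re z + d)
  - c Re z.\<close>

lemma lattice_norm_lower: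
  assumes "Im z > 0"
  obtains M where "M \<ge> 1" "\<And>c d :: real. c ^ 2 + d ^ 2 \<le> M * norm (of_real c * z + of_real d) ^ 2"
proof -
  define x y where "x = Re z" and "y = Im z"
  define M where "M = 2 + (1 + 2 * x ^ 2) / y ^ 2"
  have y: "y > 0" using assms by (simp add: y_def)
  have "c ^ 2 + d ^ 2 \<le> M * norm (of_real c * z + of_real d) ^ 2" for c d :: real
  proof -
    have n: "norm (of_real c * z + of_real d) ^ 2 = (c * x + d) ^ 2 + (c * y) ^ 2"
      by (simp add: cmod_power2 x_def y_def)
    have "d ^ 2 \<le> 2 * (c * x + d) ^ 2 + 2 * c ^ 2 * x ^ 2"
      using zero_le_power2[of "2 * c * x + d"] by (simp add: power2_eq_square algebra_simps)
    then have "c ^ 2 + d ^ 2 \<le> 2 * (c * x + d) ^ 2 + c ^ 2 * (1 + 2 * x ^ 2)" by (simp add: algebra_simps)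
    also have "c ^ 2 * (1 + 2 * x ^ 2) = (1 + 2 * x ^ 2) / y ^ 2 * (c * y) ^ 2" using y by (simp add: power_mult_distrib)
    also have "2 * (c * x + d) ^ 2 + \<dots> \<le> M * (c * x + d) ^ 2 + M * (c * y) ^ 2"
      unfolding M_def by (intro add_mono mult_right_mono) auto
    finally show ?thesis unfolding n by (simp add: algebra_simps)
  qed
  moreover have "M \<ge> 1" unfolding M_def using y by simp
  ultimately show thesis using that by blast
qed

text \<open>The factor c^p is absorbed by p of the powers in the denominator, and four of the others
  give decay like 1 / (c^2 + d^2)^2, which a product of two one-dimensional series
  dominates.\<close>

lemma lattice_summable:
  assumes "Im z > 0" "k \<ge> 4"
  shows "(\<lambda>(c :: int, d :: int). norm (of_int c ^ p / (of_int c * z + of_int d) ^ (k + p))) summable_on UNIV"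
proof -
  obtain M where M: "M \<ge> 1" "\<And>c d :: real. c ^ 2 + d ^ 2 \<le> M * norm (of_real c * z + of_real d) ^ 2"
    using lattice_norm_lower[OF assms(1)] by blast
  define w where "w c = 1 / (1 + (of_int c :: real) ^ 2)" for c :: int
  define K where "K = M ^ p * (M ^ (k - 4) * (3 * M ^ 2))"
  have "(\<lambda>(c, d). w c * w d) summable_on (UNIV \<times> UNIV)"
    by (rule summable_on_times_nonneg) (use summable_on_int_inverse_square in \<open>auto simp: w_def\<close>)
  then have s: "(\<lambda>(c, d). K * (w c * w d)) summable_on UNIV"
    using summable_on_cmult_right[of "\<lambda>(c, d). w c * w d" UNIV K] by (simp add: case_prod_unfold)
  show ?thesis
  proof (rule summable_on_comparison_test[OF s])
    fix cd :: "int \<times> int"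
    obtain c d where cd: "cd = (c, d)" by (cases cd) auto
    define W where "W = norm (of_int c * z + of_int d :: complex)"
    have "norm (of_int c ^ p / (of_int c * z + of_int d) ^ (k + p)) \<le> K * (w c * w d)"
    proof (cases "cd = (0, 0)")
      \<comment> \<open>The origin is part of the index set; its term is a division by zero with
        value 0.\<close>
      case True
      have "K \<ge> 0" using M(1) by (simp add: K_def)
      then have "0 \<le> K * (w c * w d)" by (simp add: w_def)
      moreover have "(of_int c * z + of_int d) ^ (k + p) = 0" using True assms(2) by (simp add: cd power_0_left)
      then have "norm (of_int c ^ p / (of_int c * z + of_int d) ^ (k + p)) = 0"
        by (simp only: division_ring_divide_zero norm_zero)
      ultimately show ?thesis by (simp only:)
    next
      case False
      define s where "s = (of_int c :: real) ^ 2 + of_int d ^ 2"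
      have "0 < c ^ 2 + d ^ 2" using False by (simp add: cd sum_power2_gt_zero_iff)
      then have "1 \<le> c ^ 2 + d ^ 2" by linarith
      then have "real_of_int 1 \<le> real_of_int (c ^ 2 + d ^ 2)" by (simp only: of_int_le_iff)
      then have s1: "s \<ge> 1" by (simp add: s_def)
      have sM: "s \<le> M * W ^ 2" using M(2)[of "of_int c" "of_int d"] by (simp add: s_def W_def)
      have W0: "W > 0" using sM s1 M by (cases "W = 0") (auto simp: W_def)
      have MM: "M * W ^ 2 \<le> (M * W) ^ 2" using M(1) W0 by (simp add: power2_eq_square)
      have MW1: "1 \<le> M * W"
        by (rule power2_le_imp_le) (use s1 sM MM M W0 in auto)
      have cW: "\<bar>of_int c\<bar> \<le> M * W"
      proof (rule power2_le_imp_le)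
        show "\<bar>real_of_int c\<bar> ^ 2 \<le> (M * W) ^ 2"
          using sM MM zero_le_power2[of "of_int d :: real"] unfolding s_def power2_abs by linarith
      qed (use M W0 in simp)
      have e1: "\<bar>of_int c\<bar> ^ p / W ^ p \<le> M ^ p"
        using power_mono[OF cW, of p] W0 by (simp add: power_mult_distrib divide_le_eq)
      have e2: "1 / W ^ (k - 4) \<le> M ^ (k - 4)"
        using one_le_power[OF MW1, of "k - 4"] W0 by (simp add: power_mult_distrib divide_le_eq)
      have "s ^ 2 \<le> (M * W ^ 2) ^ 2" using sM s1 by (intro power_mono) auto
      then have "s ^ 2 \<le> M ^ 2 * W ^ 4" by (simp add: power_mult_distrib flip: power_mult)
      moreover have "(1 + of_int c ^ 2) * (1 + of_int d ^ 2) \<le> 3 * s ^ 2"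
      proof -
        have "(of_int c :: real) ^ 2 * of_int d ^ 2 \<le> s * s"
          unfolding s_def by (intro mult_mono) auto
        moreover have "1 * s \<le> s * s" using s1 by (intro mult_right_mono) auto
        moreover have "(1 + (of_int c :: real) ^ 2) * (1 + of_int d ^ 2) = 1 + s + of_int c ^ 2 * of_int d ^ 2"
          by (simp add: s_def algebra_simps)
        ultimately show ?thesis using s1 unfolding power2_eq_square[of s] by linarith
      qed
      ultimately have "(1 + of_int c ^ 2) * (1 + of_int d ^ 2) \<le> 3 * (M ^ 2 * W ^ 4)" by linarith
      then have "1 / W ^ 4 \<le> (3 * M ^ 2) * (1 / ((1 + of_int c ^ 2) * (1 + of_int d ^ 2)))"
        using W0 by (simp add: divide_simps add_pos_nonneg mult.assoc)
      then have e3: "1 / W ^ 4 \<le> (3 * M ^ 2) * (w c * w d)" by (simp add: w_def)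
      have ww: "w c * w d \<ge> 0" by (simp add: w_def)
      have "norm (of_int c ^ p / (of_int c * z + of_int d) ^ (k + p)) = \<bar>of_int c\<bar> ^ p / W ^ (k + p)"
        by (simp add: norm_divide norm_power W_def)
      also have "\<dots> = (\<bar>of_int c\<bar> ^ p / W ^ p) * ((1 / W ^ (k - 4)) * (1 / W ^ 4))"
      proof -
        have "k + p = p + ((k - 4) + 4)" using assms(2) by simp
        then have "W ^ (k + p) = W ^ p * (W ^ (k - 4) * W ^ 4)" by (simp only: power_add)
        then show ?thesis by simp
      qed
      also have "\<dots> \<le> M ^ p * (M ^ (k - 4) * ((3 * M ^ 2) * (w c * w d)))"
        using e1 e2 e3 M W0 ww by (intro mult_mono) auto
      finally show ?thesis by (simp add: K_def mult_ac)
    qed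
    then show "(case cd of (c, d) \<Rightarrow> norm (of_int c ^ p / (of_int c * z + of_int d) ^ (k + p))) \<le> (case cd of (c, d) \<Rightarrow> K * (w c * w d))"
      by (simp add: cd)
  qed (auto simp: K_def w_def)
qed

text \<open>The halves d >= 0 and d < 0 are polygamma series at z and at 1 - z, joined by
  \<open>Polygamma_Fourier\<close>.\<close>

theorem Lipschitz_formula:
  assumes z: "Im z > 0" and n: "n \<ge> 3"
  shows "((\<lambda>d :: int. 1 / (z + of_int d) ^ Suc n) has_sum ((- 2 * pi * \<i>) ^ Suc n / fact n * pw n (exp (2 * pi * \<i> * z)))) UNIV"
proof -
  have "(\<lambda>(c :: int, d :: int). norm (of_int c ^ 0 / (of_int c * z + of_int d) ^ (Suc n + 0))) summable_on Pair 1 ` UNIV"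
    by (rule summable_on_subset[OF lattice_summable]) (use z n in auto)
  then have "(\<lambda>d :: int. norm (1 / (z + of_int d) ^ Suc n)) summable_on UNIV"
    by (subst (asm) summable_on_reindex) (auto simp: inj_def o_def)
  then have s: "(\<lambda>d :: int. 1 / (z + of_int d) ^ Suc n) summable_on UNIV" by (rule abs_summable_summable)
  have s1: "(\<lambda>i. 1 / (z + of_int (int i)) ^ Suc n) summable_on UNIV"
    using summable_on_reindex[of int UNIV "\<lambda>d. 1 / (z + of_int d) ^ Suc n"] summable_on_subset[OF s subset_UNIV, of "range int"]
    by (simp add: inj_def o_def)
  have s2: "(\<lambda>i. 1 / (z + of_int (- int (Suc i))) ^ Suc n) summable_on UNIV"
    using summable_on_reindex[of "\<lambda>i. - int (Suc i)" UNIV "\<lambda>d. 1 / (z + of_int d) ^ Suc n"]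
      summable_on_subset[OF s subset_UNIV, of "range (\<lambda>i. - int (Suc i))"]
    by (simp add: inj_def o_def del: of_nat_Suc of_int_minus)
  obtain a b where a: "((\<lambda>i. 1 / (z + of_int (int i)) ^ Suc n) has_sum a) UNIV"
    and b: "((\<lambda>i. 1 / (z + of_int (- int (Suc i))) ^ Suc n) has_sum b) UNIV"
    using s1 s2 unfolding summable_on_def by blast
  have "a = (\<Sum>i. inverse ((z + of_nat i) ^ Suc n))"
    using has_sum_imp_sums[OF a] by (simp add: sums_iff inverse_eq_divide)
  then have Pa: "Polygamma n z = (-1) ^ Suc n * fact n * a" using n by (simp add: Polygamma_def)
  have neg: "1 / (z + of_int (- int (Suc i))) ^ Suc n = (-1) ^ Suc n * inverse ((1 - z + of_nat i) ^ Suc n)" for i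
  proof -
    have "z + of_int (- int (Suc i)) = - (1 - z + of_nat i)" by simp
    then show ?thesis by (simp only: power_minus[of "1 - z + of_nat i"]) (simp add: divide_simps)
  qed
  have "(\<lambda>i. (-1) ^ Suc n * inverse ((1 - z + of_nat i) ^ Suc n)) sums b"
    using has_sum_imp_sums[OF b] unfolding neg .
  then have "(\<lambda>i. (-1) ^ Suc n * ((-1) ^ Suc n * inverse ((1 - z + of_nat i) ^ Suc n))) sums ((-1) ^ Suc n * b)"
    by (rule sums_mult)
  then have "(\<lambda>i. inverse ((1 - z + of_nat i) ^ Suc n)) sums ((-1) ^ Suc n * b)"
    by (simp flip: mult.assoc power_add)
  then have Pb: "Polygamma n (1 - z) = (-1) ^ Suc n * fact n * ((-1) ^ Suc n * b)" using n by (simp add: Polygamma_def sums_iff)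
  have "(- 1) ^ n * Polygamma n (1 - z) - Polygamma n z = - ((2 * pi * \<i>) ^ Suc n * pw n (exp (2 * pi * \<i> * z)))"
    using Polygamma_Fourier[OF z, of n] n by simp
  then have "(- 1) ^ n * fact n * (a + b) = - ((2 * pi * \<i>) ^ Suc n * pw n (exp (2 * pi * \<i> * z)))"
    unfolding Pa Pb by (simp add: algebra_simps flip: power_add)
  then have "(- 1) ^ n * ((- 1) ^ n * fact n * (a + b)) = (- 1) ^ n * - ((2 * pi * \<i>) ^ Suc n * pw n (exp (2 * pi * \<i> * z)))" by simp
  then have "fact n * (a + b) = (- 2 * pi * \<i>) ^ Suc n * pw n (exp (2 * pi * \<i> * z))"
    using power_minus[of "2 * pi * \<i>" "Suc n"] by (simp flip: mult.assoc power_add)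
  then have "a + b = (- 2 * pi * \<i>) ^ Suc n / fact n * pw n (exp (2 * pi * \<i> * z))"
    by (simp add: field_simps)
  then show ?thesis using has_sum_int_split[OF a b] by simp
qed


lemma has_sum_unique_summable:
  fixes f :: "'a \<Rightarrow> complex" assumes "f summable_on A" "B \<subseteq> A" obtains S where "(f has_sum S) B"
  using summable_on_subset[OF assms] unfolding summable_on_def by blast

text \<open>Up to a constant this is the p-th derivative in z of the Eisenstein series. Rows with c
  > 0 follow from Lipschitz's formula, those with c < 0 agree with them by symmetry, and the row c =
  0 survives only for p = 0, as twice a zeta value.\<close>

theorem lattice_sum:
  assumes z: "Im z > 0" and k: "even k" "k \<ge> 4"
  shows "((\<lambda>(c :: int, d :: int). of_int c ^ p / (of_int c * z + of_int d) ^ (k + p)) has_sum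
     (2 * ((- 2 * pi * \<i>) ^ (k + p) / fact (k + p - 1) * lam p (k - 1) (exp (2 * pi * \<i> * z))) +
      (if p = 0 then 2 * (\<Sum>i. 1 / of_nat (Suc i) ^ k) else 0))) UNIV"
proof -
  define A where "A = (\<lambda>(c :: int, d :: int). of_int c ^ p / (of_int c * z + of_int d) ^ (k + p))"
  define q where "q = exp (2 * pi * \<i> * z)"
  define C where "C = (- 2 * pi * \<i>) ^ (k + p) / fact (k + p - 1)"
  have nq: "norm q < 1" unfolding q_def by (rule norm_exp_2pii_less[OF z])
  have "(\<lambda>cd. norm (A cd)) summable_on UNIV"
    using lattice_summable[OF z k(2), of p] by (simp add: A_def case_prod_unfold)
  then have s: "A summable_on UNIV" by (rule abs_summable_summable)
  obtain n where n: "k + p = Suc n" "n \<ge> 3" using k by (cases "k + p") auto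
  obtain P where P: "(A has_sum P) ({1..} \<times> UNIV)" using has_sum_unique_summable[OF s] by blast
  have inner: "((\<lambda>d. A (c, d)) has_sum (of_int c ^ p * (C * pw n (q ^ nat c)))) UNIV" if "c \<in> {1..}" for c
  proof -
    have "Im (of_int c * z) > 0" using that z by simp
    from has_sum_cmult_right[OF Lipschitz_formula[OF this n(2)], of "of_int c ^ p"]
    have "((\<lambda>d. A (c, d)) has_sum (of_int c ^ p * (C * pw n (exp (2 * pi * \<i> * (of_int c * z)))))) UNIV"
      using n(1) by (simp add: A_def C_def)
    moreover have "exp (2 * pi * \<i> * (of_int c * z)) = q ^ nat c"
      using that unfolding q_def by (simp add: exp_of_nat_mult[symmetric] mult_ac)
    ultimately show ?thesis by simp
  qed
  have "((\<lambda>c. of_int c ^ p * (C * pw n (q ^ nat c))) has_sum P) {1..}"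
    by (rule has_sum_SigmaD[OF P inner])
  then have Pc: "((\<lambda>m. of_nat m ^ p * (C * pw n (q ^ m))) has_sum P) {1..}"
    by (rule iffD1[OF has_sum_reindex_bij_witness[of _ int nat], rotated -1]) auto
  have "((\<lambda>m. of_nat m ^ p * pw n (q ^ m)) has_sum lam p (k - 1) q) {1..}"
  proof (rule has_sum_SigmaD[OF lambert_has_sum(1)[OF nq]])
    fix m :: nat assume m: "m \<in> {1..}"
    have qm: "norm (q ^ m) < 1" using m nq by (simp add: norm_power power_less_one_iff)
    have "(\<lambda>j. of_nat j ^ n * (q ^ m) ^ j) sums pw n (q ^ m)"
      unfolding pw_def by (rule summable_sums[OF summable_norm_cancel[OF pw_summable[OF qm]]])
    then have "((\<lambda>j. of_nat j ^ n * (q ^ m) ^ j) has_sum pw n (q ^ m)) UNIV"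
      by (rule norm_summable_imp_has_sum[OF pw_summable[OF qm]])
    then have "((\<lambda>j. of_nat j ^ n * (q ^ m) ^ j) has_sum pw n (q ^ m)) {1..}"
      by (rule iffD1[OF has_sum_cong_neutral, rotated -1]) (use n(2) in auto)
    from has_sum_cmult_right[OF this, of "of_nat m ^ p"]
    have "((\<lambda>j. of_nat m ^ p * (of_nat j ^ n * (q ^ m) ^ j)) has_sum (of_nat m ^ p * pw n (q ^ m))) {1..}" .
    moreover have "of_nat m ^ p * (of_nat j ^ n * (q ^ m) ^ j) = (of_nat (m * j) ^ p * of_nat j ^ (k - 1) * q ^ (m * j) :: complex)" for j
    proof -
      have "n = p + (k - 1)" using n k by simp
      then show ?thesis by (simp add: power_add power_mult_distrib mult_ac flip: power_mult)
    qed
    ultimately show "((\<lambda>y. case (m, y) of (m, n) \<Rightarrow> of_nat (m * n) ^ p * of_nat n ^ (k - 1) * q ^ (m * n)) has_sum (of_nat m ^ p * pw n (q ^ m))) {1..}"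
      by simp
  qed
  from has_sum_cmult_right[OF this, of C]
  have "((\<lambda>m. of_nat m ^ p * (C * pw n (q ^ m))) has_sum (C * lam p (k - 1) q)) {1..}" by (simp add: mult_ac)
  then have Peq: "P = C * lam p (k - 1) q" using has_sum_unique[OF Pc] by blast
  have N: "(A has_sum P) ({..-1} \<times> UNIV)"
  proof (rule iffD1[OF has_sum_reindex_bij_witness[of _ "\<lambda>(c, d). (- c, - d)" "\<lambda>(c, d). (- c, - d)"] P])
    show "A (case cd of (c, d) \<Rightarrow> (- c, - d)) = A cd" for cd
    proof -
      obtain c d where cd: "cd = (c, d)" by (cases cd) auto
      have e: "of_int (- c) * z + of_int (- d) = - (of_int c * z + of_int d)" by simp
      have "(- (of_int c * z + of_int d)) ^ (k + p) = (-1) ^ p * (of_int c * z + of_int d) ^ (k + p)"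
        unfolding power_minus[of "of_int c * z + of_int d"] using k by (simp add: power_add)
      moreover have "(of_int (- c) :: complex) ^ p = (-1) ^ p * of_int c ^ p" using power_minus[of "of_int c :: complex" p] by simp
      ultimately show ?thesis unfolding A_def cd prod.case e by simp
    qed
  qed auto
  have Z: "(A has_sum (if p = 0 then 2 * (\<Sum>i. 1 / of_nat (Suc i) ^ k) else 0)) ({0} \<times> UNIV)"
  proof (cases "p = 0")
    case False
    then have "(A has_sum 0) ({0} \<times> UNIV)" by (intro has_sum_0) (auto simp: A_def)
    then show ?thesis using False by simp
  next
    case True
    have sk: "summable (\<lambda>i. norm (1 / of_nat (Suc i) ^ k :: complex))"
      using inverse_power_summable[of k, where ?'a = real] k summable_Suc_iff[of "\<lambda>n. inverse (of_nat n ^ k) :: real"]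
      by (simp add: inverse_eq_divide norm_divide norm_power del: of_nat_Suc)
    have h: "((\<lambda>i. 1 / of_nat (Suc i) ^ k :: complex) has_sum (\<Sum>i. 1 / of_nat (Suc i) ^ k)) UNIV"
      by (rule norm_summable_imp_has_sum[OF sk summable_sums[OF summable_norm_cancel[OF sk]]])
    have h1: "((\<lambda>i. 1 / of_int (int i) ^ k :: complex) has_sum (\<Sum>i. 1 / of_nat (Suc i) ^ k)) UNIV"
    proof -
      have "((\<lambda>i. 1 / of_nat i ^ k :: complex) has_sum (\<Sum>i. 1 / of_nat (Suc i) ^ k)) {1..}"
        using h by (subst has_sum_atLeast1)
      then show ?thesis
        by (rule iffD1[OF has_sum_cong_neutral, rotated -1]) (use k in \<open>auto simp: not_le power_0_left\<close>)
    qed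
    have h2: "((\<lambda>i. 1 / of_int (- int (Suc i)) ^ k :: complex) has_sum (\<Sum>i. 1 / of_nat (Suc i) ^ k)) UNIV"
      using h k by (simp del: of_nat_Suc)
    have "((\<lambda>d. A (0, d)) has_sum (2 * (\<Sum>i. 1 / of_nat (Suc i) ^ k))) UNIV"
      using has_sum_int_split[OF h1 h2] True by (simp add: A_def)
    then have "(A has_sum (2 * (\<Sum>i. 1 / of_nat (Suc i) ^ k))) ({0} \<times> UNIV)"
      by (rule iffD1[OF has_sum_reindex_bij_witness[of _ snd "Pair 0"], rotated -1]) auto
    then show ?thesis using True by simp
  qed
  have "(A has_sum (P + P)) ({1..} \<times> UNIV \<union> {..-1} \<times> UNIV)"
    by (rule has_sum_Un_disjoint[OF P N]) auto
  then have "(A has_sum (P + P + (if p = 0 then 2 * (\<Sum>i. 1 / of_nat (Suc i) ^ k) else 0)))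
      (({1..} \<times> UNIV \<union> {..-1} \<times> UNIV) \<union> {0} \<times> UNIV)"
    by (rule has_sum_Un_disjoint[OF _ Z]) auto
  moreover have "({1..} \<times> UNIV \<union> {..-1} \<times> UNIV) \<union> {0} \<times> UNIV = (UNIV :: (int \<times> int) set)" by auto
  ultimately show ?thesis unfolding A_def C_def q_def Peq by (simp add: algebra_simps)
qed

text \<open>The forms c^2, c (c z + d) and (c z + d)^2 span all binary quadratic forms in c and d;
  their sums are multiples of D^2 e, D e and e.\<close>

lemma lattice_quadratic_sum:
  assumes z: "Im z > 0" and k: "even k" "k \<ge> 4"
    and e: "eis k (exp (2 * pi * \<i> * z)) = 0" "eisD 1 k (exp (2 * pi * \<i> * z)) = 0" "eisD 2 k (exp (2 * pi * \<i> * z)) = 0"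
  shows "((\<lambda>(c :: int, d :: int). (\<alpha> * of_int c ^ 2 + \<beta> * (of_int c * (of_int c * z + of_int d)) + \<gamma> * (of_int c * z + of_int d) ^ 2) /
     (of_int c * z + of_int d) ^ (k + 2)) has_sum 0) UNIV"
proof -
  let ?q = "exp (2 * pi * \<i> * z)"
  note ls = lattice_sum[OF z k]
  have l: "lam 1 (k - 1) ?q = 0" "lam 2 (k - 1) ?q = 0" using e(2,3) unfolding eisD_def by auto
  have "(- 2 * pi * \<i>) ^ k = (2 * pi * \<i>) ^ k" using k power_minus[of "2 * pi * \<i>" k] by simp
  then have "2 * ((- 2 * pi * \<i>) ^ k / fact (k - 1) * lam 0 (k - 1) ?q) + 2 * (\<Sum>i. 1 / of_nat (Suc i) ^ k) = - ((2 * pi * \<i>) ^ k) * eis k ?q"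
    using zeta_even[OF k(1)] k(2) unfolding eis_def by (simp add: algebra_simps)
  then have s0: "((\<lambda>(c :: int, d :: int). 1 / (of_int c * z + of_int d) ^ k) has_sum 0) UNIV"
    using ls[of 0] e(1) by simp
  have s1: "((\<lambda>(c :: int, d :: int). of_int c / (of_int c * z + of_int d) ^ (k + 1)) has_sum 0) UNIV"
    using ls[of 1] l by simp
  have s2: "((\<lambda>(c :: int, d :: int). of_int c ^ 2 / (of_int c * z + of_int d) ^ (k + 2)) has_sum 0) UNIV"
    using ls[of 2] l by simp
  have "((\<lambda>x. \<alpha> * (case x of (c :: int, d :: int) \<Rightarrow> of_int c ^ 2 / (of_int c * z + of_int d) ^ (k + 2)) +
      (\<beta> * (case x of (c, d) \<Rightarrow> of_int c / (of_int c * z + of_int d) ^ (k + 1)) +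
       \<gamma> * (case x of (c, d) \<Rightarrow> 1 / (of_int c * z + of_int d) ^ k))) has_sum (\<alpha> * 0 + (\<beta> * 0 + \<gamma> * 0))) UNIV"
    by (intro has_sum_add has_sum_cmult_right s0 s1 s2)
  moreover have "\<alpha> * (case x of (c :: int, d :: int) \<Rightarrow> of_int c ^ 2 / (of_int c * z + of_int d) ^ (k + 2)) +
      (\<beta> * (case x of (c, d) \<Rightarrow> of_int c / (of_int c * z + of_int d) ^ (k + 1)) +
       \<gamma> * (case x of (c, d) \<Rightarrow> 1 / (of_int c * z + of_int d) ^ k)) =
     (case x of (c, d) \<Rightarrow> (\<alpha> * of_int c ^ 2 + \<beta> * (of_int c * (of_int c * z + of_int d)) + \<gamma> * (of_int c * z + of_int d) ^ 2) /
     (of_int c * z + of_int d) ^ (k + 2))" for x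
  proof -
    obtain c d where x: "x = (c, d)" by (cases x) auto
    define w where "w = of_int c * z + of_int d"
    show ?thesis
    proof (cases "w = 0")
      case True
      then show ?thesis using k unfolding x prod.case w_def[symmetric] by (simp add: power_0_left)
    next
      case False
      then show ?thesis unfolding x prod.case w_def[symmetric] by (simp add: power_add add_divide_distrib power2_eq_square)
    qed
  qed
  ultimately show ?thesis by simp
qed


section \<open>The numerical estimate for a reduced basis\<close>

lemma basel_square_has_sum:
  "((\<lambda>(a :: int, b :: int). 1 / (of_int a ^ 2 * of_int b ^ 2) :: real) has_sum (pi\<^sup>2 / 6)\<^sup>2) ({1..} \<times> {1..})"
proof -
  have u: "((\<lambda>a :: int. 1 / of_int a ^ 2 :: real) has_sum (pi\<^sup>2 / 6)) {1..}"
  proof -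
    have "((\<lambda>n. 1 / real ((n + 1)\<^sup>2)) has_sum (pi\<^sup>2 / 6)) UNIV"
      by (rule sums_nonneg_imp_has_sum[OF inverse_squares_sums]) simp
    then show ?thesis
      by (rule iffD1[OF has_sum_reindex_bij_witness[of _ "\<lambda>a. nat (a - 1)" "\<lambda>n. int n + 1"], rotated -1]) auto
  qed
  have s: "(\<lambda>(a :: int, b :: int). (1 / of_int a ^ 2) * (1 / of_int b ^ 2) :: real) summable_on {1..} \<times> {1..}"
    by (rule summable_on_times_nonneg) (use u in \<open>auto simp: summable_on_def\<close>)
  then obtain V where V: "((\<lambda>(a :: int, b :: int). (1 / of_int a ^ 2) * (1 / of_int b ^ 2) :: real) has_sum V) ({1..} \<times> {1..})"
    unfolding summable_on_def by blast
  have "((\<lambda>a :: int. (1 / of_int a ^ 2) * (pi\<^sup>2 / 6)) has_sum V) {1..}"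
  proof (rule has_sum_SigmaD[OF V])
    show "((\<lambda>y. case (x, y) of (a :: int, b :: int) \<Rightarrow> (1 / of_int a ^ 2) * (1 / of_int b ^ 2)) has_sum (1 / of_int x ^ 2) * (pi\<^sup>2 / 6)) {1..}" for x :: int
      using has_sum_cmult_right[OF u, of "1 / of_int x ^ 2"] by (simp only: prod.case)
  qed
  moreover have "((\<lambda>a :: int. (1 / of_int a ^ 2) * (pi\<^sup>2 / 6)) has_sum ((pi\<^sup>2 / 6) * (pi\<^sup>2 / 6))) {1..}"
    by (rule has_sum_cmult_left[OF u])
  ultimately have "V = (pi\<^sup>2 / 6) ^ 2" unfolding power2_eq_square[of "pi\<^sup>2 / 6"] by (rule has_sum_unique)
  then show ?thesis using V by simp
qed

text \<open>The two quadratic forms bound \<open>\<bar>m \<tau> + n\<bar>\<^sup>2\<close> from below in the two sign regions of \<open>(m, n)\<close>;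
  averaging over the swap of \<open>a\<close> and \<open>b\<close> makes the crude bounds \<open>2 a b\<close> and \<open>3 a b\<close> sufficient.\<close>

lemma symmetrised_bound:
  fixes a b :: real assumes "a > 0" "b > 0"
  shows "((b * (a + b) / (a ^ 2 + b ^ 2) ^ 3 + b * (a + b) / (a ^ 2 + a * b + b ^ 2) ^ 3 + a * b / (a ^ 2 + a * b + b ^ 2) ^ 3) +
     (a * (b + a) / (b ^ 2 + a ^ 2) ^ 3 + a * (b + a) / (b ^ 2 + b * a + a ^ 2) ^ 3 + b * a / (b ^ 2 + b * a + a ^ 2) ^ 3)) / 2
     \<le> 13 / 36 * (1 / (a ^ 2 * b ^ 2))"
proof -
  define D E where "D = a ^ 2 + b ^ 2" and "E = a ^ 2 + a * b + b ^ 2"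
  have ab: "a * b > 0" using assms by simp
  have D: "2 * (a * b) \<le> D" unfolding D_def using zero_le_power2[of "a - b"] by (simp add: power2_eq_square algebra_simps)
  have E: "E = D + a * b" by (simp add: D_def E_def)
  have D0: "D > 0" "E > 0" and E3: "3 * (a * b) \<le> E" using D ab E by auto
  have eqs: "b ^ 2 + a ^ 2 = D" "b ^ 2 + b * a + a ^ 2 = E" by (simp_all add: D_def E_def mult.commute)
  have 1: "(a + b) ^ 2 / 2 \<le> D" using D unfolding D_def by (simp add: power2_eq_square algebra_simps)
  have 2: "(a + b) ^ 2 / 2 + a * b \<le> E" using D unfolding E D_def by (simp add: power2_eq_square algebra_simps)
  have "((b * (a + b) / D ^ 3 + b * (a + b) / E ^ 3 + a * b / E ^ 3) + (a * (b + a) / D ^ 3 + a * (b + a) / E ^ 3 + b * a / E ^ 3)) / 2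
     = ((a + b) ^ 2 / 2) / D ^ 3 + ((a + b) ^ 2 / 2 + a * b) / E ^ 3"
    by (simp add: power2_eq_square add_divide_distrib algebra_simps)
  also have "\<dots> \<le> D / D ^ 3 + E / E ^ 3" using 1 2 D0 by (intro add_mono divide_right_mono) auto
  also have "\<dots> = 1 / D ^ 2 + 1 / E ^ 2" using D0 by (simp add: power2_eq_square power3_eq_cube)
  also have "\<dots> \<le> 1 / (2 * (a * b)) ^ 2 + 1 / (3 * (a * b)) ^ 2"
    using D E3 ab assms by (intro add_mono divide_left_mono power_mono mult_pos_pos zero_less_power D0) auto
  \<comment> \<open>13/36 = 1/4 + 1/9, from the bounds 2 a b and 3 a b.\<close>
  also have "\<dots> = 13 / 36 * (1 / (a ^ 2 * b ^ 2))" using assms by (simp add: power_mult_distrib field_simps)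
  finally show ?thesis unfolding eqs D_def[symmetric] E_def[symmetric] .
qed

text \<open>The numerator n (m + n) vanishes on the lines through tau and tau - 1, whose norms may
  equal 1, so only 1 and - 1 remain as dominant vectors. They contribute 2, and by symmetry it
  suffices that the half m > 0 has sum of norm below 1.\<close>

lemma reduced_lattice_sum_nonzero:
  fixes \<tau> :: complex and N :: nat
  assumes re: "0 \<le> Re \<tau>" "Re \<tau> \<le> 1/2" and N: "even N" "N \<ge> 6"
    and min: "\<And>m n :: int. (m, n) \<noteq> (0, 0) \<Longrightarrow> norm (of_int m * \<tau> + of_int n) \<ge> 1"
    and sum: "((\<lambda>(m :: int, n :: int). of_int n * of_int (m + n) / (of_int m * \<tau> + of_int n) ^ N) has_sum 0) UNIV"
  shows False
proof -
  define f where "f m n = of_int n * of_int (m + n) / (of_int m * \<tau> + of_int n) ^ N" for m n :: int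
  define g where "g = (\<lambda>(m, n). f m n)"
  have g0: "(g has_sum 0) UNIV" using sum by (simp add: g_def f_def)
  have sub: "\<exists>S. (g has_sum S) B" for B
    using summable_on_subset[of g UNIV B] g0 unfolding summable_on_def by blast
  have fneg: "f (- m) (- n) = f m n" for m n
  proof -
    have "of_int (- m) * \<tau> + of_int (- n) = - (of_int m * \<tau> + of_int n)" by simp
    then have "(of_int (- m) * \<tau> + of_int (- n)) ^ N = (of_int m * \<tau> + of_int n) ^ N" using N by (simp only: power_minus_even)
    moreover have "of_int (- n) * of_int (- m + - n) = (of_int n * of_int (m + n) :: complex)" by (simp add: algebra_simps)
    ultimately show ?thesis by (simp only: f_def)
  qed
  obtain S where S: "(g has_sum S) ({1..} \<times> UNIV)" using sub by blast
  have S': "(g has_sum S) ({..-1} \<times> UNIV)"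
    by (rule iffD1[OF has_sum_reindex_bij_witness[of _ "\<lambda>(m, n). (- m, - n)" "\<lambda>(m, n). (- m, - n)"] S])
      (auto simp: g_def fneg)
  obtain T where T: "(g has_sum T) ({0} \<times> UNIV)" using sub by blast
  have "S + S + T = 0"
  proof -
    have "(g has_sum (S + S)) ({1..} \<times> UNIV \<union> {..-1} \<times> UNIV)" by (rule has_sum_Un_disjoint[OF S S']) auto
    then have "(g has_sum (S + S + T)) (({1..} \<times> UNIV \<union> {..-1} \<times> UNIV) \<union> {0} \<times> UNIV)"
      by (rule has_sum_Un_disjoint[OF _ T]) auto
    moreover have "({1..} \<times> UNIV \<union> {..-1} \<times> UNIV) \<union> {0} \<times> UNIV = (UNIV :: (int \<times> int) set)" by auto
    ultimately show ?thesis using has_sum_unique[OF g0] by metis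
  qed
  \<comment> \<open>For m = 0 the terms n^2 / n^N are non-negative as N is even; n = 1 and n = - 1
    already give 2.\<close>
  moreover have "Re T \<ge> 2"
  proof -
    have r: "((\<lambda>x. Re (g x)) has_sum Re T) ({0} \<times> UNIV)" using T by (rule has_sum_Re)
    have pos: "Re (g (0, n)) = of_int n ^ 2 / of_int n ^ N" for n :: int
    proof -
      have "g (0, n) = of_real (of_int n ^ 2 / of_int n ^ N)" by (simp add: g_def f_def power2_eq_square)
      then show ?thesis by (metis Re_complex_of_real)
    qed
    have "(\<Sum>x\<in>{(0, 1), (0, -1)}. Re (g x)) \<le> Re T"
      by (rule finite_sum_le_has_sum[OF r]) (use N in \<open>auto simp: pos zero_le_even_power\<close>)
    moreover have "(\<Sum>x\<in>{(0, 1), (0, -1)}. Re (g x)) = 2" using N by (simp add: pos)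
    ultimately show ?thesis by simp
  qed
  ultimately have "Re S \<le> -1" by (simp add: complex_eq_iff)
  then have Sn: "norm S \<ge> 1" using abs_Re_le_cmod[of S] by linarith
  let ?Q = "{1..} \<times> {1..} :: (int \<times> int) set"
  \<comment> \<open>For m > 0 the zeros n = 0 and n = - m of the form cut out three sectors,
    parametrised below by a, b >= 1 as (a, b), (a, - a - b) and (a + b, - a).\<close>
  define D2 D3 where "D2 = {(m :: int, n). 1 \<le> m \<and> n \<le> - m - 1}" and "D3 = {(m :: int, n). 1 \<le> m \<and> - m < n \<and> n < 0}"
  obtain S1 S2 S3 where S1: "(g has_sum S1) ?Q" and S2: "(g has_sum S2) D2" and S3: "(g has_sum S3) D3" using sub by metis
  have "(g has_sum (S1 + S2)) (?Q \<union> D2)" by (rule has_sum_Un_disjoint[OF S1 S2]) (auto simp: D2_def)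
  then have "(g has_sum (S1 + S2 + S3)) ((?Q \<union> D2) \<union> D3)"
    by (rule has_sum_Un_disjoint[OF _ S3]) (auto simp: D2_def D3_def)
  then have "(g has_sum (S1 + S2 + S3)) ({1..} \<times> UNIV)"
  proof (rule iffD1[OF has_sum_cong_neutral, rotated -1])
    show "g x = 0" if "x \<in> {1..} \<times> UNIV - ((?Q \<union> D2) \<union> D3)" for x
    proof -
      obtain m n where x: "x = (m, n)" "m \<ge> 1" using \<open>x \<in> _\<close> by auto
      then have "n = 0 \<or> n = - m" using \<open>x \<in> _\<close> unfolding D2_def D3_def by auto
      then show ?thesis by (auto simp: x g_def f_def)
    qed
  qed (auto simp: D2_def D3_def)
  then have SS: "S = S1 + S2 + S3" using has_sum_unique[OF S] by blast
  have T1: "((\<lambda>(a, b). f a b) has_sum S1) ?Q" using S1 by (simp add: g_def)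
  have T2: "((\<lambda>(a, b). f a (- a - b)) has_sum S2) ?Q"
    by (rule iffD1[OF has_sum_reindex_bij_witness[of _ "\<lambda>(a, b). (a, - a - b)" "\<lambda>(m, n). (m, - m - n)"] S2])
      (auto simp: D2_def g_def)
  have T3: "((\<lambda>(a, b). f (a + b) (- a)) has_sum S3) ?Q"
    by (rule iffD1[OF has_sum_reindex_bij_witness[of _ "\<lambda>(a, b). (a + b, - a)" "\<lambda>(m, n). (- n, m + n)"] S3])
      (auto simp: D3_def g_def)
  define F where "F a b = f a b + f a (- a - b) + f (a + b) (- a)" for a b
  have F1: "((\<lambda>(a, b). F a b) has_sum S) ?Q"
    using has_sum_add[OF has_sum_add[OF T1 T2] T3] by (simp add: F_def SS case_prod_unfold)
  have F2: "((\<lambda>(a, b). F b a) has_sum S) ?Q"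
    by (rule iffD1[OF has_sum_reindex_bij_witness[of _ prod.swap prod.swap] F1]) auto
  have F3: "((\<lambda>(a, b). (F a b + F b a) / 2) has_sum S) ?Q"
    using has_sum_cmult_left[OF has_sum_add[OF F1 F2], of "1 / 2"] by (simp add: case_prod_unfold)
  \<comment> \<open>Non-zero lattice points have norm at least 1, so every exponent N >= 6 reduces
    to 6 and one estimate serves all weights.\<close>
  have fb: "norm (f m n) \<le> \<bar>of_int n * of_int (m + n)\<bar> / D ^ 3"
    if D: "0 < D" "D \<le> norm (of_int m * \<tau> + of_int n) ^ 2" and mn: "(m, n) \<noteq> (0, 0)" for m n D
  proof -
    define W where "W = norm (of_int m * \<tau> + of_int n)"
    have "D ^ 3 \<le> (W ^ 2) ^ 3" using D by (intro power_mono) (auto simp: W_def)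
    also have "\<dots> = W ^ 6" by (simp flip: power_mult)
    also have "\<dots> \<le> W ^ N" using min[OF mn] N by (intro power_increasing) (auto simp: W_def)
    finally have DW: "D ^ 3 \<le> W ^ N" .
    have "norm (f m n) = \<bar>of_int n * of_int (m + n)\<bar> / W ^ N"
      unfolding f_def norm_divide norm_mult norm_power W_def[symmetric] norm_of_int abs_mult ..
    also have "\<dots> \<le> \<bar>of_int n * of_int (m + n)\<bar> / D ^ 3"
    proof (rule divide_left_mono[OF DW])
      have "0 < D ^ 3" using D by simp
      then show "0 < W ^ N * D ^ 3" using DW by (intro mult_pos_pos) linarith+
    qed simp
    finally show ?thesis .
  qed
  have nsq: "norm (of_int m * \<tau> + of_int n) ^ 2 = of_int m ^ 2 * norm \<tau> ^ 2 + 2 * (of_int m * of_int n) * Re \<tau> + of_int n ^ 2" for m n :: int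
    unfolding cmod_power2 by simp (simp add: power2_eq_square algebra_simps)
  have t1: "1 \<le> norm \<tau> ^ 2" using min[of 1 0] one_le_power[of "norm \<tau>" 2] by simp
  have np: "of_int m ^ 2 + of_int n ^ 2 \<le> norm (of_int m * \<tau> + of_int n) ^ 2" if "0 \<le> m * n" for m n :: int
  proof -
    have "of_int m ^ 2 * 1 \<le> of_int m ^ 2 * norm \<tau> ^ 2" using t1 by (intro mult_left_mono) auto
    moreover have "0 \<le> real_of_int (m * n)" using that by (simp only: of_int_0_le_iff)
    then have "0 \<le> (2 * (of_int m * of_int n)) * Re \<tau>"
      unfolding of_int_mult using re(1) by (intro mult_nonneg_nonneg[of "2 * _"]) linarith+
    ultimately show ?thesis unfolding nsq by linarith
  qed
  have nn: "of_int m ^ 2 + of_int m * of_int n + of_int n ^ 2 \<le> norm (of_int m * \<tau> + of_int n) ^ 2" if "m * n \<le> 0" for m n :: int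
  proof -
    have "of_int m ^ 2 * 1 \<le> of_int m ^ 2 * norm \<tau> ^ 2" using t1 by (intro mult_left_mono) auto
    moreover have "real_of_int (m * n) \<le> 0" using that by (simp only: of_int_le_0_iff)
    then have "(2 * (of_int m * of_int n)) * (1 / 2) \<le> (2 * (of_int m * of_int n)) * Re \<tau>"
      unfolding of_int_mult using re(2) by (intro mult_left_mono_neg) linarith+
    ultimately show ?thesis unfolding nsq by linarith
  qed
  have Fb: "norm (F a b) \<le> of_int b * (of_int a + of_int b) / (of_int a ^ 2 + of_int b ^ 2) ^ 3 +
      of_int b * (of_int a + of_int b) / (of_int a ^ 2 + of_int a * of_int b + of_int b ^ 2) ^ 3 +
      of_int a * of_int b / (of_int a ^ 2 + of_int a * of_int b + of_int b ^ 2) ^ 3" if ab: "a \<ge> 1" "b \<ge> 1" for a b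
  proof -
    define x y where "x = real_of_int a" and "y = real_of_int b"
    have xy: "x > 0" "y > 0" using ab by (auto simp: x_def y_def)
    have E0: "0 < x ^ 2 + x * y + y ^ 2" "0 < x ^ 2 + y ^ 2" using xy by (intro add_pos_pos zero_less_power mult_pos_pos; simp)+
    have 1: "norm (f a b) \<le> \<bar>y * (x + y)\<bar> / (x ^ 2 + y ^ 2) ^ 3"
      using fb[of "x ^ 2 + y ^ 2" a b] np[of a b] ab E0 by (simp add: x_def y_def)
    have "x ^ 2 + x * y + y ^ 2 \<le> norm (of_int a * \<tau> + of_int (- a - b)) ^ 2"
    proof -
      have "a * (- a - b) \<le> 0" using ab by (intro mult_nonneg_nonpos) auto
      from nn[OF this] show ?thesis by (simp add: x_def y_def power2_eq_square algebra_simps)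
    qed
    then have "norm (f a (- a - b)) \<le> \<bar>of_int (- a - b) * of_int (a + (- a - b))\<bar> / (x ^ 2 + x * y + y ^ 2) ^ 3"
      using E0 ab by (intro fb) auto
    moreover have "of_int (- a - b) * of_int (a + (- a - b)) = y * (x + y)"
      by (simp add: x_def y_def algebra_simps)
    ultimately have 2: "norm (f a (- a - b)) \<le> \<bar>y * (x + y)\<bar> / (x ^ 2 + x * y + y ^ 2) ^ 3" by (simp only:)
    have "x ^ 2 + x * y + y ^ 2 \<le> norm (of_int (a + b) * \<tau> + of_int (- a)) ^ 2"
    proof -
      have "(a + b) * (- a) \<le> 0" using ab by (intro mult_nonneg_nonpos) auto
      from nn[OF this] show ?thesis by (simp add: x_def y_def power2_eq_square algebra_simps)
    qed
    then have "norm (f (a + b) (- a)) \<le> \<bar>of_int (- a) * of_int (a + b + (- a))\<bar> / (x ^ 2 + x * y + y ^ 2) ^ 3"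
      using E0 ab by (intro fb) auto
    moreover have "\<bar>of_int (- a) * of_int (a + b + (- a))\<bar> = \<bar>x * y\<bar>"
      by (simp add: x_def y_def abs_mult)
    ultimately have 3: "norm (f (a + b) (- a)) \<le> \<bar>x * y\<bar> / (x ^ 2 + x * y + y ^ 2) ^ 3" by (simp only:)
    have "norm (F a b) \<le> norm (f a b) + norm (f a (- a - b)) + norm (f (a + b) (- a))"
      unfolding F_def using norm_triangle_ineq[of "f a b + f a (- a - b)" "f (a + b) (- a)"]
        norm_triangle_ineq[of "f a b" "f a (- a - b)"] by linarith
    moreover have "\<bar>y * (x + y)\<bar> = y * (x + y)" "\<bar>x * y\<bar> = x * y" using xy by auto
    ultimately show ?thesis using 1 2 3 unfolding x_def[symmetric] y_def[symmetric] by simp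
  qed
  have "norm S \<le> 13 / 36 * (pi\<^sup>2 / 6)\<^sup>2"
  proof -
    have F4: "(\<lambda>(a, b). (F a b + F b a) / 2) summable_on ?Q" using F3 unfolding summable_on_def by blast
    then have "(\<lambda>x. norm (case x of (a, b) \<Rightarrow> (F a b + F b a) / 2)) summable_on ?Q"
      by (simp only: summable_on_iff_abs_summable_on_complex)
    then obtain R where R: "((\<lambda>x. norm (case x of (a, b) \<Rightarrow> (F a b + F b a) / 2)) has_sum R) ?Q"
      unfolding summable_on_def by blast
    have "norm S \<le> R" by (rule norm_has_sum_bound[OF R F3])
    also have "R \<le> 13 / 36 * (pi\<^sup>2 / 6)\<^sup>2"
    proof (rule has_sum_mono[OF R has_sum_cmult_right[OF basel_square_has_sum]])
      fix x :: "int \<times> int" assume "x \<in> ?Q"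
      then obtain a b where x: "x = (a, b)" "a \<ge> 1" "b \<ge> 1" by auto
      have "norm ((F a b + F b a) / 2) \<le> (norm (F a b) + norm (F b a)) / 2"
        using norm_triangle_ineq[of "F a b" "F b a"] by (simp add: norm_divide)
      also have "\<dots> \<le> 13 / 36 * (1 / (of_int a ^ 2 * of_int b ^ 2))"
        by (rule order_trans[OF divide_right_mono[OF add_mono[OF Fb[OF x(2,3)] Fb[OF x(3,2)]]] symmetrised_bound]) (use x in auto)
      finally show "norm (case x of (a, b) \<Rightarrow> (F a b + F b a) / 2) \<le> 13 / 36 * (case x of (a, b) \<Rightarrow> 1 / (of_int a ^ 2 * of_int b ^ 2))"
        by (simp add: x)
    qed
    finally show ?thesis .
  qed
  \<comment> \<open>The left side is about 0.977; the slack is small, but pi <= 3.15 is precise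
    enough.\<close>
  also have "\<dots> < 1"
  proof -
    have "pi ^ 2 \<le> 3.15 ^ 2" using pi_approx pi_gt_zero by (intro power_mono) auto
    then have "(pi\<^sup>2 / 6) ^ 2 \<le> (3.15 ^ 2 / 6) ^ 2" by (intro power_mono divide_right_mono) auto
    moreover have "13 / 36 * (3.15 ^ 2 / 6) ^ 2 < (1 :: real)" by (simp add: power2_eq_square)
    ultimately show ?thesis by linarith
  qed
  finally show False using Sn by simp
qed


text \<open>A shortest vector is primitive, so Bezout completes it to a basis. Subtracting a nearest
  integer brings the real part of the quotient into [-1/2, 1/2], and a change of sign makes it
  non-negative, at the price of a determinant that may be - 1.\<close>

lemma exists_reduced_basis:
  assumes z: "Im z > 0"
  obtains a b u v s :: int where "s * s = 1" "a * v - b * u = s" "of_int a * z + of_int b \<noteq> 0"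
    "0 \<le> Re ((of_int u * z + of_int v) / (of_int a * z + of_int b))"
    "Re ((of_int u * z + of_int v) / (of_int a * z + of_int b)) \<le> 1/2"
    "\<And>c d :: int. (c, d) \<noteq> (0, 0) \<Longrightarrow> norm (of_int a * z + of_int b) \<le> norm (of_int c * z + of_int d)"
proof -
  obtain M where M: "M \<ge> 1" "\<And>c d :: real. c ^ 2 + d ^ 2 \<le> M * norm (of_real c * z + of_real d) ^ 2"
    using lattice_norm_lower[OF z] by blast
  define f where "f = (\<lambda>(c :: int, d :: int). norm (of_int c * z + of_int d))"
  define S where "S = {cd. cd \<noteq> (0, 0) \<and> f cd \<le> 1}"
  define B where "B = \<lceil>M\<rceil>"
  have "S \<subseteq> {- B..B} \<times> {- B..B}"
  proof
    fix cd assume "cd \<in> S"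
    then obtain c d where cd: "cd = (c, d)" "f (c, d) \<le> 1" unfolding S_def by (cases cd) auto
    have "M * norm (of_int c * z + of_int d) ^ 2 \<le> M * 1"
      using cd M(1) by (intro mult_left_mono power_le_one) (auto simp: f_def)
    then have "(of_int c) ^ 2 + (of_int d) ^ 2 \<le> M" using M(2)[of "of_int c" "of_int d"] by simp
    then have "real_of_int (c ^ 2 + d ^ 2) \<le> M" by simp
    then have cdB: "c ^ 2 + d ^ 2 \<le> B" unfolding B_def by linarith
    have "\<bar>x\<bar> \<le> x ^ 2" for x :: int
      using mult_left_mono[of 1 "\<bar>x\<bar>" "\<bar>x\<bar>"] by (cases "x = 0") (auto simp: power2_eq_square abs_mult_self_eq)
    then have "\<bar>c\<bar> \<le> c ^ 2" "\<bar>d\<bar> \<le> d ^ 2" by blast+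
    moreover have "0 \<le> c ^ 2" "0 \<le> d ^ 2" by auto
    ultimately have "\<bar>c\<bar> \<le> B" "\<bar>d\<bar> \<le> B" using cdB by linarith+
    then show "cd \<in> {- B..B} \<times> {- B..B}" by (auto simp: cd)
  qed
  then have fin: "finite S" by (rule finite_subset) auto
  have "(0, 1) \<in> S" by (simp add: S_def f_def)
  then have ne: "S \<noteq> {}" by blast
  define ab where "ab = arg_min_on f S"
  obtain a b where ab: "ab = (a, b)" by (cases ab) auto
  have abS: "(a, b) \<in> S" using arg_min_if_finite(1)[OF fin ne, of f] ab by (simp add: ab_def)
  have least: "f (a, b) \<le> f cd" if "cd \<noteq> (0, 0)" for cd
  proof (cases "cd \<in> S")
    case True
    then show ?thesis using arg_min_least[OF fin ne, of cd f] ab by (simp add: ab_def)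
  next
    case False
    then show ?thesis using that abS by (auto simp: S_def)
  qed
  have f0: "f (c, d) > 0" if "(c, d) \<noteq> (0, 0)" for c d
  proof -
    have "0 < c ^ 2 + d ^ 2" using that by (simp add: sum_power2_gt_zero_iff)
    then have "0 < real_of_int (c ^ 2 + d ^ 2)" by (simp only: of_int_0_less_iff)
    then have "0 < M * norm (of_int c * z + of_int d) ^ 2" using M(2)[of "of_int c" "of_int d"] by simp
    then show ?thesis using M(1) by (auto simp: f_def zero_less_mult_iff)
  qed
  have ab0: "(a, b) \<noteq> (0, 0)" using abS by (auto simp: S_def)
  \<comment> \<open>Dividing a shortest vector by a common factor g > 1 would give a shorter
    one.\<close>
  have "gcd a b = 1"
  proof -
    define g where "g = gcd a b"
    have g: "g > 0" using ab0 by (auto simp: g_def)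
    obtain a' b' where a': "a = g * a'" "b = g * b'" using gcd_dvd1[of a b] gcd_dvd2[of a b] unfolding g_def by (elim dvdE) blast
    have n: "(a', b') \<noteq> (0, 0)" using ab0 a' by auto
    have "of_int a * z + of_int b = of_int g * (of_int a' * z + of_int b')" by (simp add: a' algebra_simps)
    then have "f (a, b) = of_int g * f (a', b')" using g by (simp add: f_def norm_mult)
    then have "of_int g * f (a', b') \<le> 1 * f (a', b')" using least[OF n] by simp
    then have "real_of_int g \<le> 1" using f0[OF n] by (simp only: mult_le_cancel_right_pos)
    then have "g = 1" using g by linarith
    then show ?thesis by (simp add: g_def)
  qed
  then obtain x y where xy: "x * a + y * b = 1" using bezout_int[of a b] by auto
  define w where "w = of_int a * z + of_int b"
  have w: "w \<noteq> 0" using f0[OF ab0] by (auto simp: f_def w_def)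
  define \<tau> where "\<tau> = (of_int (- y) * z + of_int x) / w"
  \<comment> \<open>\<open>t\<close> performs the translation and \<open>s\<close> the
    reflection.\<close>
  define t where "t = round (Re \<tau>)"
  define s :: int where "s = (if Re \<tau> - of_int t < 0 then -1 else 1)"
  define u v where "u = s * (- y - t * a)" and "v = s * (x - t * b)"
  have uv: "(of_int u * z + of_int v) / w = of_int s * (\<tau> - of_int t)"
  proof -
    have "of_int u * z + of_int v = of_int s * ((of_int (- y) * z + of_int x) - of_int t * w)"
      by (simp add: u_def v_def w_def algebra_simps)
    then show ?thesis using w by (simp add: \<tau>_def field_simps)
  qed
  have "\<bar>of_int t - Re \<tau>\<bar> \<le> 1 / 2" unfolding t_def by (rule of_int_round_abs_le)
  then have re: "0 \<le> Re ((of_int u * z + of_int v) / w)" "Re ((of_int u * z + of_int v) / w) \<le> 1/2"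
    unfolding uv by (auto simp: s_def)
  have det: "a * v - b * u = s"
  proof -
    have "a * v - b * u = s * (x * a + y * b)" by (simp add: u_def v_def algebra_simps)
    then show ?thesis using xy by simp
  qed
  show thesis
  proof (rule that[of s a v b u])
    show "s * s = 1" by (simp add: s_def)
    show "norm (of_int a * z + of_int b) \<le> norm (of_int c * z + of_int d)" if "(c, d) \<noteq> (0, 0)" for c d
      using least[OF that] by (simp add: f_def)
  qed (use det w re in \<open>auto simp: w_def\<close>)
qed

text \<open>In coordinates (m, n) for the reduced basis every lattice vector is w (m tau + n), and n
  (m + n) is still a quadratic form in (c, d). Its sum is 0 by the triple zero, while reduction
  forbids this.\<close>

theorem eis_no_triple_zero:
  assumes z: "Im z > 0" and k: "even k" "k \<ge> 4"
    and e: "eis k (exp (2 * pi * \<i> * z)) = 0" "eisD 1 k (exp (2 * pi * \<i> * z)) = 0" "eisD 2 k (exp (2 * pi * \<i> * z)) = 0"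
  shows False
proof -
  obtain a b u v s :: int where s: "s * s = 1" and det: "a * v - b * u = s"
    and w0: "of_int a * z + of_int b \<noteq> 0"
    and re: "0 \<le> Re ((of_int u * z + of_int v) / (of_int a * z + of_int b))"
      "Re ((of_int u * z + of_int v) / (of_int a * z + of_int b)) \<le> 1/2"
    and least: "\<And>c d :: int. (c, d) \<noteq> (0, 0) \<Longrightarrow> norm (of_int a * z + of_int b) \<le> norm (of_int c * z + of_int d)"
    using exists_reduced_basis[OF z] by metis
  define w where "w = of_int a * z + of_int b"
  define \<tau> where "\<tau> = (of_int u * z + of_int v) / w"
  have w: "w \<noteq> 0" using w0 by (simp add: w_def)
  define \<phi> where "\<phi> = (\<lambda>(m :: int, n :: int). (n * a + m * u, n * b + m * v))"
  define \<psi> where "\<psi> = (\<lambda>(c :: int, d :: int). (s * (a * d - b * c), s * (c * v - d * u)))"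
  have \<psi>\<phi>: "\<psi> (\<phi> x) = x" for x
  proof -
    obtain m n where x: "x = (m, n)" by (cases x) auto
    have "s * (a * (n * b + m * v) - b * (n * a + m * u)) = s * (a * v - b * u) * m" by (simp add: algebra_simps)
    moreover have "s * ((n * a + m * u) * v - (n * b + m * v) * u) = s * (a * v - b * u) * n" by (simp add: algebra_simps)
    ultimately show ?thesis using s by (simp add: x \<phi>_def \<psi>_def det)
  qed
  have \<phi>\<psi>: "\<phi> (\<psi> x) = x" for x
  proof -
    obtain c d where x: "x = (c, d)" by (cases x) auto
    have "(s * (c * v - d * u)) * a + (s * (a * d - b * c)) * u = s * (a * v - b * u) * c" by (simp add: algebra_simps)
    moreover have "(s * (c * v - d * u)) * b + (s * (a * d - b * c)) * v = s * (a * v - b * u) * d" by (simp add: algebra_simps)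
    ultimately show ?thesis using s by (simp add: x \<phi>_def \<psi>_def det)
  qed
  have \<phi>w: "of_int (n * a + m * u) * z + of_int (n * b + m * v) = w * (of_int m * \<tau> + of_int n)" for m n
  proof -
    have "w * \<tau> = of_int u * z + of_int v" using w by (simp add: \<tau>_def)
    moreover have "w * (of_int m * \<tau> + of_int n) = of_int m * (w * \<tau>) + of_int n * w" by (simp add: algebra_simps)
    ultimately show ?thesis by (simp add: w_def algebra_simps)
  qed
  have min: "norm (of_int m * \<tau> + of_int n) \<ge> 1" if "(m, n) \<noteq> (0, 0)" for m n :: int
  proof -
    have "\<phi> (m, n) \<noteq> (0, 0)"
    proof
      assume "\<phi> (m, n) = (0, 0)"
      then have "(m, n) = \<psi> (0, 0)" using \<psi>\<phi> by metis
      then show False using that by (simp add: \<psi>_def)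
    qed
    then have nz: "(n * a + m * u, n * b + m * v) \<noteq> (0, 0)" by (simp only: \<phi>_def prod.case) simp
    have "norm w \<le> norm (of_int (n * a + m * u) * z + of_int (n * b + m * v))"
      unfolding w_def by (rule least[OF nz])
    then have "norm w * 1 \<le> norm w * norm (of_int m * \<tau> + of_int n)" unfolding \<phi>w by (simp add: norm_mult)
    moreover have "0 < norm w" using w by simp
    ultimately show ?thesis by (simp only: mult_le_cancel_left_pos)
  qed
  \<comment> \<open>The coefficients of the linear forms n and m + n with respect to c and c z + d,
    obtained by inverting the change of basis, whose determinant is s.\<close>
  define \<alpha>1 \<beta>1 \<alpha>2 \<beta>2 where "\<alpha>1 = of_int s * (of_int v + z * of_int u)" and "\<beta>1 = - of_int s * (of_int u :: complex)"
    and "\<alpha>2 = \<alpha>1 - of_int s * w" and "\<beta>2 = \<beta>1 + of_int s * of_int a"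
  have Q: "((\<lambda>(c :: int, d :: int). (\<alpha>1 * \<alpha>2 * of_int c ^ 2 + (\<alpha>1 * \<beta>2 + \<beta>1 * \<alpha>2) * (of_int c * (of_int c * z + of_int d)) +
      \<beta>1 * \<beta>2 * (of_int c * z + of_int d) ^ 2) / (of_int c * z + of_int d) ^ (k + 2)) has_sum 0) UNIV" (is "(?G has_sum 0) UNIV")
    by (rule lattice_quadratic_sum[OF z k e])
  have G\<phi>: "?G (\<phi> (m, n)) = of_int n * of_int (m + n) / (w * (of_int m * \<tau> + of_int n)) ^ (k + 2)" for m n
  proof -
    define c d where "c = n * a + m * u" and "d = n * b + m * v"
    define \<omega> where "\<omega> = of_int c * z + of_int d"
    have mn: "m = s * (a * d - b * c)" "n = s * (c * v - d * u)"
      using \<psi>\<phi>[of "(m, n)"] by (auto simp: \<phi>_def \<psi>_def c_def d_def)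
    have n: "(of_int n :: complex) = \<alpha>1 * of_int c + \<beta>1 * \<omega>"
      by (subst mn(2)) (simp add: \<alpha>1_def \<beta>1_def \<omega>_def algebra_simps)
    have m: "(of_int (m + n) :: complex) = \<alpha>2 * of_int c + \<beta>2 * \<omega>"
    proof -
      have "(of_int m :: complex) = - of_int s * w * of_int c + of_int s * of_int a * \<omega>"
        by (subst mn(1)) (simp add: w_def \<omega>_def algebra_simps)
      then show ?thesis unfolding of_int_add n \<alpha>2_def \<beta>2_def by (simp add: algebra_simps)
    qed
    have "?G (c, d) = (\<alpha>1 * of_int c + \<beta>1 * \<omega>) * (\<alpha>2 * of_int c + \<beta>2 * \<omega>) / \<omega> ^ (k + 2)"
      unfolding prod.case \<omega>_def[symmetric] by (simp add: power2_eq_square algebra_simps)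
    moreover have "\<omega> = w * (of_int m * \<tau> + of_int n)" unfolding \<omega>_def c_def d_def by (rule \<phi>w)
    ultimately show ?thesis unfolding n[symmetric] m[symmetric] by (simp add: \<phi>_def c_def d_def)
  qed
  have "((\<lambda>x. ?G (\<phi> x)) has_sum 0) UNIV"
    by (rule iffD1[OF has_sum_reindex_bij_witness[of _ \<phi> \<psi>] Q]) (auto simp: \<psi>\<phi> \<phi>\<psi>)
  then have "((\<lambda>(m :: int, n :: int). of_int n * of_int (m + n) / (w * (of_int m * \<tau> + of_int n)) ^ (k + 2)) has_sum 0) UNIV"
    by (rule iffD1[OF has_sum_cong, rotated]) (use G\<phi> in auto)
  from has_sum_cmult_right[OF this, of "w ^ (k + 2)"]
  have "((\<lambda>(m :: int, n :: int). of_int n * of_int (m + n) / (of_int m * \<tau> + of_int n) ^ (k + 2)) has_sum 0) UNIV"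
    using w by (simp add: case_prod_unfold power_mult_distrib)
  then show False
    by (rule reduced_lattice_sum_nonzero[rotated -1]) (use re min k in \<open>auto simp: \<tau>_def w_def\<close>)
qed


subsection \<open>Simplicity of the zeros\<close>

lemma Eisenstein_E_eq:
  assumes "bernoulli k \<noteq> 0" "k > 0"
  shows "Eisenstein_E k z = fact k / of_real (bernoulli k) * eis k (exp (2 * pi * \<i> * z))"
proof -
  have "(fact k :: complex) = of_nat k * fact (k - 1)" using assms(2) by (metis fact_reduce)
  moreover have "(\<Sum>n. of_nat (divisor_power_sum (k - 1) (Suc n)) * exp (2 * of_real pi * \<i> * z) ^ Suc n) = lam 0 (k - 1) (exp (2 * pi * \<i> * z))"
    unfolding lam_def by simp
  ultimately show ?thesis using assms unfolding Eisenstein_E_def eis_def by (simp add: field_simps)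
qed

theorem theorem4:
  fixes k :: nat and z :: complex
  assumes "k \<ge> 4" and "even k"
    and "Im z > 0" and "deriv (Eisenstein_E k) z = 0"
  shows "zorder (deriv (Eisenstein_E k)) z = 1"
proof -
  have B: "bernoulli k \<noteq> 0" "bernoulli 4 \<noteq> 0" "bernoulli 6 \<noteq> 0"
    using bernoulli_even_nonzero assms by auto
  define H where "H = {z. Im z > 0}"
  define e where "e = (\<lambda>z :: complex. exp (2 * pi * \<i> * z))"
  define c where "c = fact k / of_real (bernoulli k) * (2 * pi * \<i>)"
  have c: "c \<noteq> 0" using B by (simp add: c_def)
  have H: "open H" "z \<in> H" using assms(3) open_halfspace_Im_gt by (auto simp: H_def)
  have eH: "e w \<in> pdisc" if "w \<in> H" for w
    using that norm_exp_2pii_less[of w] by (auto simp: H_def e_def pdisc_def)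
  have de: "(e has_field_derivative (e w * (2 * pi * \<i> * 1))) (at w)" for w
    unfolding e_def by (rule DERIV_chain2, rule DERIV_exp, rule DERIV_cmult, rule DERIV_ident)
  have d1: "((\<lambda>w. eis k (e w)) has_field_derivative (2 * pi * \<i> * eisD 1 k (e w))) (at w)" if "w \<in> H" for w
    using DERIV_chain2[of "eis k" _ e, OF eis_deriv[OF eH[OF that]] de] by (simp add: e_def mult_ac)
  have d2: "((\<lambda>w. eisD 1 k (e w)) has_field_derivative (2 * pi * \<i> * eisD 2 k (e w))) (at w)" if "w \<in> H" for w
    using DERIV_chain2[of "eisD 1 k" _ e, OF eisD_deriv[OF eH[OF that]] de] by (simp add: e_def mult_ac numeral_2_eq_2)
  have E: "deriv (Eisenstein_E k) w = c * eisD 1 k (e w)" if "w \<in> H" for w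
  proof -
    have "Eisenstein_E k = (\<lambda>w. fact k / of_real (bernoulli k) * eis k (e w))"
      using Eisenstein_E_eq[OF B(1)] assms(1) by (intro ext) (simp add: e_def)
    moreover have "((\<lambda>w. fact k / of_real (bernoulli k) * eis k (e w)) has_field_derivative
        fact k / of_real (bernoulli k) * (2 * pi * \<i> * eisD 1 k (e w))) (at w)"
      by (rule DERIV_cmult[OF d1[OF that]])
    ultimately show ?thesis using DERIV_imp_deriv by (fastforce simp: c_def mult_ac)
  qed
  have E2: "(deriv (Eisenstein_E k) has_field_derivative (c * (2 * pi * \<i> * eisD 2 k (e w)))) (at w)" if "w \<in> H" for w
    by (rule has_field_derivative_transform_within_open[OF DERIV_cmult[OF d2[OF that]] H(1) that]) (simp add: E)
  have z1: "eisD 1 k (e z) = 0" using assms(4) E[OF H(2)] c by simp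
  \<comment> \<open>Derivatives in z are derivatives with respect to q d/dq up to the factor 2 pi i,
    so simplicity of the zero is exactly this non-vanishing.\<close>
  have z2: "eisD 2 k (e z) \<noteq> 0"
  proof
    assume z2: "eisD 2 k (e z) = 0"
    show False
    proof (cases "eis k (e z) = 0")
      case True
      then show False using eis_no_triple_zero[OF assms(3,2,1)] z1 z2 unfolding e_def by blast
    next
      case False
      then show False using eis_no_inflection[OF assms(2,1) eH[OF H(2)] B] z1 z2 by blast
    qed
  qed
  have hol: "deriv (Eisenstein_E k) holomorphic_on H"
    using E2 H(1) by (auto simp: holomorphic_on_open)
  show ?thesis
  proof (rule zorder_zero_eqI[OF hol H])
    show "(deriv ^^ i) (deriv (Eisenstein_E k)) z = 0" if "i < nat 1" for i using that assms(4) by simp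
    show "(deriv ^^ nat 1) (deriv (Eisenstein_E k)) z \<noteq> 0"
      using DERIV_imp_deriv[OF E2[OF H(2)]] z2 c by simp
  qed simp
qed

end
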